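(* Let $A \in \mathbb{Z}^{m \times n}$, $b \in \mathbb{Z}^m$, and $c \in \mathbb{Z}^n$, and suppose that the absolute value of each entry of $A$ is bounded by $\Delta > 1$. Consider the integer linear program $$\min\{c^{\mathsf{T}} x : Ax = b,\ x \in \mathbb{Z}_{\ge 0}^n\}.$$ Then there is an algorithm that, in time $$(m\Delta)^{O(m(\log m + \log\log \Delta))} \cdot \mathrm{poly}(I)$$ and polynomial space, computes a solution to this integer linear program or concludes that such a solution does not exist. Here $I$ is the encoding size of $A$, $b$, and $c$.
   Context: All logarithms are base 2. The model of computation is a random-access machine with word length $\Theta(\log n + \log W)$, where $W$ is the largest absolute value of an input integer; running time is measured in the number of arithmetic operations on words and space is measured as the number of words in working memory. "Polynomial space" means space bounded by a polynomial in the input size, i.e. in $\mathrm{poly}(I) := \mathrm{poly}(n, m, \log \Delta, \log \|b\|_\infty, \log \|c\|_\infty)$. *)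

theory Defs
  imports Complex_Main "Jordan_Normal_Form.Matrix"
begin

section \<open>Integer linear programs in equality form\<close>

definition ilp_feasible :: "int mat \<Rightarrow> int vec \<Rightarrow> int vec set" where
  "ilp_feasible A b = {x \<in> carrier_vec (dim_col A). A *\<^sub>v x = b \<and> 0\<^sub>v (dim_col A) \<le> x}"

definition ilp_solution :: "int mat \<Rightarrow> int vec \<Rightarrow> int vec \<Rightarrow> int vec \<Rightarrow> bool" where
  "ilp_solution A b c x \<longleftrightarrow>
     x \<in> ilp_feasible A b \<and> (\<forall>y \<in> ilp_feasible A b. c \<bullet> x \<le> c \<bullet> y)"


section \<open>Word random-access machines\<close>

text \<open>
  A program is a finite list of instructions operating on a working memory of signed machine
  words, a read-only random-access input and a write-only output. All operands of type
  \<^typ>\<open>nat\<close> that are not jump targets are addresses of working-memory cells.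
\<close>

datatype arith = Add | Sub | Mul | Div | Mod

fun arith_op :: "arith \<Rightarrow> int \<Rightarrow> int \<Rightarrow> int" where
  "arith_op Add x y = x + y"
| "arith_op Sub x y = x - y"
| "arith_op Mul x y = x * y"
| "arith_op Div x y = x div y"
| "arith_op Mod x y = x mod y"

datatype instr =
    SetConst nat int
  | Arith arith nat nat nat
  | Load nat nat
  | Store nat nat
  | ReadInput nat nat
  | Output nat
  | Jump nat
  | JumpLess nat nat nat
  | JumpEq nat nat nat
  | Halt

definition is_word :: "nat \<Rightarrow> int \<Rightarrow> bool" where
  "is_word w v \<longleftrightarrow> - (2 ^ (w - 1)) \<le> v \<and> v < 2 ^ (w - 1)"

definition is_addr :: "int list \<Rightarrow> int \<Rightarrow> bool" where
  "is_addr M a \<longleftrightarrow> 0 \<le> a \<and> a < int (length M)"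

text \<open>
  A configuration consists of the program counter, the working memory and the output produced so
  far. Nothing wraps around: a machine that produces a value not fitting into a word of
  \<open>w\<close> bits, or that accesses a cell outside its memory or its input, is stuck, and being stuck
  is different from having halted.
\<close>

type_synonym config = "nat \<times> int list \<times> int list"

inductive step :: "nat \<Rightarrow> int list \<Rightarrow> instr list \<Rightarrow> config \<Rightarrow> config \<Rightarrow> bool"
  for w :: nat and inp :: "int list" and P :: "instr list" where
  set_const: "\<lbrakk>pc < length P; P ! pc = SetConst i v; i < length M; is_word w v\<rbrakk>
     \<Longrightarrow> step w inp P (pc, M, out) (Suc pc, M[i := v], out)"
| arith: "\<lbrakk>pc < length P; P ! pc = Arith f i j k; i < length M; j < length M; k < length M;
      v = arith_op f (M ! j) (M ! k); is_word w v\<rbrakk>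
     \<Longrightarrow> step w inp P (pc, M, out) (Suc pc, M[i := v], out)"
| load: "\<lbrakk>pc < length P; P ! pc = Load i j; i < length M; j < length M; is_addr M (M ! j)\<rbrakk>
     \<Longrightarrow> step w inp P (pc, M, out) (Suc pc, M[i := M ! nat (M ! j)], out)"
| store: "\<lbrakk>pc < length P; P ! pc = Store i j; i < length M; j < length M; is_addr M (M ! i)\<rbrakk>
     \<Longrightarrow> step w inp P (pc, M, out) (Suc pc, M[nat (M ! i) := M ! j], out)"
| read_input: "\<lbrakk>pc < length P; P ! pc = ReadInput i j; i < length M; j < length M;
      is_addr inp (M ! j); v = inp ! nat (M ! j); is_word w v\<rbrakk>
     \<Longrightarrow> step w inp P (pc, M, out) (Suc pc, M[i := v], out)"
| write_output: "\<lbrakk>pc < length P; P ! pc = Output i; i < length M\<rbrakk>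
     \<Longrightarrow> step w inp P (pc, M, out) (Suc pc, M, out @ [M ! i])"
| jump: "\<lbrakk>pc < length P; P ! pc = Jump l\<rbrakk>
     \<Longrightarrow> step w inp P (pc, M, out) (l, M, out)"
| jump_less: "\<lbrakk>pc < length P; P ! pc = JumpLess i j l; i < length M; j < length M\<rbrakk>
     \<Longrightarrow> step w inp P (pc, M, out) (if M ! i < M ! j then l else Suc pc, M, out)"
| jump_eq: "\<lbrakk>pc < length P; P ! pc = JumpEq i j l; i < length M; j < length M\<rbrakk>
     \<Longrightarrow> step w inp P (pc, M, out) (if M ! i = M ! j then l else Suc pc, M, out)"

lemma step_deterministic:
  assumes "step w inp P cf cf1" "step w inp P cf cf2"
  shows "cf1 = cf2"
  using assms by (cases rule: step.cases) (auto elim: step.cases)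

text \<open>
  Program \<open>P\<close> with word length \<open>w\<close> and a zero-initialised working memory of \<open>S\<close> words halts on
  input \<open>inp\<close> after exactly \<open>T\<close> instructions with output \<open>out\<close>.
\<close>

definition ram_computes ::
    "nat \<Rightarrow> instr list \<Rightarrow> int list \<Rightarrow> nat \<Rightarrow> nat \<Rightarrow> int list \<Rightarrow> bool" where
  "ram_computes w P inp T S out \<longleftrightarrow>
     (\<exists>pc M. (step w inp P ^^ T) (0, replicate S 0, []) (pc, M, out) \<and>
        pc < length P \<and> P ! pc = Halt)"


section \<open>Encoding of instances and solutions\<close>

definition ilp_input :: "int mat \<Rightarrow> int vec \<Rightarrow> int vec \<Rightarrow> int list" where
  "ilp_input A b c =
     [int (dim_row A), int (dim_col A)] @ concat (mat_to_list A) @ list_of_vec b @ list_of_vec c"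

text \<open>
  The factor \<open>k\<close> is the constant hidden in the \<open>\<Theta>\<close> of the word length; the summand 1 only
  matters for instances with \<open>log n + log W = 0\<close>.
\<close>

definition word_length :: "nat \<Rightarrow> nat \<Rightarrow> int list \<Rightarrow> nat" where
  "word_length k n inp =
     (let W = Max (abs ` set inp)
      in k * (1 + nat \<lceil>log 2 (real n) + log 2 (real_of_int W)\<rceil>))"

definition bits :: "nat \<Rightarrow> int \<Rightarrow> int list" where
  "bits L z = map (\<lambda>i. (z div 2 ^ i) mod 2) [0..<L]"

text \<open>
  Entries of a solution need not fit into a single word, so they are written in binary,
  least significant bit first, all with the same number of bits.
\<close>

definition encodes_vec :: "int list \<Rightarrow> int vec \<Rightarrow> bool" where
  "encodes_vec out x \<longleftrightarrow>
     (\<exists>L. (\<forall>i < dim_vec x. 0 \<le> x $ i \<and> x $ i < 2 ^ L) \<and>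
          out = concat (map (bits L) (list_of_vec x)))"

text \<open>
  Output 0 is the verdict that there is no (optimal) solution; this covers both infeasible and
  unbounded programs.
\<close>

definition ilp_answer :: "int mat \<Rightarrow> int vec \<Rightarrow> int vec \<Rightarrow> int list \<Rightarrow> bool" where
  "ilp_answer A b c out \<longleftrightarrow>
     (\<exists>x ds. ilp_solution A b c x \<and> encodes_vec ds x \<and> out = 1 # ds) \<or>
     ((\<nexists>x. ilp_solution A b c x) \<and> out = [0])"


section \<open>Encoding size\<close>

definition inf_norm :: "int vec \<Rightarrow> int" where
  "inf_norm v = Max (abs ` set\<^sub>v v)"

text \<open>The cut-off at 1 gives zero vectors logarithmic size 0.\<close>

definition log_norm :: "int vec \<Rightarrow> real" where
  "log_norm v = log 2 (real_of_int (max 1 (inf_norm v)))"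

text \<open>
  A quantity is polynomially bounded in \<open>n, m, log \<Delta>, log \<parallel>b\<parallel>, log \<parallel>c\<parallel>\<close> iff it is bounded by
  \<open>K * (ilp_size n m \<Delta> b c) ^ d\<close> for some constants \<open>K\<close> and \<open>d\<close>, because all five
  parameters are nonnegative and \<open>n, m \<ge> 1\<close>.
\<close>

definition ilp_size :: "nat \<Rightarrow> nat \<Rightarrow> int \<Rightarrow> int vec \<Rightarrow> int vec \<Rightarrow> real" where
  "ilp_size n m \<Delta> b c =
     real n + real m + log 2 (real_of_int \<Delta>) + log_norm b + log_norm c"

end

theory Submission
  imports Defs "HOL-Library.FuncSet"
begin

text \<open>
  By the pigeonhole arguments of Eisenbrand and Shmonin, an integer program that is bounded below has
  an optimal solution with few nonzero entries of small size, and an optimal solution for the right-hand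
  side \<open>b\<close> can be found near twice an optimal solution for \<open>b / 2\<close>. Hence the program is solved by scaling
  the right-hand side bit by bit; in each phase the correction \<open>z\<close> is small, and processing the bits of its
  entries from the most significant one on gives a path of polynomial length in a graph whose
  vertices are the possible residual right-hand sides, all within \<open>(m \<Delta>)\<close> to a small power of a known
  point in each coordinate. Savitch's recursion finds a cheapest such path in polynomial space. Slack
  columns of very large cost make every phase feasible, and the phase with right-hand side 0 detects
  unboundedness. All numbers are kept as arrays of bits, so that single machine words suffice.
\<close>

section \<open>Small and near optimal solutions\<close>

text \<open>Savitch's recursion returns only the length of a cheapest path, never the path itself.
  The edge weights therefore carry the solution: column \<open>j\<close> costs
  \<open>c j * 2 ^ (q * N) + 2 ^ (q * j)\<close>, so that the high part of the minimum is the true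
  cost and its low digits in base \<open>2 ^ q\<close> are the entries of a cheapest vector.
  Likewise the \<open>m\<close> equations are packed into one by the weights
  \<open>2 ^ (q * k)\<close>, which makes a vertex a single integer, and a midpoint is enumerated by
  one number \<open>\<kappa>\<close> whose digits are offsets from the residual at the current bit
  level. The support, entry and proximity bounds all derive from one exponent \<open>\<pi>\<close>,
  into which the number of columns enters only through its bit length; the final estimate moves this
  contribution into the polynomial factor. The other obstacle is the fixed memory: every long
  integer needs a bit bound in advance. Each elementary operation adds at most one bit, which
  settles all polynomially long runs. The Savitch loop takes exponential time, so its numbers are
  bounded by an invariant instead.\<close>

definition lin :: "nat => (nat => int) => (nat => int) => int" where
 "lin N a x = (\<Sum>j<N. a j * x j)"

lemma lin_add: "lin N a (%j. x j + y j) = lin N a x + lin N a y" by (simp add: lin_def distrib_left sum.distrib)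

lemma lin_diff: "lin N a (%j. x j - y j) = lin N a x - lin N a y" by (simp add: lin_def right_diff_distrib sum_subtractf)

lemma lin_minus: "lin N a (%j. - x j) = - lin N a x" by (simp add: lin_def sum_negf)

lemma lin_scale: "lin N a (%j. r * x j) = r * lin N a x" by (simp add: lin_def sum_distrib_left algebra_simps)

lemma lin_zero [simp]: "lin N a (%j. 0) = 0" by (simp add: lin_def)

lemma lin_cong: "(!!j. j < N ==> a j = a' j) ==> (!!j. j < N ==> x j = x' j) ==> lin N a x = lin N a' x'" by (simp add: lin_def)

lemma abs_lin_le:
 assumes "!!j. j < N ==> \<bar>a j\<bar> <= D" "!!j. j < N ==> \<bar>x j\<bar> <= X"
 shows "\<bar>lin N a x\<bar> <= int N * (D * X)"
proof -
 have "\<bar>lin N a x\<bar> <= (\<Sum>j<N. \<bar>a j * x j\<bar>)" unfolding lin_def by (rule sum_abs)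
 also have "... <= (\<Sum>j<N. D * X)"
 proof (rule sum_mono)
  fix j assume "j \<in> {..<N}"
  then have j: "\<bar>a j\<bar> <= D" "\<bar>x j\<bar> <= X" using assms by auto
  show "\<bar>a j * x j\<bar> <= D * X"
   unfolding abs_mult using j by (intro mult_mono) auto
 qed
 finally show ?thesis by simp
qed

definition feas :: "nat => nat => (nat => nat => int) => (nat => int) => (nat => int) => bool" where
 "feas N m \<alpha> b x \<longleftrightarrow> (\<forall>j<N. 0 <= x j) & (\<forall>k<m. lin N (\<alpha> k) x = b k)"

definition opt :: "nat => nat => (nat => nat => int) => (nat => int) => (nat => int) => (nat => int) => bool" where
 "opt N m \<alpha> c b x \<longleftrightarrow> feas N m \<alpha> b x & (\<forall>y. feas N m \<alpha> b y \<longrightarrow> lin N c x <= lin N c y)"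

text \<open>Costs are nonnegative on the recession cone. The condition does not mention the
  right-hand side, so a single test with right-hand side 0 settles it for every phase.\<close>

definition bounded_below :: "nat => nat => (nat => nat => int) => (nat => int) => bool" where
 "bounded_below N m \<alpha> c \<longleftrightarrow> (\<forall>w. feas N m \<alpha> (%k. 0) w \<longrightarrow> 0 <= lin N c w)"

lemma card_int_box: "0 <= (B::int) ==> card ({..<m} \<rightarrow>\<^sub>E {-B..B}) = nat (2 * B + 1) ^ m" by (simp add: card_PiE algebra_simps)

text \<open>Pigeonhole on the truncations of \<open>t e / H\<close>: their images stay in a fixed box.\<close>

lemma kernel_vector_below:
 fixes e :: "nat => int" and H :: nat
 assumes \<alpha>: "!!k j. k < m ==> j < N ==> \<bar>\<alpha> k j\<bar> <= \<Delta>"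
  and \<rho>: "!!k. k < m ==> \<bar>lin N (\<alpha> k) e\<bar> <= \<rho>" "0 <= \<rho>" "0 <= \<Delta>"
  and H: "nat (2 * (\<rho> + int N * \<Delta>) + 1) ^ m < H"
  and j0: "j0 < N" "int H <= \<bar>e j0\<bar>"
 obtains w where "!!j. (0 <= w j & w j <= e j) \<or> (e j <= w j & w j <= 0)"
  "!!k. k < m ==> lin N (\<alpha> k) w = 0" "w j0 ~= 0" "w j0 ~= e j0"
proof -
 define B where "B = \<rho> + int N * \<Delta>"
 have B0: "0 <= B" using \<rho> by (simp add: B_def)
 have Hpos: "0 < int H" using H by simp
 \<comment> \<open>Truncation towards 0 moves \<open>v t j\<close> monotonically in \<open>t\<close>
   between 0 and \<open>e j\<close>, so a difference of two of these vectors again lies between 0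
   and \<open>e j\<close>.\<close>
 define v where "v t j = sgn (e j) * ((int t * \<bar>e j\<bar>) div int H)" for t j
 define f where "f t = (\<lambda>k\<in>{..<m}. lin N (\<alpha> k) (v t))" for t
 have box: "\<bar>lin N (\<alpha> k) (v t)\<bar> <= B" if t: "t < H" and k: "k < m" for t k
 proof -
  have v: "int H * v t j = int t * e j - sgn (e j) * ((int t * \<bar>e j\<bar>) mod int H)" for j
  proof -
   have "int H * v t j = sgn (e j) * (int t * \<bar>e j\<bar> - (int t * \<bar>e j\<bar>) mod int H)"
    unfolding v_def by (simp add: minus_mod_eq_mult_div algebra_simps)
   also have "... = int t * (sgn (e j) * \<bar>e j\<bar>) - sgn (e j) * ((int t * \<bar>e j\<bar>) mod int H)" by (simp add: algebra_simps)
   finally show ?thesis by (simp add: sgn_mult_abs)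
  qed
  have eq: "int H * lin N (\<alpha> k) (v t) =
    int t * lin N (\<alpha> k) e - lin N (\<alpha> k) (%j. sgn (e j) * ((int t * \<bar>e j\<bar>) mod int H))"
   unfolding lin_scale[symmetric] lin_diff[symmetric] by (rule lin_cong) (simp_all add: v)
  have 1: "\<bar>lin N (\<alpha> k) (%j. sgn (e j) * ((int t * \<bar>e j\<bar>) mod int H))\<bar> <= int N * (\<Delta> * int H)"
  proof (rule abs_lin_le)
   fix j
   have "0 <= (int t * \<bar>e j\<bar>) mod int H" "(int t * \<bar>e j\<bar>) mod int H < int H" using Hpos by auto
   then show "\<bar>sgn (e j) * ((int t * \<bar>e j\<bar>) mod int H)\<bar> <= int H" by (auto simp: abs_mult sgn_if)
  qed (use \<alpha> k in auto)
  have 2: "\<bar>int t * lin N (\<alpha> k) e\<bar> <= int H * \<rho>"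
   unfolding abs_mult using t k \<rho> by (intro mult_mono) auto
  have "\<bar>int H * lin N (\<alpha> k) (v t)\<bar> <= int H * \<rho> + int N * (\<Delta> * int H)"
   unfolding eq using 1 2 by linarith
  also have "... = int H * B" by (simp add: B_def algebra_simps)
  finally have "int H * \<bar>lin N (\<alpha> k) (v t)\<bar> <= int H * B" by (simp add: abs_mult)
  then show ?thesis using Hpos by (simp add: mult_le_cancel_left)
 qed
 have sub: "f ` {..<H} \<subseteq> {..<m} \<rightarrow>\<^sub>E {-B..B}"
 proof
  fix h assume "h \<in> f ` {..<H}"
  then obtain t where t: "t < H" "h = f t" by auto
  have "lin N (\<alpha> k) (v t) \<in> {-B..B}" if "k < m" for k using box[OF t(1) that] by auto
  then show "h \<in> {..<m} \<rightarrow>\<^sub>E {-B..B}" unfolding t f_def by (simp add: restrict_PiE_iff)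
 qed
 have "card (f ` {..<H}) <= nat (2 * B + 1) ^ m" using card_mono[OF _ sub] B0 by (simp add: card_int_box finite_PiE)
 then have "card (f ` {..<H}) < card {..<H}" using H by (simp add: B_def)
 then have "\<not> inj_on f {..<H}" by (rule pigeonhole)
 then obtain t1' t2' where "t1' < H" "t2' < H" "t1' ~= t2'" "f t1' = f t2'"
  unfolding inj_on_def by auto
 then obtain t1 t2 where t: "t1 < t2" "t2 < H" "f t1 = f t2" by (metis linorder_neqE_nat)
 define w where "w j = v t2 j - v t1 j" for j
 have le: "(int t1 * \<bar>e j\<bar>) div int H <= (int t2 * \<bar>e j\<bar>) div int H" for j using t Hpos by (intro zdiv_mono1 mult_right_mono) auto
 have ge0: "0 <= (int t1 * \<bar>e j\<bar>) div int H" for j using Hpos by (simp add: pos_imp_zdiv_nonneg_iff)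
 have top: "(int t2 * \<bar>e j\<bar>) div int H <= \<bar>e j\<bar>" for j
 proof -
  have "(int t2 * \<bar>e j\<bar>) div int H <= (int H * \<bar>e j\<bar>) div int H" using t Hpos by (intro zdiv_mono1 mult_right_mono) auto
  also have "... = \<bar>e j\<bar>" using Hpos by simp
  finally show ?thesis .
 qed
 have w: "w j = sgn (e j) * ((int t2 * \<bar>e j\<bar>) div int H - (int t1 * \<bar>e j\<bar>) div int H)" for j by (simp add: w_def v_def right_diff_distrib)
 have "(0 <= w j & w j <= e j) \<or> (e j <= w j & w j <= 0)" for j using le[of j] ge0[of j] top[of j] unfolding w by (auto simp: sgn_if)
 moreover have "lin N (\<alpha> k) w = 0" if k: "k < m" for k
 proof -
  have "lin N (\<alpha> k) (v t2) = lin N (\<alpha> k) (v t1)" using fun_cong[OF t(3), of k] k by (simp add: f_def)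
  then show ?thesis unfolding w_def by (simp add: lin_diff)
 qed
 moreover have "w j0 ~= 0"
 proof -
  \<comment> \<open>Consecutive multiples of \<open>\<bar>e j0\<bar> / H\<close> are at least 1
    apart, hence different \<open>t\<close> have different truncations in coordinate
    \<open>j0\<close>.\<close>
  have "(int t1 * \<bar>e j0\<bar>) div int H + 1 = (int t1 * \<bar>e j0\<bar> + int H) div int H" using Hpos by simp
  also have "... <= (int t2 * \<bar>e j0\<bar>) div int H"
  proof (rule zdiv_mono1)
   have "(int t1 + 1) * \<bar>e j0\<bar> <= int t2 * \<bar>e j0\<bar>" using t by (intro mult_right_mono) auto
   then show "int t1 * \<bar>e j0\<bar> + int H <= int t2 * \<bar>e j0\<bar>" using j0 by (simp add: algebra_simps)
  qed (use Hpos in auto)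
  finally show ?thesis using j0 Hpos unfolding w by (auto simp: sgn_if)
 qed
 moreover have "w j0 ~= e j0"
 proof -
  have "int t2 * \<bar>e j0\<bar> < \<bar>e j0\<bar> * int H"
   unfolding mult.commute[of "\<bar>e j0\<bar>"] using t j0 Hpos by (intro mult_strict_right_mono) auto
  then have "(int t2 * \<bar>e j0\<bar>) div int H < \<bar>e j0\<bar>" using Hpos by (smt (verit) Euclidean_Rings.pos_mod_sign minus_mod_eq_mult_div mult.commute mult_le_cancel_left_pos)
  then show ?thesis using ge0[of j0] j0 Hpos unfolding w by (auto simp: sgn_if)
 qed
 ultimately show ?thesis by (rule that)
qed

text \<open>Pigeonhole over the \<open>2 ^ card S\<close> subsets of \<open>S\<close>: their column
  sums lie in a box with fewer points, and the difference of two indicator vectors with equal sums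
  is the kernel vector.\<close>

lemma kernel_sign_vector:
 assumes \<alpha>: "!!k j. k < m ==> j < N ==> \<bar>\<alpha> k j\<bar> <= \<Delta>" "0 <= \<Delta>"
  and S: "S \<subseteq> {..<N}" "nat (2 * (int (card S) * \<Delta>) + 1) ^ m < 2 ^ card S"
 obtains w where "!!j. w j \<in> {-1, 0, 1 :: int}" "!!j. w j ~= 0 ==> j \<in> S"
  "!!k. k < m ==> lin N (\<alpha> k) w = 0" "\<exists>j. w j ~= 0"
proof -
 have fin: "finite S" using S finite_subset by blast
 define B where "B = int (card S) * \<Delta>"
 have B0: "0 <= B" using \<alpha> by (simp add: B_def)
 define f where "f T = (\<lambda>k\<in>{..<m}. \<Sum>j\<in>T. \<alpha> k j)" for T
 have sub: "f ` Pow S \<subseteq> {..<m} \<rightarrow>\<^sub>E {-B..B}"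
 proof -
  have "\<bar>\<Sum>j\<in>T. \<alpha> k j\<bar> <= B" if "T \<subseteq> S" "k < m" for T k
  proof -
   have "\<bar>\<Sum>j\<in>T. \<alpha> k j\<bar> <= (\<Sum>j\<in>T. \<Delta>)"
   proof (rule order_trans[OF sum_abs], rule sum_mono)
    fix j assume "j \<in> T"
    then show "\<bar>\<alpha> k j\<bar> <= \<Delta>" using that S by (intro \<alpha>) auto
   qed
   also have "... = int (card T) * \<Delta>" by simp
   also have "... <= B" unfolding B_def using that fin by (intro mult_right_mono \<alpha>) (auto intro!: card_mono)
   finally show ?thesis .
  qed
  note bd = this
  show ?thesis
  proof
   fix h assume "h \<in> f ` Pow S"
   then obtain T where T: "T \<subseteq> S" "h = f T" by auto
   have "(\<Sum>j\<in>T. \<alpha> k j) \<in> {-B..B}" if "k < m" for k using bd[OF T(1) that] unfolding abs_le_iff by simp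
   then show "h \<in> {..<m} \<rightarrow>\<^sub>E {-B..B}" unfolding T f_def by (simp add: restrict_PiE_iff)
  qed
 qed
 have "card (f ` Pow S) <= nat (2 * B + 1) ^ m" using card_mono[OF _ sub] B0 by (simp add: card_int_box finite_PiE)
 then have "card (f ` Pow S) < card (Pow S)" using S fin by (simp add: B_def card_Pow)
 then have "\<not> inj_on f (Pow S)" by (rule pigeonhole)
 then obtain T1 T2 where T: "T1 \<subseteq> S" "T2 \<subseteq> S" "T1 ~= T2" "f T1 = f T2"
  unfolding inj_on_def by auto
 define w where "w j = (if j \<in> T1 then 1 else 0) - (if j \<in> T2 then 1 else 0 :: int)" for j
 have ind: "lin N (\<alpha> k) (%j. if j \<in> T then 1 else 0) = (\<Sum>j\<in>T. \<alpha> k j)" if "T \<subseteq> S" for T k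
 proof -
  have "lin N (\<alpha> k) (%j. if j \<in> T then 1 else 0) = (\<Sum>j\<in>{..<N}. if j \<in> T then \<alpha> k j else 0)"
   unfolding lin_def by (rule sum.cong) auto
  also have "... = (\<Sum>j\<in>{..<N} \<inter> T. \<alpha> k j)" by (simp add: sum.inter_restrict)
  also have "{..<N} \<inter> T = T" using that S by auto
  finally show ?thesis .
 qed
 show ?thesis
 proof (rule that)
  show "w j \<in> {-1, 0, 1}" for j by (simp add: w_def)
  show "w j ~= 0 ==> j \<in> S" for j using T by (auto simp: w_def split: if_splits)
  show "lin N (\<alpha> k) w = 0" if "k < m" for k using fun_cong[OF T(4), of k] that T unfolding w_def lin_diff by (simp add: ind f_def)
  show "\<exists>j. w j ~= 0" using T(3) by (auto simp: w_def)
 qed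
qed

lemma feas_add:
 "feas N m \<alpha> b x ==> (!!j. j < N ==> 0 <= x j + r * w j) ==> (!!k. k < m ==> lin N (\<alpha> k) w = 0) ==>
  feas N m \<alpha> b (%j. x j + r * w j)" by (simp add: feas_def lin_add lin_scale)

lemma feas_sub:
 "feas N m \<alpha> b x ==> (!!j. j < N ==> w j <= x j) ==> (!!k. k < m ==> lin N (\<alpha> k) w = 0) ==>
  feas N m \<alpha> b (%j. x j - w j)" by (simp add: feas_def lin_diff)

definition small :: "nat => nat => nat => (nat => int) => bool" where
 "small N s H x \<longleftrightarrow> card {j. j < N & x j ~= 0} <= s & (\<forall>j<N. x j < int H)"

text \<open>Take a vector satisfying one of the two alternatives that is minimal first in support
  size, then in the sum of its entries; a kernel vector from either pigeonhole argument would
  produce a smaller one. The alternative of a small ray of negative cost makes the statement usable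
  before boundedness is known.\<close>

lemma small_solution_exists:
 fixes s H :: nat
 assumes \<alpha>: "!!k j. k < m ==> j < N ==> \<bar>\<alpha> k j\<bar> <= \<Delta>" "0 <= \<Delta>"
  and s: "nat (2 * (int s * \<Delta>) + 1) ^ m < 2 ^ s"
  and \<rho>: "!!k. k < m ==> \<bar>b k\<bar> <= \<rho>" "0 <= \<rho>"
  and H: "nat (2 * (\<rho> + int N * \<Delta>) + 1) ^ m < H"
  and x: "feas N m \<alpha> b x"
 obtains y where "small N s H y"
  "(feas N m \<alpha> b y & lin N c y <= lin N c x) \<or> (feas N m \<alpha> (%k. 0) y & lin N c y < 0)"
proof -
 let ?supp = "%y :: nat => int. {j. j < N & y j ~= 0}"
 let ?P = "%y. (feas N m \<alpha> b y & lin N c y <= lin N c x) \<or> (feas N m \<alpha> (%k. 0) y & lin N c y < 0)"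
 let ?r = "(%y :: nat => int. card (?supp y)) <*mlex*> measure (%y. nat (\<Sum>j<N. y j))"
 have "wf ?r" by (simp add: wf_mlex)
 moreover have "x \<in> Collect ?P" using x by simp
 ultimately obtain y where "y \<in> Collect ?P" and min': "!!z. (z, y) \<in> ?r ==> z \<notin> Collect ?P" by (rule wfE_min) blast
 then have "?P y" and min: "!!z. (z, y) \<in> ?r ==> \<not> ?P z" by simp_all
 have fin: "finite (?supp z)" for z by simp
 \<comment> \<open>\<open>b'\<close> and \<open>q\<close> record the alternative that holds for
   \<open>y\<close>: a move along a kernel vector keeps the right-hand side \<open>b'\<close>, and a
   cost of at most \<open>q\<close> keeps the alternative.\<close>
 have "\<exists>b' q. (b' = b \<or> b' = (%k. 0)) & feas N m \<alpha> b' y & lin N c y <= q &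
  (\<forall>z. feas N m \<alpha> b' z & lin N c z <= q \<longrightarrow> ?P z)"
 proof (cases "feas N m \<alpha> b y & lin N c y <= lin N c x")
  case True
  then show ?thesis by (intro exI[of _ b] exI[of _ "lin N c x"]) auto
 next
  case False
  then show ?thesis using \<open>?P y\<close> by (intro exI[of _ "%k. 0"] exI[of _ "lin N c y"]) auto
 qed
 then obtain b' q where b': "b' = b \<or> b' = (%k. 0)" and y: "feas N m \<alpha> b' y" "lin N c y <= q"
  and P: "!!z. feas N m \<alpha> b' z ==> lin N c z <= q ==> ?P z" by blast
 have y0: "0 <= y j" if "j < N" for j using y that by (auto simp: feas_def)
 have "card (?supp y) <= s"
 proof (rule ccontr)
  assume "\<not> card (?supp y) <= s"
  \<comment> \<open>\<open>T\<close> has exactly \<open>s\<close> elements, fewer than the support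
    of \<open>y\<close>, so a nonnegative kernel vector on \<open>T\<close> of negative cost would
    itself contradict the minimality of \<open>y\<close>.\<close>
  then obtain T where T: "T \<subseteq> ?supp y" "card T = s" by (metis (no_types, lifting) linear obtain_subset_with_card_n)
  have TN: "T \<subseteq> {..<N}" using T by auto
  obtain w0 where w0': "!!j. w0 j \<in> {-1, 0, 1 :: int}" "!!j. w0 j ~= 0 ==> j \<in> T"
   "!!k. k < m ==> lin N (\<alpha> k) w0 = 0" "\<exists>j. w0 j ~= 0"
  proof (rule kernel_sign_vector[of m N \<alpha> \<Delta> T])
   show "nat (2 * (int (card T) * \<Delta>) + 1) ^ m < 2 ^ card T" using s T by simp
  qed (use \<alpha> TN in auto)
  then have w0: "\<forall>j. w0 j \<in> {-1, 0, 1 :: int}" "\<forall>j. w0 j ~= 0 \<longrightarrow> j \<in> T"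
   "\<forall>k<m. lin N (\<alpha> k) w0 = 0" "\<exists>j. w0 j ~= 0" by blast+
  have nonneg: False if w: "\<forall>j. 0 <= w j" "\<forall>j. w j ~= 0 \<longrightarrow> j \<in> T"
   "\<forall>k<m. lin N (\<alpha> k) w = 0" "lin N c w < 0" for w
  proof -
   have "?P w" using w by (simp add: feas_def)
   moreover have "card (?supp w) < card (?supp y)"
   proof -
    have "finite T" using TN finite_subset by blast
    then have "card (?supp w) <= s" using w(2) T by (auto intro!: card_mono)
    then show ?thesis using \<open>\<not> card (?supp y) <= s\<close> by simp
   qed
   ultimately show False using min[of w] by (simp add: mlex_less)
  qed
  have "\<exists>w. (\<forall>j. w j \<in> {-1, 0, 1 :: int}) & (\<forall>j. w j ~= 0 \<longrightarrow> j \<in> T) &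
   (\<forall>k<m. lin N (\<alpha> k) w = 0) & lin N c w <= 0 & (\<exists>j. w j = -1)"
  proof -
   define w1 where "w1 = (if lin N c w0 <= 0 then w0 else (%j. - w0 j))"
   have w1: "\<forall>j. w1 j \<in> {-1, 0, 1 :: int}" "\<forall>j. w1 j ~= 0 \<longrightarrow> j \<in> T"
    "\<forall>k<m. lin N (\<alpha> k) w1 = 0" "\<exists>j. w1 j ~= 0" "lin N c w1 <= 0" using w0 unfolding w1_def by (auto simp: lin_minus)
   show ?thesis
   proof (cases "\<exists>j. w1 j = -1")
    case True
    then show ?thesis using w1 by blast
   next
    case False
    then have pos: "\<forall>j. 0 <= w1 j" using w1(1) by (metis empty_iff insert_iff zero_le_one order_refl)
    \<comment> \<open>A nonnegative direction of negative cost is excluded by minimality, so the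
      cost is 0 and the negated vector serves equally well while having an entry -1.\<close>
    have "lin N c w1 = 0" using nonneg[OF pos w1(2,3)] w1(5) by fastforce
    moreover obtain j where "w1 j = 1" using w1(1,4) False by blast
    ultimately show ?thesis using w1 by (intro exI[of _ "%j. - w1 j"]) (auto simp: lin_minus)
   qed
  qed
  then obtain w where w: "!!j. w j \<in> {-1, 0, 1 :: int}" "!!j. w j ~= 0 ==> j \<in> T"
   "!!k. k < m ==> lin N (\<alpha> k) w = 0" "lin N c w <= 0" "\<exists>j. w j = -1" by blast
  define Neg where "Neg = {j. w j = -1}"
  have Neg: "Neg \<subseteq> T" using w(2) by (auto simp: Neg_def)
  then have finN: "finite Neg" "Neg ~= {}" using TN w(5) finite_subset[of Neg "{..<N}"] by (auto simp: Neg_def)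
  \<comment> \<open>The step length at which the first decreasing coordinate, \<open>j1\<close>,
    reaches 0. No coordinate enters the support, because \<open>w\<close> vanishes outside
    \<open>T\<close>.\<close>
  define l where "l = Min (y ` Neg)"
  obtain j1 where j1: "j1 \<in> Neg" "y j1 = l" using Min_in[of "y ` Neg"] finN unfolding l_def by (metis (no_types) finite_imageI image_is_empty imageE)
  have l: "l <= y j" if "w j = -1" for j
   unfolding l_def using that finN by (auto simp: Neg_def)
  have l0: "0 <= l" using y0[of j1] j1 Neg TN by auto
  define z where "z j = y j + l * w j" for j
  have z0: "0 <= z j" if "j < N" for j using w(1)[of j] l[of j] y0[OF that] l0 by (auto simp: z_def)
  have "feas N m \<alpha> b' z" unfolding z_def by (rule feas_add) (use y w z0 in \<open>auto simp: z_def\<close>)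
  moreover have "lin N c z <= q"
  proof -
   have "lin N c z = lin N c y + l * lin N c w" unfolding z_def by (simp add: lin_add lin_scale)
   moreover have "l * lin N c w <= 0" using l0 w(4) by (simp add: mult_nonneg_nonpos)
   ultimately show ?thesis using y by simp
  qed
  ultimately have "?P z" by (rule P)
  moreover have "?supp z \<subset> ?supp y"
  proof
   show "?supp z \<subseteq> ?supp y"
   proof
    fix j assume j: "j \<in> ?supp z"
    show "j \<in> ?supp y"
    proof (cases "w j = 0")
     case True then show ?thesis using j by (auto simp: z_def)
    next
     case False then show ?thesis using w(2) T by auto
    qed
   qed
   have "j1 \<in> ?supp y" using j1 Neg T by auto
   moreover have "j1 \<notin> ?supp z" using j1 by (auto simp: z_def Neg_def)
   ultimately show "?supp z ~= ?supp y" by blast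
  qed
  then have "card (?supp z) < card (?supp y)" using fin psubset_card_mono by blast
  ultimately show False using min[of z] by (simp add: mlex_less)
 qed
 moreover have "y j0 < int H" if j0: "j0 < N" for j0
 proof (rule ccontr)
  assume "\<not> y j0 < int H"
  then have big: "int H <= \<bar>y j0\<bar>" by simp
  have 2: "\<bar>lin N (\<alpha> k) y\<bar> <= \<rho>" if "k < m" for k using y b' \<rho> that by (auto simp: feas_def)
  obtain w where w: "!!j. (0 <= w j & w j <= y j) \<or> (y j <= w j & w j <= 0)"
   "!!k. k < m ==> lin N (\<alpha> k) w = 0" "w j0 ~= 0" "w j0 ~= y j0" by (rule kernel_vector_below[of m N \<alpha> \<Delta> y \<rho> H j0]) (use \<alpha> 2 \<rho> H j0 big in auto)
  have w0: "0 <= w j" "w j <= y j" if "j < N" for j using w(1)[of j] y0[OF that] by auto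
  have less: "(z, y) \<in> ?r" if z: "!!j. j < N ==> 0 <= z j & z j <= y j" "z j0 ~= y j0" for z
  proof -
   have "?supp z \<subseteq> ?supp y" using z by force
   then have "card (?supp z) <= card (?supp y)" by (intro card_mono) auto
   moreover have "(\<Sum>j<N. z j) < (\<Sum>j<N. y j)" using z j0 by (intro sum_strict_mono_ex1) (auto simp: less_le intro!: bexI[of _ j0])
   moreover have "0 <= (\<Sum>j<N. z j)" using z by (intro sum_nonneg) auto
   ultimately show ?thesis by (auto simp: mlex_iff)
  qed
  show False
  \<comment> \<open>Either \<open>w\<close> alone is a smaller ray of negative cost, or removing it
    from \<open>y\<close> does not raise the cost.\<close>
  proof (cases "lin N c w < 0")
   case True
   then have "?P w" using w w0 by (simp add: feas_def)
   then show False using min[of w] less[of w] w0 w(4) by auto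
  next
   case False
   have "feas N m \<alpha> b' (%j. y j - w j)" by (rule feas_sub) (use y w w0 in auto)
   moreover have "lin N c (%j. y j - w j) <= q" using False y by (simp add: lin_diff)
   ultimately have "?P (%j. y j - w j)" by (rule P)
   then show False using min[of "%j. y j - w j"] less[of "%j. y j - w j"] w0 w(3) by force
  qed
 qed
 ultimately have "small N s H y" by (simp add: small_def)
 then show ?thesis using \<open>?P y\<close> that by blast
qed
text \<open>Every feasible cost is matched or undercut by that of a small solution, and costs of
  small solutions are bounded below. Hence a minimum exists, and a small solution attains
  it.\<close>

lemma small_optimum_exists:
 fixes s H :: nat
 assumes \<alpha>: "!!k j. k < m ==> j < N ==> \<bar>\<alpha> k j\<bar> <= \<Delta>" "0 <= \<Delta>"
  and s: "nat (2 * (int s * \<Delta>) + 1) ^ m < 2 ^ s"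
  and \<rho>: "!!k. k < m ==> \<bar>b k\<bar> <= \<rho>" "0 <= \<rho>"
  and H: "nat (2 * (\<rho> + int N * \<Delta>) + 1) ^ m < H"
  and bb: "bounded_below N m \<alpha> c"
  and x: "feas N m \<alpha> b x"
 obtains z where "opt N m \<alpha> c b z" "small N s H z"
proof -
 have sm: "\<exists>z. small N s H z & feas N m \<alpha> b z & lin N c z <= lin N c y" if y: "feas N m \<alpha> b y" for y
 proof -
  obtain z where z: "small N s H z"
   "(feas N m \<alpha> b z & lin N c z <= lin N c y) \<or> (feas N m \<alpha> (%k. 0) z & lin N c z < 0)" by (rule small_solution_exists[of m N \<alpha> \<Delta> s b \<rho> H y c]) (use assms y in auto)
  then show ?thesis using bb unfolding bounded_below_def by (metis not_less)
 qed
 define C where "C = (\<Sum>j<N. \<bar>c j\<bar>)"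
 have C: "\<bar>c j\<bar> <= C" if "j < N" for j
  unfolding C_def using that by (intro member_le_sum) auto
 define B where "B = int N * (C * int H)"
 have low: "0 <= lin N c y + B" if y: "feas N m \<alpha> b y" for y
 proof -
  obtain z where z: "small N s H z" "feas N m \<alpha> b z" "lin N c z <= lin N c y" using sm[OF y] by blast
  have "\<bar>lin N c z\<bar> <= B" unfolding B_def by (rule abs_lin_le) (use z C in \<open>auto simp: small_def feas_def less_imp_le\<close>)
  then show ?thesis using z by linarith
 qed
 \<comment> \<open>Adding \<open>B\<close> turns the costs into natural numbers, among which a least
   one exists.\<close>
 obtain y where y: "feas N m \<alpha> b y"
  "!!y'. feas N m \<alpha> b y' ==> nat (lin N c y + B) <= nat (lin N c y' + B)" using ex_has_least_nat[of "feas N m \<alpha> b" x "%y. nat (lin N c y + B)"] x by blast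
 have min: "lin N c y <= lin N c y'" if "feas N m \<alpha> b y'" for y' using y(2)[OF that] low[OF that] low[OF y(1)] by linarith
 obtain z where z: "small N s H z" "feas N m \<alpha> b z" "lin N c z <= lin N c y" using sm[OF y(1)] by blast
 then have "opt N m \<alpha> c b z" using min by (fastforce simp: opt_def)
 then show ?thesis using z that by blast
qed

text \<open>Doubling an optimal solution for \<open>b'\<close> nearly solves the problem for \<open>2 b'\<close>: a large decrease
 would contain twice a kernel vector, which either improves \<open>y\<close> or can be removed from \<open>x\<close>.\<close>

lemma scaled_optimum_near:
 fixes H :: nat
 assumes \<alpha>: "!!k j. k < m ==> j < N ==> \<bar>\<alpha> k j\<bar> <= \<Delta>" "0 <= \<Delta>"
  and b: "!!k. k < m ==> \<bar>b k - 2 * b' k\<bar> <= 1"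
  and H: "nat (2 * (1 + 2 * (int N * \<Delta>)) + 1) ^ m < H"
  and y: "opt N m \<alpha> c b' y" and x0: "opt N m \<alpha> c b x0"
 obtains x where "opt N m \<alpha> c b x" "!!j. j < N ==> 2 * y j - 2 * int H <= x j"
proof -
 \<comment> \<open>Among the optimal solutions one closest to \<open>2 y\<close> in the 1-norm is
   chosen; the contradiction will be a closer one.\<close>
 obtain x where x: "opt N m \<alpha> c b x"
  and min: "!!x'. opt N m \<alpha> c b x' ==> nat (\<Sum>j<N. \<bar>x j - 2 * y j\<bar>) <= nat (\<Sum>j<N. \<bar>x' j - 2 * y j\<bar>)" using ex_has_least_nat[of "opt N m \<alpha> c b" x0 "%x. nat (\<Sum>j<N. \<bar>x j - 2 * y j\<bar>)"] x0 by blast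
 have "2 * y j - 2 * int H <= x j" if j0: "j < N" for j
 proof (rule ccontr)
  assume *: "\<not> 2 * y j - 2 * int H <= x j"
  define d where "d i = x i - 2 * y i" for i
  \<comment> \<open>Halving leaves room for \<open>w\<close> twice: if \<open>2 w\<close> lies
    between 0 and \<open>d = x - 2 y\<close>, then both \<open>y + w\<close> and
    \<open>x - w\<close> stay nonnegative.\<close>
  define e where "e i = sgn (d i) * (\<bar>d i\<bar> div 2)" for i
  have y0: "0 <= y i" and x0: "0 <= x i" if "i < N" for i using x y that by (auto simp: opt_def feas_def)
  have e2: "2 * e i = d i - sgn (d i) * (\<bar>d i\<bar> mod 2)" for i
  proof -
   have "2 * e i = sgn (d i) * (\<bar>d i\<bar> - \<bar>d i\<bar> mod 2)"
    unfolding e_def by (simp add: minus_mod_eq_mult_div algebra_simps)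
   then show ?thesis by (simp add: right_diff_distrib sgn_mult_abs)
  qed
  have e_rho: "\<bar>lin N (\<alpha> k) e\<bar> <= 1 + int N * \<Delta>" if k: "k < m" for k
  proof -
   have "lin N (\<alpha> k) d = b k - 2 * b' k" using x y k unfolding d_def by (simp add: opt_def feas_def lin_diff lin_scale)
   then have 1: "\<bar>lin N (\<alpha> k) d\<bar> <= 1" using b k by simp
   have 2: "\<bar>lin N (\<alpha> k) (%i. sgn (d i) * (\<bar>d i\<bar> mod 2))\<bar> <= int N * (\<Delta> * 1)" by (rule abs_lin_le) (use \<alpha> k in \<open>auto simp: abs_mult sgn_if\<close>)
   have "2 * lin N (\<alpha> k) e = lin N (\<alpha> k) d - lin N (\<alpha> k) (%i. sgn (d i) * (\<bar>d i\<bar> mod 2))"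
    unfolding lin_scale[symmetric] lin_diff[symmetric] by (rule lin_cong) (simp_all add: e2)
   then show ?thesis using 1 2 by linarith
  qed
  have big: "int H <= \<bar>e j\<bar>"
  proof -
   have "2 * int H < \<bar>d j\<bar>" "d j < 0" using * unfolding d_def by linarith+
   then have "int H <= \<bar>d j\<bar> div 2" by linarith
   then show ?thesis using \<open>d j < 0\<close> unfolding e_def by (simp add: abs_mult)
  qed
  obtain w where w: "!!i. (0 <= w i & w i <= e i) \<or> (e i <= w i & w i <= 0)"
   "!!k. k < m ==> lin N (\<alpha> k) w = 0" "w j ~= 0" "w j ~= e j"
  proof (rule kernel_vector_below[of m N \<alpha> \<Delta> e "1 + int N * \<Delta>" H j])
   show "nat (2 * (1 + int N * \<Delta> + int N * \<Delta>) + 1) ^ m < H" using H by (simp add: algebra_simps)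
  qed (use \<alpha> e_rho big j0 in auto)
  have wd: "(0 <= w i & 2 * w i <= d i) \<or> (d i <= 2 * w i & w i <= 0)" for i
  proof -
   have "0 <= \<bar>d i\<bar> mod 2" by simp
   then have "(0 <= e i & 2 * e i <= d i) \<or> (d i <= 2 * e i & e i <= 0)" using e2[of i] unfolding e_def by (auto simp: sgn_if)
   then show ?thesis using w(1)[of i] by linarith
  qed
  have "feas N m \<alpha> b' (%i. y i + 1 * w i)"
  proof (rule feas_add)
   show "0 <= y i + 1 * w i" if "i < N" for i using wd[of i] y0[OF that] x0[OF that] unfolding d_def by linarith
  qed (use y w in \<open>auto simp: opt_def\<close>)
  then have cw: "0 <= lin N c w" using y unfolding opt_def by (fastforce simp: lin_add)
  have "feas N m \<alpha> b (%i. x i - w i)"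
  proof (rule feas_sub)
   show "w i <= x i" if "i < N" for i using wd[of i] y0[OF that] x0[OF that] unfolding d_def by linarith
  qed (use x w in \<open>auto simp: opt_def\<close>)
  then have opt: "opt N m \<alpha> c b (%i. x i - w i)" using x cw unfolding opt_def by (fastforce simp: lin_diff)
  have le: "\<bar>x i - w i - 2 * y i\<bar> <= \<bar>x i - 2 * y i\<bar>" for i using wd[of i] unfolding d_def by linarith
  have "\<bar>x j - w j - 2 * y j\<bar> < \<bar>x j - 2 * y j\<bar>" using wd[of j] w(3) unfolding d_def by linarith
  then have "(\<Sum>i<N. \<bar>x i - w i - 2 * y i\<bar>) < (\<Sum>i<N. \<bar>x i - 2 * y i\<bar>)" using le j0 by (intro sum_strict_mono_ex1) auto
  moreover have "0 <= (\<Sum>i<N. \<bar>x i - w i - 2 * y i\<bar>)" by (intro sum_nonneg) auto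
  ultimately show False using min[OF opt] by linarith
 qed
 then show ?thesis using x that by blast
qed

text \<open>Lower bounds \<open>u\<close> close to \<open>2 y\<close> can be imposed without losing
  all optimal solutions, and substituting them away leaves the right-hand side \<open>g\<close>. It
  is small because the image of \<open>2 y\<close> misses \<open>b\<close> by at most 1 in each row
  and \<open>u\<close> differs from \<open>2 y\<close> by at most \<open>2 H\<close>.\<close>

lemma scaling_step:
 fixes H :: nat
 assumes \<alpha>: "!!k j. k < m ==> j < N ==> \<bar>\<alpha> k j\<bar> <= \<Delta>" "0 <= \<Delta>"
  and b: "!!k. k < m ==> \<bar>b k - 2 * b' k\<bar> <= 1"
  and H: "nat (2 * (1 + 2 * (int N * \<Delta>)) + 1) ^ m < H"
  and y: "opt N m \<alpha> c b' y" and x0: "opt N m \<alpha> c b x0"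
  and u: "!!j. u j = max 0 (2 * y j - 2 * int H)"
  and g: "!!k. g k = b k - lin N (\<alpha> k) u"
 shows "\<exists>z. feas N m \<alpha> g z"
  and "!!z. opt N m \<alpha> c g z ==> opt N m \<alpha> c b (%j. u j + z j)"
  and "!!k. k < m ==> \<bar>g k\<bar> <= 1 + int N * (\<Delta> * (2 * int H))"
proof -
 obtain x where x: "opt N m \<alpha> c b x" "!!j. j < N ==> 2 * y j - 2 * int H <= x j" by (rule scaled_optimum_near[of m N \<alpha> \<Delta> b b' H c y x0]) (use assms in auto)
 have xu: "u j <= x j" if "j < N" for j using x that unfolding u by (auto simp: opt_def feas_def)
 have f: "feas N m \<alpha> g (%j. x j - u j)" using x xu by (simp add: opt_def feas_def g lin_diff)
 show "\<exists>z. feas N m \<alpha> g z" using f by blast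
 show "opt N m \<alpha> c b (%j. u j + z j)" if z: "opt N m \<alpha> c g z" for z
 proof -
  have "feas N m \<alpha> b (%j. u j + z j)"
  proof -
   have u0: "0 <= u j" for j by (simp add: u)
   show ?thesis using z u0 unfolding opt_def feas_def by (auto simp: g lin_add intro!: add_nonneg_nonneg)
  qed
  moreover have "lin N c (%j. u j + z j) <= lin N c x"
  proof -
   have "lin N c z <= lin N c (%j. x j - u j)" using z f unfolding opt_def by blast
   then show ?thesis by (simp add: lin_add lin_diff)
  qed
  ultimately show ?thesis using x unfolding opt_def by fastforce
 qed
 show "\<bar>g k\<bar> <= 1 + int N * (\<Delta> * (2 * int H))" if k: "k < m" for k
 proof -
  have y0: "0 <= y j" if "j < N" for j using y that by (auto simp: opt_def feas_def)
  have "\<bar>lin N (\<alpha> k) (%j. 2 * y j - u j)\<bar> <= int N * (\<Delta> * (2 * int H))"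
  proof (rule abs_lin_le)
   show "\<bar>2 * y j - u j\<bar> <= 2 * int H" if "j < N" for j using y0[OF that] by (simp add: u)
  qed (use \<alpha> k in auto)
  moreover have "g k = (b k - 2 * b' k) + lin N (\<alpha> k) (%j. 2 * y j - u j)" using y k by (simp add: g lin_diff lin_scale opt_def feas_def)
  ultimately show ?thesis using b[OF k] by linarith
 qed
qed

section \<open>Cheapest paths by halving, and packing vectors into integers\<close>

primrec bmin :: "int => (nat => bool) => (nat => int) => nat => int" where
 "bmin v P f 0 = v"
| "bmin v P f (Suc n) = (if P n then min (bmin v P f n) (f n) else bmin v P f n)"

lemma bmin_le_init: "bmin v P f n <= v" by (induction n) auto

lemma bmin_le: "j < n ==> P j ==> bmin v P f n <= f j" by (induction n) (auto simp: less_Suc_eq min_def)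

lemma bmin_cases: "bmin v P f n = v \<or> (\<exists>j<n. P j & bmin v P f n = f j)" by (induction n) (auto simp: less_Suc_eq min_def)

text \<open>\<open>BIG\<close> plays the role of infinity. Staying at the same vertex is free, which
  accounts for bits that are 0; \<open>t div 2 ^ sg\<close> is the bit level of step
  \<open>t\<close>.\<close>

definition base_dist :: "nat => (nat => int) => (nat => int) => nat => int => nat => int => int => int" where
 "base_dist N a w sg BIG t V1 V2 =
   bmin (if V1 = V2 then 0 else BIG) (%j. a j * 2 ^ (t div 2 ^ sg) = V1 - V2) (%j. w j * 2 ^ (t div 2 ^ sg)) N"

text \<open>Savitch's recursion: the cheapest way from \<open>V1\<close> to \<open>V2\<close> with the \<open>2 ^ r\<close> steps from \<open>t\<close> on,
 where step \<open>t\<close> may subtract \<open>2 ^ (t div 2 ^ sg)\<close> times a column.\<close>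

primrec dist_rec :: "(nat => int => int => int) => int => nat => (nat => nat => int) => nat => nat => int => int => int" where
 "dist_rec bs BIG NN mid 0 = bs"
| "dist_rec bs BIG NN mid (Suc r) = (%t V1 V2. bmin BIG (%_. True)
   (%\<kappa>. dist_rec bs BIG NN mid r t V1 (mid (t + 2 ^ r) \<kappa>) +
     dist_rec bs BIG NN mid r (t + 2 ^ r) (mid (t + 2 ^ r) \<kappa>) V2) NN)"

text \<open>Weights may be negative, so a missing path shows up not as \<open>BIG\<close> itself but
  as a value no more than \<open>W * 2 ^ r\<close> below it. Every other value is the weight of an
  actual vector; a badly chosen midpoint cannot produce a false one.\<close>

lemma dist_rec_sound:
 fixes N sg NN :: nat and a w :: "nat => int" and BIG :: int and mid :: "nat => nat => int"
 defines "D \<equiv> dist_rec (base_dist N a w sg BIG) BIG NN mid"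
 assumes W: "!!j i. j < N ==> i < 2 ^ sg ==> \<bar>w j * 2 ^ i\<bar> <= W" "0 <= W" "0 <= BIG"
 shows "t + 2 ^ r <= 2 ^ sg * 2 ^ sg ==>
  D r t V1 V2 <= BIG & - (W * 2 ^ r) <= D r t V1 V2 &
  (BIG - W * 2 ^ r <= D r t V1 V2 \<or>
   (\<exists>z. (\<forall>j. 0 <= z j) & (\<Sum>j<N. z j) <= 2 ^ r * 2 ^ 2 ^ sg & lin N a z = V1 - V2 &
    lin N w z = D r t V1 V2))"
proof (induction r arbitrary: t V1 V2)
 case 0
 define i where "i = t div 2 ^ sg"
 have i: "i < 2 ^ sg" unfolding i_def using 0 by (simp add: div_less_iff_less_mult)
 let ?v = "base_dist N a w sg BIG t V1 V2"
 have D: "D 0 t V1 V2 = ?v" by (simp add: D_def)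
 consider "?v = (if V1 = V2 then 0 else BIG)"
  | j where "j < N" "a j * 2 ^ i = V1 - V2" "?v = w j * 2 ^ i" using bmin_cases[of "if V1 = V2 then 0 else BIG" "%j. a j * 2 ^ (t div 2 ^ sg) = V1 - V2"
    "%j. w j * 2 ^ (t div 2 ^ sg)" N] unfolding base_dist_def i_def by auto
 then show ?case
 proof cases
  case 1
  show ?thesis
  proof (cases "V1 = V2")
   case True
   then show ?thesis unfolding D using 1 W by (auto intro!: exI[of _ "%j. 0"])
  qed (use 1 W D in auto)
 next
  case 2
  have le: "?v <= BIG" unfolding base_dist_def by (rule order_trans[OF bmin_le_init]) (use W in auto)
  have "\<bar>?v\<bar> <= W" using W(1)[OF 2(1) i] 2 by simp
  moreover have "\<exists>z. (\<forall>j. 0 <= z j) & (\<Sum>j<N. z j) <= 2 ^ 2 ^ sg & lin N a z = V1 - V2 &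
    lin N w z = ?v"
  proof (intro exI conjI)
   let ?z = "%k. if k = j then 2 ^ i else (0::int)"
   show "\<forall>j. 0 <= ?z j" by simp
   have "(2::int) ^ i <= 2 ^ 2 ^ sg" using i by (intro power_increasing) auto
   then show "(\<Sum>j<N. ?z j) <= 2 ^ 2 ^ sg" using 2(1) by simp
   show "lin N a ?z = V1 - V2" "lin N w ?z = ?v" using 2 by (simp_all add: lin_def if_distrib[of "%x. _ * x"] cong: if_cong)
  qed
  ultimately show ?thesis using le unfolding D by auto
 qed
next
 case (Suc r)
 let ?f = "%\<kappa>. D r t V1 (mid (t + 2 ^ r) \<kappa>) + D r (t + 2 ^ r) (mid (t + 2 ^ r) \<kappa>) V2"
 have D: "D (Suc r) t V1 V2 = bmin BIG (%_. True) ?f NN" by (simp add: D_def)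
 have le: "D (Suc r) t V1 V2 <= BIG" unfolding D by (rule bmin_le_init)
 have W2: "0 <= W * 2 ^ Suc r" using W by simp
 consider "D (Suc r) t V1 V2 = BIG" | \<kappa> where "D (Suc r) t V1 V2 = ?f \<kappa>" using bmin_cases[of BIG "%_. True" ?f NN] unfolding D by blast
 then show ?case
 proof cases
  case 1
  then show ?thesis using W2 W(3) by linarith
 next
  case 2
  let ?m = "mid (t + 2 ^ r) \<kappa>"
  have t: "t + 2 ^ r <= 2 ^ sg * 2 ^ sg" "t + 2 ^ r + 2 ^ r <= 2 ^ sg * 2 ^ sg" using Suc.prems by auto
  note A = Suc.IH[OF t(1), of V1 ?m] and B = Suc.IH[OF t(2), of ?m V2]
  have WW: "W * 2 ^ Suc r = W * 2 ^ r + W * 2 ^ r" by simp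
  have "- (W * 2 ^ Suc r) <= D (Suc r) t V1 V2" using A B unfolding 2 WW by linarith
  moreover have "BIG - W * 2 ^ Suc r <= D (Suc r) t V1 V2 \<or>
   (\<exists>z. (\<forall>j. 0 <= z j) & (\<Sum>j<N. z j) <= 2 ^ Suc r * 2 ^ 2 ^ sg & lin N a z = V1 - V2 &
    lin N w z = D (Suc r) t V1 V2)"
  proof (cases "BIG - W * 2 ^ r <= D r t V1 ?m \<or> BIG - W * 2 ^ r <= D r (t + 2 ^ r) ?m V2")
   case True
   then have "BIG - W * 2 ^ Suc r <= D (Suc r) t V1 V2" using A B unfolding 2 WW by linarith
   then show ?thesis ..
  next
   case False
   then obtain z1 z2 where
    "\<forall>j. 0 <= z1 j" "(\<Sum>j<N. z1 j) <= 2 ^ r * 2 ^ 2 ^ sg" "lin N a z1 = V1 - ?m"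
    "lin N w z1 = D r t V1 ?m"
    "\<forall>j. 0 <= z2 j" "(\<Sum>j<N. z2 j) <= 2 ^ r * 2 ^ 2 ^ sg" "lin N a z2 = ?m - V2"
    "lin N w z2 = D r (t + 2 ^ r) ?m V2" using A B by blast
   then show ?thesis unfolding 2 by (intro disjI2 exI[of _ "%j. z1 j + z2 j"]) (auto simp: lin_add sum.distrib)
  qed
  ultimately show ?thesis using le by blast
 qed
qed

text \<open>A path \<open>V\<close> whose vertices all occur among the enumerated midpoints can be
  split at its middle vertex on every level, so the recursion finds a value no larger than its
  weight.\<close>

lemma dist_rec_complete:
 fixes N sg NN :: nat and a w :: "nat => int" and BIG :: int and mid :: "nat => nat => int"
 defines "D \<equiv> dist_rec (base_dist N a w sg BIG) BIG NN mid"
 assumes step: "!!t. t < T ==> (V t = V (Suc t) & \<gamma> t = 0) \<or>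
   (\<exists>j<N. a j * 2 ^ (t div 2 ^ sg) = V t - V (Suc t) & \<gamma> t = w j * 2 ^ (t div 2 ^ sg))"
  and mid: "!!t. t < T ==> \<exists>\<kappa><NN. mid t \<kappa> = V t"
 shows "t + 2 ^ r <= T ==> D r t (V t) (V (t + 2 ^ r)) <= (\<Sum>i\<in>{t..<t + 2 ^ r}. \<gamma> i)"
proof (induction r arbitrary: t)
 case 0
 then have "t < T" by simp
 from step[OF this] show ?case
 proof
  assume "V t = V (Suc t) & \<gamma> t = 0"
  then show ?thesis using bmin_le_init unfolding D_def dist_rec.simps base_dist_def by (fastforce intro: order_trans[OF bmin_le_init])
 next
  assume "\<exists>j<N. a j * 2 ^ (t div 2 ^ sg) = V t - V (Suc t) & \<gamma> t = w j * 2 ^ (t div 2 ^ sg)"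
  then obtain j where j: "j < N" "a j * 2 ^ (t div 2 ^ sg) = V t - V (Suc t)"
   "\<gamma> t = w j * 2 ^ (t div 2 ^ sg)" by blast
  then have "D 0 t (V t) (V (t + 2 ^ 0)) <= w j * 2 ^ (t div 2 ^ sg)"
   unfolding D_def dist_rec.simps base_dist_def by (intro bmin_le) auto
  then show ?thesis using j by simp
 qed
next
 case (Suc r)
 obtain \<kappa> where \<kappa>: "\<kappa> < NN" "mid (t + 2 ^ r) \<kappa> = V (t + 2 ^ r)"
 proof -
  have "(0::nat) < 2 ^ r" by simp
  then have "t + 2 ^ r < T" using Suc.prems unfolding power_Suc by linarith
  then show ?thesis using mid that by blast
 qed
 have "D (Suc r) t (V t) (V (t + 2 ^ Suc r)) <= D r t (V t) (V (t + 2 ^ r)) + D r (t + 2 ^ r) (V (t + 2 ^ r)) (V (t + 2 ^ Suc r))"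
  unfolding D_def dist_rec.simps using \<kappa> by (intro order_trans[OF bmin_le[where j = \<kappa>]]) auto
 also have "... <= (\<Sum>i\<in>{t..<t + 2 ^ r}. \<gamma> i) + (\<Sum>i\<in>{t + 2 ^ r..<t + 2 ^ r + 2 ^ r}. \<gamma> i)" using Suc.IH[of t] Suc.IH[of "t + 2 ^ r"] Suc.prems by (simp add: add.assoc mult_2)
 also have "... = (\<Sum>i\<in>{t..<t + 2 ^ Suc r}. \<gamma> i)" by (subst sum.atLeastLessThan_concat) (auto simp: mult_2 add.assoc)
 finally show ?case .
qed

text \<open>One counter enumerates all midpoint candidates: its digits in base \<open>B\<close>
  choose the coordinates independently.\<close>

lemma digits_exist:
 fixes d :: "nat => nat"
 assumes "!!k. d k < B"
 shows "\<exists>\<kappa><B ^ m. \<forall>k<m. (\<kappa> div B ^ k) mod B = d k" using assms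
proof (induction m arbitrary: d)
 case (Suc m)
 have "0 < B" using Suc.prems[of 0] by simp
 obtain \<kappa> where \<kappa>: "\<kappa> < B ^ m" "\<forall>k<m. (\<kappa> div B ^ k) mod B = d (Suc k)" using Suc.IH[of "%k. d (Suc k)"] Suc.prems by blast
 show ?case
 proof (intro exI[of _ "d 0 + B * \<kappa>"] conjI allI impI)
  have "d 0 + B * \<kappa> < B + B * \<kappa>" using Suc.prems[of 0] by simp
  also have "... = B * Suc \<kappa>" by simp
  also have "... <= B * B ^ m" using \<kappa> by (intro mult_le_mono) auto
  finally show "d 0 + B * \<kappa> < B ^ Suc m" by simp
  show "(d 0 + B * \<kappa>) div B ^ k mod B = d k" if "k < Suc m" for k
  proof (cases k)
   case 0 then show ?thesis using Suc.prems[of 0] by simp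
  next
   case (Suc k')
   have "(d 0 + B * \<kappa>) div B ^ k = ((d 0 + B * \<kappa>) div B) div B ^ k'"
    unfolding Suc by (simp add: div_mult2_eq)
   also have "(d 0 + B * \<kappa>) div B = \<kappa>" using Suc.prems[of 0] \<open>0 < B\<close> by simp
   finally show ?thesis using \<kappa> that Suc by simp
  qed
 qed
qed auto

text \<open>This is how a solution is read off an optimal value: entries below \<open>B\<close> are
  the low digits, and the cost \<open>C\<close>, which may have either sign, is the quotient above
  them.\<close>

lemma digits_decode:
 fixes z :: "nat => int" and B C :: int
 assumes "!!j. j < N ==> 0 <= z j & z j < B" "0 < B"
 shows "(C * B ^ N + (\<Sum>j<N. z j * B ^ j)) div B ^ N = C &
  (\<forall>j<N. (C * B ^ N + (\<Sum>j<N. z j * B ^ j)) div B ^ j mod B = z j)" using assms(1)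
proof (induction N arbitrary: z)
 case (Suc N)
 let ?v = "C * B ^ N + (\<Sum>j<N. z (Suc j) * B ^ j)"
 have v: "C * B ^ Suc N + (\<Sum>j<Suc N. z j * B ^ j) = z 0 + B * ?v" by (subst sum.lessThan_Suc_shift) (simp add: sum_distrib_left algebra_simps)
 have z0: "0 <= z 0" "z 0 < B" using Suc.prems[of 0] by auto
 have d: "(z 0 + B * ?v) div B = ?v" using z0 \<open>0 < B\<close> by simp
 have IH: "?v div B ^ N = C" "\<forall>j<N. ?v div B ^ j mod B = z (Suc j)" using Suc.IH[of "%j. z (Suc j)"] Suc.prems by auto
 have dd: "(z 0 + B * ?v) div B ^ Suc k = ?v div B ^ k" for k
  unfolding power_Suc using \<open>0 < B\<close> by (simp add: zdiv_zmult2_eq d)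
 show ?case unfolding v
 proof (intro conjI allI impI)
  show "(z 0 + B * ?v) div B ^ Suc N = C" unfolding dd by (rule IH)
  show "(z 0 + B * ?v) div B ^ j mod B = z j" if "j < Suc N" for j
  proof (cases j)
   case 0 then show ?thesis using z0 by simp
  next
   case (Suc j')
   then show ?thesis using that IH(2) by (simp add: dd del: power_Suc)
  qed
 qed
qed auto

text \<open>Modulo \<open>B\<close> the lowest coefficient must vanish, and division by
  \<open>B\<close> leaves the same situation with one coefficient less. Thus packing
  \<open>m\<close> equations into one loses nothing as long as the residuals are small.\<close>

lemma agg_eq_0:
 fixes d :: "nat => int" and B :: int
 assumes "!!k. k < m ==> \<bar>d k\<bar> < B" "(\<Sum>k<m. d k * B ^ k) = 0" "k < m"
 shows "d k = 0" using assms
proof (induction m arbitrary: d k)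
 case (Suc m)
 have "0 < B" using Suc.prems(1)[of 0] by simp
 have s: "d 0 + B * (\<Sum>k<m. d (Suc k) * B ^ k) = 0" using Suc.prems(2) by (subst (asm) sum.lessThan_Suc_shift) (simp add: sum_distrib_left algebra_simps)
 then have "d 0 = B * (- (\<Sum>k<m. d (Suc k) * B ^ k))" by simp
 then have "B dvd d 0" by (rule dvdI)
 then have d0: "d 0 = 0" using Suc.prems(1)[of 0] zdvd_imp_le[of B "\<bar>d 0\<bar>"] by fastforce
 show ?case
 proof (cases k)
  case (Suc k')
  have "(\<Sum>k<m. d (Suc k) * B ^ k) = 0" using s d0 \<open>0 < B\<close> by simp
  then show ?thesis using Suc.IH[of "%k. d (Suc k)" k'] Suc.prems(1,3) Suc by auto
 qed (use d0 in auto)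
qed auto
definition agg :: "nat => nat => (nat => int) => int" where
 "agg q m v = (\<Sum>k<m. v k * 2 ^ (q * k))"

text \<open>At level \<open>i\<close> coordinate \<open>k\<close> is \<open>2 ^ i\<close> times an
  integer close to \<open>g k div 2 ^ i\<close>; a digit of \<open>\<kappa>\<close> in base
  \<open>2 ^ (e + 1)\<close> is the offset, shifted by \<open>2 ^ e\<close> to be
  nonnegative.\<close>

definition mid_point :: "nat => nat => nat => nat => (nat => int) => nat => nat => int" where
 "mid_point q m sg e g t \<kappa> = (let i = t div 2 ^ sg in
   \<Sum>k<m. (g k div 2 ^ i - 2 ^ e + int ((\<kappa> div 2 ^ ((e + 1) * k)) mod 2 ^ (e + 1))) * 2 ^ (i + q * k))"

definition col :: "nat => nat => (nat => nat => int) => nat => int" where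
 "col q m \<alpha> j = agg q m (%k. \<alpha> k j)"

text \<open>The summand \<open>2 ^ (q * j)\<close> makes a total weight record entry
  \<open>j\<close> in its own block of \<open>q\<close> bits; the cost sits above all
  blocks.\<close>

definition wgt :: "nat => nat => (nat => int) => nat => int" where
 "wgt q N c j = c j * 2 ^ (q * N) + 2 ^ (q * j)"

text \<open>The depth \<open>2 * sg\<close> gives \<open>2 ^ sg\<close> bit levels times
  \<open>2 ^ sg\<close> slots, one slot for each column of a small support.\<close>

definition inner_value :: "nat => nat => nat => nat => nat => int => (nat => nat => int) => (nat => int) => (nat => int) => int" where
 "inner_value N m q sg e BIG \<alpha> c g =
   dist_rec (base_dist N (col q m \<alpha>) (wgt q N c) sg BIG) BIG (2 ^ ((e + 1) * m))
    (mid_point q m sg e g) (2 * sg) 0 (agg q m g) 0"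

lemma agg_lin: "agg q m (%k. lin N (\<alpha> k) x) = lin N (col q m \<alpha>) x"
 unfolding agg_def lin_def col_def sum_distrib_right by (subst sum.swap) (simp add: algebra_simps)

lemma lin_wgt: "lin N (wgt q N c) x = lin N c x * 2 ^ (q * N) + (\<Sum>j<N. x j * (2 ^ q) ^ j)"
 unfolding lin_def wgt_def distrib_right sum.distrib sum_distrib_right power_mult by (simp add: mult_ac)

lemma div_power_Suc: "(x::int) div 2 ^ i - 2 * (x div 2 ^ Suc i) = x div 2 ^ i mod 2"
proof -
 have "x div 2 ^ Suc i = (x div 2 ^ i) div 2" by (simp add: zdiv_zmult2_eq[symmetric] mult.commute)
 then show ?thesis by (simp add: minus_mult_div_eq_mod)
qed

text \<open>The columns of the support get distinct slots, and step \<open>t\<close> clears bit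
  \<open>t div 2 ^ sg\<close> of the column in slot \<open>t mod 2 ^ sg\<close>. In the order of
  \<open>t\<close> the low bits go first, so at level \<open>i\<close> the residual is divisible by
  \<open>2 ^ i\<close> and differs from \<open>g\<close> only by the contribution of the few cleared
  bits. This keeps it within the range of \<open>mid_point\<close>.\<close>

lemma inner_value_complete:
 fixes N m q sg \<delta> :: nat and z :: "nat => int"
 assumes \<alpha>: "!!k j. k < m ==> j < N ==> \<bar>\<alpha> k j\<bar> <= 2 ^ \<delta>"
  and z: "feas N m \<alpha> g z" "small N (2 ^ sg) (2 ^ 2 ^ sg) z"
 shows "inner_value N m q sg (\<delta> + sg + 2) BIG \<alpha> c g <= lin N (wgt q N c) z"
proof -
 let ?S = "2 ^ sg :: nat" and ?e = "\<delta> + sg + 2"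
 have S0: "0 < ?S" by simp
 define supp where "supp = {j. j < N & z j ~= 0}"
 have fin: "finite supp" and cs: "card supp <= ?S" and zL: "!!j. j < N ==> z j < 2 ^ 2 ^ sg" using z by (auto simp: supp_def small_def)
 obtain sl where sl: "sl ` supp \<subseteq> {..<?S}" "inj_on sl supp" using card_le_inj[OF fin, of "{..<?S}"] cs by auto
 have z0: "0 <= z j" if "j < N" for j using z that by (auto simp: feas_def)
 \<comment> \<open>The number of bits cleared before step \<open>t\<close> in the column of slot
   \<open>p\<close>; \<open>\<zeta> t\<close> is \<open>z\<close> with these bits removed.\<close>
 define nn where "nn p t = t div ?S + (if p < t mod ?S then 1 else 0)" for p t
 have nn0: "nn p 0 = 0" for p by (simp add: nn_def)
 have nnT: "nn p (?S * ?S) = ?S" for p by (simp add: nn_def)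
 have nnS: "nn p (Suc t) = nn p t + (if p = t mod ?S then 1 else 0)" if "p < ?S" for p t
 proof (cases "Suc (t mod ?S) = ?S")
  case True
  then have "Suc t mod ?S = 0" "Suc t div ?S = Suc (t div ?S)" by (simp_all add: mod_Suc div_Suc)
  then show ?thesis using True that by (auto simp: nn_def)
 next
  case False
  then have "Suc t mod ?S = Suc (t mod ?S)" "Suc t div ?S = t div ?S" by (simp_all add: mod_Suc div_Suc)
  then show ?thesis by (auto simp: nn_def)
 qed
 define \<zeta> where "\<zeta> t j = (if j \<in> supp then 2 ^ nn (sl j) t * (z j div 2 ^ nn (sl j) t) else 0)" for t j
 define V where "V t = lin N (col q m \<alpha>) (\<zeta> t)" for t
 define \<gamma> where "\<gamma> t = lin N (wgt q N c) (\<zeta> t) - lin N (wgt q N c) (\<zeta> (Suc t))" for t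
 have \<zeta>S: "\<zeta> t j - \<zeta> (Suc t) j =
   (if j \<in> supp & sl j = t mod ?S then 2 ^ (t div ?S) * (z j div 2 ^ (t div ?S) mod 2) else 0)" for t j
 proof (cases "j \<in> supp")
  case True
  then have lt: "sl j < ?S" using sl by auto
  show ?thesis
  proof (cases "sl j = t mod ?S")
   case eq: True
   have n: "nn (sl j) t = t div ?S" unfolding eq by (simp add: nn_def)
   have "\<zeta> t j - \<zeta> (Suc t) j = 2 ^ (t div ?S) * (z j div 2 ^ (t div ?S) - 2 * (z j div 2 ^ Suc (t div ?S)))" using True eq lt unfolding \<zeta>_def nnS[OF lt] n by (simp add: algebra_simps)
   then show ?thesis using True eq unfolding div_power_Suc by simp
  next
   case False
   then show ?thesis using True by (simp add: \<zeta>_def nnS[OF lt])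
  qed
 qed (simp add: \<zeta>_def)
 have step: "(V t = V (Suc t) & \<gamma> t = 0) \<or>
   (\<exists>j<N. col q m \<alpha> j * 2 ^ (t div 2 ^ sg) = V t - V (Suc t) & \<gamma> t = wgt q N c j * 2 ^ (t div 2 ^ sg))" for t
 proof -
  let ?d = "%j. \<zeta> t j - \<zeta> (Suc t) j"
  have eqs: "V t - V (Suc t) = lin N (col q m \<alpha>) ?d" "\<gamma> t = lin N (wgt q N c) ?d"
   unfolding V_def \<gamma>_def by (simp_all add: lin_diff)
  show ?thesis
  proof (cases "\<exists>j0\<in>supp. sl j0 = t mod ?S & z j0 div 2 ^ (t div ?S) mod 2 = 1")
   case True
   then obtain j0 where j0: "j0 \<in> supp" "sl j0 = t mod ?S" "z j0 div 2 ^ (t div ?S) mod 2 = 1" by blast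
   have "?d j = (if j = j0 then 2 ^ (t div ?S) else 0)" for j
   proof (cases "j = j0")
    case False
    then have "\<not> (j \<in> supp & sl j = t mod ?S)" using j0 inj_onD[OF sl(2), of j j0] by metis
    then show ?thesis unfolding \<zeta>S using False by (simp only: if_False)
   qed (use j0 in \<open>simp add: \<zeta>S\<close>)
   then have "lin N f ?d = f j0 * 2 ^ (t div ?S)" for f using j0(1) by (simp add: lin_def supp_def if_distrib[of "%x. _ * x"] cong: if_cong)
   then show ?thesis using eqs j0(1) by (intro disjI2 exI[of _ j0]) (auto simp: supp_def)
  next
   case False
   then have "z j div 2 ^ (t div ?S) mod 2 = 0" if "j \<in> supp" "sl j = t mod ?S" for j using that by (meson not_mod_2_eq_1_eq_0)
   then have "?d j = 0" for j unfolding \<zeta>S by auto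
   then have "lin N f ?d = 0" for f by (simp add: lin_def)
   then show ?thesis using eqs by simp
  qed
 qed
 have mid: "\<exists>\<kappa><2 ^ ((?e + 1) * m). mid_point q m sg ?e g t \<kappa> = V t" for t
 proof -
  define i where "i = t div ?S"
  define v where "v k = lin N (\<alpha> k) (%j. \<zeta> t j div 2 ^ i)" for k
  have \<zeta>i: "2 ^ i * (\<zeta> t j div 2 ^ i) = \<zeta> t j" for j
  proof -
   have "(2::int) ^ i dvd \<zeta> t j" unfolding \<zeta>_def nn_def i_def by (simp add: power_add)
   then show ?thesis by simp
  qed
  have v2: "2 ^ i * v k = lin N (\<alpha> k) (\<zeta> t)" for k
   unfolding v_def lin_scale[symmetric] \<zeta>i by simp
  \<comment> \<open>Each of at most \<open>2 ^ sg\<close> columns has lost at most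
    \<open>2 ^ (i + 1)\<close>. Multiplied by the entry bound \<open>2 ^ \<delta>\<close>, and with
    the rounding of \<open>g k\<close> added, this is where \<open>e = \<delta> + sg + 2\<close>
    comes from.\<close>
  have diff: "\<bar>v k - g k div 2 ^ i\<bar> < 2 ^ ?e" if k: "k < m" for k
  proof -
   have "\<bar>lin N (\<alpha> k) (%j. z j - \<zeta> t j)\<bar> <= (\<Sum>j<N. \<bar>\<alpha> k j * (z j - \<zeta> t j)\<bar>)"
    unfolding lin_def by (rule sum_abs)
   also have "... <= (\<Sum>j<N. if j \<in> supp then 2 ^ \<delta> * 2 ^ Suc i else 0)"
   proof (rule sum_mono)
    fix j assume "j \<in> {..<N}"
    then have j: "j < N" by simp
    show "\<bar>\<alpha> k j * (z j - \<zeta> t j)\<bar> <= (if j \<in> supp then 2 ^ \<delta> * 2 ^ Suc i else 0)"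
    proof (cases "j \<in> supp")
     case True
     have "z j - \<zeta> t j = z j mod 2 ^ nn (sl j) t"
      unfolding \<zeta>_def using True by (simp add: minus_mult_div_eq_mod)
     moreover have "z j mod 2 ^ nn (sl j) t < 2 ^ nn (sl j) t" "0 <= z j mod 2 ^ nn (sl j) t" by auto
     moreover have "(2::int) ^ nn (sl j) t <= 2 ^ Suc i" by (rule power_increasing) (auto simp: nn_def i_def)
     ultimately have "\<bar>z j - \<zeta> t j\<bar> <= 2 ^ Suc i" by linarith
     then show ?thesis using True \<alpha>[OF k j] unfolding abs_mult by (simp only: if_True) (intro mult_mono, auto)
    next
     case False
     then have "z j = 0" "\<zeta> t j = 0" using j by (auto simp: supp_def \<zeta>_def)
     then show ?thesis using False by simp
    qed
   qed
   also have "... = int (card supp) * (2 ^ \<delta> * 2 ^ Suc i)"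
   proof -
    have "{..<N} \<inter> supp = supp" by (auto simp: supp_def)
    then show ?thesis by (simp add: sum.inter_restrict[symmetric])
   qed
   also have "... <= 2 ^ sg * (2 ^ \<delta> * 2 ^ Suc i)"
   proof (rule mult_right_mono)
    show "int (card supp) <= 2 ^ sg" using cs by (metis of_nat_le_iff of_nat_numeral of_nat_power)
   qed simp
   finally have 1: "\<bar>g k - 2 ^ i * v k\<bar> <= 2 ^ sg * (2 ^ \<delta> * 2 ^ Suc i)" using z k unfolding lin_diff v2[symmetric] by (simp add: feas_def)
   have "g k = 2 ^ i * (g k div 2 ^ i) + g k mod 2 ^ i" by simp
   then have "2 ^ i * (v k - g k div 2 ^ i) = g k mod 2 ^ i - (g k - 2 ^ i * v k)" by (simp add: algebra_simps)
   moreover have "0 <= g k mod 2 ^ i" "g k mod 2 ^ i < 2 ^ i" by auto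
   ultimately have "\<bar>2 ^ i * (v k - g k div 2 ^ i)\<bar> < 2 ^ i + 2 ^ sg * (2 ^ \<delta> * 2 ^ Suc i)" using 1 by linarith
   also have "... = 2 ^ i * (1 + 2 ^ sg * 2 ^ \<delta> * 2)" by (simp add: algebra_simps)
   finally have "2 ^ i * \<bar>v k - g k div 2 ^ i\<bar> < 2 ^ i * (1 + 2 ^ sg * 2 ^ \<delta> * 2)" by (simp add: abs_mult)
   then have 2: "\<bar>v k - g k div 2 ^ i\<bar> < 1 + 2 ^ sg * 2 ^ \<delta> * 2" by simp
   have "(1::int) <= 2 ^ sg * 2 ^ \<delta>" by (simp add: power_add[symmetric])
   then have "(1::int) + 2 ^ sg * 2 ^ \<delta> * 2 <= 2 ^ sg * 2 ^ \<delta> * 4" by linarith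
   also have "... = 2 ^ ?e" by (simp add: power_add)
   finally show ?thesis using 2 by linarith
  qed
  define d where "d k = (if k < m then nat (v k - g k div 2 ^ i + 2 ^ ?e) else 0)" for k
  have d: "d k < 2 ^ (?e + 1)" for k
  proof (cases "k < m")
   case True
   have "v k - g k div 2 ^ i + 2 ^ ?e < 2 ^ (?e + 1)" using diff[OF True] by simp
   then show ?thesis using True by (simp add: d_def nat_less_iff del: power_Suc)
  qed (simp add: d_def)
  obtain \<kappa> where \<kappa>: "\<kappa> < (2 ^ (?e + 1)) ^ m" "\<forall>k<m. \<kappa> div (2 ^ (?e + 1)) ^ k mod 2 ^ (?e + 1) = d k" using digits_exist[of d "2 ^ (?e + 1)" m] d by blast
  show ?thesis
  proof (intro exI conjI)
   show "\<kappa> < 2 ^ ((?e + 1) * m)" using \<kappa>(1) by (simp only: power_mult)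
   have "mid_point q m sg ?e g t \<kappa> = (\<Sum>k<m. v k * 2 ^ (i + q * k))"
    unfolding mid_point_def Let_def i_def[symmetric]
   proof (rule sum.cong)
    fix k assume "k \<in> {..<m}"
    then have k: "k < m" by simp
    have "int (\<kappa> div 2 ^ ((?e + 1) * k) mod 2 ^ (?e + 1)) = v k - g k div 2 ^ i + 2 ^ ?e" using \<kappa>(2) k diff[OF k] by (simp only: power_mult d_def) auto
    then show "(g k div 2 ^ i - 2 ^ ?e + int (\<kappa> div 2 ^ ((?e + 1) * k) mod 2 ^ (?e + 1))) *
     2 ^ (i + q * k) = v k * 2 ^ (i + q * k)" by simp
   qed simp
   also have "... = agg q m (%k. lin N (\<alpha> k) (\<zeta> t))"
    unfolding agg_def v2[symmetric] by (simp add: power_add algebra_simps)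
   also have "... = V t" unfolding agg_lin V_def ..
   finally show "mid_point q m sg ?e g t \<kappa> = V t" .
  qed
 qed
 have SS: "2 ^ (2 * sg) = ?S * ?S" by (simp add: mult_2 power_add)
 have \<zeta>0: "\<zeta> 0 j = z j" if "j < N" for j using that by (auto simp: \<zeta>_def nn0 supp_def)
 have \<zeta>T: "\<zeta> (?S * ?S) j = 0" if "j < N" for j using z0[OF that] zL[OF that] by (simp add: \<zeta>_def nnT div_pos_pos_trivial)
 have V0: "V 0 = agg q m g"
 proof -
  have "V 0 = lin N (col q m \<alpha>) z" unfolding V_def by (rule lin_cong) (auto simp: \<zeta>0)
  also have "... = agg q m (%k. lin N (\<alpha> k) z)" by (rule agg_lin[symmetric])
  also have "... = agg q m g" using z by (simp add: agg_def feas_def)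
  finally show ?thesis .
 qed
 have VT: "V (?S * ?S) = 0" unfolding V_def lin_def by (simp add: \<zeta>T)
 have "inner_value N m q sg ?e BIG \<alpha> c g <= (\<Sum>i\<in>{0..<0 + 2 ^ (2 * sg)}. \<gamma> i)" using dist_rec_complete[of "2 ^ (2 * sg)" V \<gamma> N "col q m \<alpha>" sg "wgt q N c" "2 ^ ((?e + 1) * m)"
   "mid_point q m sg ?e g" 0 "2 * sg" BIG] step mid V0 VT
  unfolding inner_value_def SS by (simp only: add_0 order_refl simp_thms)
 also have "... = lin N (wgt q N c) (\<zeta> 0) - lin N (wgt q N c) (\<zeta> (?S * ?S))"
  unfolding SS add_0 \<gamma>_def by (simp only: atLeast0LessThan) (rule sum_lessThan_telescope')
 also have "... = lin N (wgt q N c) z" unfolding lin_def by (simp add: \<zeta>0 \<zeta>T)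
 finally show ?thesis .
qed

text \<open>The vector found need not be small, but its entries sum to at most
  \<open>2 ^ (2 * sg) * 2 ^ 2 ^ sg\<close>, so blocks of \<open>q\<close> bits suffice both for
  decoding the entries and for unpacking the equations. The low digits total less than
  \<open>2 ^ (q * N)\<close>; comparing quotients with those of \<open>y\<close> therefore compares
  true costs.\<close>

lemma inner_value_correct:
 fixes N m q sg \<delta> :: nat and c g :: "nat => int" and \<alpha> :: "nat => nat => int" and BIG :: int
 defines "v \<equiv> inner_value N m q sg (\<delta> + sg + 2) BIG \<alpha> c g"
 defines "z \<equiv> (%j. v div 2 ^ (q * j) mod 2 ^ q)"
 assumes \<alpha>: "!!k j. k < m ==> j < N ==> \<bar>\<alpha> k j\<bar> <= 2 ^ \<delta>"
  and c: "!!j. j < N ==> \<bar>c j\<bar> < 2 ^ \<mu>"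
  and g: "!!k. k < m ==> \<bar>g k\<bar> < 2 ^ (q - 1)"
  and q: "\<delta> + 2 * sg + 2 ^ sg < q"
  and BIG: "2 ^ (2 * sg + 2 ^ sg + q * N + \<mu> + 2) <= BIG"
  and y: "feas N m \<alpha> g y" "small N (2 ^ sg) (2 ^ 2 ^ sg) y"
 shows "feas N m \<alpha> g z" "lin N c z = v div 2 ^ (q * N)" "lin N c z <= lin N c y"
proof -
 let ?W = "2 ^ (2 ^ sg + q * N + \<mu>) :: int"
 have w1: "\<bar>wgt q N c j\<bar> <= 2 ^ (q * N + \<mu>)" if "j < N" for j
 proof -
  have "\<bar>c j * 2 ^ (q * N) + 2 ^ (q * j)\<bar> <= (2 ^ \<mu> - 1) * 2 ^ (q * N) + 2 ^ (q * N)"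
  proof -
   have "\<bar>c j * 2 ^ (q * N)\<bar> <= (2 ^ \<mu> - 1) * 2 ^ (q * N)"
    unfolding abs_mult using c[OF that] by (intro mult_mono) auto
   moreover have "(2::int) ^ (q * j) <= 2 ^ (q * N)" "(0::int) <= 2 ^ (q * j)" using that by (auto intro!: power_increasing)
   ultimately show ?thesis by linarith
  qed
  also have "... = 2 ^ (q * N + \<mu>)" by (simp add: algebra_simps power_add)
  finally show ?thesis by (simp add: wgt_def)
 qed
 have w: "\<bar>wgt q N c j * 2 ^ i\<bar> <= ?W" if "j < N" "i < 2 ^ sg" for j i
 proof -
  have "(2::int) ^ i <= 2 ^ 2 ^ sg" using that by (intro power_increasing) auto
  then have "\<bar>wgt q N c j\<bar> * 2 ^ i <= 2 ^ (q * N + \<mu>) * 2 ^ 2 ^ sg" using w1[OF that(1)] by (intro mult_mono) auto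
  then show ?thesis by (simp add: abs_mult power_add algebra_simps)
 qed
 have B0: "0 <= BIG" using order_trans[OF _ BIG, of 0] by simp
 have W4: "4 * (?W * 2 ^ (2 * sg)) <= BIG" using BIG by (simp add: power_add algebra_simps)
 have W0: "0 < ?W * 2 ^ (2 * sg)" by simp
 have yy: "v <= lin N (wgt q N c) y" unfolding v_def using inner_value_complete[OF \<alpha> y] by simp
 have ylt: "0 <= y j" "y j < 2 ^ 2 ^ sg" if "j < N" for j using y that by (auto simp: feas_def small_def)
 have S: "0 + 2 ^ (2 * sg) <= 2 ^ sg * (2::nat) ^ sg" by (simp add: mult_2 power_add)
 note snd = dist_rec_sound[of N sg "wgt q N c" ?W BIG 0 "2 * sg" "col q m \<alpha>" "2 ^ ((\<delta> + sg + 2 + 1) * m)"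
   "mid_point q m sg (\<delta> + sg + 2) g" "agg q m g" 0, OF w _ B0 S, folded inner_value_def, folded v_def]
 \<comment> \<open>The weight of \<open>y\<close> is at most \<open>?W * 2 ^ sg\<close>, while a
   missing path would give almost \<open>BIG\<close>. The two extra bits in \<open>BIG\<close>
   separate these ranges.\<close>
 have nBIG: "\<not> BIG - ?W * 2 ^ (2 * sg) <= v"
 proof -
  have "lin N (wgt q N c) y <= ?W * 2 ^ sg"
  proof -
   have "lin N (wgt q N c) y = (\<Sum>j\<in>{j. j < N & y j ~= 0}. wgt q N c j * y j)"
    unfolding lin_def by (rule sum.mono_neutral_right) auto
   also have "... <= (\<Sum>j\<in>{j. j < N & y j ~= 0}. ?W)"
   proof (rule sum_mono)
    fix j assume "j \<in> {j. j < N & y j ~= 0}"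
    then have j: "j < N" by simp
    have "wgt q N c j * y j <= \<bar>wgt q N c j\<bar> * y j" using ylt[OF j] by (intro mult_right_mono) auto
    also have "... <= 2 ^ (q * N + \<mu>) * 2 ^ 2 ^ sg" using ylt[OF j] w1[OF j] by (intro mult_mono) auto
    finally show "wgt q N c j * y j <= ?W" by (simp add: power_add algebra_simps)
   qed
   also have "... = int (card {j. j < N & y j ~= 0}) * ?W" by simp
   also have "... <= 2 ^ sg * ?W"
   proof (rule mult_right_mono)
    have "card {j. j < N & y j ~= 0} <= 2 ^ sg" using y by (simp add: small_def)
    then show "int (card {j. j < N & y j ~= 0}) <= 2 ^ sg" by (metis of_nat_le_iff of_nat_numeral of_nat_power)
   qed simp
   finally show ?thesis by (simp add: mult.commute)
  qed
  also have "?W * 2 ^ sg <= ?W * 2 ^ (2 * sg)" by (intro mult_left_mono power_increasing) auto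
  finally show ?thesis using yy W4 W0 by linarith
 qed
 then obtain z' where z': "\<forall>j. 0 <= z' j" "(\<Sum>j<N. z' j) <= 2 ^ (2 * sg) * 2 ^ 2 ^ sg"
  "lin N (col q m \<alpha>) z' = agg q m g" "lin N (wgt q N c) z' = v" using snd by auto
 have le: "2 ^ (2 * sg) * 2 ^ 2 ^ sg * 2 ^ \<delta> <= (2::int) ^ (q - 1)"
  unfolding power_add[symmetric] by (rule power_increasing) (use q in auto)
 have z'q: "0 <= z' j & z' j < 2 ^ q" if j: "j < N" for j
 proof -
  have "z' j <= (\<Sum>j<N. z' j)" using z'(1) j by (intro member_le_sum) auto
  also have "... <= 2 ^ (2 * sg) * 2 ^ 2 ^ sg" by (rule z')
  also have "... < 2 ^ q" unfolding power_add[symmetric] by (rule power_strict_increasing) (use q in auto)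
  finally show ?thesis using z' by simp
 qed
 have dec: "v div 2 ^ (q * N) = lin N c z'" "!!j. j < N ==> v div 2 ^ (q * j) mod 2 ^ q = z' j" using digits_decode[of N z' "2 ^ q" "lin N c z'"] z'q z'(4)
  unfolding lin_wgt power_mult by auto
 have zz: "z j = z' j" if "j < N" for j using dec(2)[OF that] by (simp add: z_def)
 have lz: "lin N f z = lin N f z'" for f by (rule lin_cong) (auto simp: zz)
 show eq: "lin N c z = v div 2 ^ (q * N)" unfolding lz dec ..
 have "lin N (\<alpha> k) z' - g k = 0" if k: "k < m" for k
 proof (rule agg_eq_0[of m "%k. lin N (\<alpha> k) z' - g k" "2 ^ q"])
  show "\<bar>lin N (\<alpha> k) z' - g k\<bar> < 2 ^ q" if k: "k < m" for k
  proof -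
   have "\<bar>lin N (\<alpha> k) z'\<bar> <= (\<Sum>j<N. \<bar>\<alpha> k j * z' j\<bar>)" unfolding lin_def by (rule sum_abs)
   also have "... <= (\<Sum>j<N. z' j * 2 ^ \<delta>)" using \<alpha>[OF k] z'(1) by (intro sum_mono) (auto simp: abs_mult mult.commute intro!: mult_mono)
   also have "... <= 2 ^ (2 * sg) * 2 ^ 2 ^ sg * 2 ^ \<delta>"
    unfolding sum_distrib_right[symmetric] using z' by (intro mult_right_mono) auto
   finally have "\<bar>lin N (\<alpha> k) z'\<bar> <= 2 ^ (q - 1)" using le by linarith
   moreover have "(2::int) ^ q = 2 * 2 ^ (q - 1)" using q by (cases q) auto
   ultimately show ?thesis using g[OF k] by linarith
  qed
  show "(\<Sum>k<m. (lin N (\<alpha> k) z' - g k) * (2 ^ q) ^ k) = 0" using z'(3) unfolding agg_lin[symmetric] agg_def by (simp add: left_diff_distrib sum_subtractf power_mult)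
 qed (use k in auto)
 then show "feas N m \<alpha> g z" using z'q by (auto simp: feas_def lz zz)
 show "lin N c z <= lin N c y"
 proof -
  have "lin N c z * 2 ^ (q * N) <= v"
   unfolding eq by (simp add: mult.commute minus_mod_eq_mult_div[symmetric])
  also have "v <= lin N c y * 2 ^ (q * N) + (\<Sum>j<N. y j * (2 ^ q) ^ j)" using yy unfolding lin_wgt .
  finally have "lin N c z <= (lin N c y * 2 ^ (q * N) + (\<Sum>j<N. y j * (2 ^ q) ^ j)) div 2 ^ (q * N)" by (metis nonzero_mult_div_cancel_right power_not_zero zdiv_mono1 zero_less_numeral zero_less_power zero_neq_numeral)
  also have "... = lin N c y"
  proof -
   have "y j < 2 ^ q" if "j < N" for j
   proof -
    have "(2::int) ^ 2 ^ sg <= 2 ^ q" using q by (intro power_increasing) auto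
    then show ?thesis using ylt[OF that] by linarith
   qed
   then show ?thesis using digits_decode[of N y "2 ^ q" "lin N c y"] ylt unfolding power_mult by auto
  qed
  finally show ?thesis .
 qed
qed

section \<open>Choice of the parameters and the scaling iteration\<close>

lemma int_le_pow2: "n <= 2 ^ k ==> int n <= 2 ^ k" by (metis of_nat_le_iff of_nat_numeral of_nat_power)

text \<open>Rounding goes towards 0, since floor division would send negative numbers to -1 and the
  scaling could not start at 0.\<close>

definition trunc_div :: "nat => int => int" where
 "trunc_div i x = sgn x * (\<bar>x\<bar> div 2 ^ i)"

lemma trunc_div_0 [simp]: "trunc_div 0 x = x" by (simp add: trunc_div_def sgn_mult_abs)

lemma trunc_div_big: "\<bar>x\<bar> < 2 ^ i ==> trunc_div i x = 0" by (simp add: trunc_div_def div_pos_pos_trivial)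

lemma trunc_div_Suc: "\<bar>trunc_div i x - 2 * trunc_div (Suc i) x\<bar> <= 1"
proof -
 have "trunc_div i x - 2 * trunc_div (Suc i) x = sgn x * (\<bar>x\<bar> div 2 ^ i - 2 * (\<bar>x\<bar> div 2 ^ Suc i))" by (simp add: trunc_div_def algebra_simps)
 then show ?thesis unfolding div_power_Suc by (auto simp: abs_mult sgn_if)
qed

lemma abs_trunc_div: "\<bar>trunc_div i x\<bar> <= \<bar>x\<bar>"
proof -
 have "\<bar>x\<bar> div 2 ^ i <= \<bar>x\<bar> div 1" by (rule zdiv_mono2) auto
 moreover have "0 <= \<bar>x\<bar> div 2 ^ i" by (simp add: pos_imp_zdiv_nonneg_iff)
 ultimately show ?thesis by (auto simp: trunc_div_def abs_mult sgn_if)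
qed

definition shift_down :: "nat => (nat => int) => nat => int" where
 "shift_down dd y j = max 0 (2 * y j - 2 ^ dd)"

definition residual :: "nat => (nat => nat => int) => (nat => int) => (nat => int) => nat => int" where
 "residual N \<alpha> b u k = b k - lin N (\<alpha> k) u"

definition digit :: "nat => int => nat => int" where
 "digit q v j = v div 2 ^ (q * j) mod 2 ^ q"

text \<open>With \<open>P = 2 ^ \<pi>\<close> above \<open>m + \<delta> + \<nu>\<close>, the support
  bound is \<open>2 ^ sg = 16 * P ^ 3\<close>, entries of a correction have \<open>2 ^ sg\<close>
  bits, and the proximity bound is \<open>2 ^ dd\<close> with \<open>dd = 8 * P ^ 2\<close>. Powers
  of two are chosen because the program obtains them by shifts.\<close>

locale instance_params =
 fixes N m \<delta> \<nu> \<pi> \<mu> sg dd q e :: nat and \<alpha> :: "nat => nat => int" and c :: "nat => int" and BIG :: int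
 assumes m1: "1 <= m"
  and \<alpha>: "!!k j. k < m ==> j < N ==> \<bar>\<alpha> k j\<bar> <= 2 ^ \<delta>"
  and c: "!!j. j < N ==> \<bar>c j\<bar> < 2 ^ \<mu>"
  and N: "N < 2 ^ \<nu>"
  and \<pi>: "m + \<delta> + \<nu> < 2 ^ \<pi>"
  and sg: "sg = 3 * \<pi> + 4" and dd: "dd = 2 ^ (2 * \<pi> + 3)" and q: "q = 4 * 2 ^ sg" and e: "e = \<delta> + sg + 2"
  and BIG: "BIG = 2 ^ (2 * sg + 2 ^ sg + q * N + \<mu> + 2)"
begin

lemma pow_bound:
 assumes "x < 2 ^ h" "m * h < h'"
 shows "(x::nat) ^ m < 2 ^ h'"
proof -
 have "x ^ m < (2 ^ h) ^ m" using assms m1 by (intro power_strict_mono) auto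
 also have "... = 2 ^ (m * h)" by (simp add: power_mult[symmetric] mult.commute)
 also have "... <= 2 ^ h'" using assms by (intro power_increasing) auto
 finally show ?thesis .
qed

abbreviation (input) "P \<equiv> (2::nat) ^ \<pi>"

lemma P1: "1 <= P" by simp

lemma \<pi>_le: "\<pi> <= P" using less_exp[of \<pi>] by simp

lemma dd8: "dd = 8 * (P * P)"
proof -
 have "2 * \<pi> + 3 = \<pi> + \<pi> + 3" by simp
 then have "(2::nat) ^ (2 * \<pi> + 3) = 2 ^ (\<pi> + \<pi> + 3)" by (rule arg_cong)
 then show ?thesis unfolding dd power_add by simp
qed

lemma sg16: "2 ^ sg = 16 * (P * P * P)"
proof -
 have "3 * \<pi> + 4 = \<pi> + \<pi> + \<pi> + 4" by simp
 then have "(2::nat) ^ (3 * \<pi> + 4) = 2 ^ (\<pi> + \<pi> + \<pi> + 4)" by (rule arg_cong)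
 then show ?thesis unfolding sg power_add by simp
qed

lemma N_int: "int N * 2 ^ \<delta> <= 2 ^ (\<nu> + \<delta>)"
proof -
 have "int N <= 2 ^ \<nu>" using N by (metis less_imp_le of_nat_le_iff of_nat_numeral of_nat_power)
 then show ?thesis unfolding power_add by (intro mult_right_mono) auto
qed

text \<open>After taking logarithms, \<open>m * (sg + \<delta> + 2)\<close> has to stay below
  \<open>2 ^ sg\<close>; the left side is at most quadratic in \<open>P\<close>, the right side is
  cubic.\<close>

lemma support_bound: "nat (2 * (int (2 ^ sg) * 2 ^ \<delta>) + 1) ^ m < 2 ^ 2 ^ sg"
proof (rule pow_bound)
 have "2 * (int (2 ^ sg) * 2 ^ \<delta>) + 1 < 2 ^ (sg + \<delta> + 2)"
 proof -
  define Y where "Y = (2::int) ^ (sg + \<delta>)"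
  have "1 <= Y" by (simp add: Y_def)
  moreover have "int (2 ^ sg) * 2 ^ \<delta> = Y" "2 ^ (sg + \<delta> + 2) = 4 * Y" by (simp_all add: Y_def power_add)
  ultimately show ?thesis by linarith
 qed
 then show "nat (2 * (int (2 ^ sg) * 2 ^ \<delta>) + 1) < 2 ^ (sg + \<delta> + 2)" by (simp add: nat_less_iff)
 have "m * (sg + \<delta> + 2) <= P * (3 * P + 4 + P + 2)"
 proof (rule mult_le_mono)
  show "m <= P" using \<pi> by linarith
  have "\<delta> <= P" using \<pi> by linarith
  then show "sg + \<delta> + 2 <= 3 * P + 4 + P + 2" using \<pi>_le unfolding sg by (intro add_mono) auto
 qed
 also have "... = 4 * (P * P) + 6 * P" by (simp add: algebra_simps)
 also have "... < 16 * (P * P * P)"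
 proof -
  have "P <= P * P" "P * P <= P * P * P" using P1 by auto
  then show ?thesis using P1 by linarith
 qed
 finally show "m * (sg + \<delta> + 2) < 2 ^ sg" unfolding sg16 .
qed

text \<open>The proximity constant is \<open>2 ^ (dd - 1)\<close>, so that the amount
  \<open>2 * H\<close> subtracted in a scaling step is exactly \<open>2 ^ dd\<close>.\<close>

lemma near_bound: "nat (2 * (1 + 2 * (int N * 2 ^ \<delta>)) + 1) ^ m < 2 ^ (dd - 1)"
proof (rule pow_bound)
 define Y where "Y = (2::int) ^ (\<nu> + \<delta>)"
 have "1 <= Y" by (simp add: Y_def)
 then have "2 * (1 + 2 * x) + 1 < 8 * Y" if "x <= Y" for x using that \<open>1 <= Y\<close> unfolding distrib_left by linarith
 from this[OF N_int[folded Y_def]] have "2 * (1 + 2 * (int N * 2 ^ \<delta>)) + 1 < 8 * Y" .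
 also have "... = 2 ^ (\<nu> + \<delta> + 3)" by (simp add: Y_def power_add)
 finally show "nat (2 * (1 + 2 * (int N * 2 ^ \<delta>)) + 1) < 2 ^ (\<nu> + \<delta> + 3)" by (simp add: nat_less_iff)
 have "m * (\<nu> + \<delta> + 3) <= P * (P + 3)" using \<pi> by (intro mult_le_mono) auto
 also have "... = P * P + 3 * P" by (simp add: algebra_simps)
 also have "... < 8 * (P * P) - 1"
 proof -
  have "P <= P * P" using P1 by auto
  then show ?thesis using P1 by linarith
 qed
 finally show "m * (\<nu> + \<delta> + 3) < dd - 1" unfolding dd8 .
qed

text \<open>A residual after a scaling step has about \<open>\<nu> + \<delta> + dd\<close> bits.
  Multiplied by \<open>m\<close> this is cubic in \<open>P\<close>, which dictates the factor 3 in
  \<open>sg = 3 * \<pi> + 4\<close>.\<close>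

lemma entry_bound:
 assumes "\<rho> <= 1 + int N * (2 ^ \<delta> * 2 ^ dd)" "0 <= \<rho>"
 shows "nat (2 * (\<rho> + int N * 2 ^ \<delta>) + 1) ^ m < 2 ^ 2 ^ sg" "\<rho> < 2 ^ (q - 1)"
proof -
 have "int N * (2 ^ \<delta> * 2 ^ dd) <= 2 ^ (\<nu> + \<delta>) * 2 ^ dd" using mult_right_mono[OF N_int, of "2 ^ dd"] by (simp add: mult.assoc)
 then have 1: "int N * (2 ^ \<delta> * 2 ^ dd) <= 2 ^ (\<nu> + \<delta> + dd)" by (simp add: power_add)
 have 2: "(2::int) ^ (\<nu> + \<delta>) <= 2 ^ (\<nu> + \<delta> + dd)" by (rule power_increasing) auto
 have 3: "(1::int) <= 2 ^ (\<nu> + \<delta> + dd)" by simp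
 have PP: "P <= P * P" "P * P <= P * P * P" using P1 by auto
 show "nat (2 * (\<rho> + int N * 2 ^ \<delta>) + 1) ^ m < 2 ^ 2 ^ sg"
 proof (rule pow_bound)
  define Y where "Y = (2::int) ^ (\<nu> + \<delta> + dd)"
  have "2 * (\<rho> + x) + 1 < 8 * Y" if "x <= Y" "\<rho> <= 1 + x'" "x' <= Y" "1 <= Y" for x x' using that unfolding distrib_left by linarith
  from this[OF order_trans[OF N_int 2, folded Y_def] assms(1) 1[folded Y_def] 3[folded Y_def]]
  have "2 * (\<rho> + int N * 2 ^ \<delta>) + 1 < 8 * Y" .
  also have "... = 2 ^ (\<nu> + \<delta> + dd + 3)" by (simp add: Y_def power_add)
  finally show "nat (2 * (\<rho> + int N * 2 ^ \<delta>) + 1) < 2 ^ (\<nu> + \<delta> + dd + 3)" by (simp add: nat_less_iff)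
  have "m * (\<nu> + \<delta> + dd + 3) <= P * (P + 8 * (P * P) + 3)" unfolding dd8 using \<pi> by (intro mult_le_mono) auto
  also have "... = P * P + 8 * (P * P * P) + 3 * P" by (simp add: algebra_simps)
  also have "... < 16 * (P * P * P)" using PP P1 by linarith
  finally show "m * (\<nu> + \<delta> + dd + 3) < 2 ^ sg" unfolding sg16 .
 qed
 have "\<rho> <= 2 * Y" if "\<rho> <= 1 + x'" "x' <= Y" "1 <= Y" for x' Y using that by linarith
 from this[OF assms(1) 1 3] have "\<rho> <= 2 * 2 ^ (\<nu> + \<delta> + dd)" .
 also have "... = 2 ^ (\<nu> + \<delta> + dd + 1)" by simp
 also have "... < 2 ^ (q - 1)"
 proof (rule power_strict_increasing)
  have "\<nu> + \<delta> + dd + 1 < 64 * (P * P * P) - 1" unfolding dd8 using \<pi> PP P1 by linarith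
  then show "\<nu> + \<delta> + dd + 1 < q - 1" unfolding q sg16 by simp
 qed simp
 finally show "\<rho> < 2 ^ (q - 1)" .
qed

lemma q_large: "\<delta> + 2 * sg + 2 ^ sg < q"
proof -
 have PP: "P <= P * P" "P * P <= P * P * P" using P1 by auto
 define X where "X = P * P * P"
 have "\<delta> + 2 * (3 * \<pi> + 4) < 48 * X" if "\<delta> <= p" "\<pi> <= p" "p <= X" "1 <= p" for p using that unfolding distrib_left by linarith
 from this[OF _ \<pi>_le order_trans[OF PP, folded X_def] P1] have "\<delta> + 2 * sg < 48 * X" unfolding sg using \<pi> by linarith
 then show ?thesis unfolding q sg16 X_def[symmetric] by linarith
qed

text \<open>Feasibility follows from the small-solution bound with cost 0, where a negative ray is
  impossible. The same bound with the true cost gives optimality. For \<open>g = 0\<close> a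
  negative ray is itself a solution, so the value found must be negative.\<close>

lemma inner_correct:
 fixes g :: "nat => int"
 defines "v \<equiv> inner_value N m q sg e BIG \<alpha> c g"
 assumes g: "!!k. k < m ==> \<bar>g k\<bar> <= 1 + int N * (2 ^ \<delta> * 2 ^ dd)"
  and y: "feas N m \<alpha> g y"
 shows "feas N m \<alpha> g (digit q v)" "lin N c (digit q v) = v div 2 ^ (q * N)"
  "bounded_below N m \<alpha> c ==> opt N m \<alpha> c g (digit q v)"
  "(!!k. k < m ==> g k = 0) ==> \<not> bounded_below N m \<alpha> c ==> v div 2 ^ (q * N) < 0"
proof -
 have g': "\<bar>g k\<bar> < 2 ^ (q - 1)" if "k < m" for k by (rule entry_bound(2)[OF g[OF that]]) simp
 have correct: "feas N m \<alpha> g (digit q v)" "lin N c (digit q v) = v div 2 ^ (q * N)"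
  "lin N c (digit q v) <= lin N c z" if z: "feas N m \<alpha> g z" "small N (2 ^ sg) (2 ^ 2 ^ sg) z" for z
 proof -
  have B: "2 ^ (2 * sg + 2 ^ sg + q * N + \<mu> + 2) <= BIG" unfolding BIG by (rule order_refl)
  have "feas N m \<alpha> g (digit q v) & lin N c (digit q v) = v div 2 ^ (q * N) & lin N c (digit q v) <= lin N c z"
   unfolding v_def digit_def[abs_def] e
  proof (intro conjI)
   note ivc = inner_value_correct[of m N \<alpha> \<delta> c \<mu> g q sg BIG z]
   show "feas N m \<alpha> g (%j. inner_value N m q sg (\<delta> + sg + 2) BIG \<alpha> c g div 2 ^ (q * j) mod 2 ^ q)" by (rule ivc(1)) (fact \<alpha> | fact c | fact g' | fact q_large | fact B | fact z)+
   show "lin N c (%j. inner_value N m q sg (\<delta> + sg + 2) BIG \<alpha> c g div 2 ^ (q * j) mod 2 ^ q) =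
     inner_value N m q sg (\<delta> + sg + 2) BIG \<alpha> c g div 2 ^ (q * N)" by (rule ivc(2)) (fact \<alpha> | fact c | fact g' | fact q_large | fact B | fact z)+
   show "lin N c (%j. inner_value N m q sg (\<delta> + sg + 2) BIG \<alpha> c g div 2 ^ (q * j) mod 2 ^ q) <= lin N c z" by (rule ivc(3)) (fact \<alpha> | fact c | fact g' | fact q_large | fact B | fact z)+
  qed
  then show "feas N m \<alpha> g (digit q v)" "lin N c (digit q v) = v div 2 ^ (q * N)"
   "lin N c (digit q v) <= lin N c z" by blast+
 qed
 have *: "\<exists>z. small N (2 ^ sg) (2 ^ 2 ^ sg) z &
  ((feas N m \<alpha> g z & lin N c z <= lin N c x) \<or> (feas N m \<alpha> (%k. 0) z & lin N c z < 0))"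
  if x: "feas N m \<alpha> g x" for x c
 proof -
  show ?thesis
  proof (rule small_solution_exists[of m N \<alpha> "2 ^ \<delta>" "2 ^ sg" g "1 + int N * (2 ^ \<delta> * 2 ^ dd)" "2 ^ 2 ^ sg" x c])
   show "nat (2 * (int (2 ^ sg) * 2 ^ \<delta>) + 1) ^ m < 2 ^ 2 ^ sg" by (rule support_bound)
   show "nat (2 * (1 + int N * (2 ^ \<delta> * 2 ^ dd) + int N * 2 ^ \<delta>) + 1) ^ m < 2 ^ 2 ^ sg" by (rule entry_bound(1)[OF order_refl]) simp
   show "\<bar>\<alpha> k j\<bar> <= 2 ^ \<delta>" if "k < m" "j < N" for k j using that by (rule \<alpha>)
   show "\<bar>g k\<bar> <= 1 + int N * (2 ^ \<delta> * 2 ^ dd)" if "k < m" for k using that by (rule g)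
   show "feas N m \<alpha> g x" by (rule x)
   show "(0::int) <= 2 ^ \<delta>" by simp
   show "0 <= 1 + int N * (2 ^ \<delta> * 2 ^ dd)" by simp
   fix z assume "small N (2 ^ sg) (2 ^ 2 ^ sg) z"
    "(feas N m \<alpha> g z & lin N c z <= lin N c x) \<or> (feas N m \<alpha> (%k. 0) z & lin N c z < 0)"
   then show ?thesis by blast
  qed
 qed
 obtain z where z: "small N (2 ^ sg) (2 ^ 2 ^ sg) z" "feas N m \<alpha> g z" using *[OF y, of "%_. 0"] by (auto simp: lin_def)
 show "feas N m \<alpha> g (digit q v)" "lin N c (digit q v) = v div 2 ^ (q * N)" by (rule correct[OF z(2,1)])+
 note res = this
 show "opt N m \<alpha> c g (digit q v)" if bb: "bounded_below N m \<alpha> c"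
  unfolding opt_def
 proof (intro conjI allI impI)
  fix x assume "feas N m \<alpha> g x"
  from *[OF this, of c] bb obtain z where z: "small N (2 ^ sg) (2 ^ 2 ^ sg) z" "feas N m \<alpha> g z" "lin N c z <= lin N c x"
   unfolding bounded_below_def by (metis not_less)
  show "lin N c (digit q v) <= lin N c x" using correct(3)[OF z(2,1)] z(3) by simp
 qed (rule res)
 show "v div 2 ^ (q * N) < 0" if g0: "!!k. k < m ==> g k = 0" and nb: "\<not> bounded_below N m \<alpha> c"
 proof -
  have fe: "feas N m \<alpha> (%k. 0) = feas N m \<alpha> g" using g0 by (auto simp: feas_def fun_eq_iff)
  obtain w where w: "feas N m \<alpha> g w" "lin N c w < 0" using nb unfolding bounded_below_def fe by (auto simp: not_le)
  from *[OF w(1), of c] w(2) obtain z where z: "small N (2 ^ sg) (2 ^ 2 ^ sg) z" "feas N m \<alpha> g z" "lin N c z < 0"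
   unfolding fe by fastforce
  then show ?thesis using correct(3)[OF z(2,1)] unfolding res(2)[symmetric] by simp
 qed
qed

definition phase_residual :: "(nat => int) => (nat => int) => nat => int" where
 "phase_residual b y = residual N \<alpha> b (shift_down dd y)"

definition phase_value :: "(nat => int) => (nat => int) => int" where
 "phase_value b y = inner_value N m q sg e BIG \<alpha> c (phase_residual b y)"

definition phase :: "(nat => int) => (nat => int) => nat => int" where
 "phase b y j = shift_down dd y j + digit q (phase_value b y) j"

lemma phase_opt:
 assumes bb: "bounded_below N m \<alpha> c" and fe: "\<exists>x. feas N m \<alpha> b x"
  and y: "opt N m \<alpha> c b' y"
  and b: "!!k. k < m ==> \<bar>b k - 2 * b' k\<bar> <= 1"
 shows "opt N m \<alpha> c b (phase b y)"
proof -
 let ?H = "2 ^ (dd - 1) :: nat"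
 have "dd ~= 0" by (simp add: dd)
 then have H: "2 * int ?H = 2 ^ dd" by (cases dd) auto
 define \<rho> where "\<rho> = Max ((%k. \<bar>b k\<bar>) ` {..<m})"
 have \<rho>: "\<bar>b k\<bar> <= \<rho>" if "k < m" for k unfolding \<rho>_def using that by (intro Max_ge) auto
 have \<rho>0: "0 <= \<rho>" using \<rho>[of 0] m1 by linarith
 obtain x0 where "opt N m \<alpha> c b x0"
 proof -
  obtain x where x: "feas N m \<alpha> b x" using fe by blast
  obtain z where "opt N m \<alpha> c b z" by (rule small_optimum_exists[of m N \<alpha> "2 ^ \<delta>" "2 ^ sg" b \<rho> "Suc (nat (2 * (\<rho> + int N * 2 ^ \<delta>) + 1) ^ m)" c x])
    (use \<alpha> \<rho> \<rho>0 support_bound bb x in auto)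
  then show ?thesis using that by blast
 qed
 note st = scaling_step[of m N \<alpha> "2 ^ \<delta>" b b' ?H c y x0 "shift_down dd y" "phase_residual b y",
   OF \<alpha> _ b near_bound y this, unfolded H]
 have u: "shift_down dd y j = max 0 (2 * y j - 2 ^ dd)" for j by (simp add: shift_down_def)
 have r: "phase_residual b y k = b k - lin N (\<alpha> k) (shift_down dd y)" for k by (simp add: phase_residual_def residual_def)
 obtain z where z: "feas N m \<alpha> (phase_residual b y) z" using st(1) u r by auto
 have "opt N m \<alpha> c (phase_residual b y) (digit q (phase_value b y))"
  unfolding phase_value_def by (rule inner_correct(3)[OF _ z bb]) (use st(3) u r in auto)
 then show ?thesis using st(2) u r unfolding phase_def[abs_def] by auto
qed

text \<open>From \<open>y = 0\<close> and right-hand side 0 the residual is 0, so the first phase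
  searches the recession cone for a vector of negative cost.\<close>

lemma phase_start:
 assumes "!!k. k < m ==> b k = 0"
 shows "phase_value b (%j. 0) div 2 ^ (q * N) < 0 \<longleftrightarrow> \<not> bounded_below N m \<alpha> c"
proof -
 have u: "shift_down dd (%j. 0) = (%j. 0)" by (simp add: shift_down_def fun_eq_iff)
 let ?g = "phase_residual b (%j. 0)"
 have g: "?g k = 0" if "k < m" for k using assms[OF that] by (simp add: phase_residual_def residual_def u)
 have f: "feas N m \<alpha> ?g (%j. 0)" using g by (simp add: feas_def)
 have g': "\<bar>?g k\<bar> <= 1 + int N * (2 ^ \<delta> * 2 ^ dd)" if "k < m" for k using g[OF that] by simp
 note ic = inner_correct[of ?g "%j. 0", OF g' f, folded phase_value_def]
 show ?thesis
 proof
  assume neg: "phase_value b (%j. 0) div 2 ^ (q * N) < 0"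
  have "feas N m \<alpha> (%k. 0) (digit q (phase_value b (%j. 0)))" using ic(1) g by (auto simp: feas_def)
  then show "\<not> bounded_below N m \<alpha> c" using ic(2) neg unfolding bounded_below_def by (metis not_less)
 next
  assume "\<not> bounded_below N m \<alpha> c"
  then show "phase_value b (%j. 0) div 2 ^ (q * N) < 0" using ic(4) g by blast
 qed
qed

text \<open>The right-hand sides \<open>b / 2 ^ l, b / 2 ^ (l - 1), ..., b\<close>, rounded towards 0.\<close>

primrec scaling :: "nat => (nat => int) => nat => nat => int" where
 "scaling l b 0 = (%j. 0)"
| "scaling l b (Suc i) = phase (%k. trunc_div (l - i) (b k)) (scaling l b i)"

text \<open>At shift \<open>l\<close> all entries of \<open>b\<close> truncate to 0, and the zero
  vector is optimal there because costs on the recession cone are nonnegative; from there each phase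
  at most doubles the right-hand side up to an error of 1 per row.\<close>

lemma scaling_opt:
 assumes bb: "bounded_below N m \<alpha> c" and fe: "!!b. \<exists>x. feas N m \<alpha> b x"
  and l: "!!k. k < m ==> \<bar>b k\<bar> < 2 ^ l"
 shows "i <= l ==> opt N m \<alpha> c (%k. trunc_div (l - i) (b k)) (scaling l b (Suc i))"
proof (induction i)
 case 0
 have "opt N m \<alpha> c (%k. 0) (%j. 0)" using bb by (auto simp: opt_def feas_def bounded_below_def)
 from phase_opt[OF bb fe this] show ?case using l by (simp add: trunc_div_big)
next
 case (Suc i)
 then have IH: "opt N m \<alpha> c (%k. trunc_div (l - i) (b k)) (scaling l b (Suc i))" by simp
 have "l - i = Suc (l - Suc i)" using Suc.prems by simp
 then show ?case using trunc_div_Suc[of "l - Suc i"] unfolding scaling.simps(2)[of l b "Suc i"] by (intro phase_opt[OF bb fe IH]) simp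
qed

end

section \<open>Slack columns and their penalty\<close>

text \<open>Unit columns of both signs make every right-hand side feasible. The scaling relies on
  this, because a truncated right-hand side may be infeasible for the original columns even if
  \<open>b\<close> is not.\<close>

definition ext_mat :: "nat => nat => (nat => nat => int) => nat => nat => int" where
 "ext_mat n m a k j = (if j < n then a k j else if j = n + k then 1 else if j = n + m + k then -1 else 0)"

definition ext_cost :: "nat => int => (nat => int) => nat => int" where
 "ext_cost n M c j = (if j < n then c j else M)"

lemma sum_split_ext:
 fixes n m :: nat
 shows "(\<Sum>j<n + 2 * m. f j) = (\<Sum>j<n. f j) + (\<Sum>j\<in>{n..<n + 2 * m}. f j :: int)" using sum.atLeastLessThan_concat[of 0 n "n + 2 * m" f] by (simp add: atLeast0LessThan)

lemma lin_ext_cost: "lin (n + 2 * m) (ext_cost n M c) x = lin n c x + M * (\<Sum>j\<in>{n..<n + 2 * m}. x j)"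
 unfolding lin_def sum_split_ext by (simp add: ext_cost_def sum_distrib_left)

lemma lin_ext_mat:
 assumes "k < m"
 shows "lin (n + 2 * m) (ext_mat n m a k) x = lin n (a k) x + x (n + k) - x (n + m + k)"
proof -
 have "(\<Sum>j\<in>{n..<n + 2 * m}. ext_mat n m a k j * x j) =
  (\<Sum>j\<in>{n..<n + 2 * m}. (if j = n + k then x j else 0) - (if j = n + m + k then x j else 0))" by (rule sum.cong) (use assms in \<open>auto simp: ext_mat_def\<close>)
 also have "... = x (n + k) - x (n + m + k)"
  unfolding sum_subtractf using assms by (simp add: sum.delta)
 finally show ?thesis unfolding lin_def sum_split_ext by (simp add: ext_mat_def)
qed

lemma feas_ext_exists: "\<exists>x. feas (n + 2 * m) m (ext_mat n m a) b x"
proof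
 let ?x = "%j. if j < n then 0 else if j < n + m then max 0 (b (j - n)) else max 0 (- b (j - n - m))"
 have "lin n (a k) ?x = 0" for k by (simp add: lin_def)
 then show "feas (n + 2 * m) m (ext_mat n m a) b ?x" by (auto simp: feas_def lin_ext_mat)
qed

locale slack_params =
 fixes n m \<delta> \<nu> l :: nat and s :: nat and M :: int and a :: "nat => nat => int" and c b :: "nat => int"
 assumes m1: "1 <= m"
  and a: "!!k j. k < m ==> j < n ==> \<bar>a k j\<bar> <= 2 ^ \<delta>"
  and c: "!!j. j < n ==> \<bar>c j\<bar> < 2 ^ l" and b: "!!k. k < m ==> \<bar>b k\<bar> < 2 ^ l"
  and N: "n + 2 * m < 2 ^ \<nu>"
  and s: "nat (2 * (int s * 2 ^ \<delta>) + 1) ^ m < 2 ^ s"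
begin

abbreviation "N \<equiv> n + 2 * m"
abbreviation "H \<equiv> (2::nat) ^ (m * (\<delta> + \<nu> + l + 4))"
text \<open>A bound for the original cost of a small solution: fewer than \<open>2 ^ \<nu>\<close>
  columns, costs below \<open>2 ^ l\<close>, entries below \<open>H\<close>.\<close>

definition Bd :: int where "Bd = 2 ^ (\<nu> + l + m * (\<delta> + \<nu> + l + 4))"

lemma Bd_pos: "0 < Bd" by (simp add: Bd_def)

lemma ext_le: "k < m ==> j < N ==> \<bar>ext_mat n m a k j\<bar> <= 2 ^ \<delta>" using a by (auto simp: ext_mat_def)

lemma H_bound:
 assumes "N' <= N" "\<rho> <= 2 ^ l" "0 <= \<rho>"
 shows "nat (2 * (\<rho> + int N' * 2 ^ \<delta>) + 1) ^ m < H"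
proof -
 have "int N' <= 2 ^ \<nu>" using N assms by (intro int_le_pow2) linarith
 then have "int N' * 2 ^ \<delta> <= 2 ^ (\<nu> + \<delta>)" unfolding power_add by (intro mult_right_mono) auto
 moreover have "(2::int) ^ (\<nu> + \<delta>) <= 2 ^ (\<delta> + \<nu> + l)" "(2::int) ^ l <= 2 ^ (\<delta> + \<nu> + l)" "(1::int) <= 2 ^ (\<delta> + \<nu> + l)" by (auto intro!: power_increasing)
 moreover have "2 * (\<rho> + x) + 1 < 16 * Y" if "x <= Z" "Z <= Y" "Z' <= Y" "1 <= Y" "\<rho> <= Z'" for x Y Z Z' :: int using that unfolding distrib_left by linarith
 ultimately have "2 * (\<rho> + int N' * 2 ^ \<delta>) + 1 < 16 * 2 ^ (\<delta> + \<nu> + l)" using assms by blast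
 also have "... = 2 ^ (\<delta> + \<nu> + l + 4)" by (simp add: power_add)
 finally have "nat (2 * (\<rho> + int N' * 2 ^ \<delta>) + 1) < 2 ^ (\<delta> + \<nu> + l + 4)" by (simp add: nat_less_iff)
 then have "nat (2 * (\<rho> + int N' * 2 ^ \<delta>) + 1) ^ m < (2 ^ (\<delta> + \<nu> + l + 4)) ^ m" using m1 by (intro power_strict_mono) auto
 then show ?thesis by (simp add: power_mult[symmetric] mult.commute)
qed

lemma small_cost: "feas N' m' \<alpha>' b' y ==> n <= N' ==> small N' s H y ==> \<bar>lin n c y\<bar> <= Bd"
proof -
 assume y: "feas N' m' \<alpha>' b' y" "n <= N'" "small N' s H y"
 have "\<bar>lin n c y\<bar> <= int n * (2 ^ l * int H)" by (rule abs_lin_le) (use y c in \<open>auto simp: small_def feas_def less_imp_le\<close>)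
 also have "... <= 2 ^ \<nu> * (2 ^ l * int H)"
 proof (rule mult_right_mono)
  have "n <= 2 ^ \<nu>" using N by simp
  then show "int n <= 2 ^ \<nu>" by (rule int_le_pow2)
 qed auto
 finally show ?thesis by (simp add: Bd_def power_add mult.assoc)
qed

lemma slack_zero:
 assumes "feas N m (ext_mat n m a) b' y" "(\<Sum>j\<in>{n..<N}. y j) <= 0"
 shows "feas n m a b' y" "lin N (ext_cost n M' c) y = lin n c y"
proof -
 have "\<forall>j\<in>{n..<N}. y j = 0"
 proof -
  have "\<forall>j\<in>{n..<N}. 0 <= y j" using assms by (auto simp: feas_def)
  then show ?thesis using assms(2) sum_nonneg_eq_0_iff[of "{n..<N}" y] sum_nonneg[of "{n..<N}" y] by auto
 qed
 then have z: "y j = 0" if "n <= j" "j < N" for j using that by auto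
 show "feas n m a b' y" using assms(1) z by (auto simp: feas_def lin_ext_mat)
 show "lin N (ext_cost n M' c) y = lin n c y" unfolding lin_ext_cost using z by simp
qed

lemma slack_nonneg: "feas N m (ext_mat n m a) b' y ==> 0 <= (\<Sum>j\<in>{n..<N}. y j)" by (auto simp: feas_def intro!: sum_nonneg)

lemma feas_ext:
 assumes "feas n m a b' x"
 shows "feas N m (ext_mat n m a) b' (%j. if j < n then x j else 0)"
  "lin N (ext_cost n M' c) (%j. if j < n then x j else 0) = lin n c x"
proof -
 have "lin n f (%j. if j < n then x j else 0) = lin n f x" for f by (rule lin_cong) auto
 then show "feas N m (ext_mat n m a) b' (%j. if j < n then x j else 0)"
  "lin N (ext_cost n M' c) (%j. if j < n then x j else 0) = lin n c x" using assms by (auto simp: feas_def lin_ext_mat lin_ext_cost)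
qed

text \<open>A negative ray may be taken small, and then a single unit of slack outweighs everything
  that the original columns can gain.\<close>

lemma bounded_below_ext:
 assumes "Bd <= M'"
 shows "bounded_below N m (ext_mat n m a) (ext_cost n M' c) \<longleftrightarrow> bounded_below n m a c"
proof
 assume "bounded_below N m (ext_mat n m a) (ext_cost n M' c)"
 then show "bounded_below n m a c" unfolding bounded_below_def using feas_ext(1)[of "%k. 0"] feas_ext(2)[of "%k. 0" _ M'] by fastforce
next
 assume bb: "bounded_below n m a c"
 show "bounded_below N m (ext_mat n m a) (ext_cost n M' c)"
 proof (rule ccontr)
  assume "\<not> ?thesis"
  then obtain w where w: "feas N m (ext_mat n m a) (%k. 0) w" "lin N (ext_cost n M' c) w < 0"
   unfolding bounded_below_def by (auto simp: not_le)
  obtain y where y: "small N s H y" "feas N m (ext_mat n m a) (%k. 0) y" "lin N (ext_cost n M' c) y < 0"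
  proof -
   obtain y where "small N s H y" "(feas N m (ext_mat n m a) (%k. 0) y & lin N (ext_cost n M' c) y <= lin N (ext_cost n M' c) w) \<or>
    (feas N m (ext_mat n m a) (%k. 0) y & lin N (ext_cost n M' c) y < 0)" by (rule small_solution_exists[of m N "ext_mat n m a" "2 ^ \<delta>" s "%k. 0" 0 H w "ext_cost n M' c"])
     (use ext_le s H_bound[of N 0] w in auto)
   then show ?thesis using that w(2) by fastforce
  qed
  show False
  proof (cases "(\<Sum>j\<in>{n..<N}. y j) <= 0")
   case True
   then show False using slack_zero[OF y(2) True] y(3) bb unfolding bounded_below_def by force
  next
   case False
   have "M' * 1 <= M' * (\<Sum>j\<in>{n..<N}. y j)" using False assms Bd_pos by (intro mult_left_mono) auto
   then show False using y(3) small_cost[OF y(2) _ y(1)] assms unfolding lin_ext_cost by simp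
  qed
 qed
qed

text \<open>The given optimum need not be small, so the penalty is split as
  \<open>M = 2 * M'\<close>. With penalty \<open>M'\<close> every solution costs at least
  \<open>- Bd\<close>, by comparison with a small one. The other half adds at least
  \<open>M'\<close>, more than \<open>2 * Bd\<close>, as soon as slack is used; this exceeds the
  cost of a small slack-free solution.\<close>

lemma opt_ext:
 assumes M: "M = 2 * M'" "2 * Bd < M'" and bb: "bounded_below n m a c"
  and x: "opt N m (ext_mat n m a) (ext_cost n M c) b x"
 shows "(\<Sum>j\<in>{n..<N}. x j) <= 0 ==> opt n m a c b x"
  and "\<not> (\<Sum>j\<in>{n..<N}. x j) <= 0 ==> \<not> feas n m a b y"
proof -
 have xf: "feas N m (ext_mat n m a) b x" using x by (simp add: opt_def)
 show "opt n m a c b x" if "(\<Sum>j\<in>{n..<N}. x j) <= 0"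
  unfolding opt_def
 proof (intro conjI allI impI)
  show "feas n m a b x" by (rule slack_zero[OF xf that])
  fix y assume y: "feas n m a b y"
  have "lin N (ext_cost n M c) x <= lin N (ext_cost n M c) (%j. if j < n then y j else 0)" using x feas_ext[OF y] unfolding opt_def by blast
  then show "lin n c x <= lin n c y" unfolding slack_zero(2)[OF xf that] feas_ext(2)[OF y] .
 qed
 show "\<not> feas n m a b y" if sl: "\<not> (\<Sum>j\<in>{n..<N}. x j) <= 0"
 proof
  assume y: "feas n m a b y"
  note Bd0 = Bd_pos
  have bb': "bounded_below N m (ext_mat n m a) (ext_cost n M' c)" using bounded_below_ext[of M'] bb M Bd0 by linarith
  obtain x1 where x1: "small n s H x1" "feas n m a b x1"
  proof -
   obtain z where "small n s H z" "(feas n m a b z & lin n c z <= lin n c y) \<or> (feas n m a (%k. 0) z & lin n c z < 0)" by (rule small_solution_exists[of m n a "2 ^ \<delta>" s b "2 ^ l" H y c])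
     (use a s H_bound[of n "2 ^ l"] b y in \<open>auto simp: less_imp_le\<close>)
   then show ?thesis using that bb unfolding bounded_below_def by (metis not_less)
  qed
  obtain x2 where x2: "small N s H x2" "feas N m (ext_mat n m a) b x2" "lin N (ext_cost n M' c) x2 <= lin N (ext_cost n M' c) x"
  proof -
   obtain z where "small N s H z" "(feas N m (ext_mat n m a) b z & lin N (ext_cost n M' c) z <= lin N (ext_cost n M' c) x)
     \<or> (feas N m (ext_mat n m a) (%k. 0) z & lin N (ext_cost n M' c) z < 0)" by (rule small_solution_exists[of m N "ext_mat n m a" "2 ^ \<delta>" s b "2 ^ l" H x "ext_cost n M' c"])
     (use ext_le s H_bound[of N "2 ^ l"] b xf in \<open>auto simp: less_imp_le\<close>)
   then show ?thesis using that bb' unfolding bounded_below_def by (metis not_less)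
  qed
  have 1: "lin N (ext_cost n M c) x <= Bd"
  proof -
   have "lin N (ext_cost n M c) x <= lin n c x1" using x feas_ext(1)[OF x1(2)] unfolding opt_def feas_ext(2)[OF x1(2), of M, symmetric] by blast
   then show ?thesis using small_cost[OF x1(2) _ x1(1)] by simp
  qed
  have 2: "- Bd <= lin N (ext_cost n M' c) x"
  proof -
   have "0 <= M' * (\<Sum>j\<in>{n..<N}. x2 j)" using slack_nonneg[OF x2(2)] M Bd0 by simp
   then show ?thesis using x2(3) small_cost[OF x2(2) _ x2(1)] unfolding lin_ext_cost by simp
  qed
  have "lin N (ext_cost n M c) x = lin N (ext_cost n M' c) x + M' * (\<Sum>j\<in>{n..<N}. x j)"
   unfolding lin_ext_cost M(1) by simp
  moreover have "M' * 1 <= M' * (\<Sum>j\<in>{n..<N}. x j)" using sl M Bd0 by (intro mult_left_mono) auto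
  ultimately show False using 1 2 M by linarith
 qed
qed

end

section \<open>Structured programs on the word machine\<close>
text \<open>Atoms and tests are parameters, so that the same programs and the same rules serve both
  the machine on words and the machine on long integers.\<close>

datatype 'a com = Block "'a list" | Seq "'a com" "'a com" (infixr \<open>;;\<close> 60)
 | Cond nat "'a com" "'a com" | Loop nat "'a com"

fun execs :: "('a => 's => 's option) => 'a list => 's => 's option" where
 "execs f [] s = Some s"
| "execs f (a # as) s = (case f a s of None => None | Some s' => execs f as s')"

text \<open>Each test is charged 2, an upper bound for the jumps that compilation adds around
  it.\<close>

inductive runs :: "('a => 's => 's option) => (nat => 's => bool option) => 'a com => 's => nat => 's => bool"
 for f g where
 Block: "execs f as s = Some s' ==> runs f g (Block as) s (length as) s'"
| Seq: "runs f g c s t s1 ==> runs f g d s1 t' s' ==> runs f g (c ;; d) s (t + t') s'"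
| CondT: "g x s = Some True ==> runs f g c s t s' ==> runs f g (Cond x c d) s (t + 2) s'"
| CondF: "g x s = Some False ==> runs f g d s t s' ==> runs f g (Cond x c d) s (t + 2) s'"
| LoopT: "g x s = Some True ==> runs f g c s t s1 ==> runs f g (Loop x c) s1 t' s' ==>
  runs f g (Loop x c) s (t + t' + 2) s'"
| LoopF: "g x s = Some False ==> runs f g (Loop x c) s 2 s"

text \<open>Total correctness within a time budget. An atom returning \<open>None\<close> has no
  run, so \<open>hp\<close> also certifies that nothing overflows and no access is out of
  range.\<close>

definition hp :: "('a => 's => 's option) => (nat => 's => bool option) => 'a com => 's => nat => ('s => bool) => bool" where
 "hp f g c s b Q \<longleftrightarrow> (\<exists>t s'. t <= b & runs f g c s t s' & Q s')"

lemma hp_mono: "hp f g c s b Q ==> b <= b' ==> (!!s'. Q s' ==> Q' s') ==> hp f g c s b' Q'"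
 unfolding hp_def using le_trans by blast

lemma hp_Block: "execs f as s = Some s' ==> length as <= b ==> Q s' ==> hp f g (Block as) s b Q"
 unfolding hp_def by (blast intro: runs.Block)

lemma hp_Seq: "hp f g c s b1 (%s1. hp f g d s1 b2 Q) ==> b1 + b2 <= b ==> hp f g (c ;; d) s b Q"
 unfolding hp_def using runs.Seq by (meson add_mono le_trans)

lemma hp_CondT: "g x s = Some True ==> hp f g c s b1 Q ==> b1 + 2 <= b ==> hp f g (Cond x c d) s b Q"
 unfolding hp_def using runs.CondT by (meson add_right_mono le_trans)

lemma hp_CondF: "g x s = Some False ==> hp f g d s b1 Q ==> b1 + 2 <= b ==> hp f g (Cond x c d) s b Q"
 unfolding hp_def using runs.CondF by (meson add_right_mono le_trans)

lemma hp_LoopF: "g x s = Some False ==> Q s ==> 2 <= b ==> hp f g (Loop x c) s b Q"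
 unfolding hp_def using runs.LoopF by fastforce

lemma hp_LoopT:
 assumes "g x s = Some True" "hp f g c s b1 (%s1. hp f g (Loop x c) s1 b2 Q)" "b1 + b2 + 2 <= b"
 shows "hp f g (Loop x c) s b Q"
proof -
 obtain t s1 where 1: "t <= b1" "runs f g c s t s1" "hp f g (Loop x c) s1 b2 Q" using assms unfolding hp_def by blast
 then obtain t' s' where "t' <= b2" "runs f g (Loop x c) s1 t' s'" "Q s'" unfolding hp_def by blast
 then show ?thesis using runs.LoopT[OF assms(1) 1(2)] 1(1) assms(3) unfolding hp_def by (intro exI[of _ "t + t' + 2"] exI[of _ s']) auto
qed

lemma hp_for:
 assumes step: "!!i s. i < n ==> I i s ==> g x s = Some True & hp f g c s b (I (Suc i))"
  and fin: "!!s. I n s ==> g x s = Some False" and init: "I 0 s"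
 shows "hp f g (Loop x c) s (n * (b + 2) + 2) (I n)"
proof -
 have "hp f g (Loop x c) s ((n - i) * (b + 2) + 2) (I n)" if "i <= n" "I i s" for i s using that
 proof (induction "n - i" arbitrary: i s)
  case 0
  then show ?case using fin by (auto intro: hp_LoopF)
 next
  case (Suc k)
  then have i: "i < n" "n - i = Suc (n - Suc i)" by auto
  from step[OF i(1) Suc.prems(2)] have g: "g x s = Some True" and h: "hp f g c s b (I (Suc i))" by auto
  show ?case
  proof (rule hp_LoopT[where ?b1.0 = b and ?b2.0 = "(n - Suc i) * (b + 2) + 2"])
   show "g x s = Some True" by (rule g)
   show "hp f g c s b (%s1. hp f g (Loop x c) s1 ((n - Suc i) * (b + 2) + 2) (I n))"
   proof (rule hp_mono[OF h order_refl])
    fix s' assume "I (Suc i) s'"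
    moreover have "k = n - Suc i" "Suc i <= n" using Suc.hyps(2) i by auto
    ultimately show "hp f g (Loop x c) s' ((n - Suc i) * (b + 2) + 2) (I n)" by (intro Suc.hyps(1))
   qed
   show "b + ((n - Suc i) * (b + 2) + 2) + 2 <= (n - i) * (b + 2) + 2" unfolding i(2) by simp
  qed
 qed
 from this[of 0 s] init show ?thesis by simp
qed

section \<open>Word programs and their compilation\<close>

datatype watom = WConst nat int | WArith arith nat nat nat | WLoad nat nat | WStore nat nat
 | WRead nat nat | WOut nat

type_synonym wst = "(nat => int) \<times> int list"

fun wat :: "nat => nat => int list => watom => wst => wst option" where
 "wat w S inp (WConst i v) (M, out) = (if i < S & is_word w v then Some (M(i := v), out) else None)"
| "wat w S inp (WArith f i j k) (M, out) = (if i < S & j < S & k < S & is_word w (arith_op f (M j) (M k))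
   then Some (M(i := arith_op f (M j) (M k)), out) else None)"
| "wat w S inp (WLoad i j) (M, out) = (if i < S & j < S & 0 <= M j & M j < int S
   then Some (M(i := M (nat (M j))), out) else None)"
| "wat w S inp (WStore i j) (M, out) = (if i < S & j < S & 0 <= M i & M i < int S
   then Some (M(nat (M i) := M j), out) else None)"
| "wat w S inp (WRead i j) (M, out) = (if i < S & j < S & 0 <= M j & M j < int (length inp) & is_word w (inp ! nat (M j))
   then Some (M(i := inp ! nat (M j)), out) else None)"
| "wat w S inp (WOut i) (M, out) = (if i < S then Some (M, out @ [M i]) else None)"

text \<open>Word 0 is kept at 0 by the programs, so this tests whether word \<open>x\<close> is
  positive.\<close>

definition wts :: "nat => nat => wst => bool option" where
 "wts S x s = (if 0 < S & x < S then Some (fst s 0 < fst s x) else None)"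

fun winstr :: "watom => instr" where
 "winstr (WConst i v) = SetConst i v"
| "winstr (WArith f i j k) = Arith f i j k"
| "winstr (WLoad i j) = Load i j"
| "winstr (WStore i j) = Store i j"
| "winstr (WRead i j) = ReadInput i j"
| "winstr (WOut i) = Output i"

fun csize :: "watom com => nat" where
 "csize (Block as) = length as"
| "csize (c ;; d) = csize c + csize d"
| "csize (Cond x c d) = csize c + csize d + 2"
| "csize (Loop x c) = csize c + 3"

fun compile :: "nat => watom com => instr list" where
 "compile p (Block as) = map winstr as"
| "compile p (c ;; d) = compile p c @ compile (p + csize c) d"
| "compile p (Cond x c d) = [JumpLess 0 x (p + csize d + 2)] @ compile (p + 1) d @
   [Jump (p + csize d + 2 + csize c)] @ compile (p + csize d + 2) c"
| "compile p (Loop x c) = [JumpLess 0 x (p + 2), Jump (p + csize c + 3)] @ compile (p + 2) c @ [Jump p]"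

lemma length_comp [simp]: "length (compile p c) = csize c" by (induction p c rule: compile.induct) auto

definition mrel :: "nat => (nat => int) => int list => bool" where
 "mrel S M L \<longleftrightarrow> length L = S & (\<forall>i<S. L ! i = M i)"

lemma mrel_nonempty: "mrel S M L ==> 0 < S ==> L ~= []" by (auto simp: mrel_def)

lemma wat_step:
 assumes "wat w S inp a s = Some s'" "mrel S (fst s) L" "P = pre @ [winstr a] @ post"
 shows "\<exists>L'. step w inp P (length pre, L, snd s) (Suc (length pre), L', snd s') & mrel S (fst s') L'"
proof -
 have pc: "length pre < length P" "P ! length pre = winstr a" using assms(3) by simp_all
 show ?thesis
 proof (cases s)
  case (Pair M out)
  have L: "length L = S" "!!i. i < S ==> L ! i = M i" using assms(2) unfolding Pair by (auto simp: mrel_def)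
  have upd: "mrel S (M(i := v)) (L[i := v])" for i v using L by (auto simp: mrel_def nth_list_update)
  show ?thesis
  proof (cases a)
   case (WConst i v)
   then show ?thesis using assms(1) pc L set_const[of "length pre" P i v L w inp out] upd[of i v] unfolding Pair by (auto split: if_splits)
  next
   case (WArith f i j k)
   then show ?thesis using assms(1) pc L arith[of "length pre" P f i j k L _ w inp out, OF _ _ _ _ _ refl] upd[of i] unfolding Pair by (auto split: if_splits)
  next
   case (WLoad i j)
   then show ?thesis using assms(1) pc L load[of "length pre" P i j L w inp out] upd[of i] unfolding Pair by (auto split: if_splits simp: is_addr_def)
  next
   case (WStore i j)
   then show ?thesis using assms(1) pc L store[of "length pre" P i j L w inp out] upd unfolding Pair by (auto split: if_splits simp: is_addr_def)
  next
   case (WRead i j)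
   then show ?thesis using assms(1) pc L read_input[of "length pre" P i j L inp _ w out, OF _ _ _ _ _ refl] upd[of i] unfolding Pair by (auto split: if_splits simp: is_addr_def)
  next
   case (WOut i)
   then show ?thesis using assms(1,2) pc L write_output[of "length pre" P i L w inp out] unfolding Pair by (auto split: if_splits)
  qed
 qed
qed

lemma step1: "step w inp P x y ==> (step w inp P ^^ n) y z ==> (step w inp P ^^ Suc n) x z" by (metis relpowp_Suc_I2)

lemma comp_block:
 "execs (wat w S inp) as s = Some s' ==> mrel S (fst s) L ==> P = pre @ map winstr as @ post ==>
  \<exists>L'. (step w inp P ^^ length as) (length pre, L, snd s) (length pre + length as, L', snd s') & mrel S (fst s') L'"
proof (induction as arbitrary: s L pre)
 case (Cons a as)
 from Cons.prems(1) obtain s1 where s1: "wat w S inp a s = Some s1" "execs (wat w S inp) as s1 = Some s'" by (auto split: option.splits)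
 obtain L1 where L1: "step w inp P (length pre, L, snd s) (Suc (length pre), L1, snd s1)" "mrel S (fst s1) L1" using wat_step[OF s1(1) Cons.prems(2), of P pre "map winstr as @ post"] Cons.prems(3) by auto
 obtain L2 where "(step w inp P ^^ length as) (Suc (length pre), L1, snd s1) (Suc (length pre) + length as, L2, snd s')"
  "mrel S (fst s') L2" using Cons.IH[OF s1(2) L1(2), of "pre @ [winstr a]"] Cons.prems(3) by auto
 then show ?case using step1[OF L1(1)] by (intro exI[of _ L2]) (simp del: relpowp.simps)
qed auto

text \<open>Jump targets are absolute; the code is therefore treated at its position
  \<open>length pre\<close> inside a surrounding program.\<close>

lemma comp_correct:
 assumes "runs (wat w S inp) (wts S) c s t s'"
 shows "mrel S (fst s) L ==> P = pre @ compile (length pre) c @ post ==>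
  \<exists>T L'. T <= t & (step w inp P ^^ T) (length pre, L, snd s) (length pre + csize c, L', snd s') & mrel S (fst s') L'" using assms
proof (induction arbitrary: L pre post)
 case (Block as s s')
 then show ?case using comp_block[OF Block(1) Block(2), of P pre post] by auto
next
 case (Seq c s t s1 d t' s')
 obtain T1 L1 where 1: "T1 <= t" "(step w inp P ^^ T1) (length pre, L, snd s) (length pre + csize c, L1, snd s1)" "mrel S (fst s1) L1" using Seq.IH(1)[OF Seq.prems(1), of pre "compile (length pre + csize c) d @ post"] Seq.prems(2) by auto
 obtain T2 L2 where 2: "T2 <= t'" "(step w inp P ^^ T2) (length pre + csize c, L1, snd s1) (length pre + csize c + csize d, L2, snd s')" "mrel S (fst s') L2" using Seq.IH(2)[OF 1(3), of "pre @ compile (length pre) c" post] Seq.prems(2) by auto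
 show ?case using relpowp_trans[OF 1(2) 2(2)] 1 2 by (intro exI[of _ "T1 + T2"] exI[of _ L2]) (auto simp: add.assoc)
next
 case (CondT x s c t s' d)
 have x: "0 < S" "x < S" "fst s 0 < fst s x" using CondT(1) by (auto simp: wts_def split: if_splits)
 have P: "P ! length pre = JumpLess 0 x (length pre + csize d + 2)" "length pre < length P" using CondT.prems(2) by auto
 have j: "step w inp P (length pre, L, snd s) (length pre + csize d + 2, L, snd s)" using jump_less[OF P(2,1), of L w inp "snd s"] x mrel_nonempty[OF CondT.prems(1)] CondT.prems(1) by (auto simp: mrel_def)
 obtain T1 L1 where 1: "T1 <= t" "(step w inp P ^^ T1) (length pre + csize d + 2, L, snd s) (length pre + csize d + 2 + csize c, L1, snd s')" "mrel S (fst s') L1" using CondT.IH[OF CondT.prems(1), of "pre @ [JumpLess 0 x (length pre + csize d + 2)] @ compile (length pre + 1) d @ [Jump (length pre + csize d + 2 + csize c)]" post] CondT.prems(2) by (auto simp: add_ac)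
 show ?case using step1[OF j 1(2)] 1 by (intro exI[of _ "Suc T1"] exI[of _ L1]) (auto simp: add_ac)
next
 case (CondF x s d t s' c)
 have x: "0 < S" "x < S" "\<not> fst s 0 < fst s x" using CondF(1) by (auto simp: wts_def split: if_splits)
 have P: "P ! length pre = JumpLess 0 x (length pre + csize d + 2)" "length pre < length P" using CondF.prems(2) by auto
 have j: "step w inp P (length pre, L, snd s) (Suc (length pre), L, snd s)" using jump_less[OF P(2,1), of L w inp "snd s"] x mrel_nonempty[OF CondF.prems(1)] CondF.prems(1) by (auto simp: mrel_def)
 obtain T1 L1 where 1: "T1 <= t" "(step w inp P ^^ T1) (Suc (length pre), L, snd s) (Suc (length pre) + csize d, L1, snd s')" "mrel S (fst s') L1" using CondF.IH[OF CondF.prems(1), of "pre @ [JumpLess 0 x (length pre + csize d + 2)]" "[Jump (length pre + csize d + 2 + csize c)] @ compile (length pre + csize d + 2) c @ post"] CondF.prems(2) by auto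
 have P2: "P ! (Suc (length pre) + csize d) = Jump (length pre + csize d + 2 + csize c)" "Suc (length pre) + csize d < length P" using CondF.prems(2) by (auto simp: nth_append)
 have j2: "(step w inp P ^^ 1) (Suc (length pre) + csize d, L1, snd s') (length pre + csize d + 2 + csize c, L1, snd s')" using jump[OF P2(2,1), of w inp L1 "snd s'"] by (simp only: relpowp_1)
 show ?case using relpowp_trans[OF step1[OF j 1(2)] j2] 1 by (intro exI[of _ "Suc T1 + 1"] exI[of _ L1]) (auto simp: add_ac)
next
 case (LoopT x s c t s1 t' s')
 have x: "0 < S" "x < S" "fst s 0 < fst s x" using LoopT(1) by (auto simp: wts_def split: if_splits)
 have P: "P ! length pre = JumpLess 0 x (length pre + 2)" "length pre < length P" using LoopT.prems(2) by auto
 have j: "step w inp P (length pre, L, snd s) (length pre + 2, L, snd s)" using jump_less[OF P(2,1), of L w inp "snd s"] x mrel_nonempty[OF LoopT.prems(1)] LoopT.prems(1) by (auto simp: mrel_def)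
 obtain T1 L1 where 1: "T1 <= t" "(step w inp P ^^ T1) (length pre + 2, L, snd s) (length pre + 2 + csize c, L1, snd s1)" "mrel S (fst s1) L1" using LoopT.IH(1)[OF LoopT.prems(1), of "pre @ [JumpLess 0 x (length pre + 2), Jump (length pre + csize c + 3)]" "[Jump (length pre)] @ post"] LoopT.prems(2) by auto
 have P2: "P ! (length pre + 2 + csize c) = Jump (length pre)" "length pre + 2 + csize c < length P" using LoopT.prems(2) by (auto simp: nth_append)
 have j2: "(step w inp P ^^ 1) (length pre + 2 + csize c, L1, snd s1) (length pre, L1, snd s1)" using jump[OF P2(2,1), of w inp L1 "snd s1"] by (simp only: relpowp_1)
 obtain T2 L2 where 2: "T2 <= t'" "(step w inp P ^^ T2) (length pre, L1, snd s1) (length pre + csize (Loop x c), L2, snd s')" "mrel S (fst s') L2" using LoopT.IH(2)[OF 1(3), of pre post] LoopT.prems(2) by auto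
 show ?case using relpowp_trans[OF relpowp_trans[OF step1[OF j 1(2)] j2] 2(2)] 1 2 by (intro exI[of _ "Suc T1 + 1 + T2"] exI[of _ L2]) auto
next
 case (LoopF x s c)
 have x: "0 < S" "x < S" "\<not> fst s 0 < fst s x" using LoopF(1) by (auto simp: wts_def split: if_splits)
 have P: "P ! length pre = JumpLess 0 x (length pre + 2)" "length pre < length P" using LoopF.prems(2) by auto
 have j: "step w inp P (length pre, L, snd s) (Suc (length pre), L, snd s)" using jump_less[OF P(2,1), of L w inp "snd s"] x mrel_nonempty[OF LoopF.prems(1)] LoopF.prems(1) by (auto simp: mrel_def)
 have P2: "P ! Suc (length pre) = Jump (length pre + csize c + 3)" "Suc (length pre) < length P" using LoopF.prems(2) by (auto simp: nth_append)
 have j2: "(step w inp P ^^ 1) (Suc (length pre), L, snd s) (length pre + csize c + 3, L, snd s)" using jump[OF P2(2,1), of w inp L "snd s"] by (simp only: relpowp_1)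
 show ?case using step1[OF j j2] LoopF.prems by (intro exI[of _ "Suc 1"] exI[of _ L]) (simp add: add.assoc del: relpowp.simps)
qed

lemma compiled_computes:
 assumes "hp (wat w S inp) (wts S) c ((%i. 0), []) b (%s. snd s = out)"
 shows "\<exists>T\<le>b. ram_computes w (compile 0 c @ [Halt]) inp T S out"
proof -
 obtain t s' where t: "t <= b" "runs (wat w S inp) (wts S) c ((%i. 0), []) t s'" "snd s' = out" using assms unfolding hp_def by blast
 obtain T L where "T <= t" "(step w inp (compile 0 c @ [Halt]) ^^ T) (0, replicate S 0, []) (csize c, L, out)" using comp_correct[OF t(2), of "replicate S 0" "compile 0 c @ [Halt]" "[]" "[Halt]"] t(3) by (auto simp: mrel_def)
 moreover have "csize c < length (compile 0 c @ [Halt])" "(compile 0 c @ [Halt]) ! csize c = Halt" by (simp_all add: nth_append)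
 ultimately show ?thesis using t(1) unfolding ram_computes_def by (meson le_trans)
qed

section \<open>Programs on long integers\<close>
text \<open>Floor division yields two's complement: a negative number has ones in all high
  positions.\<close>

definition bt :: "int => nat => int" where
 "bt v i = v div 2 ^ i mod 2"

lemma bt_01: "bt v i = 0 \<or> bt v i = 1"
 unfolding bt_def by presburger

lemma bt_range: "0 <= bt v i" "bt v i <= 1" using bt_01[of v i] by auto

lemma div_pow_Suc: "(v::int) div 2 ^ Suc i = v div 2 ^ i div 2" by (simp add: zdiv_zmult2_eq[symmetric] mult.commute)

lemma div_pow_bt: "(v::int) div 2 ^ i = 2 * (v div 2 ^ Suc i) + bt v i"
 unfolding div_pow_Suc bt_def by simp

definition sg_op :: "arith => bool" where "sg_op f \<longleftrightarrow> f = Add \<or> f = Sub"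

text \<open>The carry into position \<open>i\<close> of the ripple-carry addition or subtraction.\<close>

definition carry :: "arith => int => int => nat => int" where
 "carry f x y i = arith_op f x y div 2 ^ i - arith_op f (x div 2 ^ i) (y div 2 ^ i)"

lemma carry_step:
 assumes "sg_op f"
 shows "arith_op f (bt x i) (bt y i) + carry f x y i = arith_op f x y div 2 ^ i - 2 * arith_op f (x div 2 ^ Suc i) (y div 2 ^ Suc i)"
proof -
 define X where "X = x div 2 ^ i"
 define Y where "Y = y div 2 ^ i"
 have "bt x i = X - 2 * (x div 2 ^ Suc i)" "bt y i = Y - 2 * (y div 2 ^ Suc i)" using div_pow_bt[of x i] div_pow_bt[of y i] unfolding X_def Y_def by linarith+
 then show ?thesis using assms unfolding carry_def sg_op_def X_def[symmetric] Y_def[symmetric] by (elim disjE) (simp_all add: algebra_simps)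
qed

lemma carry_digit: "sg_op f ==> (arith_op f (bt x i) (bt y i) + carry f x y i) mod 2 = bt (arith_op f x y) i"
proof -
 assume f: "sg_op f"
 have "(z - 2 * u) mod 2 = z mod 2" for z u :: int by presburger
 then show ?thesis by (simp only: carry_step[OF f]) (simp only: bt_def)
qed

lemma carry_Suc: "sg_op f ==> (arith_op f (bt x i) (bt y i) + carry f x y i) div 2 = carry f x y (Suc i)"
proof -
 assume f: "sg_op f"
 have "(z - 2 * u) div 2 = z div 2 - u" for z u :: int by presburger
 then show ?thesis by (simp only: carry_step[OF f]) (simp only: carry_def div_pow_Suc)
qed

lemma carry_0: "sg_op f ==> carry f x y 0 = 0" by (auto simp: carry_def sg_op_def)

lemma carry_bound: "sg_op f ==> \<bar>carry f x y i\<bar> <= 1"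
proof (induction i)
 case (Suc i)
 have "\<bar>arith_op f (bt x i) (bt y i)\<bar> <= 2" "- 1 <= arith_op f (bt x i) (bt y i)" using Suc.prems bt_range[of x i] bt_range[of y i] by (auto simp: sg_op_def)
 then show ?case using Suc unfolding carry_Suc[OF Suc.prems, symmetric] by linarith
qed (simp add: carry_0)

lemma carry_digit_bound: "sg_op f ==> \<bar>arith_op f (bt x i) (bt y i)\<bar> <= 2" using bt_range[of x i] bt_range[of y i] by (auto simp: sg_op_def)

section \<open>A machine on integers, with control of magnitudes\<close>

text \<open>The operations are chosen so that each is easy on bit arrays and raises the bit bound by
  at most one; multiplication is programmed from them.\<close>

datatype hatom = HConst nat int | HAdd nat nat nat | HSub nat nat nat | HHalf nat nat
 | HLoad nat nat nat | HStore nat nat nat | HRead nat nat | HOut nat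

type_synonym hst = "(nat => int) \<times> (nat => nat => int) \<times> int list"

fun hat :: "int list => nat => hatom => hst => hst option" where
 "hat inp J (HConst x v) (R, A, out) = (if x < 46 & \<bar>v\<bar> <= 1 then Some (R(x := v), A, out) else None)"
| "hat inp J (HAdd x y z) (R, A, out) = (if x < 46 & y < 46 & z < 46 then Some (R(x := R y + R z), A, out) else None)"
| "hat inp J (HSub x y z) (R, A, out) = (if x < 46 & y < 46 & z < 46 then Some (R(x := R y - R z), A, out) else None)"
| "hat inp J (HHalf x y) (R, A, out) = (if x < 46 & y < 46 then Some (R(x := R y div 2), A, out) else None)"
| "hat inp J (HLoad x f y) (R, A, out) = (if x < 46 & y < 46 & f < 16 & 0 <= R y & R y < int J
   then Some (R(x := A f (nat (R y))), A, out) else None)"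
| "hat inp J (HStore f y x) (R, A, out) = (if x < 46 & y < 46 & f < 16 & 0 <= R y & R y < int J
   then Some (R, A(f := (A f)(nat (R y) := R x)), out) else None)"
| "hat inp J (HRead x y) (R, A, out) = (if x < 46 & y < 46 & 0 <= R y & R y < int (length inp)
   then Some (R(x := inp ! nat (R y)), A, out) else None)"
| "hat inp J (HOut x) (R, A, out) = (if x < 46 then Some (R, A, out @ [R x mod 2]) else None)"

definition hts :: "nat => hst => bool option" where
 "hts x s = (if x < 46 then Some (fst s x < 0) else None)"

definition hbnd :: "nat => hst => bool" where
 "hbnd q s \<longleftrightarrow> (\<forall>x. \<bar>fst s x\<bar> < 2 ^ q) & (\<forall>f j. \<bar>fst (snd s) f j\<bar> < 2 ^ q)"

text \<open>This semantics is stuck once a value leaves the range of \<open>q\<close> bits. Its runs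
  are those that can be simulated in bit arrays of length \<open>q + 1\<close>, one position being
  the sign.\<close>

definition hq :: "nat => int list => nat => hatom => hst => hst option" where
 "hq q inp J a s = (if hbnd q s then
   (case hat inp J a s of None => None | Some s' => if hbnd q s' then Some s' else None) else None)"

definition hqt :: "nat => nat => hst => bool option" where
 "hqt q x s = (if hbnd q s then hts x s else None)"

lemma hbnd_mono: "hbnd q s ==> q <= q' ==> hbnd q' s"
proof -
 assume "hbnd q s" "q <= q'"
 moreover have "(2::int) ^ q <= 2 ^ q'" using \<open>q <= q'\<close> by (intro power_increasing) auto
 ultimately show "hbnd q' s" unfolding hbnd_def by (meson less_le_trans)
qed

lemma hat_bnd:
 assumes "hat inp J a s = Some s'" "hbnd q s" "!!v. v \<in> set inp ==> \<bar>v\<bar> < 2 ^ q" "1 <= q"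
 shows "hbnd (Suc q) s'"
proof -
 obtain R A out where s: "s = (R, A, out)" by (cases s) auto
 have R: "\<bar>R x\<bar> < 2 ^ q" and A: "\<bar>A f j\<bar> < 2 ^ q" for x f j using assms(2) unfolding s hbnd_def by auto
 have p: "(2::int) ^ Suc q = 2 * 2 ^ q" "(1::int) < 2 ^ q" using assms(4) by (auto simp: one_less_power)
 have R': "\<bar>R x\<bar> < 2 ^ Suc q" and A': "\<bar>A f j\<bar> < 2 ^ Suc q" for x f j using R[of x] A[of f j] p by linarith+
 have upd: "hbnd (Suc q) (R(x := v), A, out)" if "\<bar>v\<bar> < 2 ^ Suc q" for x v using R' A' that unfolding hbnd_def by simp
 have half: "\<bar>R y div 2\<bar> < 2 ^ Suc q" for y using R[of y] p by (auto simp: abs_less_iff)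
 show ?thesis
 proof (cases a)
  case (HConst x v)
  then show ?thesis using assms(1) upd[of v x] p unfolding s by (auto split: if_splits)
 next
  case (HAdd x y z)
  have "\<bar>R y + R z\<bar> < 2 ^ Suc q" using R[of y] R[of z] p(1) by linarith
  then show ?thesis using assms(1) upd[of "R y + R z" x] HAdd unfolding s by (auto split: if_splits)
 next
  case (HSub x y z)
  have "\<bar>R y - R z\<bar> < 2 ^ Suc q" using R[of y] R[of z] p(1) by linarith
  then show ?thesis using assms(1) upd[of "R y - R z" x] HSub unfolding s by (auto split: if_splits)
 next
  case (HHalf x y)
  then show ?thesis using assms(1) upd[OF half[of y], of x] unfolding s by (auto split: if_splits)
 next
  case (HLoad x f y)
  then show ?thesis using assms(1) upd[OF A'[of f "nat (R y)"], of x] unfolding s by (auto split: if_splits)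
 next
  case (HStore f y x)
  then show ?thesis using assms(1) R' A' unfolding s hbnd_def by (auto split: if_splits simp del: power_Suc)
 next
  case (HRead x y)
  show ?thesis
  proof (cases "0 <= R y & R y < int (length inp)")
   case True
   then have "\<bar>inp ! nat (R y)\<bar> < 2 ^ q" by (intro assms(3) nth_mem) linarith
   then have "\<bar>inp ! nat (R y)\<bar> < 2 ^ Suc q" using p by linarith
   then show ?thesis using assms(1) upd[of "inp ! nat (R y)" x] HRead unfolding s by (auto split: if_splits)
  qed (use HRead assms(1) s in \<open>auto split: if_splits\<close>)
 next
  case (HOut x)
  then show ?thesis using assms(1) R' A' unfolding s hbnd_def by (auto split: if_splits simp del: power_Suc)
 qed
qed

lemma execs_hq_mono:
 "execs (hq q inp J) as s = Some s' ==> q <= q' ==> execs (hq q' inp J) as s = Some s'"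
proof (induction as arbitrary: s)
 case (Cons a as)
 then obtain s1 where "hq q inp J a s = Some s1" "execs (hq q inp J) as s1 = Some s'" by (auto split: option.splits)
 moreover have "hq q' inp J a s = Some s1" using calculation(1) hbnd_mono[OF _ Cons.prems(2)]
  unfolding hq_def by (auto split: if_splits option.splits)
 ultimately show ?case using Cons by auto
qed auto

lemma runs_hq_mono:
 "runs (hq q inp J) (hqt q) c s t s' ==> q <= q' ==> runs (hq q' inp J) (hqt q') c s t s'"
proof (induction rule: runs.induct)
 case (Block as s s')
 then show ?case using execs_hq_mono[OF Block(1) Block(2)] by (intro runs.Block)
next
 case (CondT x s c t s' d)
 then have "hqt q' x s = Some True" using hbnd_mono unfolding hqt_def by (auto split: if_splits)
 then show ?case using CondT by (intro runs.CondT) auto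
next
 case (CondF x s d t s' c)
 then have "hqt q' x s = Some False" using hbnd_mono unfolding hqt_def by (auto split: if_splits)
 then show ?case using CondF by (intro runs.CondF) auto
next
 case (LoopT x s c t s1 t' s')
 then have "hqt q' x s = Some True" using hbnd_mono unfolding hqt_def by (auto split: if_splits)
 then show ?case using LoopT by (intro runs.LoopT) auto
next
 case (LoopF x s c)
 then have "hqt q' x s = Some False" using hbnd_mono unfolding hqt_def by (auto split: if_splits)
 then show ?case by (intro runs.LoopF) auto
qed (auto intro: runs.Seq)

lemma execs_hq:
 assumes "!!v. v \<in> set inp ==> \<bar>v\<bar> < 2 ^ q0" "1 <= q0"
 shows "execs (hat inp J) as s = Some s' ==> hbnd q s ==> q0 <= q ==>
  execs (hq (q + length as) inp J) as s = Some s' & hbnd (q + length as) s'"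
proof (induction as arbitrary: s q)
 case (Cons a as)
 then obtain s1 where s1: "hat inp J a s = Some s1" "execs (hat inp J) as s1 = Some s'" by (auto split: option.splits)
 have inp: "\<bar>v\<bar> < 2 ^ q" if "v \<in> set inp" for v using less_le_trans[OF assms(1)[OF that] power_increasing[OF Cons.prems(3)]] by simp
 have b1: "hbnd (Suc q) s1" using hat_bnd[OF s1(1) Cons.prems(2) inp] assms(2) Cons.prems(3) by simp
 have "hq (q + length (a # as)) inp J a s = Some s1"
  unfolding hq_def using s1 hbnd_mono[OF Cons.prems(2)] hbnd_mono[OF b1] by simp
 then show ?case using Cons.IH[OF s1(2) b1] Cons.prems(3) by simp
qed auto

text \<open>In a run of \<open>t\<close> steps magnitudes grow by at most \<open>t\<close> bits. For
  polynomially long runs this provides all bit bounds at once.\<close>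

lemma runs_hq:
 assumes inp: "!!v. v \<in> set inp ==> \<bar>v\<bar> < 2 ^ q0" "1 <= q0"
  and "runs (hat inp J) hts c s t s'"
 shows "hbnd q s ==> q0 <= q ==> runs (hq (q + t) inp J) (hqt (q + t)) c s t s' & hbnd (q + t) s'" using assms(3)
proof (induction arbitrary: q)
 case (Block as s s')
 then show ?case using execs_hq[of inp q0 J as s s' q] inp by (auto intro: runs.Block)
next
 case (Seq c s t s1 d t' s')
 have 1: "runs (hq (q + t) inp J) (hqt (q + t)) c s t s1" "hbnd (q + t) s1" using Seq.IH(1)[of q] Seq.prems by auto
 have 2: "runs (hq (q + t + t') inp J) (hqt (q + t + t')) d s1 t' s'" "hbnd (q + t + t') s'" using Seq.IH(2)[of "q + t"] 1 Seq.prems by auto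
 show ?case using runs.Seq[OF runs_hq_mono[OF 1(1), of "q + t + t'"] 2(1)] 2(2) by (simp add: add.assoc)
next
 case (CondT x s c t s' d)
 have 1: "runs (hq (q + t) inp J) (hqt (q + t)) c s t s'" "hbnd (q + t) s'" using CondT.IH[of q] CondT.prems by auto
 have "hqt (q + (t + 2)) x s = Some True" using CondT.hyps(1) hbnd_mono[OF CondT.prems(1)] by (simp add: hqt_def)
 then show ?case using runs.CondT[OF _ runs_hq_mono[OF 1(1), of "q + (t + 2)"]] hbnd_mono[OF 1(2)] by simp
next
 case (CondF x s d t s' c)
 have 1: "runs (hq (q + t) inp J) (hqt (q + t)) d s t s'" "hbnd (q + t) s'" using CondF.IH[of q] CondF.prems by auto
 have "hqt (q + (t + 2)) x s = Some False" using CondF.hyps(1) hbnd_mono[OF CondF.prems(1)] by (simp add: hqt_def)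
 then show ?case using runs.CondF[OF _ runs_hq_mono[OF 1(1), of "q + (t + 2)"]] hbnd_mono[OF 1(2)] by simp
next
 case (LoopT x s c t s1 t' s')
 have 1: "runs (hq (q + t) inp J) (hqt (q + t)) c s t s1" "hbnd (q + t) s1" using LoopT.IH(1)[of q] LoopT.prems by auto
 have 2: "runs (hq (q + t + t') inp J) (hqt (q + t + t')) (Loop x c) s1 t' s'" "hbnd (q + t + t') s'" using LoopT.IH(2)[of "q + t"] 1 LoopT.prems by auto
 let ?q = "q + (t + t' + 2)"
 have "hqt ?q x s = Some True" using LoopT.hyps(1) hbnd_mono[OF LoopT.prems(1)] by (simp add: hqt_def)
 then show ?case using runs.LoopT[OF _ runs_hq_mono[OF 1(1), of ?q] runs_hq_mono[OF 2(1), of ?q]] hbnd_mono[OF 2(2)] by simp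
next
 case (LoopF x s c)
 have "hqt (q + 2) x s = Some False" using LoopF.hyps(1) hbnd_mono[OF LoopF.prems(1)] by (simp add: hqt_def)
 then show ?case using hbnd_mono[OF LoopF.prems(1)] by (auto intro: runs.LoopF)
qed

lemma hp_hq:
 assumes "!!v. v \<in> set inp ==> \<bar>v\<bar> < 2 ^ q" "1 <= q" "hp (hat inp J) hts c s b Q" "hbnd q s" "q + b <= q'"
 shows "hp (hq q' inp J) (hqt q') c s b Q"
proof -
 obtain t s' where t: "t <= b" "runs (hat inp J) hts c s t s'" "Q s'" using assms(3) unfolding hp_def by blast
 have "runs (hq (q + t) inp J) (hqt (q + t)) c s t s'" using runs_hq[OF assms(1,2) t(2) assms(4)] by simp
 from runs_hq_mono[OF this, of q'] have "runs (hq q' inp J) (hqt q') c s t s'" using t assms(5) by simp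
 then show ?thesis using t unfolding hp_def by blast
qed

section \<open>Arithmetic on bit arrays\<close>

text \<open>Words 0 to 4 hold constants, words 5 to 31 are scratch and may change, and the memory
  from 32 on is described exactly.\<close>

definition wrote :: "nat => (nat => int) => nat => int => (nat => int) => bool" where
 "wrote n M p v M' \<longleftrightarrow> (\<forall>x<5. M' x = M x) &
   (\<forall>x\<ge>32. M' x = (if p <= x & x < p + n then bt v (x - p) else M x))"

text \<open>Words 8, 9 and 10 point to the result and the two operands. Word 11 is the carry, which
  becomes -1 for a borrow.\<close>

definition big_add :: "arith => watom com" where
 "big_add f = Block [WConst 11 0, WArith Add 12 3 0] ;; Loop 12 (Block [WLoad 13 9, WLoad 14 10,
   WArith f 13 13 14, WArith Add 13 13 11, WArith Mod 14 13 2, WStore 8 14, WArith Div 11 13 2,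
   WArith Add 8 8 1, WArith Add 9 9 1, WArith Add 10 10 1, WArith Sub 12 12 1])"

text \<open>A shift by one position; afterwards the source pointer stands one past the array and is
  moved back to copy the sign bit once more.\<close>

definition big_half :: "watom com" where
 "big_half = Block [WArith Add 9 9 1, WArith Sub 12 3 1] ;; Loop 12 (Block [WLoad 13 9, WStore 8 13,
   WArith Add 8 8 1, WArith Add 9 9 1, WArith Sub 12 12 1]) ;;
   Block [WArith Sub 9 9 1, WLoad 13 9, WStore 8 13]"

definition from_word :: "watom com" where
 "from_word = Block [WArith Add 12 3 0] ;; Loop 12 (Block [WArith Mod 14 13 2, WStore 8 14,
   WArith Div 13 13 2, WArith Add 8 8 1, WArith Sub 12 12 1])"

text \<open>Horner's scheme from the most significant bit; it turns a nonnegative index into a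
  machine word.\<close>

definition to_word :: "watom com" where
 "to_word = Block [WArith Add 12 3 0, WArith Add 9 9 12, WConst 13 0] ;; Loop 12 (Block [
   WArith Sub 9 9 1, WLoad 14 9, WArith Add 13 13 13, WArith Add 13 13 14, WArith Sub 12 12 1])"

text \<open>Memory consists of 32 special words and \<open>48 + 16 * J\<close> cells of
  \<open>Q\<close> words: the first 48 cells for a zero and the registers, the others for 16
  interleaved arrays of length \<open>J\<close>.\<close>

locale wram =
 fixes w S Q J :: nat and inp :: "int list"
 assumes S: "S = 32 + (48 + 16 * J) * Q" and Q2: "2 <= Q"
  and word: "!!v. \<bar>v\<bar> <= 2 * int S + 100 ==> is_word w v"
  and inpw: "!!v. v \<in> set inp ==> is_word w v" and inpl: "length inp <= S"
begin

abbreviation W :: "watom com => wst => nat => (wst => bool) => bool" where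
 "W \<equiv> hp (wat w S inp) (wts S)"

definition ok :: "(nat => int) => bool" where
 "ok M \<longleftrightarrow> M 0 = 0 & M 1 = 1 & M 2 = 2 & M 3 = int Q & M 4 = 32"

lemma S_ge: "32 <= S" "int Q <= int S" "96 <= S"
proof -
 have "48 * Q <= (48 + 16 * J) * Q" by (intro mult_le_mono1) simp
 then show "32 <= S" "int Q <= int S" "96 <= S" using S Q2 by linarith+
qed

lemma wrote_ok: "wrote n M p v M' ==> ok M ==> ok M'" by (simp add: wrote_def ok_def)

text \<open>An operand either coincides with the target or is disjoint from it; working upwards from
  the lowest bit is then safe in place.\<close>

definition apart :: "nat => nat => bool" where
 "apart p q \<longleftrightarrow> q = p \<or> q + Q <= p \<or> p + Q <= q"

lemma big_add_correct:
 assumes f: "sg_op f" and M: "ok M" and p: "M 8 = int p" "M 9 = int q" "M 10 = int r"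
  and pge: "32 <= p" "32 <= q" "32 <= r" "p + Q <= S" "q + Q <= S" "r + Q <= S" "apart p q" "apart p r"
  and b: "!!i. i < Q ==> M (q + i) = bt x i" "!!i. i < Q ==> M (r + i) = bt y i"
 shows "W (big_add f) (M, out) (13 * Q + 4) (%s. snd s = out & wrote Q M p (arith_op f x y) (fst s))"
proof -
 define I where "I i s \<longleftrightarrow> snd s = out & fst s 8 = int (p + i) & fst s 9 = int (q + i) & fst s 10 = int (r + i) &
  fst s 11 = carry f x y i & fst s 12 = int Q - int i & wrote i M p (arith_op f x y) (fst s)" for i and s :: wst
 have small: "is_word w v" if "\<bar>v\<bar> <= int S + 96" for v using that by (intro word) linarith
 show ?thesis unfolding big_add_def
 proof (rule hp_Seq[where ?b1.0 = 2 and ?b2.0 = "Q * (11 + 2) + 2"])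
  have I0: "I 0 (M(11 := 0, 12 := int Q), out)" using p M unfolding I_def by (simp add: wrote_def carry_0[OF f] ok_def)
  have L: "W (Loop 12 (Block [WLoad 13 9, WLoad 14 10, WArith f 13 13 14, WArith Add 13 13 11, WArith Mod 14 13 2,
    WStore 8 14, WArith Div 11 13 2, WArith Add 8 8 1, WArith Add 9 9 1, WArith Add 10 10 1, WArith Sub 12 12 1]))
    (M(11 := 0, 12 := int Q), out) (Q * (11 + 2) + 2) (I Q)"
  proof (rule hp_for[where I = I])
   fix i s assume i: "i < Q" and Is: "I i s"
   obtain M' where s: "s = (M', out)" using Is unfolding I_def by (cases s) auto
   have M': "M' 8 = int (p + i)" "M' 9 = int (q + i)" "M' 10 = int (r + i)" "M' 11 = carry f x y i"
    "M' 12 = int Q - int i" and wr: "wrote i M p (arith_op f x y) M'" using Is unfolding s I_def by auto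
   have c: "M' 0 = 0" "M' (Suc 0) = 1" "M' 2 = 2" using wr M by (auto simp: wrote_def ok_def)
   have e: "M' (q + i) = bt x i" "M' (r + i) = bt y i" using wr b[OF i] pge i unfolding wrote_def apart_def by (auto simp: le_Suc_eq)
   define d where "d = arith_op f (bt x i) (bt y i)"
   have d: "\<bar>d\<bar> <= 2" "\<bar>d + carry f x y i\<bar> <= 3" unfolding d_def using carry_digit_bound[OF f, of x i y] carry_bound[OF f, of x y i] by linarith+
   have m: "(d + carry f x y i) mod 2 = bt (arith_op f x y) i" "(d + carry f x y i) div 2 = carry f x y (Suc i)" using carry_digit[OF f, of x i y] carry_Suc[OF f, of x i y] unfolding d_def by auto
   have wd: "is_word w d" "is_word w (d + carry f x y i)" "is_word w (bt (arith_op f x y) i)" "is_word w (carry f x y (Suc i))"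
    "is_word w (int p + int i + 1)" "is_word w (int q + int i + 1)" "is_word w (int r + int i + 1)" "is_word w (int Q - int i - 1)" using d bt_range[of "arith_op f x y" i] carry_bound[OF f, of x y "Suc i"] pge i S_ge by (auto intro!: small)
   have ad: "p + i < S" "q + i < S" "r + i < S" using pge i by linarith+
   have nz: "32 <= p + i" "32 <= q + i" "32 <= r + i" using pge by linarith+
   have lt: "int p + int i < int S" "int q + int i < int S" "int r + int i < int S" using ad by linarith+
   have nt: "nat (int p + int i) = p + i" "nat (int q + int i) = q + i" "nat (int r + int i) = r + i" by simp_all
   have S15: "15 < S" using S_ge by simp
   show "wts S 12 s = Some True & W (Block [WLoad 13 9, WLoad 14 10, WArith f 13 13 14, WArith Add 13 13 11, WArith Mod 14 13 2,
    WStore 8 14, WArith Div 11 13 2, WArith Add 8 8 1, WArith Add 9 9 1, WArith Add 10 10 1, WArith Sub 12 12 1]) s 11 (I (Suc i))"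
   proof
    show "wts S 12 s = Some True" using S15 M' c i unfolding s wts_def by simp
    show "W (Block [WLoad 13 9, WLoad 14 10, WArith f 13 13 14, WArith Add 13 13 11, WArith Mod 14 13 2,
     WStore 8 14, WArith Div 11 13 2, WArith Add 8 8 1, WArith Add 9 9 1, WArith Add 10 10 1, WArith Sub 12 12 1]) s 11 (I (Suc i))"
     unfolding s
     apply (rule hp_Block)
      apply (use S15 M' c e nt lt nz wd m in \<open>simp add: d_def[symmetric]\<close>)
      apply simp
     apply (use wr nz in \<open>auto simp: I_def wrote_def\<close>)
     done
   qed
  next
   fix s assume "I Q s"
   then show "wts S 12 s = Some False" using M S_ge by (simp add: I_def wts_def wrote_def ok_def)
  qed (rule I0)
  have "W (Loop 12 (Block [WLoad 13 9, WLoad 14 10, WArith f 13 13 14, WArith Add 13 13 11, WArith Mod 14 13 2,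
    WStore 8 14, WArith Div 11 13 2, WArith Add 8 8 1, WArith Add 9 9 1, WArith Add 10 10 1, WArith Sub 12 12 1]))
    (M(11 := 0, 12 := int Q), out) (Q * (11 + 2) + 2) (%s. snd s = out & wrote Q M p (arith_op f x y) (fst s))" by (rule hp_mono[OF L order_refl]) (simp add: I_def)
  then show "W (Block [WConst 11 0, WArith Add 12 3 0]) (M, out) 2 (%s1. W (Loop 12 (Block [WLoad 13 9, WLoad 14 10, WArith f 13 13 14, WArith Add 13 13 11, WArith Mod 14 13 2,
    WStore 8 14, WArith Div 11 13 2, WArith Add 8 8 1, WArith Add 9 9 1, WArith Add 10 10 1, WArith Sub 12 12 1])) s1 (Q * (11 + 2) + 2) (%s. snd s = out & wrote Q M p (arith_op f x y) (fst s)))" using M S_ge small[of "int Q"] small[of 0] by (intro hp_Block) (auto simp: ok_def)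
 qed simp
qed

lemma big_half_correct:
 assumes M: "ok M" and p: "M 8 = int p" "M 9 = int q"
  and pge: "32 <= p" "32 <= q" "p + Q <= S" "q + Q <= S" "apart p q"
  and b: "!!i. i < Q ==> M (q + i) = bt x i" and x: "\<bar>x\<bar> < 2 ^ (Q - 1)"
 shows "W big_half (M, out) (7 * Q + 7) (%s. snd s = out & wrote Q M p (x div 2) (fst s))"
proof -
 define I where "I i s \<longleftrightarrow> snd s = out & fst s 8 = int (p + i) & fst s 9 = int (q + i + 1) &
  fst s 12 = int (Q - 1) - int i & wrote i M p (x div 2) (fst s)" for i and s :: wst
 have small: "is_word w v" if "\<bar>v\<bar> <= int S + 96" for v using that by (intro word) linarith
 have bt2: "bt (x div 2) i = bt x (Suc i)" for i
 proof -
  have "x div 2 div 2 ^ i = x div 2 ^ Suc i" by (simp add: zdiv_zmult2_eq[symmetric])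
  then show ?thesis unfolding bt_def by simp
 qed
 \<comment> \<open>Since \<open>\<bar>x\<bar> < 2 ^ (Q - 1)\<close>, the top bit is the sign, and
   halving preserves the sign bit.\<close>
 have top: "bt (x div 2) (Q - 1) = bt x (Q - 1)"
 proof -
  have "x div 2 ^ (Q - 1) = (if 0 <= x then 0 else -1)"
  proof (cases "0 <= x")
   case True then show ?thesis using x by (simp add: div_pos_pos_trivial)
  next
   case False
   then show ?thesis using x int_div_pos_eq[of x "2 ^ (Q - 1)" "-1" "x + 2 ^ (Q - 1)"] by auto
  qed
  then show ?thesis unfolding bt2 by (simp add: bt_def div_pow_Suc del: power_Suc)
 qed
 let ?body = "Block [WLoad 13 9, WStore 8 13, WArith Add 8 8 1, WArith Add 9 9 1, WArith Sub 12 12 1]"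
 let ?Q = "%s. snd s = out & wrote Q M p (x div 2) (fst s)"
 let ?end = "Block [WArith Sub 9 9 1, WLoad 13 9, WStore 8 13]"
 have S15: "15 < S" using S_ge by simp
 have L: "W (Loop 12 ?body) (M(9 := int q + 1, 12 := int Q - 1), out) ((Q - 1) * (5 + 2) + 2) (I (Q - 1))"
 proof (rule hp_for[where I = I])
  fix i s assume i: "i < Q - 1" and Is: "I i s"
  obtain M' where s: "s = (M', out)" using Is unfolding I_def by (cases s) auto
  have M': "M' 8 = int (p + i)" "M' 9 = int (q + i + 1)"
   "M' 12 = int (Q - 1) - int i" and wr: "wrote i M p (x div 2) M'" using Is unfolding s I_def by auto
  have c: "M' 0 = 0" "M' (Suc 0) = 1" using wr M by (auto simp: wrote_def ok_def)
  have e: "M' (Suc (q + i)) = bt (x div 2) i" using wr b[of "Suc i"] pge i unfolding wrote_def apart_def bt2 by (auto simp: le_Suc_eq)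
  have wd: "is_word w (int p + int i + 1)" "is_word w (int q + int i + 1 + 1)" "is_word w (2 + (int q + int i))" "is_word w (int (Q - Suc 0) - int i - 1)" using pge i S_ge by (auto intro!: small)
  have ad: "p + i < S" "q + i + 1 < S" using pge i by linarith+
  have nz: "32 <= p + i" "32 <= q + i" using pge by linarith+
  have lt: "int p + int i < int S" "int q + int i + 1 < int S" "1 + (int q + int i) < int S" using ad by linarith+
  have nt: "nat (int p + int i) = p + i" "nat (int q + int i + 1) = Suc (q + i)" "nat (1 + (int q + int i)) = Suc (q + i)" by simp_all
  show "wts S 12 s = Some True & W ?body s 5 (I (Suc i))"
  proof
   show "wts S 12 s = Some True" using S15 M' c i unfolding s wts_def by simp
   show "W ?body s 5 (I (Suc i))"
    unfolding s
    apply (rule hp_Block)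
     apply (use S15 M' c e nt lt nz wd in \<open>simp add: add.commute[of _ 1]\<close>)
     apply simp
    apply (use wr nz M' in \<open>auto simp: I_def wrote_def\<close>)
    done
  qed
 next
  fix s assume "I (Q - 1) s"
  then show "wts S 12 s = Some False" using M S_ge by (simp add: I_def wts_def wrote_def ok_def)
 next
  show "I 0 (M(9 := int q + 1, 12 := int Q - 1), out)" using p M Q2 unfolding I_def by (simp add: wrote_def of_nat_diff)
 qed
 have E: "W ?end s 3 ?Q" if Is: "I (Q - 1) s" for s
 proof -
  obtain M' where s: "s = (M', out)" using Is unfolding I_def by (cases s) auto
  have M': "M' 8 = int (p + (Q - 1))" "M' 9 = int (q + Q)" and wr: "wrote (Q - 1) M p (x div 2) M'" using Is Q2 unfolding s I_def by auto
  have c: "M' 0 = 0" "M' (Suc 0) = 1" using wr M by (auto simp: wrote_def ok_def)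
  define r where "r = Q - 1"
  have r: "Q = Suc r" using Q2 by (simp add: r_def)
  have e: "M' (q + r) = bt (x div 2) r"
  proof -
   have "\<not> (p <= q + r & q + r < p + r)" using pge r unfolding apart_def by linarith
   moreover have "bt (x div 2) r = bt x r" using top by (simp add: r_def)
   ultimately show ?thesis using wr b[of r] pge r unfolding wrote_def r_def[symmetric] by auto
  qed
  have wd: "is_word w (int q + int r)" using pge S_ge r by (auto intro!: small)
  have ad: "int p + int r < int S" "int q + int r < int S" using pge r by linarith+
  have nz: "32 <= p + r" "32 <= q + r" using pge by linarith+
  have nt: "nat (int p + int r) = p + r" "nat (int q + int r) = q + r" by simp_all
  show ?thesis unfolding s
   apply (rule hp_Block)
    apply (use S15 M' c e nt ad nz wd in \<open>simp add: r\<close>)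
    apply simp
   apply (use wr nz M' in \<open>auto simp: wrote_def r\<close>)
   done
 qed
 show ?thesis unfolding big_half_def
 proof (rule hp_Seq[where ?b1.0 = 2 and ?b2.0 = "(Q - 1) * (5 + 2) + 2 + 3"])
  have "W (Loop 12 ?body ;; ?end) (M(9 := int q + 1, 12 := int Q - 1), out) ((Q - 1) * (5 + 2) + 2 + 3) ?Q" by (rule hp_Seq[OF hp_mono[OF L order_refl E]]) auto
  then show "W (Block [WArith Add 9 9 1, WArith Sub 12 3 1]) (M, out) 2
    (%s1. W (Loop 12 ?body ;; ?end) s1 ((Q - 1) * (5 + 2) + 2 + 3) ?Q)" using M S_ge p pge small[of "int Q - 1"] small[of "int q + 1"] by (intro hp_Block) (auto simp: ok_def)
  show "2 + ((Q - 1) * (5 + 2) + 2 + 3) <= 7 * Q + 7" using Q2 by simp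
 qed
qed

lemma is_word_div: "is_word w v ==> is_word w (v div 2 ^ i)"
proof -
 assume v: "is_word w v"
 have one: "(1::int) <= 2 ^ i" by simp
 have w0: "(0::int) < 2 ^ (w - 1)" by simp
 show ?thesis
 proof (cases "0 <= v")
  case True
  have "v div 2 ^ i <= v" using zdiv_mono2[OF True _ one] by simp
  moreover have "0 <= v div 2 ^ i" using True by (simp add: pos_imp_zdiv_nonneg_iff)
  ultimately show ?thesis using v w0 unfolding is_word_def by linarith
 next
  case False
  have "v <= v div 2 ^ i" using zdiv_mono2_neg[of v 1 "2 ^ i"] one False by simp
  moreover have "v div 2 ^ i < 0" using False by (intro div_neg_pos_less0) auto
  ultimately show ?thesis using v w0 unfolding is_word_def by linarith
 qed
qed

lemma from_word_correct:
 assumes M: "ok M" and p: "M 8 = int p" "M 13 = v" and v: "is_word w v"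
  and pge: "32 <= p" "p + Q <= S"
 shows "W from_word (M, out) (7 * Q + 3) (%s. snd s = out & wrote Q M p v (fst s))"
proof -
 define I where "I i s \<longleftrightarrow> snd s = out & fst s 8 = int (p + i) & fst s 13 = v div 2 ^ i &
  fst s 12 = int Q - int i & wrote i M p v (fst s)" for i and s :: wst
 have small: "is_word w v" if "\<bar>v\<bar> <= int S + 96" for v using that by (intro word) linarith
 let ?body = "Block [WArith Mod 14 13 2, WStore 8 14, WArith Div 13 13 2, WArith Add 8 8 1, WArith Sub 12 12 1]"
 let ?Q = "%s. snd s = out & wrote Q M p v (fst s)"
 have S15: "15 < S" using S_ge by simp
 have L: "W (Loop 12 ?body) (M(12 := int Q), out) (Q * (5 + 2) + 2) (I Q)"
 proof (rule hp_for[where I = I])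
  fix i s assume i: "i < Q" and Is: "I i s"
  obtain M' where s: "s = (M', out)" using Is unfolding I_def by (cases s) auto
  have M': "M' 8 = int (p + i)" "M' 13 = v div 2 ^ i"
   "M' 12 = int Q - int i" and wr: "wrote i M p v M'" using Is unfolding s I_def by auto
  have c: "M' 0 = 0" "M' (Suc 0) = 1" "M' 2 = 2" using wr M by (auto simp: wrote_def ok_def)
  have e: "v div 2 ^ i mod 2 = bt v i" "v div 2 ^ i div 2 = v div 2 ^ Suc i" by (simp_all only: bt_def div_pow_Suc)
  have wd: "is_word w (int p + int i + 1)" "is_word w (int Q - int i - 1)" "is_word w (bt v i)" "is_word w (v div 2 ^ Suc i)" using pge i S_ge bt_range[of v i] is_word_div[OF v, of "Suc i"] by (auto intro!: small)
  have ad: "p + i < S" using pge i by linarith+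
  have nz: "32 <= p + i" using pge by linarith+
  have lt: "int p + int i < int S" using ad by linarith+
  have nt: "nat (int p + int i) = p + i" by simp_all
  show "wts S 12 s = Some True & W ?body s 5 (I (Suc i))"
  proof
   show "wts S 12 s = Some True" using S15 M' c i unfolding s wts_def by simp
   show "W ?body s 5 (I (Suc i))"
    unfolding s
    apply (rule hp_Block)
     apply (use S15 M' c e nt lt nz wd in \<open>simp del: power_Suc\<close>)
     apply simp
    apply (use wr nz M' in \<open>auto simp: I_def wrote_def simp del: power_Suc\<close>)
    done
  qed
 next
  fix s assume "I Q s"
  then show "wts S 12 s = Some False" using M S_ge by (simp add: I_def wts_def wrote_def ok_def)
 next
  show "I 0 (M(12 := int Q), out)" using p M Q2 unfolding I_def by (simp add: wrote_def)
 qed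
 show ?thesis unfolding from_word_def
 proof (rule hp_Seq[where ?b1.0 = 1 and ?b2.0 = "Q * (5 + 2) + 2"])
  have "W (Loop 12 ?body) (M(12 := int Q), out) (Q * (5 + 2) + 2) ?Q" by (rule hp_mono[OF L order_refl]) (simp add: I_def)
  then show "W (Block [WArith Add 12 3 0]) (M, out) 1 (%s1. W (Loop 12 ?body) s1 (Q * (5 + 2) + 2) ?Q)" using M S_ge small[of "int Q"] by (intro hp_Block) (auto simp: ok_def)
 qed simp
qed

lemma to_word_correct:
 assumes M: "ok M" and p: "M 9 = int q" and pge: "32 <= q" "q + Q <= S"
  and b: "!!i. i < Q ==> M (q + i) = bt v i" and v: "0 <= v" "v <= int S" "v < 2 ^ Q"
 shows "W to_word (M, out) (7 * Q + 5) (%s. snd s = out & fst s 13 = v & (\<forall>x. x \<notin> {9, 12, 13, 14} \<longrightarrow> fst s x = M x))"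
proof -
 define I where "I i s \<longleftrightarrow> snd s = out & fst s 9 = int (q + (Q - i)) & fst s 13 = v div 2 ^ (Q - i) &
  fst s 12 = int Q - int i & (\<forall>x. x \<notin> {9, 12, 13, 14} \<longrightarrow> fst s x = M x)" for i and s :: wst
 have small: "is_word w v" if "\<bar>v\<bar> <= 2 * int S + 96" for v using that by (intro word) linarith
 let ?body = "Block [WArith Sub 9 9 1, WLoad 14 9, WArith Add 13 13 13, WArith Add 13 13 14, WArith Sub 12 12 1]"
 let ?Q = "%s. snd s = out & fst s 13 = v & (\<forall>x. x \<notin> {9, 12, 13, 14} \<longrightarrow> fst s x = M x)"
 have S15: "15 < S" using S_ge by simp
 have L: "W (Loop 12 ?body) (M(12 := int Q, 9 := int q + int Q, 13 := 0), out) (Q * (5 + 2) + 2) (I Q)"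
 proof (rule hp_for[where I = I])
  fix i s assume i: "i < Q" and Is: "I i s"
  obtain M' where s: "s = (M', out)" using Is unfolding I_def by (cases s) auto
  define k where "k = Q - Suc i"
  have k: "Q - i = Suc k" "k < Q" "Q - Suc i = k" using i by (auto simp: k_def)
  have M': "M' 9 = int (q + Suc k)" "M' 13 = v div 2 ^ Suc k"
   "M' 12 = int Q - int i" and wr: "!!x. x \<notin> {9, 12, 13, 14} ==> M' x = M x" using Is k unfolding s I_def by auto
  have c: "M' 0 = 0" "M' (Suc 0) = 1" "M' 2 = 2" using wr[of 0] wr[of 1] wr[of 2] M by (auto simp: ok_def)
  have e: "M' (q + k) = bt v k" using wr[of "q + k"] b[OF k(2)] pge by auto
  have dv: "v div 2 ^ Suc k + v div 2 ^ Suc k + bt v k = v div 2 ^ k" using div_pow_bt[of v k] by linarith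
  have dl: "0 <= v div 2 ^ Suc k" "v div 2 ^ k <= int S" "0 <= v div 2 ^ k"
  proof -
   have "v div 2 ^ k <= v div 1" using v by (intro zdiv_mono2) auto
   then show "0 <= v div 2 ^ Suc k" "v div 2 ^ k <= int S" "0 <= v div 2 ^ k" using v by (auto simp: pos_imp_zdiv_nonneg_iff)
  qed
  have wd: "is_word w (int q + int k)" "is_word w (int Q - int i - 1)" "is_word w (v div 2 ^ k)"
   "is_word w (v div 2 ^ Suc k + v div 2 ^ Suc k)" using pge i S_ge k dl dv bt_range[of v k] by (auto intro!: small simp del: power_Suc)
  have nz: "32 <= q + k" using pge by linarith+
  have lt: "int q + int k < int S" using pge k by linarith+
  have nt: "nat (int q + int k) = q + k" by simp_all
  show "wts S 12 s = Some True & W ?body s 5 (I (Suc i))"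
  proof
   show "wts S 12 s = Some True" using S15 M' c i unfolding s wts_def by simp
   show "W ?body s 5 (I (Suc i))"
    unfolding s
    apply (rule hp_Block)
     apply (use S15 M' c e nt lt nz wd dv in \<open>simp del: power_Suc\<close>)
     apply simp
    apply (use wr nz M' k in \<open>auto simp: I_def simp del: power_Suc\<close>)
    done
  qed
 next
  fix s assume "I Q s"
  then show "wts S 12 s = Some False" using M S_ge by (simp add: I_def wts_def ok_def)
 next
  show "I 0 (M(12 := int Q, 9 := int q + int Q, 13 := 0), out)" using p M v unfolding I_def by (simp add: div_pos_pos_trivial)
 qed
 show ?thesis unfolding to_word_def
 proof (rule hp_Seq[where ?b1.0 = 3 and ?b2.0 = "Q * (5 + 2) + 2"])
  have "W (Loop 12 ?body) (M(12 := int Q, 9 := int q + int Q, 13 := 0), out) (Q * (5 + 2) + 2) ?Q" by (rule hp_mono[OF L order_refl]) (simp add: I_def)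
  then show "W (Block [WArith Add 12 3 0, WArith Add 9 9 12, WConst 13 0]) (M, out) 3 (%s1. W (Loop 12 ?body) s1 (Q * (5 + 2) + 2) ?Q)" using M S_ge p pge small[of "int Q"] small[of "int q + int Q"] small[of 0] by (intro hp_Block) (auto simp: ok_def)
 qed simp
qed

end

section \<open>Translating integer programs into word programs\<close>

text \<open>Cell 0 is constantly 0, so that copying a number is an addition. Interleaving puts entry
  \<open>j\<close> of array \<open>f\<close> at cell \<open>48 + 16 * j + f\<close>, an address that
  does not involve the array length.\<close>

fun cellv :: "hst => nat => int" where
 "cellv (R, A, out) c = (if c = 0 then 0 else if c < 48 then R (c - 1) else A ((c - 48) mod 16) ((c - 48) div 16))"

definition ptr :: "nat => nat => watom list" where
 "ptr r c = [WConst r (int c), WArith Mul r r 3, WArith Add r r 4]"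

definition idx_ptr :: "nat => nat => watom list" where
 "idx_ptr r f = [WConst 14 16, WArith Mul 13 13 14, WConst 14 (int (48 + f)), WArith Add 13 13 14,
   WArith Mul r 13 3, WArith Add r r 4]"

fun tr_atom :: "hatom => watom com" where
 "tr_atom (HConst x v) = Block (ptr 8 (Suc x) @ [WConst 13 v]) ;; from_word"
| "tr_atom (HAdd x y z) = Block (ptr 8 (Suc x) @ ptr 9 (Suc y) @ ptr 10 (Suc z)) ;; big_add Add"
| "tr_atom (HSub x y z) = Block (ptr 8 (Suc x) @ ptr 9 (Suc y) @ ptr 10 (Suc z)) ;; big_add Sub"
| "tr_atom (HHalf x y) = Block (ptr 8 (Suc x) @ ptr 9 (Suc y)) ;; big_half"
| "tr_atom (HLoad x f y) = Block (ptr 9 (Suc y)) ;; to_word ;; Block (idx_ptr 9 f @ ptr 8 (Suc x) @ ptr 10 0) ;; big_add Add"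
| "tr_atom (HStore f y x) = Block (ptr 9 (Suc y)) ;; to_word ;; Block (idx_ptr 8 f @ ptr 9 (Suc x) @ ptr 10 0) ;; big_add Add"
| "tr_atom (HRead x y) = Block (ptr 9 (Suc y)) ;; to_word ;; Block (WRead 13 13 # ptr 8 (Suc x)) ;; from_word"
| "tr_atom (HOut x) = Block (ptr 9 (Suc x) @ [WLoad 13 9, WOut 13])"

text \<open>The sign bit is the last word of the cell of register \<open>x\<close>, just before the
  next cell. Word 5 thus becomes positive exactly when the register is negative.\<close>

definition sgn_code :: "nat => watom com" where
 "sgn_code x = Block (ptr 9 (Suc (Suc x)) @ [WArith Sub 9 9 1, WLoad 5 9])"

fun tr :: "hatom com => watom com" where
 "tr (Block as) = foldr (%a c. tr_atom a ;; c) as (Block [])"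
| "tr (c ;; d) = tr c ;; tr d"
| "tr (Cond x c d) = sgn_code x ;; Cond 5 (tr c) (tr d)"
| "tr (Loop x c) = sgn_code x ;; Loop 5 (tr c ;; sgn_code x)"

context wram
begin

abbreviation "Cn \<equiv> 48 + 16 * J"

definition cell :: "nat => nat" where "cell c = 32 + c * Q"

definition brel :: "hst => wst => bool" where
 "brel s st \<longleftrightarrow> ok (fst st) & snd st = snd (snd s) & (\<forall>c<Cn. \<forall>i<Q. fst st (cell c + i) = bt (cellv s c) i)"

lemma cell_le: "c < Cn ==> cell c + Q <= S"
proof -
 assume "c < Cn"
 then have "Suc c * Q <= Cn * Q" by (intro mult_le_mono1) simp
 then show ?thesis unfolding cell_def S by simp
qed

lemma cell_ge: "32 <= cell c" by (simp add: cell_def)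

lemma cell_ne [simp]: "numeral k < (32::nat) ==> (cell c + i = numeral k) = False"
 "numeral k < (32::nat) ==> (cell c = numeral k) = False"
 unfolding simp_thms using cell_ge[of c] by linarith+

lemma cell_apart: "apart (cell c) (cell c')"
proof (cases c c' rule: linorder_cases)
 case less
 then have "Suc c * Q <= c' * Q" by (intro mult_le_mono1) simp
 then show ?thesis by (simp add: apart_def cell_def)
next
 case greater
 then have "Suc c' * Q <= c * Q" by (intro mult_le_mono1) simp
 then show ?thesis by (simp add: apart_def cell_def)
qed (simp add: apart_def)

lemma cell_in: "i < Q ==> (cell c <= cell c' + i & cell c' + i < cell c + Q) \<longleftrightarrow> c = c'"
proof (cases c c' rule: linorder_cases)
 case less
 then have "Suc c * Q <= c' * Q" by (intro mult_le_mono1) simp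
 then show ?thesis using less by (simp add: cell_def)
next
 case greater
 moreover assume "i < Q"
 moreover have "Suc c' * Q <= c * Q" using greater by (intro mult_le_mono1) simp
 ultimately show ?thesis by (simp add: cell_def)
qed simp

lemma word_cell:
 assumes "c <= Cn"
 shows "is_word w (int c)" "is_word w (int c * int Q)" "is_word w (int c * int Q + 32)" "int c * int Q + 32 = int (cell c)" "int c <= int S"
proof -
 have "c * Q <= Cn * Q" using assms by (rule mult_le_mono1)
 moreover have "c * 1 <= c * Q" using Q2 by (intro mult_le_mono2) simp
 ultimately have "c <= S" "c * Q + 32 <= S" using S by linarith+
 then have "int c <= int S" "int c * int Q + 32 <= int S" by (auto simp: of_nat_mult[symmetric] simp del: of_nat_mult)
 then show "is_word w (int c)" "is_word w (int c * int Q)" "is_word w (int c * int Q + 32)" "int c <= int S" by (auto intro!: word)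
 show "int c * int Q + 32 = int (cell c)" by (simp add: cell_def)
qed

lemma S15: "15 < S" using S_ge by simp

lemma exec_append: "execs f (as @ bs) s = (case execs f as s of None => None | Some s' => execs f bs s')" by (induction as arbitrary: s) (auto split: option.splits)

lemma exec_ptr:
 assumes "ok M" "c <= Cn" "5 <= r" "r < 16"
 shows "execs (wat w S inp) (ptr r c) (M, out) = Some (M(r := int (cell c)), out)" using assms word_cell(1,2,3)[OF assms(2)] S15 unfolding ptr_def ok_def by (simp add: word_cell(4)[OF assms(2)])

lemma ok_upd: "ok M ==> 5 <= r ==> ok (M(r := v))" by (auto simp: ok_def)

lemma wrote_upd: "wrote n (M(r := v)) p x M' ==> 5 <= r ==> r < 32 ==> wrote n M p x M'" by (auto simp: wrote_def)

lemma brel_wrote: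
 assumes b: "brel s (M, out)" and w: "wrote Q M (cell c0) v M'" and c0: "c0 < Cn"
  and s': "!!c. c < Cn ==> cellv s' c = (if c = c0 then v else cellv s c)" and o: "snd (snd s') = out"
 shows "brel s' (M', out)"
 unfolding brel_def
proof (intro conjI allI impI)
 show "ok (fst (M', out))" using wrote_ok[OF w] b by (simp add: brel_def)
 show "snd (M', out) = snd (snd s')" using o by simp
 fix c i assume c: "c < Cn" and i: "i < Q"
 have "M' (cell c + i) = (if c0 = c then bt v (cell c + i - cell c0) else M (cell c + i))" using w cell_in[OF i, of c0 c] cell_ge[of c] unfolding wrote_def by (simp add: trans_le_add1)
 then show "fst (M', out) (cell c + i) = bt (cellv s' c) i" using b c i s'[OF c] unfolding brel_def by auto
qed

lemma brel_bits: "brel s (M, out) ==> c < Cn ==> i < Q ==> M (cell c + i) = bt (cellv s c) i" by (simp add: brel_def)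

lemma add_code:
 assumes f: "sg_op f" and b: "brel s (M, out)" and c: "c1 < Cn" "c2 < Cn" "c3 < Cn"
 shows "W (Block (ptr 8 c1 @ ptr 9 c2 @ ptr 10 c3) ;; big_add f) (M, out) (13 * Q + 13)
  (%st. snd st = out & wrote Q M (cell c1) (arith_op f (cellv s c2) (cellv s c3)) (fst st))"
proof (rule hp_Seq[where ?b1.0 = 9 and ?b2.0 = "13 * Q + 4"])
 have ok: "ok M" using b by (simp add: brel_def)
 let ?M = "M(8 := int (cell c1), 9 := int (cell c2), 10 := int (cell c3))"
 have "W (big_add f) (?M, out) (13 * Q + 4)
  (%st. snd st = out & wrote Q ?M (cell c1) (arith_op f (cellv s c2) (cellv s c3)) (fst st))" by (rule big_add_correct[where q = "cell c2" and r = "cell c3"])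
   (use f ok c cell_ge cell_le cell_apart brel_bits[OF b] cell_ge[of c2] cell_ge[of c3] in \<open>auto intro!: ok_upd simp: trans_le_add1\<close>)
 then have "W (big_add f) (?M, out) (13 * Q + 4)
  (%st. snd st = out & wrote Q M (cell c1) (arith_op f (cellv s c2) (cellv s c3)) (fst st))" by (rule hp_mono) (auto dest!: wrote_upd)
 moreover have "execs (wat w S inp) (ptr 8 c1 @ ptr 9 c2 @ ptr 10 c3) (M, out) = Some (?M, out)" using c ok by (simp add: exec_append exec_ptr ok_upd)
 ultimately show "W (Block (ptr 8 c1 @ ptr 9 c2 @ ptr 10 c3)) (M, out) 9 (%s1. W (big_add f) s1 (13 * Q + 4)
   (%st. snd st = out & wrote Q M (cell c1) (arith_op f (cellv s c2) (cellv s c3)) (fst st)))" by (intro hp_Block) (auto simp: ptr_def)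
qed simp

lemma index_code:
 assumes b: "brel s (M, out)" and c: "c < Cn" and v: "0 <= cellv s c" "cellv s c <= int S" "cellv s c < 2 ^ Q"
  and rest: "!!M'. M' 13 = cellv s c ==> brel s (M', out) ==> W d (M', out) t P"
 shows "W (Block (ptr 9 c) ;; to_word ;; d) (M, out) (7 * Q + 8 + t) P"
proof (rule hp_Seq[where ?b1.0 = 3 and ?b2.0 = "7 * Q + 5 + t"])
 have ok: "ok M" using b by (simp add: brel_def)
 let ?M = "M(9 := int (cell c))"
 have "W to_word (?M, out) (7 * Q + 5) (%s'. snd s' = out & fst s' 13 = cellv s c & (\<forall>x. x \<notin> {9, 12, 13, 14} \<longrightarrow> fst s' x = ?M x))" by (rule to_word_correct[where q = "cell c"])
   (use ok c cell_ge[of c] cell_le brel_bits[OF b] v in \<open>auto intro!: ok_upd\<close>)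
 then have "W to_word (?M, out) (7 * Q + 5) (%s1. W d s1 t P)"
 proof (rule hp_mono)
  fix st assume st: "snd st = out & fst st 13 = cellv s c & (\<forall>x. x \<notin> {9, 12, 13, 14} \<longrightarrow> fst st x = ?M x)"
  obtain M' where M': "st = (M', out)" using st by (cases st) auto
  have eq: "M' x = M x" if "x < 5 \<or> 32 <= x" for x using st that unfolding M' by auto
  have "brel s (M', out)" using b eq cell_ge unfolding brel_def ok_def by (simp add: trans_le_add1)
  then show "W d st t P" using rest st unfolding M' by simp
 qed simp
 then have "W (to_word ;; d) (?M, out) (7 * Q + 5 + t) P" by (rule hp_Seq) simp
 moreover have "execs (wat w S inp) (ptr 9 c) (M, out) = Some (?M, out)" using c ok by (simp add: exec_ptr)
 ultimately show "W (Block (ptr 9 c)) (M, out) 3 (%s1. W (to_word ;; d) s1 (7 * Q + 5 + t) P)" by (intro hp_Block) (auto simp: ptr_def)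
qed simp

lemma exec_idx_ptr:
 assumes "ok M" "M 13 = int j" "j < J" "f < 16" "r = 8 \<or> r = 9"
 shows "\<exists>M'. execs (wat w S inp) (idx_ptr r f) (M, out) = Some (M', out) & M' r = int (cell (48 + 16 * j + f)) &
  (\<forall>x. x \<notin> {13, 14, r} \<longrightarrow> M' x = M x)"
proof -
 define c where "c = 48 + 16 * j + f"
 have c: "c <= Cn" using assms by (simp add: c_def)
 have ci: "int j * 16 + (48 + int f) = int c" by (simp add: c_def)
 have "is_word w 16" "is_word w (int j * 16)" "is_word w (48 + int f)" using word_cell(1)[of "16 * j"] word_cell(1)[of 16] word_cell(1)[of "48 + f"] assms by (auto simp: mult.commute)
 then show ?thesis using assms word_cell[OF c] S15 unfolding idx_ptr_def ok_def c_def[symmetric] by (auto simp: ci)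
qed

lemma tr_atom_correct:
 assumes h: "hq q inp J a s = Some s'" and q: "Suc q <= Q" and b: "brel s st"
 shows "W (tr_atom a) st (40 * Q) (brel s')"
proof -
 obtain R A out where s: "s = (R, A, out)" by (cases s) auto
 obtain M where st: "st = (M, out)" using b unfolding s brel_def by (cases st) auto
 note b = b[unfolded st]
 have ok: "ok M" using b by (simp add: brel_def)
 have ha: "hat inp J a s = Some s'" and bq: "hbnd q s" using h unfolding hq_def by (auto split: if_splits option.splits)
 have p: "(2::int) ^ q <= 2 ^ (Q - 1)" "(2::int) ^ q <= 2 ^ Q" using q by (auto intro!: power_increasing)
 have Rb: "\<bar>R x\<bar> < 2 ^ (Q - 1)" "R x < 2 ^ Q" for x using bq p unfolding s hbnd_def by (auto simp: abs_less_iff intro: less_le_trans)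
 have reg: "cellv s (Suc x) = R x" if "x < 46" for x using that by (simp add: s)
 have zero: "cellv s 0 = 0" by (simp add: s)
 have arr: "cellv s (48 + 16 * j + f) = A f j" if "f < 16" for f j using that by (simp add: s)
 have lt: "Suc x < Cn" if "x < 46" for x using that by simp
 have updR: "cellv (R(x := v), A, out') c = (if c = Suc x then v else cellv s c)" if "x < 46" for x v c out' using that unfolding s by auto
 have updA: "cellv (R, A(f := (A f)(j := v)), out') c = (if c = 48 + 16 * j + f then v else cellv s c)" if "f < 16" for f j v c out'
 proof (cases "c < 48")
  case False
  then obtain d where c: "c = 48 + d" using le_Suc_ex by (metis not_less)
  have "d mod 16 = f & d div 16 = j \<longleftrightarrow> d = 16 * j + f"
  proof
   assume "d mod 16 = f & d div 16 = j"
   then show "d = 16 * j + f" using mult_div_mod_eq[of 16 d] by simp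
  qed (use that in simp)
  then show ?thesis unfolding c s by (auto simp: fun_upd_apply)
 qed (use that in \<open>auto simp: s\<close>)
 have fw: "W from_word (M', out) (7 * Q + 3) (%st. snd st = out & wrote Q M' (cell c) v (fst st))"
  if "ok M'" "M' 8 = int (cell c)" "M' 13 = v" "is_word w v" "c < Cn" for M' c v by (rule from_word_correct) (use that cell_ge cell_le in auto)
 show ?thesis
 proof (cases a)
  case (HConst x v)
  then have x: "x < 46" "\<bar>v\<bar> <= 1" and s': "s' = (R(x := v), A, out)" using ha by (auto simp: s split: if_splits)
  have v: "is_word w v" using x by (intro word) simp
  let ?M = "M(8 := int (cell (Suc x)), 13 := v)"
  have okM: "ok ?M" using ok by (simp add: ok_upd)
  have "W from_word (?M, out) (7 * Q + 3) (brel s')"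
  proof (rule hp_mono[OF fw[of ?M "Suc x" v] order_refl])
   fix st assume *: "snd st = out & wrote Q ?M (cell (Suc x)) v (fst st)"
   then have "wrote Q M (cell (Suc x)) v (fst st)" by (auto dest!: wrote_upd)
   then have "brel s' (fst st, out)" using updR x by (intro brel_wrote[OF b]) (auto simp: s')
   then show "brel s' st" using * by (cases st) auto
  qed (use okM v x in auto)
  then show ?thesis unfolding HConst st tr_atom.simps using ok x v S15 by (intro hp_Seq[where ?b1.0 = 4 and ?b2.0 = "7 * Q + 3"] hp_Block[where s' = "(?M, out)"])
    (use Q2 in \<open>auto simp: exec_append exec_ptr\<close>, auto simp: ptr_def)
 next
  case (HAdd x y z)
  then have x: "x < 46" "y < 46" "z < 46" and s': "s' = (R(x := R y + R z), A, out)" using ha by (auto simp: s split: if_splits)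
  show ?thesis unfolding HAdd st tr_atom.simps
  proof (rule hp_mono[OF add_code[OF _ b lt[OF x(1)] lt[OF x(2)] lt[OF x(3)]]])
   fix st assume "snd st = out & wrote Q M (cell (Suc x)) (arith_op Add (cellv s (Suc y)) (cellv s (Suc z))) (fst st)"
   then have *: "snd st = out" "wrote Q M (cell (Suc x)) (R y + R z) (fst st)" using x by (auto simp: reg)
   then have "brel s' (fst st, out)" using updR x by (intro brel_wrote[OF b]) (auto simp: s')
   then show "brel s' st" using * by (cases st) auto
  qed (use Q2 in \<open>auto simp: sg_op_def\<close>)
 next
  case (HSub x y z)
  then have x: "x < 46" "y < 46" "z < 46" and s': "s' = (R(x := R y - R z), A, out)" using ha by (auto simp: s split: if_splits)
  show ?thesis unfolding HSub st tr_atom.simps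
  proof (rule hp_mono[OF add_code[OF _ b lt[OF x(1)] lt[OF x(2)] lt[OF x(3)]]])
   fix st assume "snd st = out & wrote Q M (cell (Suc x)) (arith_op Sub (cellv s (Suc y)) (cellv s (Suc z))) (fst st)"
   then have *: "snd st = out" "wrote Q M (cell (Suc x)) (R y - R z) (fst st)" using x by (auto simp: reg)
   then have "brel s' (fst st, out)" using updR x by (intro brel_wrote[OF b]) (auto simp: s')
   then show "brel s' st" using * by (cases st) auto
  qed (use Q2 in \<open>auto simp: sg_op_def\<close>)
 next
  case (HHalf x y)
  then have x: "x < 46" "y < 46" and s': "s' = (R(x := R y div 2), A, out)" using ha by (auto simp: s split: if_splits)
  let ?M = "M(8 := int (cell (Suc x)), 9 := int (cell (Suc y)))"
  have "W big_half (?M, out) (7 * Q + 7) (%st. snd st = out & wrote Q ?M (cell (Suc x)) (R y div 2) (fst st))" by (rule big_half_correct[where q = "cell (Suc y)"])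
    (use ok lt[OF x(1)] lt[OF x(2)] cell_ge[of "Suc x"] cell_ge[of "Suc y"] cell_le cell_apart brel_bits[OF b lt[OF x(2)]] reg[OF x(2)] Rb in \<open>auto intro!: ok_upd\<close>)
  then have "W big_half (?M, out) (7 * Q + 7) (brel s')"
  proof (rule hp_mono)
   fix st assume *: "snd st = out & wrote Q ?M (cell (Suc x)) (R y div 2) (fst st)"
   then have "wrote Q M (cell (Suc x)) (R y div 2) (fst st)" by (auto dest!: wrote_upd)
   then have "brel s' (fst st, out)" using updR x by (intro brel_wrote[OF b]) (auto simp: s')
   then show "brel s' st" using * by (cases st) auto
  qed simp
  then show ?thesis unfolding HHalf st tr_atom.simps using ok x S15 by (intro hp_Seq[where ?b1.0 = 6 and ?b2.0 = "7 * Q + 7"] hp_Block[where s' = "(?M, out)"])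
    (use Q2 in \<open>auto simp: exec_append exec_ptr ok_upd\<close>, auto simp: ptr_def)
 next
  case (HLoad x f y)
  then have x: "x < 46" "y < 46" "f < 16" "0 <= R y" "R y < int J" and s': "s' = (R(x := A f (nat (R y))), A, out)" using ha by (auto simp: s split: if_splits)
  define j where "j = nat (R y)"
  have j: "R y = int j" "j < J" using x by (auto simp: j_def)
  have cj: "48 + 16 * j + f < Cn" using j x by simp
  have jS: "int j <= int S" using j by (intro word_cell(5)) simp
  have "W (Block (ptr 9 (Suc y)) ;; to_word ;; Block (idx_ptr 9 f @ ptr 8 (Suc x) @ ptr 10 0) ;; big_add Add)
   (M, out) (7 * Q + 8 + (12 + (13 * Q + 4))) (brel s')"
  proof (rule index_code[OF b lt[OF x(2)]])
   show "0 <= cellv s (Suc y)" "cellv s (Suc y) <= int S" "cellv s (Suc y) < 2 ^ Q" using x Rb[of y] jS j by (auto simp: reg)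
   fix M1 assume M1: "M1 13 = cellv s (Suc y)" "brel s (M1, out)"
   have ok1: "ok M1" using M1 by (simp add: brel_def)
   obtain M2 where M2: "execs (wat w S inp) (idx_ptr 9 f) (M1, out) = Some (M2, out)" "M2 9 = int (cell (48 + 16 * j + f))"
    "\<forall>x. x \<notin> {13, 14, 9} \<longrightarrow> M2 x = M1 x" using exec_idx_ptr[OF ok1, of j f 9 out] M1 j x by (auto simp: reg)
   have M2eq: "M2 (cell c + i) = M1 (cell c + i)" for c i using M2(3) cell_ge[of c] by auto
   have ok2: "ok M2" using ok1 M2(3) by (simp add: ok_def)
   have b2: "brel s (M2, out)" using M1(2) ok2 M2eq unfolding brel_def by simp
   let ?M = "M2(8 := int (cell (Suc x)), 10 := int (cell 0))"
   have "W (big_add Add) (?M, out) (13 * Q + 4) (%st. snd st = out & wrote Q ?M (cell (Suc x)) (arith_op Add (A f j) 0) (fst st))" by (rule big_add_correct[where q = "cell (48 + 16 * j + f)" and r = "cell 0"])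
     (use ok2 M2(2) lt[OF x(1)] cj cell_ge[of "Suc x"] cell_ge[of 0] cell_ge[of "48 + 16 * j + f"] cell_le cell_apart brel_bits[OF b2] arr[OF x(3)] zero
      in \<open>auto intro!: ok_upd simp: sg_op_def\<close>)
   then have "W (big_add Add) (?M, out) (13 * Q + 4) (brel s')"
   proof (rule hp_mono)
    fix st assume *: "snd st = out & wrote Q ?M (cell (Suc x)) (arith_op Add (A f j) 0) (fst st)"
    then have "wrote Q M2 (cell (Suc x)) (A f j) (fst st)" by (auto dest!: wrote_upd)
    then have "brel s' (fst st, out)" using updR x by (intro brel_wrote[OF b2]) (auto simp: s' j_def)
    then show "brel s' st" using * by (cases st) auto
   qed simp
   moreover have "execs (wat w S inp) (idx_ptr 9 f @ ptr 8 (Suc x) @ ptr 10 0) (M1, out) = Some (?M, out)" using M2(1) ok2 x by (simp add: exec_append exec_ptr ok_upd)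
   ultimately show "W (Block (idx_ptr 9 f @ ptr 8 (Suc x) @ ptr 10 0) ;; big_add Add) (M1, out) (12 + (13 * Q + 4)) (brel s')" by (intro hp_Seq[where ?b1.0 = 12 and ?b2.0 = "13 * Q + 4"] hp_Block[where s' = "(?M, out)"]) (auto simp: ptr_def idx_ptr_def)
  qed
  then show ?thesis unfolding HLoad st tr_atom.simps by (rule hp_mono) (use Q2 in auto)
 next
  case (HStore f y x)
  then have x: "x < 46" "y < 46" "f < 16" "0 <= R y" "R y < int J" and s': "s' = (R, A(f := (A f)(nat (R y) := R x)), out)" using ha by (auto simp: s split: if_splits)
  define j where "j = nat (R y)"
  have j: "R y = int j" "j < J" using x by (auto simp: j_def)
  have cj: "48 + 16 * j + f < Cn" using j x by simp
  have jS: "int j <= int S" using j by (intro word_cell(5)) simp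
  have "W (Block (ptr 9 (Suc y)) ;; to_word ;; Block (idx_ptr 8 f @ ptr 9 (Suc x) @ ptr 10 0) ;; big_add Add)
   (M, out) (7 * Q + 8 + (12 + (13 * Q + 4))) (brel s')"
  proof (rule index_code[OF b lt[OF x(2)]])
   show "0 <= cellv s (Suc y)" "cellv s (Suc y) <= int S" "cellv s (Suc y) < 2 ^ Q" using x Rb[of y] jS j by (auto simp: reg)
   fix M1 assume M1: "M1 13 = cellv s (Suc y)" "brel s (M1, out)"
   have ok1: "ok M1" using M1 by (simp add: brel_def)
   obtain M2 where M2: "execs (wat w S inp) (idx_ptr 8 f) (M1, out) = Some (M2, out)" "M2 8 = int (cell (48 + 16 * j + f))"
    "\<forall>x. x \<notin> {13, 14, 8} \<longrightarrow> M2 x = M1 x" using exec_idx_ptr[OF ok1, of j f 8 out] M1 j x by (auto simp: reg)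
   have M2eq: "M2 (cell c + i) = M1 (cell c + i)" for c i using M2(3) cell_ge[of c] by auto
   have ok2: "ok M2" using ok1 M2(3) by (simp add: ok_def)
   have b2: "brel s (M2, out)" using M1(2) ok2 M2eq unfolding brel_def by simp
   let ?M = "M2(9 := int (cell (Suc x)), 10 := int (cell 0))"
   have "W (big_add Add) (?M, out) (13 * Q + 4) (%st. snd st = out & wrote Q ?M (cell (48 + 16 * j + f)) (arith_op Add (R x) 0) (fst st))" by (rule big_add_correct[where q = "cell (Suc x)" and r = "cell 0"])
     (use ok2 M2(2) lt[OF x(1)] cj cell_ge[of "Suc x"] cell_ge[of 0] cell_ge[of "48 + 16 * j + f"] cell_le cell_apart brel_bits[OF b2] reg[OF x(1)] zero
      in \<open>auto intro!: ok_upd simp: sg_op_def\<close>)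
   then have "W (big_add Add) (?M, out) (13 * Q + 4) (brel s')"
   proof (rule hp_mono)
    fix st assume *: "snd st = out & wrote Q ?M (cell (48 + 16 * j + f)) (arith_op Add (R x) 0) (fst st)"
    then have "wrote Q M2 (cell (48 + 16 * j + f)) (R x) (fst st)" by (auto dest!: wrote_upd)
    then have "brel s' (fst st, out)" using updA x cj by (intro brel_wrote[OF b2]) (auto simp: s' j_def)
    then show "brel s' st" using * by (cases st) auto
   qed simp
   moreover have "execs (wat w S inp) (idx_ptr 8 f @ ptr 9 (Suc x) @ ptr 10 0) (M1, out) = Some (?M, out)" using M2(1) ok2 x by (simp add: exec_append exec_ptr ok_upd)
   ultimately show "W (Block (idx_ptr 8 f @ ptr 9 (Suc x) @ ptr 10 0) ;; big_add Add) (M1, out) (12 + (13 * Q + 4)) (brel s')" by (intro hp_Seq[where ?b1.0 = 12 and ?b2.0 = "13 * Q + 4"] hp_Block[where s' = "(?M, out)"]) (auto simp: ptr_def idx_ptr_def)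
  qed
  then show ?thesis unfolding HStore st tr_atom.simps by (rule hp_mono) (use Q2 in auto)
 next
  case (HRead x y)
  then have x: "x < 46" "y < 46" "0 <= R y" "R y < int (length inp)" and s': "s' = (R(x := inp ! nat (R y)), A, out)" using ha by (auto simp: s split: if_splits)
  have "R y <= int S" using x inpl by simp
  have iw: "is_word w (inp ! nat (R y))" using x by (intro inpw nth_mem) linarith
  have "W (Block (ptr 9 (Suc y)) ;; to_word ;; Block (WRead 13 13 # ptr 8 (Suc x)) ;; from_word)
   (M, out) (7 * Q + 8 + (4 + (7 * Q + 3))) (brel s')"
  proof (rule index_code[OF b lt[OF x(2)]])
   show "0 <= cellv s (Suc y)" "cellv s (Suc y) <= int S" "cellv s (Suc y) < 2 ^ Q" using x Rb[of y] \<open>R y <= int S\<close> by (auto simp: reg)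
   fix M1 assume M1: "M1 13 = cellv s (Suc y)" "brel s (M1, out)"
   have ok1: "ok M1" using M1 by (simp add: brel_def)
   let ?M = "M1(13 := inp ! nat (R y), 8 := int (cell (Suc x)))"
   have okM: "ok ?M" using ok1 by (simp add: ok_upd)
   have "W from_word (?M, out) (7 * Q + 3) (brel s')"
   proof (rule hp_mono[OF fw[of ?M "Suc x" "inp ! nat (R y)"] order_refl])
    fix st assume *: "snd st = out & wrote Q ?M (cell (Suc x)) (inp ! nat (R y)) (fst st)"
    then have "wrote Q M1 (cell (Suc x)) (inp ! nat (R y)) (fst st)" by (auto dest!: wrote_upd)
    then have "brel s' (fst st, out)" using updR x by (intro brel_wrote[OF M1(2)]) (auto simp: s')
    then show "brel s' st" using * by (cases st) auto
   qed (use okM iw x in auto)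
   moreover have "execs (wat w S inp) (WRead 13 13 # ptr 8 (Suc x)) (M1, out) = Some (?M, out)" using M1(1) ok1 x iw S15 by (simp add: reg exec_ptr ok_upd)
   ultimately show "W (Block (WRead 13 13 # ptr 8 (Suc x)) ;; from_word) (M1, out) (4 + (7 * Q + 3)) (brel s')" by (intro hp_Seq[where ?b1.0 = 4 and ?b2.0 = "7 * Q + 3"] hp_Block[where s' = "(?M, out)"]) (auto simp: ptr_def)
  qed
  then show ?thesis unfolding HRead st tr_atom.simps by (rule hp_mono) (use Q2 in auto)
 next
  case (HOut x)
  then have x: "x < 46" and s': "s' = (R, A, out @ [R x mod 2])" using ha by (auto simp: s split: if_splits)
  let ?M = "M(9 := int (cell (Suc x)), 13 := R x mod 2)"
  have e: "M (cell (Suc x)) = R x mod 2" using brel_bits[OF b lt[OF x], of 0] Q2 reg[OF x] by (simp add: bt_def)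
  have lS: "cell (Suc x) < S" "32 <= cell (Suc x)" using cell_le[OF lt[OF x]] Q2 cell_ge by auto
  have "execs (wat w S inp) (ptr 9 (Suc x) @ [WLoad 13 9, WOut 13]) (M, out) = Some (?M, out @ [R x mod 2])" using ok x S15 e lS by (simp add: exec_append exec_ptr)
  moreover have "brel s' (?M, out @ [R x mod 2])"
  proof -
   have "cellv s' c = cellv s c" for c by (simp add: s s')
   moreover have "ok ?M" using ok by (simp add: ok_upd)
   moreover have "?M (cell c + i) = M (cell c + i)" for c i using cell_ge[of c] by auto
   ultimately show ?thesis using b unfolding brel_def by (simp add: s')
  qed
  ultimately show ?thesis unfolding HOut st tr_atom.simps using Q2 by (intro hp_Block) (auto simp: ptr_def)
 qed
qed

lemma tr_block:
 "execs (hq q inp J) as s = Some s' ==> Suc q <= Q ==> brel s st ==> W (tr (Block as)) st (length as * (40 * Q)) (brel s')"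
proof (induction as arbitrary: s st)
 case Nil
 then show ?case by (auto intro: hp_Block)
next
 case (Cons a as)
 then obtain s1 where s1: "hq q inp J a s = Some s1" "execs (hq q inp J) as s1 = Some s'" by (auto split: option.splits)
 have "W (tr_atom a) st (40 * Q) (%st1. W (tr (Block as)) st1 (length as * (40 * Q)) (brel s'))" by (rule hp_mono[OF tr_atom_correct[OF s1(1) Cons.prems(2,3)] order_refl]) (use Cons s1 in auto)
 then show ?case by (simp, intro hp_Seq[where ?b1.0 = "40 * Q" and ?b2.0 = "length as * (40 * Q)"]) auto
qed

lemma sgn_code_correct:
 assumes h: "hqt q x s = Some v" and q: "Suc q <= Q" and b: "brel s st"
 shows "W (sgn_code x) st 5 (%st'. brel s st' & wts S 5 st' = Some v)"
proof -
 obtain R A out where s: "s = (R, A, out)" by (cases s) auto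
 obtain M where st: "st = (M, out)" using b unfolding s brel_def by (cases st) auto
 note b = b[unfolded st]
 have ok: "ok M" using b by (simp add: brel_def)
 have x: "x < 46" and v: "v = (R x < 0)" and bq: "hbnd q s" using h unfolding hqt_def hts_def s by (auto split: if_splits)
 have p: "(2::int) ^ q <= 2 ^ (Q - 1)" using q by (auto intro!: power_increasing)
 have Rb: "\<bar>R x\<bar> < 2 ^ (Q - 1)" using bq p unfolding s hbnd_def by (auto simp: abs_less_iff intro: less_le_trans)
 define r where "r = Q - 1"
 have r: "Q = Suc r" using Q2 by (simp add: r_def)
 have cr: "cell (Suc (Suc x)) = cell (Suc x) + r + 1" unfolding cell_def using r by simp
 have bt: "bt (R x) r = (if R x < 0 then 1 else 0)"
 proof (cases "R x < 0")
  case True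
  then have "R x div 2 ^ r = -1" using Rb int_div_pos_eq[of "R x" "2 ^ r" "-1" "R x + 2 ^ r"] by (auto simp: r_def)
  then show ?thesis using True by (simp add: bt_def)
 next
  case False then show ?thesis using Rb by (simp add: bt_def r_def div_pos_pos_trivial)
 qed
 have e: "M (cell (Suc x) + r) = (if R x < 0 then 1 else 0)" using brel_bits[OF b, of "Suc x" r] x r bt by (simp add: s)
 let ?M = "M(9 := int (cell (Suc x) + r), 5 := (if R x < 0 then 1 else 0))"
 have lS: "cell (Suc x) + r < S" "32 <= cell (Suc x)" using cell_le[of "Suc x"] x r cell_ge by auto
 have wd: "is_word w (int (cell (Suc x) + r))" using lS by (intro word) auto
 have "execs (wat w S inp) (ptr 9 (Suc (Suc x)) @ [WArith Sub 9 9 1, WLoad 5 9]) (M, out) = Some (?M, out)" using ok x S15 e lS wd by (simp add: exec_append exec_ptr cr ok_def nat_add_distrib del: of_nat_add)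
 moreover have "brel s (?M, out)"
 proof -
  have "ok ?M" using ok by (simp add: ok_upd)
  moreover have "?M (cell c + i) = M (cell c + i)" for c i using cell_ge[of c] by auto
  ultimately show ?thesis using b unfolding brel_def by simp
 qed
 moreover have "wts S 5 (?M, out) = Some v" using S15 ok v by (simp add: wts_def ok_def)
 ultimately show ?thesis unfolding sgn_code_def st by (intro hp_Block) (auto simp: ptr_def)
qed

text \<open>Each translated atom takes at most \<open>40 * Q\<close> steps. The second claim
  strengthens the induction for loops: after the first round the word loop is reentered with the
  sign bit already computed in word 5.\<close>

theorem tr_correct:
 assumes "runs (hq q inp J) (hqt q) c s t s'" and q: "Suc q <= Q"
 shows "brel s st ==> W (tr c) st (t * (40 * Q)) (brel s') &
  (\<forall>x c0. c = Loop x c0 \<longrightarrow> wts S 5 st = hqt q x s \<longrightarrow>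
   2 <= t & W (Loop 5 (tr c0 ;; sgn_code x)) st (t * (40 * Q) - 5) (brel s'))" using assms(1)
proof (induction arbitrary: st)
 case (Block as s s')
 then show ?case using tr_block[OF Block(1) q Block(2)] by simp
next
 case (Seq c s t s1 d t' s')
 have "W (tr c) st (t * (40 * Q)) (%st1. W (tr d) st1 (t' * (40 * Q)) (brel s'))" by (rule hp_mono[OF conjunct1[OF Seq.IH(1)[OF Seq.prems]] order_refl]) (use Seq.IH(2) in blast)
 then show ?case by (simp, intro hp_Seq[where ?b1.0 = "t * (40 * Q)" and ?b2.0 = "t' * (40 * Q)"]) (auto simp: algebra_simps)
next
 case (CondT x s c t s' d)
 have "W (sgn_code x) st 5 (%st1. W (Cond 5 (tr c) (tr d)) st1 (t * (40 * Q) + 2) (brel s'))"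
 proof (rule hp_mono[OF sgn_code_correct[OF CondT.hyps(1) q CondT.prems] order_refl])
  fix st' assume *: "brel s st' & wts S 5 st' = Some True"
  then show "W (Cond 5 (tr c) (tr d)) st' (t * (40 * Q) + 2) (brel s')" using CondT.IH[of st'] by (intro hp_CondT[where ?b1.0 = "t * (40 * Q)"]) auto
 qed
 then show ?case using Q2 by (simp, intro hp_Seq[where ?b1.0 = 5 and ?b2.0 = "t * (40 * Q) + 2"]) auto
next
 case (CondF x s d t s' c)
 have "W (sgn_code x) st 5 (%st1. W (Cond 5 (tr c) (tr d)) st1 (t * (40 * Q) + 2) (brel s'))"
 proof (rule hp_mono[OF sgn_code_correct[OF CondF.hyps(1) q CondF.prems] order_refl])
  fix st' assume *: "brel s st' & wts S 5 st' = Some False"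
  then show "W (Cond 5 (tr c) (tr d)) st' (t * (40 * Q) + 2) (brel s')" using CondF.IH[of st'] by (intro hp_CondF[where ?b1.0 = "t * (40 * Q)"]) auto
 qed
 then show ?case using Q2 by (simp, intro hp_Seq[where ?b1.0 = 5 and ?b2.0 = "t * (40 * Q) + 2"]) auto
next
 case (LoopT x s c t s1 t' s')
 let ?K = "40 * Q"
 have t2: "2 <= t'" using LoopT.hyps(3) by (cases rule: runs.cases) auto
 have inner: "W (Loop 5 (tr c ;; sgn_code x)) st ((t + t' + 2) * ?K - 5) (brel s')"
  if b: "brel s st" and f: "wts S 5 st = Some True" for st
 proof (rule hp_LoopT[where ?b1.0 = "t * ?K + 5" and ?b2.0 = "t' * ?K - 5"])
  show "wts S 5 st = Some True" by (rule f)
  obtain v where v: "hqt q x s1 = Some v" using LoopT.hyps(3) by (cases rule: runs.cases) auto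
  have "W (tr c) st (t * ?K) (%st1. W (sgn_code x) st1 5 (%st2. W (Loop 5 (tr c ;; sgn_code x)) st2 (t' * ?K - 5) (brel s')))"
  proof (rule hp_mono[OF conjunct1[OF LoopT.IH(1)[OF b]] order_refl])
   fix st1 assume b1: "brel s1 st1"
   show "W (sgn_code x) st1 5 (%st2. W (Loop 5 (tr c ;; sgn_code x)) st2 (t' * ?K - 5) (brel s'))" by (rule hp_mono[OF sgn_code_correct[OF v q b1] order_refl]) (use LoopT.IH(2) v in auto)
  qed
  then show "W (tr c ;; sgn_code x) st (t * ?K + 5) (%st2. W (Loop 5 (tr c ;; sgn_code x)) st2 (t' * ?K - 5) (brel s'))" by (rule hp_Seq) simp
  have "2 * 1 <= t' * ?K" using t2 Q2 by (intro mult_le_mono) auto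
  moreover have "40 * 2 <= t' * ?K" using t2 Q2 mult_le_mono[of 1 t' 80 ?K] by simp
  ultimately show "t * ?K + 5 + (t' * ?K - 5) + 2 <= (t + t' + 2) * ?K - 5" using Q2 by (simp add: algebra_simps)
 qed
 have "W (sgn_code x) st 5 (%st1. W (Loop 5 (tr c ;; sgn_code x)) st1 ((t + t' + 2) * ?K - 5) (brel s'))" by (rule hp_mono[OF sgn_code_correct[OF LoopT.hyps(1) q LoopT.prems] order_refl]) (use inner in auto)
 then have "W (tr (Loop x c)) st ((t + t' + 2) * ?K) (brel s')" using Q2 by (simp, intro hp_Seq[where ?b1.0 = 5 and ?b2.0 = "(t + t' + 2) * ?K - 5"]) (auto simp: algebra_simps)
 then show ?case using inner[OF LoopT.prems] LoopT.hyps(1) by auto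
next
 case (LoopF x s c)
 let ?K = "40 * Q"
 have inner: "W (Loop 5 (tr c ;; sgn_code x)) st (2 * ?K - 5) (brel s)"
  if b: "brel s st" and f: "wts S 5 st = Some False" for st using f b Q2 by (intro hp_LoopF) auto
 have "W (sgn_code x) st 5 (%st1. W (Loop 5 (tr c ;; sgn_code x)) st1 (2 * ?K - 5) (brel s))" by (rule hp_mono[OF sgn_code_correct[OF LoopF.hyps(1) q LoopF.prems] order_refl]) (use inner in auto)
 then have "W (tr (Loop x c)) st (2 * ?K) (brel s)" using Q2 by (simp, intro hp_Seq[where ?b1.0 = 5 and ?b2.0 = "2 * ?K - 5"]) auto
 then show ?case using inner[OF LoopF.prems] LoopF.hyps(1) by auto
qed

end

section \<open>Computing the cell length from the input\<close>

lemma hp_while: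
 assumes tst: "!!s. I s ==> g x s ~= None"
  and step: "!!s. I s ==> g x s = Some True ==> hp f g c s b (%s'. I s' & \<mu> s' < (\<mu> s :: nat))"
 shows "I s ==> hp f g (Loop x c) s (\<mu> s * (b + 2) + 2) (%s'. I s' & g x s' = Some False)"
proof (induction "\<mu> s" arbitrary: s rule: less_induct)
 case less
 show ?case
 proof (cases "g x s = Some True")
  case True
  have "hp f g c s b (%s1. hp f g (Loop x c) s1 ((\<mu> s - 1) * (b + 2) + 2) (%s'. I s' & g x s' = Some False)) & 1 <= \<mu> s"
  proof
   from step[OF less.prems True] show "1 <= \<mu> s" unfolding hp_def by auto
   show "hp f g c s b (%s1. hp f g (Loop x c) s1 ((\<mu> s - 1) * (b + 2) + 2) (%s'. I s' & g x s' = Some False))"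
   proof (rule hp_mono[OF step[OF less.prems True] order_refl])
    fix s1 assume s1: "I s1 & \<mu> s1 < \<mu> s"
    have "\<mu> s1 * (b + 2) <= (\<mu> s - 1) * (b + 2)" using s1 by (intro mult_le_mono1) auto
    then show "hp f g (Loop x c) s1 ((\<mu> s - 1) * (b + 2) + 2) (%s'. I s' & g x s' = Some False)" using s1 by (intro hp_mono[OF less.hyps]) auto
   qed
  qed
  then obtain k where k: "\<mu> s = Suc k" and h: "hp f g c s b (%s1. hp f g (Loop x c) s1 (k * (b + 2) + 2) (%s'. I s' & g x s' = Some False))" by (cases "\<mu> s") auto
  show ?thesis unfolding k by (rule hp_LoopT[where ?b1.0 = b and ?b2.0 = "k * (b + 2) + 2"]) (use True h in auto)
 next
  case False
  then have "g x s = Some False" using tst[OF less.prems] by (cases "g x s") auto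
  then show ?thesis using less.prems by (intro hp_LoopF) auto
 qed
qed

definition in_bits :: "int list => nat" where
 "in_bits inp = (LEAST l. \<forall>v\<in>set inp. \<bar>v\<bar> < 2 ^ l)"

lemma in_bits: "v \<in> set inp ==> \<bar>v\<bar> < 2 ^ in_bits inp"
proof -
 define B where "B = (\<Sum>v\<leftarrow>inp. nat \<bar>v\<bar>)"
 have "\<bar>v\<bar> < 2 ^ B" if "v \<in> set inp" for v
 proof -
  have "nat \<bar>v\<bar> <= B" unfolding B_def using that by (intro member_le_sum_list) auto
  then have "\<bar>v\<bar> <= int B" by linarith
  also have "int B < 2 ^ B" using less_exp[of B] by (metis of_nat_less_iff of_nat_numeral of_nat_power)
  finally show ?thesis .
 qed
 then have "\<exists>l. \<forall>v\<in>set inp. \<bar>v\<bar> < 2 ^ l" by blast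
 from LeastI_ex[OF this] show "v \<in> set inp ==> \<bar>v\<bar> < 2 ^ in_bits inp" unfolding in_bits_def by blast
qed

lemma in_bits_le: "(!!v. v \<in> set inp ==> \<bar>v\<bar> < 2 ^ l) ==> in_bits inp <= l"
 unfolding in_bits_def by (rule Least_le) blast

definition boot_scan :: "watom com" where
 "boot_scan = Loop 18 (
   Block [WRead 22 21, WArith Sub 23 0 22] ;; Cond 23 (Block [WArith Add 22 23 0]) (Block []) ;;
   Block [WArith Sub 24 22 19, WArith Add 24 24 1] ;;
   Loop 24 (Block [WArith Add 19 19 19, WArith Add 20 20 1, WArith Sub 24 22 19, WArith Add 24 24 1]) ;;
   Block [WArith Add 21 21 1, WArith Sub 18 18 1])"

text \<open>The cell length must be known before any long number is written. It is a fixed power of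
  \<open>m + n + in_bits inp + 100\<close>, where a scan of the input determines the bit length by
  doubling a power of two whenever an entry reaches it.\<close>

definition boot :: "nat => watom com" where
 "boot \<kappa> = Block [WConst 1 1, WConst 2 2, WConst 4 32, WRead 16 0, WRead 17 1, WArith Mul 18 16 17, WArith Add 18 18 16,
    WArith Add 18 18 17, WArith Add 18 18 2, WConst 19 1] ;; boot_scan ;;
   Block [WArith Add 16 16 17, WArith Add 16 16 20, WConst 25 100, WArith Add 16 16 25, WConst 3 1] ;;
   Block (replicate \<kappa> (WArith Mul 3 3 16))"

lemma exec_pow:
 assumes "15 < S" "!!i. i <= \<kappa> ==> is_word w (X ^ i)"
 shows "i <= \<kappa> ==> S \<ge> 32 ==> M 16 = X ==> M 3 = X ^ (\<kappa> - i) ==>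
  execs (wat w S inp) (replicate i (WArith Mul 3 3 16)) (M, out) = Some (M(3 := X ^ \<kappa>), out)"
proof (induction i arbitrary: M)
 case 0
 then show ?case by auto
next
 case (Suc i)
 then have k: "\<kappa> - i = Suc (\<kappa> - Suc i)" by simp
 have "is_word w (X ^ (\<kappa> - i))" by (rule assms(2)) simp
 then have 1: "wat w S inp (WArith Mul 3 3 16) (M, out) = Some (M(3 := X ^ (\<kappa> - i)), out)" using Suc.prems by (simp add: k mult.commute)
 have 2: "execs (wat w S inp) (replicate i (WArith Mul 3 3 16)) (M(3 := X ^ (\<kappa> - i)), out) = Some ((M(3 := X ^ (\<kappa> - i)))(3 := X ^ \<kappa>), out)" by (rule Suc.IH) (use Suc.prems in auto)
 show ?case by (simp only: replicate.simps execs.simps 1 2 option.case fun_upd_upd)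
qed

lemma boot_correct:
 fixes m n w S \<kappa> :: nat
 assumes inp: "length inp = m * n + m + n + 2" "inp ! 0 = int m" "inp ! 1 = int n"
  and word: "!!v. \<bar>v\<bar> <= Bw ==> is_word w v"
  and X: "X = m + n + in_bits inp + 100" and Bw: "int (X ^ \<kappa>) <= Bw" "4 * 2 ^ in_bits inp <= Bw" "2 * int (length inp) <= Bw" "int X <= Bw"
  and S: "32 <= S"
 shows "hp (wat w S inp) (wts S) (boot \<kappa>) ((%_. 0), []) (20 + length inp * (6 * in_bits inp + 20) + \<kappa>)
  (%st. snd st = [] & fst st 0 = 0 & fst st 1 = 1 & fst st 2 = 2 & fst st 3 = int (X ^ \<kappa>) & fst st 4 = 32 & (\<forall>x\<ge>32. fst st x = 0))"
proof -
 let ?W = "hp (wat w S inp) (wts S)"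
 let ?L = "in_bits inp"
 define len where "len = length inp"
 have L4: "4 * 2 ^ ?L <= Bw" and l2: "2 * int len <= Bw" using Bw by (auto simp: len_def)
 have B100: "100 <= Bw" using Bw(4) X by linarith
 have in_word: "is_word w v" if "v \<in> set inp" for v using in_bits[OF that] L4 by (intro word) linarith
 have in0: "inp ! 0 \<in> set inp" "inp ! Suc 0 \<in> set inp" using inp(1) by (auto intro!: nth_mem)
 have mn: "is_word w (int m)" "is_word w (int n)" using in_word[OF in0(1)] in_word[OF in0(2)] inp(2,3) by auto
 have lenmn: "int m * int n + int m + int n + 2 = int len" using inp(1) by (simp add: len_def)
 define fixd where "fixd M \<longleftrightarrow> M 0 = (0::int) & M 1 = 1 & M 2 = 2 & M 4 = 32 & M 16 = int m & M 17 = int n & (\<forall>x\<ge>32. M x = 0)"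
  for M :: "nat => int"
 define I where "I i st \<longleftrightarrow> snd st = [] & fixd (fst st) & fst st 18 = int len - int i & fst st 21 = int i &
  (\<exists>l\<le>?L. fst st 19 = 2 ^ l & fst st 20 = int l & (\<forall>j<i. \<bar>inp ! j\<bar> < 2 ^ l))" for i and st :: wst
 let ?inner = "Loop 24 (Block [WArith Add 19 19 19, WArith Add 20 20 1, WArith Sub 24 22 19, WArith Add 24 24 1])"
 have inner: "?W ?inner (M, []) (?L * (4 + 2) + 2)
  (%st. snd st = [] & fixd (fst st) & fst st 18 = M 18 & fst st 21 = M 21 &
   (\<exists>l. l0 <= l & l <= ?L & fst st 19 = 2 ^ l & fst st 20 = int l & v < 2 ^ l))"
  if M: "fixd M" "M 19 = 2 ^ l0" "M 20 = int l0" "l0 <= ?L" "M 22 = v" "M 24 = v - 2 ^ l0 + 1" and v: "0 <= v" "v < 2 ^ ?L"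
  for M l0 v
 proof -
  define K where "K st \<longleftrightarrow> snd st = [] & fixd (fst st) & fst st 18 = M 18 & fst st 21 = M 21 & fst st 22 = v &
   (\<exists>l. l0 <= l & l <= ?L & fst st 19 = 2 ^ l & fst st 20 = int l & fst st 24 = v - 2 ^ l + 1)" for st :: wst
  have "?W ?inner (M, []) ((?L - nat (fst (M, [] :: int list) 20)) * (4 + 2) + 2) (%s'. K s' & wts S 24 s' = Some False)"
  proof (rule hp_while[where I = K and \<mu> = "%st::wst. ?L - nat (fst st 20)"])
   show "wts S 24 s ~= None" for s using S by (simp add: wts_def)
   show "K (M, [])" using M by (auto simp: K_def)
   fix st assume K: "K st" and t: "wts S 24 st = Some True"
   obtain M' l where st: "st = (M', [])" and M': "fixd M'" "M' 18 = M 18" "M' 21 = M 21" "M' 22 = v" "l0 <= l" "l <= ?L"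
    "M' 19 = 2 ^ l" "M' 20 = int l" "M' 24 = v - 2 ^ l + 1" using K unfolding K_def by (cases st) auto
   have c: "M' 0 = 0" "M' (Suc 0) = 1" "M' 2 = 2" using M'(1) by (auto simp: fixd_def)
   have "2 ^ l <= v" using t S M' c unfolding st by (auto simp: wts_def)
   then have "(2::int) ^ l < 2 ^ ?L" using v by linarith
   then have l: "Suc l <= ?L" by (simp add: power_strict_increasing_iff)
   have p: "(2::int) ^ l + 2 ^ l <= 2 ^ ?L" using power_increasing[OF l, of "2::int"] by simp
   have lw: "int l + 1 <= 2 ^ ?L"
   proof -
    have "Suc l <= 2 ^ ?L" using l less_exp[of ?L] by linarith
    then have "int (Suc l) <= int (2 ^ ?L)" by (rule of_nat_mono)
    then show ?thesis by simp
   qed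
   have wd: "is_word w (2 ^ l + 2 ^ l)" "is_word w (int l + 1)" "is_word w (v - (2 ^ l + 2 ^ l))" "is_word w (v - (2 ^ l + 2 ^ l) + 1)" using p lw v L4 zero_less_power[of "2::int" l] by (intro word; linarith)+
   show "?W (Block [WArith Add 19 19 19, WArith Add 20 20 1, WArith Sub 24 22 19, WArith Add 24 24 1]) st 4
    (%s'. K s' & ?L - nat (fst s' 20) < ?L - nat (fst st 20))"
    unfolding st
    apply (rule hp_Block)
     apply (use S M' c wd in simp)
     apply simp
    apply (use M' l in \<open>auto simp: K_def fixd_def intro!: exI[of _ "Suc l"]\<close>)
    done
  qed
  then show ?thesis
  proof (rule hp_mono)
   show "(?L - nat (fst (M, [] :: int list) 20)) * (4 + 2) + 2 <= ?L * (4 + 2) + 2" by (intro add_mono mult_le_mono1) auto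
   fix st assume *: "K st & wts S 24 st = Some False"
   then obtain l where l: "l0 <= l" "l <= ?L" "fst st 19 = 2 ^ l" "fst st 20 = int l" "fst st 24 = v - 2 ^ l + 1" "fst st 0 = 0" by (auto simp: K_def fixd_def)
   have "v < 2 ^ l" using * l S by (auto simp: wts_def split: if_splits)
   then show "snd st = [] & fixd (fst st) & fst st 18 = M 18 & fst st 21 = M 21 &
    (\<exists>l. l0 <= l & l <= ?L & fst st 19 = 2 ^ l & fst st 20 = int l & v < 2 ^ l)" using * l by (auto simp: K_def)
  qed
 qed
 have scan: "?W boot_scan (M, []) (len * (?L * 6 + 12 + 2) + 2) (I len)" if M: "I 0 (M, [])" for M
  unfolding boot_scan_def
 proof (rule hp_for[where I = I])
  show "I 0 (M, [])" by (rule M)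
  show "wts S 18 s = Some False" if "I len s" for s using that S by (auto simp: I_def wts_def fixd_def)
  fix i s assume i: "i < len" and Is: "I i s"
  obtain M' l0 where s: "s = (M', [])" and M': "fixd M'" "M' 18 = int len - int i" "M' 21 = int i" "l0 <= ?L" "M' 19 = 2 ^ l0" "M' 20 = int l0"
   "\<forall>j<i. \<bar>inp ! j\<bar> < 2 ^ l0" using Is unfolding I_def by (cases s) auto
  have c: "M' 0 = 0" "M' (Suc 0) = 1" "M' 2 = 2" using M'(1) by (auto simp: fixd_def)
  let ?v = "inp ! i"
  have vin: "?v \<in> set inp" using i by (simp add: len_def)
  have vb: "\<bar>?v\<bar> < 2 ^ ?L" by (rule in_bits[OF vin])
  have pL: "(2::int) ^ l0 <= 2 ^ ?L" using M'(4) by (intro power_increasing) auto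
  have p0: "(0::int) < 2 ^ l0" by simp
  have wd: "is_word w ?v" "is_word w (- ?v)" "is_word w \<bar>?v\<bar>" "is_word w (\<bar>?v\<bar> - 2 ^ l0)" "is_word w (\<bar>?v\<bar> - 2 ^ l0 + 1)"
   "is_word w (int i + 1)" "is_word w (int len - int i - 1)" using vb L4 l2 i pL p0 by (intro word; linarith)+
  let ?M1 = "M'(22 := ?v, 23 := - ?v)"
  let ?M2 = "M'(22 := \<bar>?v\<bar>, 23 := - ?v)"
  let ?M3 = "M'(22 := \<bar>?v\<bar>, 23 := - ?v, 24 := \<bar>?v\<bar> - 2 ^ l0 + 1)"
  let ?fin = "Block [WArith Add 21 21 1, WArith Sub 18 18 1]"
  have F: "?W ?fin st 2 (I (Suc i))" if *: "snd st = [] & fixd (fst st) & fst st 18 = ?M3 18 & fst st 21 = ?M3 21 &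
   (\<exists>l. l0 <= l & l <= ?L & fst st 19 = 2 ^ l & fst st 20 = int l & \<bar>?v\<bar> < 2 ^ l)" for st
  proof -
   obtain M4 l where st: "st = (M4, [])" and M4: "fixd M4" "M4 18 = int len - int i" "M4 21 = int i" "l0 <= l" "l <= ?L" "M4 19 = 2 ^ l" "M4 20 = int l" "\<bar>?v\<bar> < 2 ^ l" using * M' by (cases st) auto
   have c4: "M4 (Suc 0) = 1" using M4(1) by (auto simp: fixd_def)
   have all: "\<bar>inp ! j\<bar> < 2 ^ l" if "j < Suc i" for j
   proof (cases "j = i")
    case False
    then have "\<bar>inp ! j\<bar> < 2 ^ l0" using that M'(7) by simp
    also have "(2::int) ^ l0 <= 2 ^ l" using M4(4) by (intro power_increasing) auto
    finally show ?thesis .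
   qed (use M4 in simp)
   show ?thesis unfolding st
    apply (rule hp_Block)
     apply (use S M4 c4 wd in simp)
     apply simp
    apply (use M4 all in \<open>auto simp: I_def fixd_def intro!: exI[of _ l]\<close>)
    done
  qed
  have A3: "?W (?inner ;; ?fin) (?M3, []) (?L * 6 + 4) (I (Suc i))" by (rule hp_Seq[OF hp_mono[OF inner[where ?l0.0 = l0 and v = "\<bar>?v\<bar>"] order_refl F]])
    (use M' vb in \<open>auto simp: fixd_def\<close>)
  have A2: "?W (Block [WArith Sub 24 22 19, WArith Add 24 24 1] ;; ?inner ;; ?fin) (?M2, []) (?L * 6 + 6) (I (Suc i))"
  proof (rule hp_Seq[where ?b1.0 = 2 and ?b2.0 = "?L * 6 + 4"])
   show "?W (Block [WArith Sub 24 22 19, WArith Add 24 24 1]) (?M2, []) 2 (%s1. ?W (?inner ;; ?fin) s1 (?L * 6 + 4) (I (Suc i)))" by (rule hp_Block[where s' = "(?M3, [])"]) (use A3 S M' c wd in simp_all)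
  qed simp
  have A1: "?W (Cond 23 (Block [WArith Add 22 23 0]) (Block []) ;; Block [WArith Sub 24 22 19, WArith Add 24 24 1] ;; ?inner ;; ?fin) (?M1, []) (?L * 6 + 9) (I (Suc i))"
  proof (rule hp_Seq[where ?b1.0 = 3 and ?b2.0 = "?L * 6 + 6"])
   show "?W (Cond 23 (Block [WArith Add 22 23 0]) (Block [])) (?M1, []) 3
    (%s1. ?W (Block [WArith Sub 24 22 19, WArith Add 24 24 1] ;; ?inner ;; ?fin) s1 (?L * 6 + 6) (I (Suc i)))"
   proof (cases "?v < 0")
    case True
    show ?thesis
    proof (rule hp_CondT[where ?b1.0 = 1])
     show "wts S 23 (?M1, []) = Some True" using S c True by (simp add: wts_def)
     have e: "?M1(22 := - ?v) = ?M2" using True by auto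
     have ex: "execs (wat w S inp) [WArith Add 22 23 0] (?M1, []) = Some (?M1(22 := - ?v), [])" using S c wd by simp
     show "?W (Block [WArith Add 22 23 0]) (?M1, []) 1
      (%s1. ?W (Block [WArith Sub 24 22 19, WArith Add 24 24 1] ;; ?inner ;; ?fin) s1 (?L * 6 + 6) (I (Suc i)))" by (rule hp_Block[OF ex[unfolded e]]) (use A2 in simp_all)
    qed simp
   next
    case False
    show ?thesis
    proof (rule hp_CondF[where ?b1.0 = 0])
     show "wts S 23 (?M1, []) = Some False" using S c False by (simp add: wts_def)
     have e: "?M1 = ?M2" using False by auto
     show "?W (Block []) (?M1, []) 0
      (%s1. ?W (Block [WArith Sub 24 22 19, WArith Add 24 24 1] ;; ?inner ;; ?fin) s1 (?L * 6 + 6) (I (Suc i)))"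
      unfolding e by (rule hp_Block[where s' = "(?M2, [])"]) (use A2 in simp_all)
    qed simp
   qed
  qed simp
  have "?W (Block [WRead 22 21, WArith Sub 23 0 22] ;; Cond 23 (Block [WArith Add 22 23 0]) (Block []) ;; Block [WArith Sub 24 22 19, WArith Add 24 24 1] ;; ?inner ;; ?fin)
    s (?L * 6 + 12) (I (Suc i))"
  proof (rule hp_Seq[where ?b1.0 = 2 and ?b2.0 = "?L * 6 + 9"])
   show "?W (Block [WRead 22 21, WArith Sub 23 0 22]) s 2 (%s1. ?W (Cond 23 (Block [WArith Add 22 23 0]) (Block []) ;;
     Block [WArith Sub 24 22 19, WArith Add 24 24 1] ;; ?inner ;; ?fin) s1 (?L * 6 + 9) (I (Suc i)))"
    unfolding s by (rule hp_Block[where s' = "(?M1, [])"]) (use A1 S M' c wd i in \<open>simp_all add: len_def\<close>)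
  qed simp
  then show "wts S 18 s = Some True & ?W (Block [WRead 22 21, WArith Sub 23 0 22] ;; Cond 23 (Block [WArith Add 22 23 0]) (Block []) ;;
    Block [WArith Sub 24 22 19, WArith Add 24 24 1] ;; ?inner ;; ?fin) s (?L * 6 + 12) (I (Suc i))" using S M' c i unfolding s by (simp add: wts_def)
 qed
 let ?end1 = "Block [WArith Add 16 16 17, WArith Add 16 16 20, WConst 25 100, WArith Add 16 16 25, WConst 3 1]"
 let ?end2 = "Block (replicate \<kappa> (WArith Mul 3 3 16))"
 let ?P = "%st. snd st = [] & fst st 0 = 0 & fst st 1 = 1 & fst st 2 = 2 & fst st 3 = int (X ^ \<kappa>) & fst st 4 = 32 & (\<forall>x\<ge>32. fst st x = (0::int))"
 have E: "?W (?end1 ;; ?end2) st (5 + \<kappa>) ?P" if I: "I len st" for st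
 proof -
  obtain M l where st: "st = (M, [])" and M: "fixd M" "l <= ?L" "M 20 = int l" "\<forall>j<len. \<bar>inp ! j\<bar> < 2 ^ l" using I unfolding I_def by (cases st) auto
  have "?L <= l" by (rule in_bits_le) (use M(4) in \<open>auto simp: len_def in_set_conv_nth\<close>)
  then have l: "l = ?L" using M by simp
  have c: "M 16 = int m" "M 17 = int n" using M(1) by (auto simp: fixd_def)
  have XX: "int m + int n + int l + 100 = int X" using X l by simp
  have wd: "is_word w (int m + int n)" "is_word w (int m + int n + int l)" "is_word w 100" "is_word w (int X)" "is_word w 1" using Bw(4) XX B100 by (auto intro!: word)
  let ?M = "M(25 := 100, 16 := int X, 3 := 1)"
  have pw: "is_word w (int X ^ i)" if "i <= \<kappa>" for i
  proof -
   have "X ^ i <= X ^ \<kappa>" using that X by (intro power_increasing) auto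
   then have "int (X ^ i) <= int (X ^ \<kappa>)" by (rule of_nat_mono)
   then show ?thesis using Bw(1) by (intro word) simp
  qed
  have ex: "execs (wat w S inp) (replicate \<kappa> (WArith Mul 3 3 16)) (?M, []) = Some (?M(3 := int X ^ \<kappa>), [])" by (rule exec_pow) (use S pw in auto)
  have 2: "?W ?end2 (?M, []) \<kappa> ?P" by (rule hp_Block[OF ex]) (use M(1) in \<open>auto simp: fixd_def\<close>)
  have ex1: "execs (wat w S inp) [WArith Add 16 16 17, WArith Add 16 16 20, WConst 25 100, WArith Add 16 16 25, WConst 3 1] (M, []) = Some (?M, [])" using S M c wd XX by simp
  show ?thesis unfolding st by (rule hp_Seq[OF hp_Block[OF ex1, of 5, where Q = "%s. ?W ?end2 s \<kappa> ?P"]]) (use 2 in auto)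
 qed
 let ?M0 = "(%_. 0)(1 := 1, 2 := 2, 4 := 32, 16 := int m, 17 := int n, 18 := int len, 19 := 1)"
 have I0: "I 0 (?M0, [])" unfolding I_def fixd_def by (auto intro!: exI[of _ 0])
 have 1: "?W (boot_scan ;; ?end1 ;; ?end2) (?M0, []) (len * (?L * 6 + 12 + 2) + 2 + (5 + \<kappa>)) ?P" by (rule hp_Seq[OF hp_mono[OF scan[OF I0] order_refl E]]) auto
 have wd: "is_word w 1" "is_word w 2" "is_word w 32" "is_word w (int m * int n)" "is_word w (int m * int n + int m)" "is_word w (int m * int n + int m + int n)" "is_word w (int len)" using B100 lenmn l2 by (auto intro!: word)
 have lc: "0 < len" "1 < len" using inp(1) by (auto simp: len_def)
 have ex: "execs (wat w S inp) [WConst 1 1, WConst 2 2, WConst 4 32, WRead 16 0, WRead 17 1, WArith Mul 18 16 17, WArith Add 18 18 16,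
    WArith Add 18 18 17, WArith Add 18 18 2, WConst 19 1] ((%_. 0), []) = Some (?M0, [])"
 proof -
  have l1: "inp ~= []" "Suc 0 < length inp" using lc by (auto simp: len_def)
  have l1': "1 < int (length inp)" using l1 by linarith
  show ?thesis using S wd mn inp(2,3) l1 l1' by (simp add: lenmn)
 qed
 show ?thesis unfolding boot_def by (rule hp_Seq[OF hp_Block[OF ex, of 10, where Q = "%s. ?W (boot_scan ;; ?end1 ;; ?end2) s (len * (?L * 6 + 12 + 2) + 2 + (5 + \<kappa>)) ?P"]])
   (use 1 in \<open>auto simp: len_def[symmetric] algebra_simps\<close>)
qed

text \<open>Array length and cell length are both \<open>X inp ^ \<kappa>\<close>, so memory is of
  order \<open>X inp ^ (2 * \<kappa>)\<close>. Words only have to hold addresses, input numbers and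
  small multiples of these.\<close>

theorem ram_from_H:
 fixes m n w \<kappa> q b :: nat and c :: "hatom com"
 defines "X \<equiv> %inp. m + n + in_bits inp + 100"
 defines "Q \<equiv> %inp. X inp ^ \<kappa>"
 defines "S \<equiv> %inp. 32 + (48 + 16 * Q inp) * Q inp"
 assumes inp: "length inp = m * n + m + n + 2" "inp ! 0 = int m" "inp ! 1 = int n"
  and word: "!!v. \<bar>v\<bar> <= 2 * int (S inp) + 100 + 4 * 2 ^ in_bits inp ==> is_word w v"
  and \<kappa>: "2 <= \<kappa>" and q: "Suc q <= Q inp"
  and h: "hp (hq q inp (Q inp)) (hqt q) c ((%_. 0), (%_ _. 0), []) b (%s. snd (snd s) = out)"
 shows "\<exists>T \<le> 20 + length inp * (6 * in_bits inp + 20) + \<kappa> + b * (40 * Q inp).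
  ram_computes w (compile 0 (boot \<kappa> ;; tr c) @ [Halt]) inp T (S inp) out"
proof (rule compiled_computes)
 let ?Q = "Q inp" and ?S = "S inp" and ?X = "X inp"
 have X100: "100 <= ?X" by (simp add: X_def)
 have Xle: "?X <= ?Q" unfolding Q_def using \<kappa> X100 self_le_power[of ?X \<kappa>] by simp
 have X2: "?X * ?X <= ?Q" unfolding Q_def using power_increasing[OF \<kappa>, of ?X] X100 by (simp add: power2_eq_square)
 have lenX: "length inp <= ?X * ?X"
 proof -
  define r where "r = in_bits inp + 100"
  have "?X * ?X = m * m + n * n + r * r + 2 * (m * n) + 2 * (m * r) + 2 * (n * r)"
   unfolding X_def by (simp add: r_def[symmetric] add.assoc algebra_simps)
  moreover have "m * 100 <= m * r" "n * 100 <= n * r" "100 * 100 <= r * r" by (intro mult_le_mono; simp add: r_def)+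
  ultimately show ?thesis unfolding inp(1) by linarith
 qed
 have QS: "48 * ?Q <= ?S" unfolding S_def by (simp add: algebra_simps)
 interpret wram w ?S ?Q ?Q inp
 proof
  show "?S = 32 + (48 + 16 * ?Q) * ?Q" by (simp add: S_def)
  show "2 <= ?Q" using Xle X100 by linarith
  show "is_word w v" if "\<bar>v\<bar> <= 2 * int ?S + 100" for v using that by (intro word) (simp add: add_increasing2)
  show "is_word w v" if "v \<in> set inp" for v
  proof (rule word)
   have "\<bar>v\<bar> < 2 ^ in_bits inp" by (rule in_bits[OF that])
   moreover have "(0::int) <= 2 ^ in_bits inp" by simp
   ultimately show "\<bar>v\<bar> <= 2 * int ?S + 100 + 4 * 2 ^ in_bits inp" by linarith
  qed
  show "length inp <= ?S" using lenX X2 QS by linarith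
 qed
 obtain t s' where t: "t <= b" "runs (hq q inp ?Q) (hqt q) c ((%_. 0), (%_ _. 0), []) t s'" "snd (snd s') = out" using h unfolding hp_def by blast
 have B0: "(0::int) <= 2 ^ in_bits inp" by simp
 have boot: "W (boot \<kappa>) ((%_. 0), []) (20 + length inp * (6 * in_bits inp + 20) + \<kappa>)
  (%st. snd st = [] & fst st 0 = 0 & fst st 1 = 1 & fst st 2 = 2 & fst st 3 = int (?X ^ \<kappa>) & fst st 4 = 32 & (\<forall>x\<ge>32. fst st x = 0))"
 proof (rule boot_correct[OF inp])
  show "is_word w v" if "\<bar>v\<bar> <= 2 * int ?S + 100 + 4 * 2 ^ in_bits inp" for v using that by (rule assms(7))
  show "?X = m + n + in_bits inp + 100" by (simp add: X_def)
  have "?X ^ \<kappa> <= ?S" using QS by (simp add: Q_def)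
  then have "int (?X ^ \<kappa>) <= int ?S" by (rule of_nat_mono)
  then show "int (?X ^ \<kappa>) <= 2 * int ?S + 100 + 4 * 2 ^ in_bits inp" using B0 by linarith
  show "4 * 2 ^ in_bits inp <= 2 * int ?S + 100 + 4 * 2 ^ in_bits inp" by simp
  have "length inp <= ?S" "?X <= ?S" using lenX X2 QS Xle by linarith+
  then have "int (length inp) <= int ?S" "int ?X <= int ?S" by (auto simp: of_nat_mono)
  then show "2 * int (length inp) <= 2 * int ?S + 100 + 4 * 2 ^ in_bits inp" "int ?X <= 2 * int ?S + 100 + 4 * 2 ^ in_bits inp" using B0 by linarith+
  show "32 <= ?S" by (simp add: S_def)
 qed
 show "W (boot \<kappa> ;; tr c) ((%i. 0), []) (20 + length inp * (6 * in_bits inp + 20) + \<kappa> + b * (40 * ?Q)) (%s. snd s = out)"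
 proof (rule hp_Seq[OF hp_mono[OF boot order_refl]])
  fix st :: wst
  assume st: "snd st = [] & fst st 0 = 0 & fst st 1 = 1 & fst st 2 = 2 & fst st 3 = int (?X ^ \<kappa>) & fst st 4 = 32 & (\<forall>x\<ge>32. fst st x = 0)"
  have "brel ((%_. 0), (%_ _. 0), []) st" using st cell_ge unfolding brel_def ok_def by (simp add: Q_def trans_le_add1 bt_def)
  from conjunct1[OF tr_correct[OF t(2) q this]]
  show "W (tr c) st (b * (40 * ?Q)) (%s. snd s = out)" by (rule hp_mono) (use t in \<open>auto simp: brel_def\<close>)
 qed simp
qed

section \<open>The program\<close>
text \<open>The final state is given exactly instead of by a postcondition: subroutines act as
  functions on registers, and they compose by simplifying function updates.\<close>

definition hr :: "int list => nat => hatom com => hst => nat => hst => bool" where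
 "hr inp J c s b s' \<longleftrightarrow> hp (hat inp J) hts c s b (%x. x = s')"

lemma hr_conv: "hr inp J c s b s' ==> b <= b' ==> s' = s'' ==> hr inp J c s b' s''"
 unfolding hr_def by (auto elim: hp_mono)

lemma hr_Block: "execs (hat inp J) as s = Some s' ==> hr inp J (Block as) s (length as) s'"
 unfolding hr_def by (auto intro: hp_Block)

lemmas hr_Blk = hr_conv[OF hr_Block]

lemma hr_Seq: "hr inp J c s b1 s1 ==> hr inp J d s1 b2 s2 ==> hr inp J (c ;; d) s (b1 + b2) s2"
proof -
 assume 1: "hr inp J c s b1 s1" and 2: "hr inp J d s1 b2 s2"
 have "hp (hat inp J) hts c s b1 (%s1. hp (hat inp J) hts d s1 b2 (%x. x = s2))" by (rule hp_mono[OF 1[unfolded hr_def] order_refl]) (use 2 in \<open>simp add: hr_def\<close>)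
 then show "hr inp J (c ;; d) s (b1 + b2) s2" unfolding hr_def by (rule hp_Seq) simp
qed

lemma hr_conv2: "hr inp J c s0 b s' ==> s = s0 ==> b <= b' ==> s' = s'' ==> hr inp J c s b' s''" using hr_conv by blast

lemma hr_LoopF: "x < 46 ==> \<not> R x < 0 ==> hr inp J (Loop x c) (R, A, out) 2 (R, A, out)"
 unfolding hr_def by (auto intro!: hp_LoopF simp: hts_def)

lemma hr_LoopT:
 assumes "x < 46" "R x < 0" "hr inp J c (R, A, out) b1 s1" "hr inp J (Loop x c) s1 b2 s2"
 shows "hr inp J (Loop x c) (R, A, out) (b1 + b2 + 2) s2"
proof -
 have "hp (hat inp J) hts c (R, A, out) b1 (%s1. hp (hat inp J) hts (Loop x c) s1 b2 (%x. x = s2))" by (rule hp_mono[OF assms(3)[unfolded hr_def] order_refl]) (use assms(4) in \<open>simp add: hr_def\<close>)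
 then show ?thesis unfolding hr_def by (rule hp_LoopT[rotated 1]) (use assms in \<open>auto simp: hts_def\<close>)
qed

lemma hr_Cond:
 "x < 46 ==> (R x < 0 ==> hr inp J c (R, A, out) b1 s') ==> (\<not> R x < 0 ==> hr inp J d (R, A, out) b2 s') ==>
  hr inp J (Cond x c d) (R, A, out) (max b1 b2 + 2) s'"
proof (cases "R x < 0")
 case True
 assume x: "x < 46" and "R x < 0 ==> hr inp J c (R, A, out) b1 s'"
 then have "hr inp J c (R, A, out) b1 s'" using True by simp
 then show ?thesis unfolding hr_def by (intro hp_CondT[where ?b1.0 = b1]) (use x True in \<open>auto simp: hts_def\<close>)
next
 case False
 assume x: "x < 46" and "\<not> R x < 0 ==> hr inp J d (R, A, out) b2 s'"
 then have "hr inp J d (R, A, out) b2 s'" using False by simp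
 then show ?thesis unfolding hr_def by (intro hp_CondF[where ?b1.0 = b2]) (use x False in \<open>auto simp: hts_def\<close>)
qed

lemma hr_CondT:
 "x < 46 ==> R x < 0 ==> hr inp J c (R, A, out) b1 s' ==> hr inp J (Cond x c d) (R, A, out) (b1 + 2) s'"
 unfolding hr_def by (auto intro!: hp_CondT[where ?b1.0 = b1] simp: hts_def)

lemma hr_CondF:
 "x < 46 ==> \<not> R x < 0 ==> hr inp J d (R, A, out) b1 s' ==> hr inp J (Cond x c d) (R, A, out) (b1 + 2) s'"
 unfolding hr_def by (auto intro!: hp_CondF[where ?b1.0 = b1] simp: hts_def)

text \<open>The only available test is for a negative number, so the counter runs from
  \<open>- n\<close> up to 0. Registers 44 and 45 hold 0 and 1.\<close>

definition Rep :: "nat => nat => hatom com => hatom com" where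
 "Rep k n c = Block [HSub k 44 n] ;; Loop k (c ;; Block [HAdd k k 45])"

definition For :: "nat => nat => nat => hatom com => hatom com" where
 "For j k n c = Rep k n (c ;; Block [HAdd j j 45]) ;; Block [HConst j 0]"

text \<open>The families \<open>RR\<close>, \<open>AA\<close> and \<open>oo\<close> describe the
  state after \<open>i\<close> rounds apart from the counter. The counter ends at 0, so it leaves no
  trace.\<close>

lemma hr_Rep:
 assumes k: "k < 44" "n < 46" "n ~= k"
  and R: "RR 0 44 = 0" "RR 0 n = int m" "RR 0 k = 0" "!!i. i <= m ==> RR i 45 = 1"
  and step: "!!i. i < m ==> hr inp J c ((RR i)(k := int i - int m), AA i, oo i) b ((RR (Suc i))(k := int i - int m), AA (Suc i), oo (Suc i))"
 shows "hr inp J (Rep k n c) (RR 0, AA 0, oo 0) (m * (b + 3) + 3) ((RR m)(k := 0), AA m, oo m)"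
proof -
 let ?f = "hat inp J"
 define st where "st i = ((RR i)(k := int i - int m), AA i, oo i)" for i
 have one: "hp ?f hts (c ;; Block [HAdd k k 45]) (st i) (b + 1) (%x. x = st (Suc i))" if i: "i < m" for i
 proof (rule hp_Seq[where ?b1.0 = b and ?b2.0 = 1])
  show "hp ?f hts c (st i) b (%s1. hp ?f hts (Block [HAdd k k 45]) s1 1 (%x. x = st (Suc i)))"
  proof (rule hp_mono[OF step[OF i, unfolded hr_def, folded st_def] order_refl])
   fix s1 assume s1: "s1 = ((RR (Suc i))(k := int i - int m), AA (Suc i), oo (Suc i))"
   have "RR (Suc i) 45 = 1" using R(4) i by simp
   then show "hp ?f hts (Block [HAdd k k 45]) s1 1 (%x. x = st (Suc i))"
    unfolding s1 st_def using k by (intro hp_Block) (auto simp: fun_eq_iff)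
  qed
 qed simp
 have "hp ?f hts (Loop k (c ;; Block [HAdd k k 45])) (st 0) (m * (b + 1 + 2) + 2) (%s. s = st m)"
 proof (rule hp_for[where I = "%i s. s = st i"])
  show "i < m ==> s = st i ==> hts k s = Some True & hp ?f hts (c ;; Block [HAdd k k 45]) s (b + 1) (%s. s = st (Suc i))" for i s using one[of i] k by (auto simp: hts_def st_def)
  show "s = st m ==> hts k s = Some False" for s using k by (auto simp: hts_def st_def)
 qed simp
 then have L: "hp ?f hts (Loop k (c ;; Block [HAdd k k 45])) ((RR 0)(k := - int m), AA 0, oo 0) (m * (b + 3) + 2)
  (%s. s = ((RR m)(k := 0), AA m, oo m))" by (simp add: st_def numeral_3_eq_3 add.commute)
 show ?thesis unfolding hr_def Rep_def by (rule hp_Seq[where ?b1.0 = 1 and ?b2.0 = "m * (b + 3) + 2"], rule hp_Block) (use L k R in auto)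
qed

lemma hr_For:
 assumes k: "k < 44" "n < 46" "n ~= k" "j < 44" "j ~= k" "j ~= n"
  and R: "RR 0 44 = 0" "RR 0 n = int m" "RR 0 k = 0" "!!i. i <= m ==> RR i 45 = 1" "RR 0 j = 0" "RR m k = 0" "RR m j = 0"
  and step: "!!i. i < m ==> hr inp J c ((RR i)(j := int i, k := int i - int m), AA i, oo i) b
    ((RR (Suc i))(j := int i, k := int i - int m), AA (Suc i), oo (Suc i))"
 shows "hr inp J (For j k n c) (RR 0, AA 0, oo 0) (m * (b + 4) + 4) (RR m, AA m, oo m)"
proof -
 define RS where "RS i = (RR i)(j := int i)" for i
 have RS0: "RS 0 = RR 0" using R(5) by (auto simp: RS_def)
 have 1: "hr inp J (Rep k n (c ;; Block [HAdd j j 45])) (RS 0, AA 0, oo 0) (m * (b + 1 + 3) + 3) ((RS m)(k := 0), AA m, oo m)"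
 proof (rule hr_Rep[where RR = RS])
  fix i assume i: "i < m"
  have "RR (Suc i) 45 = 1" using R(4) i by simp
  then have 2: "hr inp J (Block [HAdd j j 45]) ((RR (Suc i))(j := int i, k := int i - int m), AA (Suc i), oo (Suc i)) 1
   ((RS (Suc i))(k := int i - int m), AA (Suc i), oo (Suc i))" using k by (intro hr_Blk) (auto simp: RS_def fun_eq_iff)
  show "hr inp J (c ;; Block [HAdd j j 45]) ((RS i)(k := int i - int m), AA i, oo i) (b + 1)
   ((RS (Suc i))(k := int i - int m), AA (Suc i), oo (Suc i))" by (rule hr_Seq[OF step[OF i, folded RS_def] 2])
 qed (use k R in \<open>auto simp: RS_def\<close>)
 have 2: "hr inp J (Block [HConst j 0]) ((RS m)(k := 0), AA m, oo m) 1 (RR m, AA m, oo m)" using k R by (intro hr_Blk) (auto simp: RS_def fun_eq_iff)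
 show ?thesis unfolding For_def using hr_conv[OF hr_Seq[OF 1 2], of "m * (b + 4) + 4" "(RR m, AA m, oo m)"] by (simp add: RS0 algebra_simps)
qed

section \<open>Shifts, products, bit lengths and maxima\<close>

definition shl :: "nat => nat => hatom com" where
 "shl x c = Rep 43 c (Block [HAdd x x x])"

definition shr :: "nat => nat => hatom com" where
 "shr x c = Rep 43 c (Block [HHalf x x])"

lemma shl_correct:
 assumes "x < 43" "c < 43" "x ~= c" "R 44 = 0" "R 45 = 1" "R 43 = 0" "R c = int m" "m <= Z" "1 <= Z"
 shows "hr inp J (shl x c) (R, A, out) (7 * Z) (R(x := R x * 2 ^ m), A, out)"
proof -
 have "hr inp J (shl x c) (R(x := R x * 2 ^ 0), A, out) (m * (1 + 3) + 3) ((R(x := R x * 2 ^ m))(43 := 0), A, out)"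
  unfolding shl_def by (rule hr_Rep[where RR = "%i. R(x := R x * 2 ^ i)"])
   (use assms in \<open>auto intro!: hr_Blk simp: fun_eq_iff\<close>)
 then show ?thesis by (rule hr_conv2) (use assms in \<open>auto simp: fun_eq_iff\<close>)
qed

lemma shr_correct:
 assumes "x < 43" "c < 43" "x ~= c" "R 44 = 0" "R 45 = 1" "R 43 = 0" "R c = int m" "m <= Z" "1 <= Z"
 shows "hr inp J (shr x c) (R, A, out) (7 * Z) (R(x := R x div 2 ^ m), A, out)"
proof -
 have "hr inp J (shr x c) (R(x := R x div 2 ^ 0), A, out) (m * (1 + 3) + 3) ((R(x := R x div 2 ^ m))(43 := 0), A, out)"
  unfolding shr_def
 proof (rule hr_Rep[where RR = "%i. R(x := R x div 2 ^ i)"])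
  fix i
  have "R x div 2 ^ i div 2 = R x div 2 ^ Suc i" by (rule div_pow_Suc[symmetric])
  then show "hr inp J (Block [HHalf x x]) ((R(x := R x div 2 ^ i))(43 := int i - int m), A, out) 1
   ((R(x := R x div 2 ^ Suc i))(43 := int i - int m), A, out)" using assms by (intro hr_Blk) (auto simp: fun_eq_iff simp del: power_Suc)
 qed (use assms in auto)
 then show ?thesis by (rule hr_conv2) (use assms in \<open>auto simp: fun_eq_iff\<close>)
qed

fun bl :: "nat => nat" where
 "bl n = (if n = 0 then 0 else Suc (bl (n div 2)))"

declare bl.simps [simp del]

lemma bl_0 [simp]: "bl 0 = 0" by (simp add: bl.simps)

lemma less_bl: "n < 2 ^ bl n"
proof (induction n rule: bl.induct)
 case (1 n)
 then show ?case by (subst bl.simps) auto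
qed

lemma bl_least: "n < 2 ^ k ==> bl n <= k"
proof (induction n arbitrary: k rule: bl.induct)
 case (1 n)
 show ?case
 proof (cases "n = 0")
  case False
  then have k: "k ~= 0" using 1(2) by (cases k) auto
  then have "n div 2 < 2 ^ (k - 1)" using 1(2) by (cases k) auto
  then show ?thesis using 1(1)[OF False, of "k - 1"] False k by (subst bl.simps) auto
 qed simp
qed

lemma bl_le: "0 < n ==> 2 ^ (bl n - 1) <= n" using bl_least[of n "bl n - 1"] by (metis bl.simps diff_Suc_1 not_less not_less_eq_eq order_refl)

text \<open>Binary multiplication by halving \<open>z\<close> and doubling \<open>y\<close>.
  Register 42 receives minus the lowest bit of \<open>z\<close>, the form in which it can be
  tested.\<close>

definition mulc :: "nat => nat => nat => hatom com" where
 "mulc x y z = Block [HAdd 40 y 44, HAdd 41 z 44, HSub 42 44 41] ;;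
   Loop 42 (Block [HHalf 43 41, HSub 42 41 43, HSub 42 43 42] ;; Cond 42 (Block [HAdd x x 40]) (Block []) ;;
    Block [HAdd 40 40 40, HAdd 41 43 44, HSub 42 44 41]) ;; Block [HConst 40 0, HConst 43 0]"

lemma mulc_loop:
 assumes "x < 40" "R 44 = 0"
 shows "hr inp J (Loop 42 (Block [HHalf 43 41, HSub 42 41 43, HSub 42 43 42] ;; Cond 42 (Block [HAdd x x 40]) (Block []) ;;
    Block [HAdd 40 40 40, HAdd 41 43 44, HSub 42 44 41]))
   (R(x := v, 40 := yy, 41 := int z, 42 := - int z, 43 := h), A, out) (bl z * 11 + 2)
   (R(x := v + yy * int z, 40 := yy * 2 ^ bl z, 41 := 0, 42 := 0, 43 := if z = 0 then h else 0), A, out)"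
proof (induction z arbitrary: v yy h rule: bl.induct)
 case (1 z)
 show ?case
 proof (cases "z = 0")
  case True
  then show ?thesis by (intro hr_conv[OF hr_LoopF]) (auto simp: fun_eq_iff)
 next
  case False
  let ?z = "z div 2"
  let ?v = "if odd z then v + yy else v"
  let ?b1 = "Block [HHalf 43 41, HSub 42 41 43, HSub 42 43 42]"
  let ?b2 = "Cond 42 (Block [HAdd x x 40]) (Block [])"
  let ?b3 = "Block [HAdd 40 40 40, HAdd 41 43 44, HSub 42 44 41]"
  have hz: "int z div 2 = int ?z" by simp
  have od: "int ?z - (int z - int ?z) = - int (z mod 2)" using mult_div_mod_eq[of 2 z] by linarith
  have 1: "hr inp J ?b1 (R(x := v, 40 := yy, 41 := int z, 42 := - int z, 43 := h), A, out) 3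
   (R(x := v, 40 := yy, 41 := int z, 42 := - int (z mod 2), 43 := int ?z), A, out)" using assms by (intro hr_Blk) (auto simp: fun_eq_iff hz od)
  have 2: "hr inp J ?b2 (R(x := v, 40 := yy, 41 := int z, 42 := - int (z mod 2), 43 := int ?z), A, out) (max 1 0 + 2)
   (R(x := ?v, 40 := yy, 41 := int z, 42 := - int (z mod 2), 43 := int ?z), A, out)" by (rule hr_Cond) (use assms in \<open>auto intro!: hr_Blk simp: fun_eq_iff odd_iff_mod_2_eq_one\<close>)
  have 3: "hr inp J ?b3 (R(x := ?v, 40 := yy, 41 := int z, 42 := - int (z mod 2), 43 := int ?z), A, out) 3
   (R(x := ?v, 40 := 2 * yy, 41 := int ?z, 42 := - int ?z, 43 := int ?z), A, out)" using assms by (intro hr_Blk) (auto simp: fun_eq_iff)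
  note body = hr_Seq[OF 1 hr_Seq[OF 2 3]]
  note IH = "1.IH"[OF False, of ?v "2 * yy" "int ?z"]
  have "?v + 2 * yy * int ?z = v + yy * int z"
  proof (cases "odd z")
   case True
   then have "int z = 2 * int ?z + 1" by (metis int_ops(2) odd_two_times_div_two_succ of_nat_add of_nat_mult of_nat_numeral)
   then show ?thesis using True by (simp add: algebra_simps)
  next
   case False
   then have "int z = 2 * int ?z" by (metis even_two_times_div_two of_nat_mult of_nat_numeral)
   then show ?thesis using False by (simp add: algebra_simps)
  qed
  then have IH': "hr inp J (Loop 42 (?b1 ;; ?b2 ;; ?b3)) (R(x := ?v, 40 := 2 * yy, 41 := int ?z, 42 := - int ?z, 43 := int ?z), A, out) (bl ?z * 11 + 2)
   (R(x := v + yy * int z, 40 := yy * 2 ^ bl z, 41 := 0, 42 := 0, 43 := 0), A, out)" by (intro hr_conv[OF IH]) (use False in \<open>auto simp: fun_eq_iff bl.simps[of z]\<close>)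
  show ?thesis by (rule hr_conv[OF hr_LoopT[OF _ _ body IH']]) (use False in \<open>auto simp: bl.simps[of z]\<close>)
 qed
qed

lemma mulc_correct:
 assumes "x < 40" "y < 40" "z < 40" "R 44 = 0" "R 40 = 0" "R 41 = 0" "R 42 = 0" "R 43 = 0" "0 <= R z" "R z < 2 ^ Z" "1 <= Z"
 shows "hr inp J (mulc x y z) (R, A, out) (18 * Z) (R(x := R x + R y * R z), A, out)"
proof -
 define zz where "zz = nat (R z)"
 have z: "R z = int zz" using assms by (simp add: zz_def)
 have "zz < 2 ^ Z" using assms by (simp add: zz_def nat_less_iff)
 then have bl: "bl zz <= Z" by (rule bl_least)
 have 1: "hr inp J (Block [HAdd 40 y 44, HAdd 41 z 44, HSub 42 44 41]) (R, A, out) 3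
  (R(x := R x, 40 := R y, 41 := int zz, 42 := - int zz, 43 := 0), A, out)" using assms z by (intro hr_Blk) (auto simp: fun_eq_iff)
 note 2 = mulc_loop[where R = R and x = x and v = "R x" and yy = "R y" and z = zz and h = 0 and A = A and out = out and inp = inp and J = J, OF assms(1,4)]
 have 3: "hr inp J (Block [HConst 40 0, HConst 43 0])
   (R(x := R x + R y * int zz, 40 := R y * 2 ^ bl zz, 41 := 0, 42 := 0, 43 := if zz = 0 then 0 else 0), A, out) 2
   (R(x := R x + R y * R z), A, out)" using assms z by (intro hr_Blk) (auto simp: fun_eq_iff)
 show ?thesis unfolding mulc_def by (rule hr_conv[OF hr_Seq[OF 1 hr_Seq[OF 2 3]]]) (use bl assms in auto)
qed

definition bitlen :: "nat => nat => hatom com" where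
 "bitlen x y = Block [HConst x 0, HAdd 40 y 44, HSub 41 44 40] ;;
   Loop 41 (Block [HAdd x x 45, HHalf 40 40, HSub 41 44 40])"

lemma bitlen_loop:
 assumes "x < 40" "R 44 = 0" "R 45 = 1"
 shows "hr inp J (Loop 41 (Block [HAdd x x 45, HHalf 40 40, HSub 41 44 40]))
   (R(x := v, 40 := int z, 41 := - int z), A, out) (bl z * 5 + 2) (R(x := v + int (bl z), 40 := 0, 41 := 0), A, out)"
proof (induction z arbitrary: v rule: bl.induct)
 case (1 z)
 show ?case
 proof (cases "z = 0")
  case True
  then show ?thesis by (intro hr_conv[OF hr_LoopF]) (auto simp: fun_eq_iff)
 next
  case False
  let ?b = "Block [HAdd x x 45, HHalf 40 40, HSub 41 44 40]"
  have hz: "int z div 2 = int (z div 2)" by simp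
  have 1: "hr inp J ?b (R(x := v, 40 := int z, 41 := - int z), A, out) 3 (R(x := v + 1, 40 := int (z div 2), 41 := - int (z div 2)), A, out)" using assms by (intro hr_Blk) (auto simp: fun_eq_iff hz)
  have b: "bl z = Suc (bl (z div 2))" using False by (subst bl.simps) simp
  show ?thesis by (rule hr_conv[OF hr_LoopT[OF _ _ 1 "1.IH"[OF False, of "v + 1"]]]) (use False in \<open>auto simp: b fun_eq_iff\<close>)
 qed
qed

lemma bitlen_correct:
 assumes "x < 40" "y < 40" "x ~= y" "R 44 = 0" "R 45 = 1" "R 40 = 0" "R 41 = 0" "R y = int z" "bl z <= Z" "1 <= Z"
 shows "hr inp J (bitlen x y) (R, A, out) (10 * Z) (R(x := int (bl z)), A, out)"
proof -
 have 1: "hr inp J (Block [HConst x 0, HAdd 40 y 44, HSub 41 44 40]) (R, A, out) 3 (R(x := 0, 40 := int z, 41 := - int z), A, out)" using assms by (intro hr_Blk) (auto simp: fun_eq_iff)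
 show ?thesis unfolding bitlen_def by (rule hr_conv[OF hr_Seq[OF 1 bitlen_loop[OF assms(1,4,5)]]]) (use assms in \<open>auto simp: fun_eq_iff\<close>)
qed

primrec mxa :: "int => (nat => int) => nat => int" where
 "mxa v f 0 = v"
| "mxa v f (Suc n) = max (mxa v f n) \<bar>f n\<bar>"

definition maxabs :: "nat => nat => nat => hatom com" where
 "maxabs x f n = For 38 39 n (Block [HLoad 40 f 38] ;; Cond 40 (Block [HSub 40 44 40]) (Block []) ;;
   Block [HSub 41 x 40] ;; Cond 41 (Block [HAdd x 40 44]) (Block []) ;; Block [HConst 40 0, HConst 41 0])"

lemma maxabs_correct:
 assumes x: "x < 38" "n < 38" "x ~= n" "f < 16" and R: "R 44 = 0" "R 45 = 1" "R 38 = 0" "R 39 = 0" "R 40 = 0" "R 41 = 0" "R n = int m"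
  and m: "m <= J" "m <= Z" "1 <= Z"
 shows "hr inp J (maxabs x f n) (R, A, out) (18 * Z) (R(x := mxa (R x) (A f) m), A, out)"
proof -
 have "hr inp J (maxabs x f n) (R(x := mxa (R x) (A f) 0), A, out) (m * (10 + 4) + 4) (R(x := mxa (R x) (A f) m), A, out)"
  unfolding maxabs_def
 proof (rule hr_For[where RR = "%i. R(x := mxa (R x) (A f) i)"])
  fix i assume i: "i < m"
  let ?R = "(R(x := mxa (R x) (A f) i))(38 := int i, 39 := int i - int m)"
  let ?v = "A f i"
  have 1: "hr inp J (Block [HLoad 40 f 38]) (?R, A, out) 1 (?R(40 := ?v), A, out)" using x i m by (intro hr_Blk) (auto simp: fun_eq_iff)
  have 2: "hr inp J (Cond 40 (Block [HSub 40 44 40]) (Block [])) (?R(40 := ?v), A, out) (max 1 0 + 2) (?R(40 := \<bar>?v\<bar>), A, out)" by (rule hr_Cond) (use x R in \<open>auto intro!: hr_Blk simp: fun_eq_iff\<close>)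
  have 3: "hr inp J (Block [HSub 41 x 40]) (?R(40 := \<bar>?v\<bar>), A, out) 1 (?R(40 := \<bar>?v\<bar>, 41 := mxa (R x) (A f) i - \<bar>?v\<bar>), A, out)" using x by (intro hr_Blk) (auto simp: fun_eq_iff)
  have 4: "hr inp J (Cond 41 (Block [HAdd x 40 44]) (Block [])) (?R(40 := \<bar>?v\<bar>, 41 := mxa (R x) (A f) i - \<bar>?v\<bar>), A, out) (max 1 0 + 2)
   (?R(40 := \<bar>?v\<bar>, 41 := mxa (R x) (A f) i - \<bar>?v\<bar>, x := mxa (R x) (A f) (Suc i)), A, out)" by (rule hr_Cond) (use x R in \<open>auto intro!: hr_Blk simp: fun_eq_iff\<close>)
  have 5: "hr inp J (Block [HConst 40 0, HConst 41 0]) (?R(40 := \<bar>?v\<bar>, 41 := mxa (R x) (A f) i - \<bar>?v\<bar>, x := mxa (R x) (A f) (Suc i)), A, out) 2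
   ((R(x := mxa (R x) (A f) (Suc i)))(38 := int i, 39 := int i - int m), A, out)" using x R by (intro hr_Blk) (auto simp: fun_eq_iff)
  show "hr inp J (Block [HLoad 40 f 38] ;; Cond 40 (Block [HSub 40 44 40]) (Block []) ;;
   Block [HSub 41 x 40] ;; Cond 41 (Block [HAdd x 40 44]) (Block []) ;; Block [HConst 40 0, HConst 41 0]) (?R, A, out) 10
   ((R(x := mxa (R x) (A f) (Suc i)))(38 := int i, 39 := int i - int m), A, out)" by (rule hr_conv[OF hr_Seq[OF 1 hr_Seq[OF 2 hr_Seq[OF 3 hr_Seq[OF 4 5]]]]]) auto
 qed (use x R in auto)
 then show ?thesis by (rule hr_conv2) (use m in \<open>auto simp: fun_eq_iff\<close>)
qed

section \<open>Savitch's recursion with an explicit stack\<close>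

text \<open>Registers 24 to 43 are scratch and are returned to 0, which keeps specifications free of
  intermediate values.\<close>

definition clean :: "(nat => int) => bool" where
 "clean R \<longleftrightarrow> R 44 = 0 & R 45 = 1 & (\<forall>x. 24 <= x & x < 44 \<longrightarrow> R x = 0)"

lemma cleanD: "clean R ==> R 44 = 0" "clean R ==> R 45 = 1"
 "clean R ==> 24 <= (numeral k :: nat) ==> numeral k < (44::nat) ==> R (numeral k) = 0" by (auto simp: clean_def)

text \<open>Equality is detected by two sign tests, on the difference and on its negative.\<close>

definition base_body :: "hatom com" where
 "base_body = Block [HLoad 31 3 29] ;; shl 31 25 ;; Block [HSub 31 31 26, HSub 32 44 31] ;;
   Cond 31 (Block []) (Cond 32 (Block []) (Block [HLoad 33 4 29] ;; shl 33 25 ;; Block [HSub 34 33 23] ;;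
    Cond 34 (Block [HAdd 23 33 44]) (Block []))) ;;
   Block [HConst 31 0, HConst 32 0, HConst 33 0, HConst 34 0]"

definition base_code :: "hatom com" where
 "base_code = Block [HLoad 25 7 22, HLoad 26 8 22, HLoad 27 9 22, HSub 26 26 27, HConst 27 0, HAdd 23 13 44] ;;
   shr 25 6 ;; Block [HSub 28 44 26] ;; Cond 26 (Block []) (Cond 28 (Block []) (Block [HConst 23 0])) ;;
   For 29 30 4 base_body ;; Block [HConst 25 0, HConst 26 0, HConst 28 0]"

text \<open>A digit of \<open>\<kappa>\<close> is extracted by shifting down, shifting up again and
  subtracting. Register 24 is consumed digit by digit, and register 29 carries the exponent of the
  current summand.\<close>

definition mid_body :: "hatom com" where
 "mid_body = Block [HLoad 33 6 31] ;; shr 33 27 ;; Block [HSub 33 33 9, HAdd 34 24 44] ;; shr 34 8 ;;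
   Block [HAdd 35 34 44] ;; shl 35 8 ;; Block [HSub 35 24 35, HAdd 33 33 35, HAdd 24 34 44] ;; shl 33 29 ;;
   Block [HAdd 30 30 33, HAdd 29 29 10, HConst 33 0, HConst 34 0, HConst 35 0]"

definition mid_code :: "hatom com" where
 "mid_code = Block [HSub 26 22 45, HConst 27 1] ;; shl 27 26 ;; Block [HLoad 28 7 22, HAdd 27 27 28] ;; shr 27 6 ;;
   Block [HAdd 29 27 44] ;; For 31 32 2 mid_body ;;
   Block [HStore 14 22 30, HStore 7 26 28, HLoad 36 8 22, HStore 8 26 36, HStore 9 26 30, HStore 13 22 44,
    HAdd 22 26 44, HSub 21 44 45, HConst 26 0, HConst 27 0, HConst 28 0, HConst 29 0, HConst 30 0, HConst 36 0]"

definition call_code :: "hatom com" where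
 "call_code = Block [HSub 24 44 22] ;; Cond 24 (Block [HStore 10 22 44, HStore 11 22 13, HConst 21 0, HConst 24 0])
   (base_code ;; Block [HConst 21 1, HConst 22 1])"

definition next_code :: "hatom com" where
 "next_code = Block [HLoad 24 10 22, HSub 25 24 15] ;; Cond 25 mid_code (Block [HLoad 23 11 22, HAdd 22 22 45, HConst 21 1]) ;;
   Block [HConst 24 0, HConst 25 0]"

definition ret_code :: "hatom com" where
 "ret_code = Block [HLoad 24 13 22, HSub 24 24 45] ;; Cond 24
   (Block [HConst 24 0, HStore 12 22 23, HStore 13 22 45, HSub 26 22 45, HConst 27 1] ;; shl 27 26 ;;
   Block [HLoad 28 7 22, HAdd 27 27 28, HStore 7 26 27, HLoad 28 14 22, HStore 8 26 28, HLoad 28 9 22, HStore 9 26 28,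
    HAdd 22 26 44, HSub 21 44 45, HConst 26 0, HConst 27 0, HConst 28 0])
   (Block [HLoad 26 12 22, HAdd 26 26 23, HLoad 27 11 22, HSub 27 26 27] ;; Cond 27 (Block [HStore 11 22 26]) (Block []) ;;
   Block [HLoad 26 10 22, HAdd 26 26 45, HStore 10 22 26, HConst 21 0, HConst 26 0, HConst 27 0])"

text \<open>One transition of a state machine. Register 21 is the mode: -1 call, 0 try the next
  midpoint, 1 return. Register 22 is the level, register 23 the returned value, and register 20 is
  negative while the level is at most \<open>2 * sg\<close>. Only one call per level is active, so
  the level indexes the stack. Arrays 7 to 14 hold the first step, the two end points, the midpoint
  counter, the best value, the value of the first half, the flag for the second half, and the
  midpoint.\<close>

definition sav_body :: "hatom com" where
 "sav_body = Cond 21 call_code (Block [HSub 37 21 45] ;; Cond 37 (Block [HConst 37 0] ;; next_code) (Block [HConst 37 0] ;; ret_code)) ;;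
   Block [HSub 20 22 14, HSub 20 20 45]"

locale sav =
 fixes inp :: "int list" and J N m sg e q Z :: nat and BIG :: int and a w g :: "nat => int"
  and R0 :: "nat => int" and out :: "int list"
 assumes R0: "clean R0" "R0 2 = int m" "R0 4 = int N" "R0 6 = int sg" "R0 8 = int (e + 1)" "R0 9 = 2 ^ e" "R0 10 = int q"
   "R0 13 = BIG" "R0 14 = int (2 * sg)" "R0 15 = int (2 ^ ((e + 1) * m))"
  and J: "N <= J" "m <= J" "2 * sg < J"
  and Z: "1 <= Z" "sg <= Z" "2 * sg <= Z" "2 ^ sg <= Z" "e + 1 <= Z" "2 ^ sg + q * m <= Z" "N <= Z" "m <= Z"
begin

definition tabs :: "(nat => nat => int) => bool" where
 "tabs A \<longleftrightarrow> (\<forall>j<N. A 3 j = a j) & (\<forall>j<N. A 4 j = w j) & (\<forall>k<m. A 6 k = g k)"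

lemma base_loop:
 assumes A: "tabs A" and lv: "lv <= Z" and R: "clean R" "R 4 = int N"
 shows "hr inp J (For 29 30 4 base_body) (R(25 := int lv, 26 := W, 28 := - W, 23 := v), A, out) (N * (31 * Z + 4) + 4)
  (R(25 := int lv, 26 := W, 28 := - W, 23 := bmin v (%j. a j * 2 ^ lv = W) (%j. w j * 2 ^ lv) N), A, out)"
proof -
 let ?f = "%i. bmin v (%j. a j * 2 ^ lv = W) (%j. w j * 2 ^ lv) i"
 have "hr inp J (For 29 30 4 base_body) (R(25 := int lv, 26 := W, 28 := - W, 23 := ?f 0), A, out) (N * (31 * Z + 4) + 4)
  (R(25 := int lv, 26 := W, 28 := - W, 23 := ?f N), A, out)"
 proof (rule hr_For[where RR = "%i. R(25 := int lv, 26 := W, 28 := - W, 23 := ?f i)"])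
  fix i assume i: "i < N"
  let ?R = "R(25 := int lv, 26 := W, 28 := - W, 23 := ?f i, 29 := int i, 30 := int i - int N)"
  let ?d = "a i * 2 ^ lv - W"
  have ai: "A 3 i = a i" "A 4 i = w i" using A i by (auto simp: tabs_def)
  have iJ: "i < J" using i J by simp
  have 1: "hr inp J (Block [HLoad 31 3 29]) (?R, A, out) 1 (?R(31 := a i), A, out)" by (intro hr_Blk) (use iJ ai in \<open>auto simp: fun_eq_iff\<close>)
  have 2: "hr inp J (shl 31 25) (?R(31 := a i), A, out) (7 * Z) (?R(31 := a i * 2 ^ lv), A, out)" by (intro hr_conv[OF shl_correct[where m = lv and Z = Z]]) (use R lv Z in \<open>auto simp: cleanD\<close>)
  have 3: "hr inp J (Block [HSub 31 31 26, HSub 32 44 31]) (?R(31 := a i * 2 ^ lv), A, out) 2 (?R(31 := ?d, 32 := - ?d), A, out)" by (intro hr_Blk) (use R in \<open>auto simp: fun_eq_iff cleanD\<close>)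
  let ?c4 = "Cond 31 (Block []) (Cond 32 (Block []) (Block [HLoad 33 4 29] ;; shl 33 25 ;; Block [HSub 34 33 23] ;;
    Cond 34 (Block [HAdd 23 33 44]) (Block [])))"
  \<comment> \<open>The branches leave different values in scratch registers 33 and 34, which are
    cleared right afterwards.\<close>
  have 4: "\<exists>x y. hr inp J ?c4 (?R(31 := ?d, 32 := - ?d), A, out) (7 * Z + 9) (?R(31 := ?d, 32 := - ?d, 33 := x, 34 := y, 23 := ?f (Suc i)), A, out)"
  proof (cases "?d = 0")
   case False
   have "hr inp J ?c4 (?R(31 := ?d, 32 := - ?d), A, out) (7 * Z + 9) (?R(31 := ?d, 32 := - ?d, 33 := 0, 34 := 0, 23 := ?f (Suc i)), A, out)"
   proof (cases "?d < 0")
    case True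
    show ?thesis by (rule hr_conv[OF hr_CondT[OF _ _ hr_Block[OF execs.simps(1)]]]) (use True False R in \<open>auto simp: fun_eq_iff cleanD\<close>)
   next
    case ge: False
    show ?thesis by (rule hr_conv[OF hr_CondF[OF _ _ hr_CondT[OF _ _ hr_Block[OF execs.simps(1)]]]]) (use ge False R in \<open>auto simp: fun_eq_iff cleanD\<close>)
   qed
   then show ?thesis by blast
  next
   case True
   let ?w = "w i * 2 ^ lv"
   let ?R1 = "?R(31 := ?d, 32 := - ?d)"
   have a1: "hr inp J (Block [HLoad 33 4 29]) (?R1, A, out) 1 (?R1(33 := w i), A, out)" by (intro hr_Blk) (use iJ ai in \<open>auto simp: fun_eq_iff\<close>)
   have a2: "hr inp J (shl 33 25) (?R1(33 := w i), A, out) (7 * Z) (?R1(33 := ?w), A, out)" by (intro hr_conv[OF shl_correct[where m = lv and Z = Z]]) (use R lv Z in \<open>auto simp: cleanD\<close>)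
   have a3: "hr inp J (Block [HSub 34 33 23]) (?R1(33 := ?w), A, out) 1 (?R1(33 := ?w, 34 := ?w - ?f i), A, out)" by (intro hr_Blk) (auto simp: fun_eq_iff)
   have a4: "hr inp J (Cond 34 (Block [HAdd 23 33 44]) (Block [])) (?R1(33 := ?w, 34 := ?w - ?f i), A, out) (max 1 0 + 2)
    (?R1(33 := ?w, 34 := ?w - ?f i, 23 := ?f (Suc i)), A, out)" by (rule hr_Cond) (use True R in \<open>auto intro!: hr_Blk simp: fun_eq_iff cleanD min_def\<close>)
   have "hr inp J ?c4 (?R1, A, out) (7 * Z + 9) (?R1(33 := ?w, 34 := ?w - ?f i, 23 := ?f (Suc i)), A, out)" by (rule hr_conv[OF hr_CondF[OF _ _ hr_CondF[OF _ _ hr_Seq[OF a1 hr_Seq[OF a2 hr_Seq[OF a3 a4]]]]]]) (use True in auto)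
   then show ?thesis by blast
  qed
  then obtain x y where 4: "hr inp J ?c4 (?R(31 := ?d, 32 := - ?d), A, out) (7 * Z + 9) (?R(31 := ?d, 32 := - ?d, 33 := x, 34 := y, 23 := ?f (Suc i)), A, out)" by blast
  have 5: "hr inp J (Block [HConst 31 0, HConst 32 0, HConst 33 0, HConst 34 0]) (?R(31 := ?d, 32 := - ?d, 33 := x, 34 := y, 23 := ?f (Suc i)), A, out) 4
   (R(25 := int lv, 26 := W, 28 := - W, 23 := ?f (Suc i), 29 := int i, 30 := int i - int N), A, out)" by (intro hr_Blk) (use R in \<open>auto simp: fun_eq_iff cleanD\<close>)
  show "hr inp J base_body (?R, A, out) (31 * Z) (R(25 := int lv, 26 := W, 28 := - W, 23 := ?f (Suc i), 29 := int i, 30 := int i - int N), A, out)"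
   unfolding base_body_def by (rule hr_conv[OF hr_Seq[OF 1 hr_Seq[OF 2 hr_Seq[OF 3 hr_Seq[OF 4 5]]]]]) (use Z in auto)
 qed (use R in \<open>auto simp: cleanD\<close>)
 then show ?thesis by simp
qed

lemma base_code_correct:
 assumes A: "tabs A" and t: "A 7 0 = int t" "t < 2 ^ sg * 2 ^ sg"
  and R: "clean R" "R 4 = int N" "R 6 = int sg" "R 13 = BIG" "R 22 = 0"
 shows "hr inp J base_code (R, A, out) (N * (31 * Z + 4) + 7 * Z + 19)
  (R(23 := base_dist N a w sg BIG t (A 8 0) (A 9 0)), A, out)"
proof -
 let ?W = "A 8 0 - A 9 0" and ?lv = "t div 2 ^ sg"
 let ?v = "if A 8 0 = A 9 0 then 0 else BIG"
 have lv: "?lv <= Z" using t(2) Z by (meson div_less_iff_less_mult less_imp_le_nat less_le_trans pos2 zero_less_power)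
 have J0: "0 < J" using J by simp
 have 1: "hr inp J (Block [HLoad 25 7 22, HLoad 26 8 22, HLoad 27 9 22, HSub 26 26 27, HConst 27 0, HAdd 23 13 44]) (R, A, out) 6
  (R(25 := int t, 26 := ?W, 23 := BIG), A, out)" by (intro hr_Blk) (use R t J0 in \<open>auto simp: fun_eq_iff cleanD\<close>)
 have 2: "hr inp J (shr 25 6) (R(25 := int t, 26 := ?W, 23 := BIG), A, out) (7 * Z) (R(25 := int ?lv, 26 := ?W, 23 := BIG), A, out)" by (intro hr_conv[OF shr_correct[where m = sg and Z = Z]]) (use R Z in \<open>auto simp: cleanD zdiv_int fun_eq_iff\<close>)
 have 3: "hr inp J (Block [HSub 28 44 26]) (R(25 := int ?lv, 26 := ?W, 23 := BIG), A, out) 1 (R(25 := int ?lv, 26 := ?W, 23 := BIG, 28 := - ?W), A, out)" by (intro hr_Blk) (use R in \<open>auto simp: fun_eq_iff cleanD\<close>)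
 have 4: "hr inp J (Cond 26 (Block []) (Cond 28 (Block []) (Block [HConst 23 0]))) (R(25 := int ?lv, 26 := ?W, 23 := BIG, 28 := - ?W), A, out) (max 0 (max 0 1 + 2) + 2)
  (R(25 := int ?lv, 26 := ?W, 28 := - ?W, 23 := ?v), A, out)" by (rule hr_Cond; (rule hr_Cond)?) (auto intro!: hr_Blk simp: fun_eq_iff)
 note 5 = base_loop[OF A lv R(1,2), of ?W ?v]
 have 6: "hr inp J (Block [HConst 25 0, HConst 26 0, HConst 28 0])
  (R(25 := int ?lv, 26 := ?W, 28 := - ?W, 23 := bmin ?v (%j. a j * 2 ^ ?lv = ?W) (%j. w j * 2 ^ ?lv) N), A, out) 3
  (R(23 := base_dist N a w sg BIG t (A 8 0) (A 9 0)), A, out)" by (intro hr_Blk) (use R in \<open>auto simp: fun_eq_iff cleanD base_dist_def\<close>)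
 show ?thesis unfolding base_code_def by (rule hr_conv[OF hr_Seq[OF 1 hr_Seq[OF 2 hr_Seq[OF 3 hr_Seq[OF 4 hr_Seq[OF 5 6]]]]]]) auto
qed

lemma mid_loop:
 assumes A: "tabs A" and lv: "lv < 2 ^ sg" and R: "clean R" "R 2 = int m" "R 8 = int (e + 1)" "R 9 = 2 ^ e" "R 10 = int q"
 shows "hr inp J (For 31 32 2 mid_body) (R(24 := int \<kappa>, 25 := d, 26 := r1, 27 := int lv, 28 := t, 29 := int lv), A, out) (m * (50 * Z + 4) + 4)
  (R(24 := int (\<kappa> div 2 ^ ((e + 1) * m)), 25 := d, 26 := r1, 27 := int lv, 28 := t, 29 := int (lv + q * m),
    30 := \<Sum>k<m. (g k div 2 ^ lv - 2 ^ e + int (\<kappa> div 2 ^ ((e + 1) * k) mod 2 ^ (e + 1))) * 2 ^ (lv + q * k)), A, out)"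
proof -
 let ?s = "%i. \<Sum>k<i. (g k div 2 ^ lv - 2 ^ e + int (\<kappa> div 2 ^ ((e + 1) * k) mod 2 ^ (e + 1))) * 2 ^ (lv + q * k)"
 let ?RR = "%i. R(24 := int (\<kappa> div 2 ^ ((e + 1) * i)), 25 := d, 26 := r1, 27 := int lv, 28 := t, 29 := int (lv + q * i), 30 := ?s i)"
 have "hr inp J (For 31 32 2 mid_body) (?RR 0, A, out) (m * (50 * Z + 4) + 4) (?RR m, A, out)"
 proof (rule hr_For[where RR = ?RR])
  fix i assume i: "i < m"
  let ?R = "(?RR i)(31 := int i, 32 := int i - int m)"
  let ?k = "\<kappa> div 2 ^ ((e + 1) * i)"
  let ?x = "g i div 2 ^ lv"
  let ?k' = "?k div 2 ^ (e + 1)"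
  have gi: "A 6 i = g i" using A i by (auto simp: tabs_def)
  have iJ: "i < J" using i J by simp
  have lvZ: "lv <= Z" using lv Z by linarith
  have sZ: "lv + q * i <= Z"
  proof -
   have "q * i <= q * m" using i by (intro mult_le_mono2) simp
   then show ?thesis using lv Z by linarith
  qed
  have 1: "hr inp J (Block [HLoad 33 6 31]) (?R, A, out) 1 (?R(33 := g i), A, out)" by (intro hr_Blk) (use iJ gi in \<open>auto simp: fun_eq_iff\<close>)
  have 2: "hr inp J (shr 33 27) (?R(33 := g i), A, out) (7 * Z) (?R(33 := ?x), A, out)" by (intro hr_conv[OF shr_correct[where m = lv and Z = Z]]) (use R lvZ Z in \<open>auto simp: cleanD\<close>)
  have 3: "hr inp J (Block [HSub 33 33 9, HAdd 34 24 44]) (?R(33 := ?x), A, out) 2 (?R(33 := ?x - 2 ^ e, 34 := int ?k), A, out)" by (intro hr_Blk) (use R in \<open>auto simp: fun_eq_iff cleanD\<close>)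
  have kk: "int ?k div 2 ^ (e + 1) = int ?k'" by (metis of_nat_numeral of_nat_power zdiv_int)
  have 4: "hr inp J (shr 34 8) (?R(33 := ?x - 2 ^ e, 34 := int ?k), A, out) (7 * Z) (?R(33 := ?x - 2 ^ e, 34 := int ?k'), A, out)" by (intro hr_conv[OF shr_correct[where m = "e + 1" and Z = Z]]) (use R Z kk in \<open>auto simp: cleanD fun_eq_iff\<close>)
  have 5: "hr inp J (Block [HAdd 35 34 44]) (?R(33 := ?x - 2 ^ e, 34 := int ?k'), A, out) 1 (?R(33 := ?x - 2 ^ e, 34 := int ?k', 35 := int ?k'), A, out)" by (intro hr_Blk) (use R in \<open>auto simp: fun_eq_iff cleanD\<close>)
  have 6: "hr inp J (shl 35 8) (?R(33 := ?x - 2 ^ e, 34 := int ?k', 35 := int ?k'), A, out) (7 * Z)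
    (?R(33 := ?x - 2 ^ e, 34 := int ?k', 35 := int ?k' * 2 ^ (e + 1)), A, out)" by (intro hr_conv[OF shl_correct[where m = "e + 1" and Z = Z]]) (use R Z in \<open>auto simp: cleanD fun_eq_iff\<close>)
  have dig: "int ?k - int ?k' * 2 ^ (e + 1) = int (?k mod 2 ^ (e + 1))"
  proof -
   have "?k = ?k' * 2 ^ (e + 1) + ?k mod 2 ^ (e + 1)" by (rule div_mult_mod_eq[symmetric])
   then have "int ?k = int (?k' * 2 ^ (e + 1) + ?k mod 2 ^ (e + 1))" by (rule arg_cong)
   then show ?thesis by (simp only: of_nat_add of_nat_mult of_nat_power of_nat_numeral)
  qed
  let ?y = "?x - 2 ^ e + int (?k mod 2 ^ (e + 1))"
  have 7: "hr inp J (Block [HSub 35 24 35, HAdd 33 33 35, HAdd 24 34 44]) (?R(33 := ?x - 2 ^ e, 34 := int ?k', 35 := int ?k' * 2 ^ (e + 1)), A, out) 3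
   (?R(33 := ?y, 34 := int ?k', 35 := int (?k mod 2 ^ (e + 1)), 24 := int ?k'), A, out)" by (intro hr_Blk) (use R dig in \<open>auto simp: fun_eq_iff cleanD\<close>)
  have 8: "hr inp J (shl 33 29) (?R(33 := ?y, 34 := int ?k', 35 := int (?k mod 2 ^ (e + 1)), 24 := int ?k'), A, out) (7 * Z)
   (?R(33 := ?y * 2 ^ (lv + q * i), 34 := int ?k', 35 := int (?k mod 2 ^ (e + 1)), 24 := int ?k'), A, out)" by (intro hr_conv[OF shl_correct[where m = "lv + q * i" and Z = Z]]) (use R Z sZ in \<open>auto simp: cleanD fun_eq_iff\<close>)
  have kS: "?k' = \<kappa> div 2 ^ ((e + 1) * Suc i)" by (simp add: div_mult2_eq[symmetric] power_add[symmetric] algebra_simps del: power_Suc)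
  have qS: "int (lv + q * i) + int q = int (lv + q * Suc i)" by (simp add: algebra_simps)
  have 9: "hr inp J (Block [HAdd 30 30 33, HAdd 29 29 10, HConst 33 0, HConst 34 0, HConst 35 0])
   (?R(33 := ?y * 2 ^ (lv + q * i), 34 := int ?k', 35 := int (?k mod 2 ^ (e + 1)), 24 := int ?k'), A, out) 5
   ((?RR (Suc i))(31 := int i, 32 := int i - int m), A, out)" by (intro hr_Blk) (use R kS qS in \<open>auto simp: fun_eq_iff cleanD simp del: of_nat_add\<close>)
  show "hr inp J mid_body (?R, A, out) (50 * Z) ((?RR (Suc i))(31 := int i, 32 := int i - int m), A, out)"
   unfolding mid_body_def by (rule hr_conv[OF hr_Seq[OF 1 hr_Seq[OF 2 hr_Seq[OF 3 hr_Seq[OF 4 hr_Seq[OF 5 hr_Seq[OF 6 hr_Seq[OF 7 hr_Seq[OF 8 9]]]]]]]]]) (use Z in auto)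
 qed (use R in \<open>auto simp: cleanD\<close>)
 then show ?thesis by (rule hr_conv2) (use R in \<open>auto simp: fun_eq_iff cleanD\<close>)
qed

definition st :: "int => nat => int => (nat => nat => int) => hst" where
 "st mo r v A = (R0(20 := int r - int (2 * sg) - 1, 21 := mo, 22 := int r, 23 := v), A, out)"

abbreviation "NN \<equiv> (2::nat) ^ ((e + 1) * m)"
abbreviation "tau \<equiv> N * (31 * Z + 4) + m * (50 * Z + 4) + 14 * Z + 80"

lemma mid_code_correct:
 assumes A: "tabs A" and r: "Suc r <= 2 * sg" and t: "A 7 (Suc r) = int t" "t + 2 ^ r < 2 ^ sg * 2 ^ sg"
  and R: "clean R" "R 2 = int m" "R 8 = int (e + 1)" "R 9 = 2 ^ e" "R 10 = int q" "R 6 = int sg" "R 22 = int (Suc r)"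
 shows "\<exists>y. hr inp J mid_code (R(24 := int \<kappa>, 25 := d), A, out) (m * (50 * Z + 4) + 14 * Z + 30)
  (R(24 := y, 25 := d, 21 := -1, 22 := int r), A(14 := (A 14)(Suc r := mid_point q m sg e g (t + 2 ^ r) \<kappa>), 7 := (A 7)(r := int t),
   8 := (A 8)(r := A 8 (Suc r)), 9 := (A 9)(r := mid_point q m sg e g (t + 2 ^ r) \<kappa>), 13 := (A 13)(Suc r := 0)), out)"
proof -
 let ?lv = "(t + 2 ^ r) div 2 ^ sg"
 let ?m = "mid_point q m sg e g (t + 2 ^ r) \<kappa>"
 have lv: "?lv < 2 ^ sg" using t(2) by (simp add: div_less_iff_less_mult)
 have rJ: "Suc r < J" using r J by simp
 have rZ: "r <= Z" using r Z by simp
 let ?R = "R(24 := int \<kappa>, 25 := d)"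
 have 1: "hr inp J (Block [HSub 26 22 45, HConst 27 1]) (?R, A, out) 2 (?R(26 := int r, 27 := 1), A, out)" by (intro hr_Blk) (use R in \<open>auto simp: fun_eq_iff cleanD\<close>)
 have 2: "hr inp J (shl 27 26) (?R(26 := int r, 27 := 1), A, out) (7 * Z) (?R(26 := int r, 27 := 2 ^ r), A, out)" by (intro hr_conv[OF shl_correct[where m = r and Z = Z]]) (use R rZ Z in \<open>auto simp: cleanD fun_eq_iff\<close>)
 have 3: "hr inp J (Block [HLoad 28 7 22, HAdd 27 27 28]) (?R(26 := int r, 27 := 2 ^ r), A, out) 2 (?R(26 := int r, 27 := int (t + 2 ^ r), 28 := int t), A, out)" by (intro hr_Blk) (use R t rJ in \<open>auto simp: fun_eq_iff nat_add_distrib\<close>)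
 have dv: "int (t + 2 ^ r) div 2 ^ sg = int ?lv" by (metis of_nat_numeral of_nat_power zdiv_int)
 have 4: "hr inp J (shr 27 6) (?R(26 := int r, 27 := int (t + 2 ^ r), 28 := int t), A, out) (7 * Z) (?R(26 := int r, 27 := int ?lv, 28 := int t), A, out)" by (intro hr_conv[OF shr_correct[where m = sg and Z = Z]]) (use R Z dv in \<open>auto simp: cleanD fun_eq_iff simp del: of_nat_add\<close>)
 have 5: "hr inp J (Block [HAdd 29 27 44]) (?R(26 := int r, 27 := int ?lv, 28 := int t), A, out) 1
   (R(24 := int \<kappa>, 25 := d, 26 := int r, 27 := int ?lv, 28 := int t, 29 := int ?lv), A, out)" by (intro hr_Blk) (use R in \<open>auto simp: fun_eq_iff cleanD\<close>)
 note 6 = mid_loop[OF A lv R(1-5), of \<kappa> d "int r" "int t"]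
 let ?y = "int (\<kappa> div 2 ^ ((e + 1) * m))"
 have mm: "(\<Sum>k<m. (g k div 2 ^ ?lv - 2 ^ e + int (\<kappa> div 2 ^ ((e + 1) * k) mod 2 ^ (e + 1))) * 2 ^ (?lv + q * k)) = ?m" by (simp add: mid_point_def Let_def)
 have 7: "hr inp J (Block [HStore 14 22 30, HStore 7 26 28, HLoad 36 8 22, HStore 8 26 36, HStore 9 26 30, HStore 13 22 44,
    HAdd 22 26 44, HSub 21 44 45, HConst 26 0, HConst 27 0, HConst 28 0, HConst 29 0, HConst 30 0, HConst 36 0])
  (R(24 := ?y, 25 := d, 26 := int r, 27 := int ?lv, 28 := int t, 29 := int (?lv + q * m), 30 := ?m), A, out) 14
  (R(24 := ?y, 25 := d, 21 := -1, 22 := int r), A(14 := (A 14)(Suc r := ?m), 7 := (A 7)(r := int t),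
   8 := (A 8)(r := A 8 (Suc r)), 9 := (A 9)(r := ?m), 13 := (A 13)(Suc r := 0)), out)" by (intro hr_Blk) (use R rJ in \<open>auto simp: fun_eq_iff cleanD nat_add_distrib\<close>)
 show ?thesis unfolding mid_code_def by (rule exI[of _ ?y], rule hr_conv[OF hr_Seq[OF 1 hr_Seq[OF 2 hr_Seq[OF 3 hr_Seq[OF 4 hr_Seq[OF 5 hr_Seq[OF 6[unfolded mm] 7]]]]]]]) auto
qed

lemma tail: "hr inp J (Block [HSub 20 22 14, HSub 20 20 45]) (R0(20 := x, 21 := mo, 22 := int r, 23 := v), A, out) 2 (st mo r v A)"
 unfolding st_def by (intro hr_Blk) (use R0 in \<open>auto simp: fun_eq_iff cleanD\<close>)

lemma call_pos:
 assumes "0 < r" "r <= 2 * sg"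
 shows "hr inp J sav_body (st (-1) r v A) tau (st 0 r v (A(10 := (A 10)(r := 0), 11 := (A 11)(r := BIG))))"
proof -
 let ?R = "R0(20 := int r - int (2 * sg) - 1, 21 := -1, 22 := int r, 23 := v)"
 have rJ: "r < J" using assms J by simp
 have 1: "hr inp J (Block [HSub 24 44 22]) (?R, A, out) 1 (?R(24 := - int r), A, out)" by (intro hr_Blk) (use R0 in \<open>auto simp: fun_eq_iff cleanD\<close>)
 have 2: "hr inp J (Block [HStore 10 22 44, HStore 11 22 13, HConst 21 0, HConst 24 0]) (?R(24 := - int r), A, out) 4
  (R0(20 := int r - int (2 * sg) - 1, 21 := 0, 22 := int r, 23 := v), A(10 := (A 10)(r := 0), 11 := (A 11)(r := BIG)), out)" by (intro hr_Blk) (use R0 rJ in \<open>auto simp: fun_eq_iff cleanD\<close>)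
 show ?thesis unfolding sav_body_def call_code_def by (subst st_def, rule hr_conv[OF hr_Seq[OF hr_CondT[OF _ _ hr_Seq[OF 1 hr_CondT[OF _ _ 2]]] tail]]) (use assms in auto)
qed

lemma call_0:
 assumes A: "tabs A" and t: "A 7 0 = int t" "t < 2 ^ sg * 2 ^ sg"
 shows "hr inp J sav_body (st (-1) 0 v A) tau (st 1 1 (base_dist N a w sg BIG t (A 8 0) (A 9 0)) A)"
proof -
 let ?R = "R0(20 := int 0 - int (2 * sg) - 1, 21 := -1, 22 := int 0, 23 := v)"
 let ?b = "base_dist N a w sg BIG t (A 8 0) (A 9 0)"
 have 1: "hr inp J (Block [HSub 24 44 22]) (?R, A, out) 1 (?R, A, out)" by (intro hr_Blk) (use R0 in \<open>auto simp: fun_eq_iff cleanD\<close>)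
 have 2: "hr inp J base_code (?R, A, out) (N * (31 * Z + 4) + 7 * Z + 19) (?R(23 := ?b), A, out)" by (rule base_code_correct[OF A t]) (use R0 in \<open>auto simp: clean_def\<close>)
 have 3: "hr inp J (Block [HConst 21 1, HConst 22 1]) (?R(23 := ?b), A, out) 2 (R0(20 := int 0 - int (2 * sg) - 1, 21 := 1, 22 := int 1, 23 := ?b), A, out)" by (intro hr_Blk) (auto simp: fun_eq_iff)
 show ?thesis unfolding sav_body_def call_code_def by (subst st_def, rule hr_conv[OF hr_Seq[OF hr_CondT[OF _ _ hr_Seq[OF 1 hr_CondF[OF _ _ hr_Seq[OF 2 3]]]] tail]]) (use R0 in \<open>auto simp: cleanD\<close>)
qed

lemma next_lt:
 assumes A: "tabs A" and r: "Suc r <= 2 * sg" and k: "A 10 (Suc r) = int \<kappa>" "\<kappa> < NN" and t: "A 7 (Suc r) = int t" "t + 2 ^ r < 2 ^ sg * 2 ^ sg"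
 shows "hr inp J sav_body (st 0 (Suc r) v A) tau (st (-1) r v (A(14 := (A 14)(Suc r := mid_point q m sg e g (t + 2 ^ r) \<kappa>), 7 := (A 7)(r := int t),
   8 := (A 8)(r := A 8 (Suc r)), 9 := (A 9)(r := mid_point q m sg e g (t + 2 ^ r) \<kappa>), 13 := (A 13)(Suc r := 0))))"
proof -
 let ?x = "int (Suc r) - int (2 * sg) - 1"
 let ?R = "R0(20 := ?x, 21 := 0, 22 := int (Suc r), 23 := v)"
 let ?A = "A(14 := (A 14)(Suc r := mid_point q m sg e g (t + 2 ^ r) \<kappa>), 7 := (A 7)(r := int t),
   8 := (A 8)(r := A 8 (Suc r)), 9 := (A 9)(r := mid_point q m sg e g (t + 2 ^ r) \<kappa>), 13 := (A 13)(Suc r := 0))"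
 let ?d = "int \<kappa> - int NN"
 have rJ: "Suc r < J" using r J by simp
 have d: "?d < 0" using k(2) by linarith
 have 1: "hr inp J (Block [HSub 37 21 45]) (?R, A, out) 1 (?R(37 := -1), A, out)" by (intro hr_Blk) (use R0 in \<open>auto simp: fun_eq_iff cleanD\<close>)
 have 2: "hr inp J (Block [HConst 37 0]) (?R(37 := -1), A, out) 1 (?R, A, out)" by (intro hr_Blk) (use R0 in \<open>auto simp: fun_eq_iff cleanD\<close>)
 have 3: "hr inp J (Block [HLoad 24 10 22, HSub 25 24 15]) (?R, A, out) 2 (?R(24 := int \<kappa>, 25 := ?d), A, out)" by (intro hr_Blk) (use R0(10) rJ k(1) in \<open>auto simp: fun_eq_iff nat_add_distrib\<close>)
 obtain y where 4: "hr inp J mid_code (?R(24 := int \<kappa>, 25 := ?d), A, out) (m * (50 * Z + 4) + 14 * Z + 30)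
  (?R(24 := y, 25 := ?d, 21 := -1, 22 := int r), ?A, out)" using mid_code_correct[OF A r t, of ?R \<kappa> ?d] R0 by (auto simp: clean_def)
 have 5: "hr inp J (Block [HConst 24 0, HConst 25 0]) (?R(24 := y, 25 := ?d, 21 := -1, 22 := int r), ?A, out) 2
  (R0(20 := ?x, 21 := -1, 22 := int r, 23 := v), ?A, out)" by (intro hr_Blk) (use R0 in \<open>auto simp: fun_eq_iff cleanD\<close>)
 show ?thesis unfolding sav_body_def next_code_def by (subst st_def, rule hr_conv[OF hr_Seq[OF hr_CondF[OF _ _ hr_Seq[OF 1 hr_CondT[OF _ _ hr_Seq[OF 2 hr_Seq[OF 3 hr_Seq[OF hr_CondT[OF _ _ 4] 5]]]]]] tail]])
   (use d in auto)
qed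

lemma next_ge:
 assumes r: "r <= 2 * sg" and k: "A 10 r = int NN"
 shows "hr inp J sav_body (st 0 r v A) tau (st 1 (Suc r) (A 11 r) A)"
proof -
 let ?x = "int r - int (2 * sg) - 1"
 let ?R = "R0(20 := ?x, 21 := 0, 22 := int r, 23 := v)"
 have rJ: "r < J" using r J by simp
 have 1: "hr inp J (Block [HSub 37 21 45]) (?R, A, out) 1 (?R(37 := -1), A, out)" by (intro hr_Blk) (use R0 in \<open>auto simp: fun_eq_iff cleanD\<close>)
 have 2: "hr inp J (Block [HConst 37 0]) (?R(37 := -1), A, out) 1 (?R, A, out)" by (intro hr_Blk) (use R0 in \<open>auto simp: fun_eq_iff cleanD\<close>)
 have 3: "hr inp J (Block [HLoad 24 10 22, HSub 25 24 15]) (?R, A, out) 2 (?R(24 := int NN, 25 := 0), A, out)" by (intro hr_Blk) (use R0(10) rJ k(1) in \<open>auto simp: fun_eq_iff\<close>)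
 have 4: "hr inp J (Block [HLoad 23 11 22, HAdd 22 22 45, HConst 21 1]) (?R(24 := int NN, 25 := 0), A, out) 3
  (?R(24 := int NN, 25 := 0, 23 := A 11 r, 22 := int (Suc r), 21 := 1), A, out)" by (intro hr_Blk) (use R0 rJ in \<open>auto simp: fun_eq_iff cleanD\<close>)
 have 5: "hr inp J (Block [HConst 24 0, HConst 25 0]) (?R(24 := int NN, 25 := 0, 23 := A 11 r, 22 := int (Suc r), 21 := 1), A, out) 2
  (R0(20 := ?x, 21 := 1, 22 := int (Suc r), 23 := A 11 r), A, out)" by (intro hr_Blk) (use R0 in \<open>auto simp: fun_eq_iff cleanD\<close>)
 show ?thesis unfolding sav_body_def next_code_def by (subst st_def, rule hr_conv[OF hr_Seq[OF hr_CondF[OF _ _ hr_Seq[OF 1 hr_CondT[OF _ _ hr_Seq[OF 2 hr_Seq[OF 3 hr_Seq[OF hr_CondF[OF _ _ 4] 5]]]]]] tail]]) auto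
qed

lemma ret_0:
 assumes r: "Suc r <= 2 * sg" and p: "A 13 (Suc r) = 0" and t: "A 7 (Suc r) = int t"
 shows "hr inp J sav_body (st 1 (Suc r) v A) tau (st (-1) r v (A(12 := (A 12)(Suc r := v), 13 := (A 13)(Suc r := 1), 7 := (A 7)(r := int (t + 2 ^ r)),
   8 := (A 8)(r := A 14 (Suc r)), 9 := (A 9)(r := A 9 (Suc r)))))"
proof -
 let ?x = "int (Suc r) - int (2 * sg) - 1"
 let ?R = "R0(20 := ?x, 21 := 1, 22 := int (Suc r), 23 := v)"
 let ?A1 = "A(12 := (A 12)(Suc r := v), 13 := (A 13)(Suc r := 1))"
 let ?A = "A(12 := (A 12)(Suc r := v), 13 := (A 13)(Suc r := 1), 7 := (A 7)(r := int (t + 2 ^ r)),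
   8 := (A 8)(r := A 14 (Suc r)), 9 := (A 9)(r := A 9 (Suc r)))"
 have rJ: "Suc r < J" using r J by simp
 have rZ: "r <= Z" using r Z by simp
 have 1: "hr inp J (Block [HSub 37 21 45]) (?R, A, out) 1 (?R, A, out)" by (intro hr_Blk) (use R0 in \<open>auto simp: fun_eq_iff cleanD\<close>)
 have 2: "hr inp J (Block [HConst 37 0]) (?R, A, out) 1 (?R, A, out)" by (intro hr_Blk) (use R0 in \<open>auto simp: fun_eq_iff cleanD\<close>)
 have 3: "hr inp J (Block [HLoad 24 13 22, HSub 24 24 45]) (?R, A, out) 2 (?R(24 := -1), A, out)" by (intro hr_Blk) (use R0 rJ p in \<open>auto simp: fun_eq_iff cleanD nat_add_distrib\<close>)
 have 4: "hr inp J (Block [HConst 24 0, HStore 12 22 23, HStore 13 22 45, HSub 26 22 45, HConst 27 1]) (?R(24 := -1), A, out) 5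
  (?R(26 := int r, 27 := 1), ?A1, out)" by (intro hr_Blk) (use R0 rJ in \<open>auto simp: fun_eq_iff cleanD nat_add_distrib\<close>)
 have 5: "hr inp J (shl 27 26) (?R(26 := int r, 27 := 1), ?A1, out) (7 * Z) (?R(26 := int r, 27 := 2 ^ r), ?A1, out)" by (intro hr_conv[OF shl_correct[where m = r and Z = Z]]) (use R0 rZ Z in \<open>auto simp: cleanD fun_eq_iff\<close>)
 have 6: "hr inp J (Block [HLoad 28 7 22, HAdd 27 27 28, HStore 7 26 27, HLoad 28 14 22, HStore 8 26 28, HLoad 28 9 22, HStore 9 26 28,
    HAdd 22 26 44, HSub 21 44 45, HConst 26 0, HConst 27 0, HConst 28 0]) (?R(26 := int r, 27 := 2 ^ r), ?A1, out) 12
  (R0(20 := ?x, 21 := -1, 22 := int r, 23 := v), ?A, out)" by (intro hr_Blk) (use R0 rJ t in \<open>auto simp: fun_eq_iff cleanD nat_add_distrib\<close>)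
 show ?thesis unfolding sav_body_def ret_code_def by (subst st_def, rule hr_conv[OF hr_Seq[OF hr_CondF[OF _ _ hr_Seq[OF 1 hr_CondF[OF _ _ hr_Seq[OF 2 hr_Seq[OF 3 hr_CondT[OF _ _ hr_Seq[OF 4 hr_Seq[OF 5 6]]]]]]]] tail]])
   (use R0 in \<open>auto simp: cleanD\<close>)
qed

lemma ret_1:
 assumes r: "r <= 2 * sg" and p: "A 13 r = 1"
 shows "hr inp J sav_body (st 1 r v A) tau (st 0 r v (A(11 := (A 11)(r := min (A 11 r) (A 12 r + v)), 10 := (A 10)(r := A 10 r + 1))))"
proof -
 let ?x = "int r - int (2 * sg) - 1"
 let ?R = "R0(20 := ?x, 21 := 1, 22 := int r, 23 := v)"
 let ?s = "A 12 r + v"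
 let ?A1 = "A(11 := (A 11)(r := min (A 11 r) ?s))"
 have rJ: "r < J" using r J by simp
 have 1: "hr inp J (Block [HSub 37 21 45]) (?R, A, out) 1 (?R, A, out)" by (intro hr_Blk) (use R0 in \<open>auto simp: fun_eq_iff cleanD\<close>)
 have 2: "hr inp J (Block [HConst 37 0]) (?R, A, out) 1 (?R, A, out)" by (intro hr_Blk) (use R0 in \<open>auto simp: fun_eq_iff cleanD\<close>)
 have 3: "hr inp J (Block [HLoad 24 13 22, HSub 24 24 45]) (?R, A, out) 2 (?R, A, out)" by (intro hr_Blk) (use R0 rJ p in \<open>auto simp: fun_eq_iff cleanD\<close>)
 have 4: "hr inp J (Block [HLoad 26 12 22, HAdd 26 26 23, HLoad 27 11 22, HSub 27 26 27]) (?R, A, out) 4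
  (?R(26 := ?s, 27 := ?s - A 11 r), A, out)" by (intro hr_Blk) (use rJ in \<open>auto simp: fun_eq_iff\<close>)
 have 5: "hr inp J (Cond 27 (Block [HStore 11 22 26]) (Block [])) (?R(26 := ?s, 27 := ?s - A 11 r), A, out) (max 1 0 + 2)
  (?R(26 := ?s, 27 := ?s - A 11 r), ?A1, out)" by (rule hr_Cond) (use rJ in \<open>auto intro!: hr_Blk simp: fun_eq_iff min_def\<close>)
 have 6: "hr inp J (Block [HLoad 26 10 22, HAdd 26 26 45, HStore 10 22 26, HConst 21 0, HConst 26 0, HConst 27 0]) (?R(26 := ?s, 27 := ?s - A 11 r), ?A1, out) 6
  (R0(20 := ?x, 21 := 0, 22 := int r, 23 := v), ?A1(10 := (A 10)(r := A 10 r + 1)), out)" by (intro hr_Blk) (use R0 rJ in \<open>auto simp: fun_eq_iff cleanD\<close>)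
 show ?thesis unfolding sav_body_def ret_code_def by (subst st_def, rule hr_conv[OF hr_Seq[OF hr_CondF[OF _ _ hr_Seq[OF 1 hr_CondF[OF _ _ hr_Seq[OF 2 hr_Seq[OF 3 hr_CondF[OF _ _ hr_Seq[OF 4 hr_Seq[OF 5 6]]]]]]]] tail]])
   (use R0 in \<open>auto simp: cleanD\<close>)
qed

end

section \<open>Correctness and running time of the stack machine\<close>

text \<open>A call at level \<open>r\<close> may overwrite frames up to level \<open>r\<close>, but
  neither the frames of its callers nor the data outside the stack arrays.\<close>

definition agree :: "nat => (nat => nat => int) => (nat => nat => int) => bool" where
 "agree r A A' \<longleftrightarrow> (\<forall>f j. f < 7 \<or> 14 < f \<or> r < j \<longrightarrow> A' f j = A f j)"

lemma agreeD: "agree r A A' ==> r < j ==> A' f j = A f j" "agree r A A' ==> f < 7 ==> A' f j = A f j" by (auto simp: agree_def)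

lemma agree_trans: "agree r A B ==> agree r' B C ==> r' <= r ==> agree r A C"
 unfolding agree_def by (metis le_less_trans)

text \<open>One bit per step is no useful bound for an exponentially long loop. Here
  \<open>qb\<close> bounds all numbers present at the start of an iteration, and only the
  \<open>tau\<close> steps within one iteration are counted. The factor 2 in \<open>Db\<close> makes
  room for the sum of two halves.\<close>

locale savb = sav +
 fixes qb :: nat
 assumes inpb: "!!v. v \<in> set inp ==> \<bar>v\<bar> < 2 ^ qb" "1 <= qb"
  and R0b: "!!x. \<bar>R0 x\<bar> < 2 ^ qb"
  and sgb: "int (2 * sg + 2) < 2 ^ qb" "int (2 ^ sg * 2 ^ sg) < 2 ^ qb" "\<bar>BIG\<bar> < 2 ^ qb" "int (2 ^ ((e + 1) * m)) < 2 ^ qb"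
  and Db: "!!r t V1 V2. t + 2 ^ r <= 2 ^ sg * 2 ^ sg ==>
   2 * \<bar>dist_rec (base_dist N a w sg BIG) BIG (2 ^ ((e + 1) * m)) (mid_point q m sg e g) r t V1 V2\<bar> < 2 ^ qb"
  and mb: "!!t \<kappa>. t < 2 ^ sg * 2 ^ sg ==> \<bar>mid_point q m sg e g t \<kappa>\<bar> < 2 ^ qb"
begin

abbreviation "D \<equiv> dist_rec (base_dist N a w sg BIG) BIG (2 ^ ((e + 1) * m)) (mid_point q m sg e g)"
abbreviation "md \<equiv> mid_point q m sg e g"

definition Ab :: "(nat => nat => int) => bool" where
 "Ab A \<longleftrightarrow> (\<forall>f j. \<bar>A f j\<bar> < 2 ^ qb)"

definition HB :: "hatom com => hst => nat => (hst => bool) => bool" where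
 "HB = hp (hq (qb + tau) inp J) (hqt (qb + tau))"

lemma st_bnd:
 assumes "Ab A" "\<bar>v\<bar> < 2 ^ qb" "r <= 2 * sg + 1" "\<bar>mo\<bar> <= 1"
 shows "hbnd qb (st mo r v A)"
proof -
 have "\<bar>int r - int (2 * sg) - 1\<bar> < 2 ^ qb" "\<bar>int r\<bar> < 2 ^ qb" "\<bar>mo\<bar> < 2 ^ qb" using sgb(1) assms(3,4) by linarith+
 then show ?thesis using assms(1,2) R0b unfolding hbnd_def st_def Ab_def by simp
qed

lemma loop_step:
 assumes "hr inp J sav_body (st mo r v A) tau s'" "Ab A" "\<bar>v\<bar> < 2 ^ qb" "r <= 2 * sg" "\<bar>mo\<bar> <= 1"
  and "HB (Loop 20 sav_body) s' b Q"
 shows "HB (Loop 20 sav_body) (st mo r v A) (b + (tau + 2)) Q"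
proof -
 have bd: "hbnd qb (st mo r v A)" by (rule st_bnd) (use assms in auto)
 have "hp (hq (qb + tau) inp J) (hqt (qb + tau)) sav_body (st mo r v A) tau (%x. x = s')" by (rule hp_hq[OF inpb assms(1)[unfolded hr_def] bd]) simp_all
 then have "hp (hq (qb + tau) inp J) (hqt (qb + tau)) sav_body (st mo r v A) tau
  (%s1. hp (hq (qb + tau) inp J) (hqt (qb + tau)) (Loop 20 sav_body) s1 b Q)" by (rule hp_mono) (use assms(6) in \<open>auto simp: HB_def\<close>)
 moreover have "hqt (qb + tau) 20 (st mo r v A) = Some True" using hbnd_mono[OF bd, of "qb + tau"] assms(4) by (simp add: hqt_def hts_def) (simp add: st_def)
 ultimately show ?thesis unfolding HB_def by (intro hp_LoopT) auto
qed

text \<open>Two iterations for opening a call and returning from it; for each midpoint three more,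
  besides the two recursive calls.\<close>

primrec cost :: "nat => nat" where
 "cost 0 = tau + 2"
| "cost (Suc r) = 2 * (tau + 2) + NN * (3 * (tau + 2) + 2 * cost r)"

lemma cost_le: "cost r <= (tau + 2) * (8 * NN) ^ r"
proof (induction r)
 case (Suc r)
 define c where "c = tau + 2"
 define M where "M = NN"
 define x where "x = c * (8 * M) ^ r"
 have "1 <= M" by (simp add: M_def)
 then have "1 <= (8 * M) ^ r" by simp
 then have cx: "c * 1 <= x" unfolding x_def by (rule mult_le_mono2)
 have "cost (Suc r) <= 2 * c + M * (3 * c + 2 * x)" using Suc unfolding cost.simps c_def[symmetric] M_def[symmetric] x_def[symmetric] by simp
 also have "... <= M * (2 * x) + M * (3 * x + 2 * x)"
 proof (rule add_mono)
  have "1 * (2 * c) <= M * (2 * x)" by (rule mult_le_mono) (use cx \<open>1 <= M\<close> in auto)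
  then show "2 * c <= M * (2 * x)" by simp
  show "M * (3 * c + 2 * x) <= M * (3 * x + 2 * x)" using cx by (intro mult_le_mono2) simp
 qed
 also have "... <= c * (8 * M) ^ Suc r" unfolding x_def by simp
 finally show ?case unfolding c_def M_def .
qed simp

lemma tabs_agree: "tabs A ==> agree r A A' ==> tabs A'" by (auto simp: tabs_def agree_def)

lemma int_less: "t < 2 ^ sg * 2 ^ sg ==> \<bar>int t\<bar> < 2 ^ qb" using sgb(2) by linarith

text \<open>Since the program is one flat loop, a call is specified by a continuation: if the loop
  succeeds from the return state within \<open>b\<close>, it succeeds from the call state within
  \<open>b + cost r\<close>. Nested calls then compose by nesting such premises.\<close>

lemma savitch:
 assumes "tabs A" "Ab A" "A 7 r = int t" "t + 2 ^ r <= 2 ^ sg * 2 ^ sg" "r <= 2 * sg" "\<bar>v\<bar> < 2 ^ qb"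
  and "!!A'. agree r A A' ==> Ab A' ==> HB (Loop 20 sav_body) (st 1 (Suc r) (D r t (A 8 r) (A 9 r)) A') b Q"
 shows "HB (Loop 20 sav_body) (st (-1) r v A) (b + cost r) Q" using assms
proof (induction r arbitrary: A t v b)
 case 0
 have t: "t < 2 ^ sg * 2 ^ sg" using 0(4) by simp
 show ?case unfolding cost.simps by (rule loop_step[OF call_0[where A = A, OF 0(1) 0(3) t] 0(2) 0(6)]) (use 0(7)[of A] 0(2) in \<open>auto simp: agree_def\<close>)
next
 case (Suc r)
 note IH = Suc.IH
 let ?c = "tau + 2"
 let ?V1 = "A 8 (Suc r)" and ?V2 = "A 9 (Suc r)"
 let ?f = "%\<kappa>. D r t ?V1 (md (t + 2 ^ r) \<kappa>) + D r (t + 2 ^ r) (md (t + 2 ^ r) \<kappa>) ?V2"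
 let ?B = "%\<kappa>. bmin BIG (%_. True) ?f \<kappa>"
 have tr: "t + 2 ^ r <= 2 ^ sg * 2 ^ sg" "t + 2 ^ r + 2 ^ r <= 2 ^ sg * 2 ^ sg" using Suc.prems(4) by auto
 have pw: "(0::nat) < 2 ^ r" by simp
 have tl: "t + 2 ^ r < 2 ^ sg * 2 ^ sg" "t < 2 ^ sg * 2 ^ sg" using tr pw by linarith+
 have DD: "\<bar>?f \<kappa>\<bar> < 2 ^ qb" for \<kappa> using Db[OF tr(1), of ?V1 "md (t + 2 ^ r) \<kappa>"] Db[OF tr(2), of "md (t + 2 ^ r) \<kappa>" ?V2] by linarith
 have Bb: "\<bar>?B \<kappa>\<bar> < 2 ^ qb" for \<kappa>
 proof (induction \<kappa>)
  case (Suc \<kappa>)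
  then show ?case using DD[of \<kappa>] by (simp add: min_def)
 qed (use sgb in simp)
 have D1: "\<bar>D r t x y\<bar> < 2 ^ qb" "\<bar>D r (t + 2 ^ r) x y\<bar> < 2 ^ qb" for x y using Db[OF tr(1), of x y] Db[OF tr(2), of x y] by linarith+
 have p1: "(1::int) < 2 ^ qb" "(0::int) < 2 ^ qb" using sgb(1) by linarith+
 \<comment> \<open>Induction on the number \<open>k\<close> of midpoints still to be tried; array 11
   holds the minimum over those already tried.\<close>
 have inner: "HB (Loop 20 sav_body) (st 0 (Suc r) u A2) (b + ?c + k * (3 * ?c + 2 * cost r)) Q"
  if "k + \<kappa> = NN" "agree (Suc r) A A2" "Ab A2" "\<bar>u\<bar> < 2 ^ qb" "A2 10 (Suc r) = int \<kappa>" "A2 11 (Suc r) = ?B \<kappa>"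
   "A2 7 (Suc r) = int t" "A2 8 (Suc r) = ?V1" "A2 9 (Suc r) = ?V2" for k \<kappa> u A2 using that
 proof (induction k arbitrary: \<kappa> u A2)
  case 0
  then have \<kappa>: "\<kappa> = NN" by simp
  have 1: "A2 10 (Suc r) = int NN" using 0 by simp
  have "?B NN = D (Suc r) t ?V1 ?V2" by simp
  then have "HB (Loop 20 sav_body) (st 1 (Suc (Suc r)) (A2 11 (Suc r)) A2) b Q" using Suc.prems(7)[OF 0(2,3)] 0(6) \<kappa> by simp
  from loop_step[OF next_ge[where A = A2, OF Suc.prems(5) 1] 0(3,4) Suc.prems(5) _ this]
  show ?case by simp
 next
  case (Suc k)
  note h = Suc.prems
  let ?m = "md (t + 2 ^ r) \<kappa>"
  have \<kappa>: "\<kappa> < NN" using h(1) by simp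
  have r: "Suc r <= 2 * sg" by fact
  have tabs2: "tabs A2" by (rule tabs_agree[OF \<open>tabs A\<close> h(2)])
  let ?A3 = "A2(14 := (A2 14)(Suc r := ?m), 7 := (A2 7)(r := int t),
   8 := (A2 8)(r := A2 8 (Suc r)), 9 := (A2 9)(r := ?m), 13 := (A2 13)(Suc r := 0))"
  have mm: "\<bar>?m\<bar> < 2 ^ qb" by (rule mb[OF tl(1)])
  have A2b: "\<bar>A2 f j\<bar> < 2 ^ qb" for f j using h(3) by (simp add: Ab_def)
  have b3: "Ab ?A3" unfolding Ab_def using A2b mm int_less[OF tl(2)] p1 by simp
  have t3: "tabs ?A3" using tabs2 by (simp add: tabs_def)
  have step3: "HB (Loop 20 sav_body) (st 1 (Suc r) (D r t ?V1 ?m) A4) (b + ?c + k * (3 * ?c + 2 * cost r) + 2 * ?c + cost r) Q"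
   if a4: "agree r ?A3 A4" and b4: "Ab A4" for A4
  proof -
   have A4: "A4 13 (Suc r) = 0" "A4 7 (Suc r) = int t" "A4 14 (Suc r) = ?m" "A4 9 (Suc r) = ?V2" "A4 8 (Suc r) = ?V1"
    "A4 10 (Suc r) = int \<kappa>" "A4 11 (Suc r) = ?B \<kappa>" using agreeD(1)[OF a4, of "Suc r"] h by auto
   let ?A5 = "A4(12 := (A4 12)(Suc r := D r t ?V1 ?m), 13 := (A4 13)(Suc r := 1), 7 := (A4 7)(r := int (t + 2 ^ r)),
    8 := (A4 8)(r := A4 14 (Suc r)), 9 := (A4 9)(r := A4 9 (Suc r)))"
   have A4b: "\<bar>A4 f j\<bar> < 2 ^ qb" for f j using b4 by (simp add: Ab_def)
   have b5: "Ab ?A5" unfolding Ab_def using A4b D1 int_less[OF tl(1)] p1 by simp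
   have t5: "tabs ?A5" using tabs_agree[OF t3 a4] by (simp add: tabs_def)
   have step5: "HB (Loop 20 sav_body) (st 1 (Suc r) (D r (t + 2 ^ r) ?m ?V2) A6) (b + ?c + k * (3 * ?c + 2 * cost r) + ?c) Q"
    if a6: "agree r ?A5 A6" and b6: "Ab A6" for A6
   proof -
    have A6: "A6 13 (Suc r) = 1" "A6 7 (Suc r) = int t" "A6 9 (Suc r) = ?V2" "A6 8 (Suc r) = ?V1"
     "A6 10 (Suc r) = int \<kappa>" "A6 11 (Suc r) = ?B \<kappa>" "A6 12 (Suc r) = D r t ?V1 ?m" using agreeD(1)[OF a6, of "Suc r"] A4 by auto
    let ?v = "D r (t + 2 ^ r) ?m ?V2"
    let ?A7 = "A6(11 := (A6 11)(Suc r := min (A6 11 (Suc r)) (A6 12 (Suc r) + ?v)), 10 := (A6 10)(Suc r := A6 10 (Suc r) + 1))"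
    have val: "min (A6 11 (Suc r)) (A6 12 (Suc r) + ?v) = ?B (Suc \<kappa>)" using A6 by simp
    have kb: "\<bar>A6 10 (Suc r) + 1\<bar> < 2 ^ qb" using sgb(4) \<kappa> A6(5) by linarith
    have A6b: "\<bar>A6 f j\<bar> < 2 ^ qb" for f j using b6 by (simp add: Ab_def)
    have b7: "Ab ?A7" unfolding Ab_def val using A6b Bb[of "Suc \<kappa>"] kb by (simp del: bmin.simps)
    have a7: "agree (Suc r) A ?A7"
    proof -
     have x1: "agree (Suc r) A2 ?A3" by (auto simp: agree_def)
     have x2: "agree (Suc r) A4 ?A5" by (auto simp: agree_def)
     have x3: "agree (Suc r) A6 ?A7" by (auto simp: agree_def)
     show ?thesis by (rule agree_trans[OF agree_trans[OF agree_trans[OF agree_trans[OF agree_trans[OF h(2) x1 order_refl] a4] x2] a6] x3]) auto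
    qed
    have "HB (Loop 20 sav_body) (st 0 (Suc r) ?v ?A7) (b + ?c + k * (3 * ?c + 2 * cost r)) Q"
    proof (rule Suc.IH[of "Suc \<kappa>"])
     show "k + Suc \<kappa> = NN" using h(1) by simp
     show "agree (Suc r) A ?A7" "Ab ?A7" "\<bar>?v\<bar> < 2 ^ qb" by (fact a7 b7 D1)+
     show "?A7 10 (Suc r) = int (Suc \<kappa>)" using A6 by simp
     show "?A7 11 (Suc r) = ?B (Suc \<kappa>)" unfolding val[symmetric] by simp
     show "?A7 7 (Suc r) = int t" "?A7 8 (Suc r) = ?V1" "?A7 9 (Suc r) = ?V2" using A6 by simp_all
    qed
    from loop_step[OF ret_1[where v = ?v and A = A6, OF r A6(1)] b6 _ r _ this] show ?thesis using D1 by simp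
   qed
   have "HB (Loop 20 sav_body) (st (-1) r (D r t ?V1 ?m) ?A5) (b + ?c + k * (3 * ?c + 2 * cost r) + ?c + cost r) Q"
   proof (rule IH[of ?A5 "t + 2 ^ r"])
    show "tabs ?A5" "Ab ?A5" by (fact t5 b5)+
    show "?A5 7 r = int (t + 2 ^ r)" by simp
    show "t + 2 ^ r + 2 ^ r <= 2 ^ sg * 2 ^ sg" by fact
    show "r <= 2 * sg" using r by simp
    show "\<bar>D r t ?V1 ?m\<bar> < 2 ^ qb" by (rule D1)
    fix A6 assume "agree r ?A5 A6" "Ab A6"
    from step5[OF this] show "HB (Loop 20 sav_body) (st 1 (Suc r) (D r (t + 2 ^ r) (?A5 8 r) (?A5 9 r)) A6) (b + ?c + k * (3 * ?c + 2 * cost r) + ?c) Q" using A4 by simp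
   qed
   from loop_step[OF ret_0[where v = "D r t ?V1 ?m" and A = A4, OF r A4(1,2)] b4 D1(1) r _ this] show ?thesis by (simp add: algebra_simps)
  qed
  have "HB (Loop 20 sav_body) (st (-1) r u ?A3) (b + ?c + k * (3 * ?c + 2 * cost r) + 2 * ?c + cost r + cost r) Q"
  proof (rule IH[of ?A3 t])
   show "tabs ?A3" "Ab ?A3" by (fact t3 b3)+
   show "?A3 7 r = int t" by simp
   show "t + 2 ^ r <= 2 ^ sg * 2 ^ sg" by fact
   show "r <= 2 * sg" using r by simp
   show "\<bar>u\<bar> < 2 ^ qb" by (rule h(4))
   fix A4 assume "agree r ?A3 A4" "Ab A4"
   from step3[OF this] show "HB (Loop 20 sav_body) (st 1 (Suc r) (D r t (?A3 8 r) (?A3 9 r)) A4) (b + ?c + k * (3 * ?c + 2 * cost r) + 2 * ?c + cost r) Q" using h by simp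
  qed
  from loop_step[OF next_lt[where A = A2 and t = t, OF tabs2 r h(5) \<kappa> h(7) tl(1)] h(3,4) r _ this]
  show ?case by (simp add: algebra_simps)
 qed
 let ?A1 = "A(10 := (A 10)(Suc r := 0), 11 := (A 11)(Suc r := BIG))"
 have "\<bar>A f j\<bar> < 2 ^ qb" for f j using Suc.prems(2) by (simp add: Ab_def)
 then have b1: "Ab ?A1" unfolding Ab_def using p1 sgb(3) by simp
 have "HB (Loop 20 sav_body) (st 0 (Suc r) v ?A1) (b + ?c + NN * (3 * ?c + 2 * cost r)) Q" by (rule inner[of NN 0]) (use Suc.prems b1 in \<open>auto simp: agree_def\<close>)
 from loop_step[OF call_pos[where A = A, OF _ Suc.prems(5)] Suc.prems(2,6,5) _ this]
 show ?case by (simp add: algebra_simps)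
qed

lemma savitch_loop:
 assumes "tabs A" "Ab A" "A 7 (2 * sg) = 0" "\<bar>v\<bar> < 2 ^ qb"
 shows "HB (Loop 20 sav_body) (st (-1) (2 * sg) v A) ((tau + 2) * (8 * NN) ^ (2 * sg) + 2)
  (%s. \<exists>A'. agree (2 * sg) A A' & Ab A' & s = st 1 (Suc (2 * sg)) (D (2 * sg) 0 (A 8 (2 * sg)) (A 9 (2 * sg))) A')"
proof -
 have sq: "(2::nat) ^ (2 * sg) = 2 ^ sg * 2 ^ sg" by (simp add: mult_2 power_add)
 have "HB (Loop 20 sav_body) (st (-1) (2 * sg) v A) (2 + cost (2 * sg))
  (%s. \<exists>A'. agree (2 * sg) A A' & Ab A' & s = st 1 (Suc (2 * sg)) (D (2 * sg) 0 (A 8 (2 * sg)) (A 9 (2 * sg))) A')"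
 proof (rule savitch[where t = 0])
  fix A' assume A': "agree (2 * sg) A A'" "Ab A'"
  let ?v = "D (2 * sg) 0 (A 8 (2 * sg)) (A 9 (2 * sg))"
  have "2 * \<bar>?v\<bar> < 2 ^ qb" by (rule Db) (simp add: sq)
  then have "hbnd qb (st 1 (Suc (2 * sg)) ?v A')" by (intro st_bnd A') auto
  then have "hqt (qb + tau) 20 (st 1 (Suc (2 * sg)) ?v A') = Some False" using hbnd_mono[of qb _ "qb + tau"] by (simp add: hqt_def hts_def) (simp add: st_def)
  then show "HB (Loop 20 sav_body) (st 1 (Suc (2 * sg)) ?v A') 2
   (%s. \<exists>A'. agree (2 * sg) A A' & Ab A' & s = st 1 (Suc (2 * sg)) ?v A')"
   unfolding HB_def by (intro hp_LoopF) (use A' in auto)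
 qed (use assms sq in auto)
 then show ?thesis unfolding HB_def by (rule hp_mono) (use cost_le[of "2 * sg"] in auto)
qed

end
lemma hr_ForZ:
 assumes k: "k < 44" "n < 46" "n ~= k" "j < 44" "j ~= k" "j ~= n"
  and R: "RR 0 44 = 0" "RR 0 n = int m" "RR 0 k = 0" "!!i. i <= m ==> RR i 45 = 1" "RR 0 j = 0" "RR m k = 0" "RR m j = 0"
  and step: "!!i. i < m ==> hr inp J c ((RR i)(j := int i, k := int i - int m), AA i, oo i) b
    ((RR (Suc i))(j := int i, k := int i - int m), AA (Suc i), oo (Suc i))"
  and Z: "m <= Z" "1 <= Z"
 shows "hr inp J (For j k n c) (RR 0, AA 0, oo 0) (Z * (b + 8)) (RR m, AA m, oo m)"
proof (rule hr_conv[OF hr_For[where RR = RR and AA = AA and oo = oo, OF k R step]])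
 have "m * (b + 4) + 4 <= Z * (b + 4) + Z * 4" using Z by (intro add_mono mult_le_mono1) auto
 then show "m * (b + 4) + 4 <= Z * (b + 8)" by (simp add: algebra_simps)
qed auto

section \<open>A scaling phase as a program\<close>

text \<open>The contents of an array after \<open>i\<close> rounds of a loop that fills it with
  \<open>v\<close>.\<close>

definition ov :: "nat => (nat => int) => (nat => int) => nat => int" where
 "ov i v f = (%j. if j < i then v j else f j)"

lemma ov_0 [simp]: "ov 0 v f = f" by (simp add: ov_def)
lemma ov_Suc: "(ov i v f)(i := v i) = ov (Suc i) v f" by (auto simp: ov_def fun_eq_iff)
lemma ov_lt [simp]: "j < i ==> ov i v f j = v j" by (simp add: ov_def)
lemma ov_ge [simp]: "\<not> j < i ==> ov i v f j = f j" by (simp add: ov_def)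

definition fill_col :: "hatom com" where
 "fill_col = Block [HLoad 30 0 28] ;; shl 30 31 ;;
   Block [HAdd 29 29 30, HAdd 28 28 4, HAdd 31 31 10, HConst 30 0]"

definition fill_code :: "hatom com" where
 "fill_code = For 24 25 4 (Block [HAdd 28 24 44] ;; For 26 27 2 fill_col ;;
   Block [HStore 3 24 29, HConst 28 0, HConst 29 0, HConst 31 0, HLoad 30 2 24] ;; shl 30 17 ;;
   Block [HConst 33 1] ;; shl 33 32 ;;
   Block [HAdd 30 30 33, HStore 4 24 30, HAdd 32 32 10, HConst 30 0, HConst 33 0]) ;; Block [HConst 32 0]"

definition shift_code :: "hatom com" where
 "shift_code = For 24 25 4 (Block [HLoad 26 5 24, HAdd 26 26 26, HSub 26 26 12] ;; Cond 26 (Block [HConst 26 0]) (Block []) ;;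
   Block [HStore 5 24 26, HConst 26 0])"

definition res_row :: "hatom com" where
 "res_row = Block [HLoad 31 0 28, HLoad 32 5 29] ;; mulc 33 31 32 ;; Block [HAdd 28 28 45, HConst 31 0, HConst 32 0]"

text \<open>A right shift rounds down; truncation towards 0 is obtained by shifting the absolute
  value and restoring the sign.\<close>

definition res_body :: "hatom com" where
 "res_body = Block [HLoad 26 1 24] ;; Cond 26 (Block [HSub 26 44 26] ;; shr 26 18 ;; Block [HSub 26 44 26]) (shr 26 18) ;;
   For 29 30 4 res_row ;; Block [HSub 26 26 33, HStore 6 24 26] ;; shl 26 34 ;;
   Block [HAdd 27 27 26, HAdd 34 34 10, HConst 26 0, HConst 33 0]"

definition res_code :: "hatom com" where
 "res_code = For 24 25 2 res_body ;;
   Block [HStore 7 14 44, HStore 8 14 27, HStore 9 14 44, HAdd 22 14 44, HSub 21 44 45, HSub 20 44 45,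
    HConst 23 0, HConst 27 0, HConst 28 0, HConst 34 0]"

text \<open>The low digits of the value in register 23 are added to the shifted solution in array 5.
  What remains in register 23 is the cost of the correction, whose sign is inspected after the first
  phase.\<close>

definition dec_code :: "hatom com" where
 "dec_code = For 24 25 4 (Block [HAdd 26 23 44] ;; shr 26 10 ;; Block [HAdd 27 26 44] ;; shl 27 10 ;;
   Block [HSub 27 23 27, HLoad 28 5 24, HAdd 28 28 27, HStore 5 24 28, HAdd 23 26 44, HConst 26 0, HConst 27 0, HConst 28 0]) ;;
   Block [HSub 18 18 45, HConst 21 0, HConst 22 0]"

locale prm =
 fixes inp :: "int list" and J Z N m n l sg e q dd :: nat and BIG :: int
 assumes Zb: "1 <= Z" "N <= Z" "m <= Z" "q * N <= Z" "q * m <= Z" "q <= Z" "l <= Z"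
  and Jb: "m * N <= J" "N <= J" "m <= J" "2 * sg < J"
begin

definition preg :: "(nat => int) => bool" where
 "preg R \<longleftrightarrow> clean R & R 2 = int m & R 3 = int n & R 4 = int N & R 6 = int sg & R 8 = int (e + 1) & R 9 = 2 ^ e &
   R 10 = int q & R 12 = 2 ^ dd & R 13 = BIG & R 14 = int (2 * sg) & R 15 = int (2 ^ ((e + 1) * m)) & R 16 = int l & R 17 = int (q * N)"

lemma pregD: "preg R ==> R 44 = 0" "preg R ==> R 45 = 1"
 "preg R ==> 24 <= (numeral k :: nat) ==> numeral k < (44::nat) ==> R (numeral k) = 0"
 "preg R ==> R 2 = int m" "preg R ==> R 3 = int n" "preg R ==> R 4 = int N" "preg R ==> R 6 = int sg"
 "preg R ==> R 10 = int q" "preg R ==> R 12 = 2 ^ dd" "preg R ==> R 14 = 2 * int sg" "preg R ==> R 16 = int l"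
 "preg R ==> R 17 = int q * int N" by (auto simp: preg_def clean_def)

lemma idx: "k < m ==> j < N ==> k * N + j < J"
proof -
 assume k: "k < m" "j < N"
 then have "k * N + j < Suc k * N" by simp
 also have "... <= m * N" using k by (intro mult_le_mono1) simp
 finally show ?thesis using Jb by simp
qed

lemma qi: "i <= N ==> q * i <= Z" "i <= m ==> q * i <= Z" using Zb(4,5) le_trans mult_le_mono2 by blast+

lemma Z3: "Z <= Z * Z" "Z * Z <= Z * (Z * Z)" "1 <= Z * Z" using Zb(1) by (simp_all add: mult_le_mono)

lemma cubic_bound: "Z * (Z * (a * Z + b) + c * Z + d) + k <= (a + b + c + d + k) * (Z * (Z * Z))"
proof -
 have "b * (Z * Z) <= b * (Z * (Z * Z))" "c * (Z * Z) <= c * (Z * (Z * Z))" using Z3(2) by (intro mult_le_mono2; simp)+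
 moreover have "d * Z <= d * (Z * (Z * Z))" using le_trans[OF Z3(1,2)] by (intro mult_le_mono2)
 moreover have "k * 1 <= k * (Z * (Z * Z))" using le_trans[OF Z3(3,2)] by (intro mult_le_mono2)
 moreover have "Z * (Z * (a * Z + b) + c * Z + d) + k = a * (Z * (Z * Z)) + b * (Z * Z) + c * (Z * Z) + d * Z + k * 1" by (simp add: algebra_simps)
 ultimately show ?thesis unfolding distrib_right by linarith
qed

lemma quad_bound: "Z * (a * Z + b) + k <= (a + b + k) * (Z * Z)"
proof -
 have "b * Z <= b * (Z * Z)" using Z3(1) by (intro mult_le_mono2)
 moreover have "k * 1 <= k * (Z * Z)" using Z3(3) by (intro mult_le_mono2)
 moreover have "Z * (a * Z + b) + k = a * (Z * Z) + b * Z + k * 1" by (simp add: algebra_simps)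
 ultimately show ?thesis unfolding distrib_right by linarith
qed

lemma fill_col_correct:
 assumes R: "preg R" and \<alpha>: "!!k. k < m ==> A 0 (k * N + j) = \<alpha> k" and j: "j < N"
 shows "hr inp J (For 26 27 2 fill_col) (R(24 := x, 25 := y, 28 := int j, 32 := z), A, out) (Z * (12 * Z + 8))
  (R(24 := x, 25 := y, 28 := int (m * N + j), 29 := agg q m \<alpha>, 31 := int (q * m), 32 := z), A, out)"
proof -
 let ?RR = "%i. R(24 := x, 25 := y, 28 := int (i * N + j), 29 := agg q i \<alpha>, 31 := int (q * i), 32 := z)"
 have "hr inp J (For 26 27 2 fill_col) (?RR 0, A, out) (Z * (12 * Z + 8)) (?RR m, A, out)"
 proof (rule hr_ForZ[where RR = ?RR])
  fix i assume i: "i < m"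
  let ?R = "(?RR i)(26 := int i, 27 := int i - int m)"
  have 1: "hr inp J (Block [HLoad 30 0 28]) (?R, A, out) 1 (?R(30 := \<alpha> i), A, out)" by (intro hr_Blk) (use idx[OF i j] \<alpha>[OF i] in \<open>auto simp: nat_add_distrib nat_mult_distrib simp flip: of_nat_mult of_nat_add\<close>)
  have 2: "hr inp J (shl 30 31) (?R(30 := \<alpha> i), A, out) (7 * Z) (?R(30 := \<alpha> i * 2 ^ (q * i)), A, out)" by (intro hr_conv[OF shl_correct[where m = "q * i" and Z = Z]]) (use R i Zb qi(2)[of i] in \<open>auto simp: pregD\<close>)
  have 3: "hr inp J (Block [HAdd 29 29 30, HAdd 28 28 4, HAdd 31 31 10, HConst 30 0]) (?R(30 := \<alpha> i * 2 ^ (q * i)), A, out) 4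
   ((?RR (Suc i))(26 := int i, 27 := int i - int m), A, out)" by (intro hr_Blk) (use R in \<open>auto simp: pregD fun_eq_iff agg_def algebra_simps\<close>)
  show "hr inp J fill_col (?R, A, out) (12 * Z) ((?RR (Suc i))(26 := int i, 27 := int i - int m), A, out)"
   unfolding fill_col_def by (rule hr_conv[OF hr_Seq[OF 1 hr_Seq[OF 2 3]]]) (use Zb in auto)
 qed (use R Zb in \<open>auto simp: pregD\<close>)
 then show ?thesis by (rule hr_conv2) (use R in \<open>auto simp: fun_eq_iff pregD agg_def\<close>)
qed

lemma fill_code_correct:
 assumes R: "preg R" and \<alpha>: "!!k j. k < m ==> j < N ==> A 0 (k * N + j) = \<alpha> k j" and c: "!!j. j < N ==> A 2 j = c j"
 shows "hr inp J fill_code (R, A, out) (60 * (Z * (Z * Z)))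
  (R, A(3 := ov N (col q m \<alpha>) (A 3), 4 := ov N (wgt q N c) (A 4)), out)"
proof -
 let ?RR = "%i. R(32 := int (q * i))"
 let ?AA = "%i. A(3 := ov i (col q m \<alpha>) (A 3), 4 := ov i (wgt q N c) (A 4))"
 let ?body = "Block [HAdd 28 24 44] ;; For 26 27 2 fill_col ;;
   Block [HStore 3 24 29, HConst 28 0, HConst 29 0, HConst 31 0, HLoad 30 2 24] ;; shl 30 17 ;;
   Block [HConst 33 1] ;; shl 33 32 ;;
   Block [HAdd 30 30 33, HStore 4 24 30, HAdd 32 32 10, HConst 30 0, HConst 33 0]"
 have L: "hr inp J (For 24 25 4 ?body) (?RR 0, ?AA 0, out) (Z * (Z * (12 * Z + 8) + 26 * Z + 8)) (?RR N, ?AA N, out)"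
 proof (rule hr_ForZ[where RR = ?RR and AA = ?AA])
  fix i assume i: "i < N"
  let ?R = "(?RR i)(24 := int i, 25 := int i - int N)"
  let ?A1 = "(?AA i)(3 := ov (Suc i) (col q m \<alpha>) (A 3))"
  have iJ: "i < J" using i Jb by simp
  have 1: "hr inp J (Block [HAdd 28 24 44]) (?R, ?AA i, out) 1 (?R(28 := int i), ?AA i, out)" by (intro hr_Blk) (use R in \<open>auto simp: pregD fun_eq_iff\<close>)
  have 2: "hr inp J (For 26 27 2 fill_col) (?R(28 := int i), ?AA i, out) (Z * (12 * Z + 8))
   (?R(28 := int (m * N + i), 29 := col q m \<alpha> i, 31 := int (q * m)), ?AA i, out)" by (rule hr_conv2[OF fill_col_correct[OF R _ i, of "?AA i" "%k. \<alpha> k i"]]) (use \<alpha> i in \<open>auto simp: fun_eq_iff col_def\<close>)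
  have 3: "hr inp J (Block [HStore 3 24 29, HConst 28 0, HConst 29 0, HConst 31 0, HLoad 30 2 24])
   (?R(28 := int (m * N + i), 29 := col q m \<alpha> i, 31 := int (q * m)), ?AA i, out) 5 (?R(30 := c i), ?A1, out)" by (intro hr_Blk) (use R iJ c[OF i] in \<open>auto simp: pregD fun_eq_iff simp flip: ov_Suc\<close>)
  have 4: "hr inp J (shl 30 17) (?R(30 := c i), ?A1, out) (7 * Z) (?R(30 := c i * 2 ^ (q * N)), ?A1, out)" by (intro hr_conv[OF shl_correct[where m = "q * N" and Z = Z]]) (use R Zb in \<open>auto simp: pregD\<close>)
  have 5: "hr inp J (Block [HConst 33 1]) (?R(30 := c i * 2 ^ (q * N)), ?A1, out) 1 (?R(30 := c i * 2 ^ (q * N), 33 := 1), ?A1, out)" by (intro hr_Blk) auto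
  have 6: "hr inp J (shl 33 32) (?R(30 := c i * 2 ^ (q * N), 33 := 1), ?A1, out) (7 * Z) (?R(30 := c i * 2 ^ (q * N), 33 := 2 ^ (q * i)), ?A1, out)" by (intro hr_conv[OF shl_correct[where m = "q * i" and Z = Z]]) (use R Zb i qi(1)[of i] in \<open>auto simp: pregD\<close>)
  have 7: "hr inp J (Block [HAdd 30 30 33, HStore 4 24 30, HAdd 32 32 10, HConst 30 0, HConst 33 0])
    (?R(30 := c i * 2 ^ (q * N), 33 := 2 ^ (q * i)), ?A1, out) 5 ((?RR (Suc i))(24 := int i, 25 := int i - int N), ?AA (Suc i), out)" by (intro hr_Blk) (use R iJ in \<open>auto simp: pregD fun_eq_iff algebra_simps wgt_def simp flip: ov_Suc\<close>)
  show "hr inp J ?body (?R, ?AA i, out) (Z * (12 * Z + 8) + 26 * Z) ((?RR (Suc i))(24 := int i, 25 := int i - int N), ?AA (Suc i), out)" by (rule hr_conv[OF hr_Seq[OF 1 hr_Seq[OF 2 hr_Seq[OF 3 hr_Seq[OF 4 hr_Seq[OF 5 hr_Seq[OF 6 7]]]]]]]) (use Zb in auto)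
 qed (use R Zb in \<open>auto simp: pregD\<close>)
 have E: "hr inp J (Block [HConst 32 0]) (?RR N, ?AA N, out) 1 (R, ?AA N, out)" by (intro hr_Blk) (use R in \<open>auto simp: pregD fun_eq_iff\<close>)
 have s: "?RR 0 = R" "?AA 0 = A" using R by (auto simp: fun_eq_iff pregD)
 show ?thesis unfolding fill_code_def by (rule hr_conv2[OF hr_Seq[OF L E]]) (use s cubic_bound[of 12 8 26 8 1] in auto)
qed

lemma shift_code_correct:
 assumes R: "preg R"
 shows "hr inp J shift_code (R, A, out) (17 * Z) (R, A(5 := ov N (shift_down dd (A 5)) (A 5)), out)"
proof -
 let ?AA = "%i. A(5 := ov i (shift_down dd (A 5)) (A 5))"
 have "hr inp J shift_code (R, ?AA 0, out) (Z * (9 + 8)) (R, ?AA N, out)" unfolding shift_code_def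
 proof (rule hr_ForZ[where RR = "%i. R" and AA = ?AA])
  fix i assume i: "i < N"
  let ?R = "R(24 := int i, 25 := int i - int N)"
  have iJ: "i < J" using i Jb by simp
  have 1: "hr inp J (Block [HLoad 26 5 24, HAdd 26 26 26, HSub 26 26 12]) (?R, ?AA i, out) 3 (?R(26 := 2 * A 5 i - 2 ^ dd), ?AA i, out)" by (intro hr_Blk) (use R iJ in \<open>auto simp: pregD fun_eq_iff\<close>)
  have 2: "hr inp J (Cond 26 (Block [HConst 26 0]) (Block [])) (?R(26 := 2 * A 5 i - 2 ^ dd), ?AA i, out) (max 1 0 + 2) (?R(26 := shift_down dd (A 5) i), ?AA i, out)" by (rule hr_Cond) (auto intro!: hr_Blk simp: shift_down_def)
  have 3: "hr inp J (Block [HStore 5 24 26, HConst 26 0]) (?R(26 := shift_down dd (A 5) i), ?AA i, out) 2 (?R, ?AA (Suc i), out)" by (intro hr_Blk) (use R iJ in \<open>auto simp: pregD fun_eq_iff simp flip: ov_Suc\<close>)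
  show "hr inp J (Block [HLoad 26 5 24, HAdd 26 26 26, HSub 26 26 12] ;; Cond 26 (Block [HConst 26 0]) (Block []) ;;
   Block [HStore 5 24 26, HConst 26 0]) (?R, ?AA i, out) 9 (?R, ?AA (Suc i), out)" by (rule hr_conv[OF hr_Seq[OF 1 hr_Seq[OF 2 3]]]) auto
 qed (use R Zb in \<open>auto simp: pregD\<close>)
 then show ?thesis by (simp add: mult.commute)
qed

lemma res_row_correct:
 assumes R: "preg R" and A: "!!j. j < N ==> A 0 (k * N + j) = \<alpha> j" "!!j. j < N ==> A 5 j = u j"
  and u: "!!j. j < N ==> 0 <= u j & u j < 2 ^ Z" and k: "k < m"
 shows "hr inp J (For 29 30 4 res_row) (R(24 := x, 25 := y, 26 := z, 27 := z', 28 := int (k * N), 34 := z''), A, out) (Z * (23 * Z + 8))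
  (R(24 := x, 25 := y, 26 := z, 27 := z', 28 := int (Suc k * N), 33 := lin N \<alpha> u, 34 := z''), A, out)"
proof -
 let ?RR = "%i. R(24 := x, 25 := y, 26 := z, 27 := z', 28 := int (k * N + i), 33 := lin i \<alpha> u, 34 := z'')"
 have "hr inp J (For 29 30 4 res_row) (?RR 0, A, out) (Z * (23 * Z + 8)) (?RR N, A, out)"
 proof (rule hr_ForZ[where RR = ?RR])
  fix i assume i: "i < N"
  let ?R = "(?RR i)(29 := int i, 30 := int i - int N)"
  have iJ: "i < J" using i Jb by simp
  have 1: "hr inp J (Block [HLoad 31 0 28, HLoad 32 5 29]) (?R, A, out) 2 (?R(31 := \<alpha> i, 32 := u i), A, out)" by (intro hr_Blk) (use idx[OF k i] A i iJ in \<open>auto simp: nat_add_distrib nat_mult_distrib simp flip: of_nat_mult of_nat_add\<close>)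
  have 2: "hr inp J (mulc 33 31 32) (?R(31 := \<alpha> i, 32 := u i), A, out) (18 * Z) (?R(31 := \<alpha> i, 32 := u i, 33 := lin (Suc i) \<alpha> u), A, out)" by (rule hr_conv[OF mulc_correct[where Z = Z]]) (use R u[OF i] Zb in \<open>auto simp: pregD fun_eq_iff lin_def\<close>)
  have 3: "hr inp J (Block [HAdd 28 28 45, HConst 31 0, HConst 32 0]) (?R(31 := \<alpha> i, 32 := u i, 33 := lin (Suc i) \<alpha> u), A, out) 3
   ((?RR (Suc i))(29 := int i, 30 := int i - int N), A, out)" by (intro hr_Blk) (use R in \<open>auto simp: pregD fun_eq_iff\<close>)
  show "hr inp J res_row (?R, A, out) (23 * Z) ((?RR (Suc i))(29 := int i, 30 := int i - int N), A, out)"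
   unfolding res_row_def by (rule hr_conv[OF hr_Seq[OF 1 hr_Seq[OF 2 3]]]) (use Zb in auto)
 qed (use R Zb in \<open>auto simp: pregD\<close>)
 then show ?thesis by (rule hr_conv2) (use R in \<open>auto simp: fun_eq_iff pregD lin_def algebra_simps\<close>)
qed

lemma res_code_correct:
 assumes R: "preg R" "R 18 = int p" "p <= Z"
  and A: "!!k j. k < m ==> j < N ==> A 0 (k * N + j) = \<alpha> k j" "!!j. j < N ==> A 5 j = u j" "!!k. k < m ==> A 1 k = b k"
  and u: "!!j. j < N ==> 0 <= u j & u j < 2 ^ Z"
 defines "g \<equiv> residual N \<alpha> (%k. trunc_div p (b k)) u"
 shows "hr inp J res_code (R, A, out) (80 * (Z * (Z * Z))) (R(20 := -1, 21 := -1, 22 := 2 * int sg, 23 := 0),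
   A(6 := ov m g (A 6), 7 := (A 7)(2 * sg := 0), 8 := (A 8)(2 * sg := agg q m g), 9 := (A 9)(2 * sg := 0)), out)"
proof -
 let ?RR = "%i. R(27 := agg q i g, 28 := int (i * N), 34 := int (q * i))"
 let ?AA = "%i. A(6 := ov i g (A 6))"
 have L: "hr inp J (For 24 25 2 res_body) (?RR 0, ?AA 0, out) (Z * (Z * (23 * Z + 8) + 25 * Z + 8)) (?RR m, ?AA m, out)"
 proof (rule hr_ForZ[where RR = ?RR and AA = ?AA])
  fix i assume i: "i < m"
  let ?R = "(?RR i)(24 := int i, 25 := int i - int m)"
  let ?t = "trunc_div p (b i)" and ?s = "lin N (\<alpha> i) u"
  have iJ: "i < J" using i Jb by simp
  have 1: "hr inp J (Block [HLoad 26 1 24]) (?R, ?AA i, out) 1 (?R(26 := b i), ?AA i, out)" by (intro hr_Blk) (use A(3)[OF i] iJ in \<open>auto\<close>)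
  have 2: "hr inp J (Cond 26 (Block [HSub 26 44 26] ;; shr 26 18 ;; Block [HSub 26 44 26]) (shr 26 18)) (?R(26 := b i), ?AA i, out) (max (1 + (7 * Z + 1)) (7 * Z) + 2) (?R(26 := ?t), ?AA i, out)"
  proof (rule hr_Cond)
   assume "(?R(26 := b i)) 26 < 0"
   then have bn: "b i < 0" by simp
   have a1: "hr inp J (Block [HSub 26 44 26]) (?R(26 := b i), ?AA i, out) 1 (?R(26 := - b i), ?AA i, out)" by (intro hr_Blk) (use R in \<open>auto simp: pregD\<close>)
   have a2: "hr inp J (shr 26 18) (?R(26 := - b i), ?AA i, out) (7 * Z) (?R(26 := - b i div 2 ^ p), ?AA i, out)" by (intro hr_conv[OF shr_correct[where m = p and Z = Z]]) (use R Zb in \<open>auto simp: pregD\<close>)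
   have a3: "hr inp J (Block [HSub 26 44 26]) (?R(26 := - b i div 2 ^ p), ?AA i, out) 1 (?R(26 := ?t), ?AA i, out)" by (intro hr_Blk) (use R bn in \<open>auto simp: pregD trunc_div_def\<close>)
   show "hr inp J (Block [HSub 26 44 26] ;; shr 26 18 ;; Block [HSub 26 44 26]) (?R(26 := b i), ?AA i, out) (1 + (7 * Z + 1)) (?R(26 := ?t), ?AA i, out)" by (rule hr_Seq[OF a1 hr_Seq[OF a2 a3]])
  next
   assume "\<not> (?R(26 := b i)) 26 < 0"
   then have bn: "0 <= b i" by simp
   then have "b i div 2 ^ p = ?t" by (cases "b i = 0") (auto simp: trunc_div_def)
   then show "hr inp J (shr 26 18) (?R(26 := b i), ?AA i, out) (7 * Z) (?R(26 := ?t), ?AA i, out)" by (intro hr_conv[OF shr_correct[where m = p and Z = Z]]) (use R Zb in \<open>auto simp: pregD\<close>)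
  qed simp
  have 3: "hr inp J (For 29 30 4 res_row) (?R(26 := ?t), ?AA i, out) (Z * (23 * Z + 8)) (?R(26 := ?t, 28 := int (Suc i * N), 33 := ?s), ?AA i, out)" by (rule hr_conv2[OF res_row_correct[where k = i and \<alpha> = "\<alpha> i" and u = u and A = "?AA i", OF R(1) _ _ u i]]) (use A i in \<open>auto simp: fun_eq_iff\<close>)
  have 4: "hr inp J (Block [HSub 26 26 33, HStore 6 24 26]) (?R(26 := ?t, 28 := int (Suc i * N), 33 := ?s), ?AA i, out) 2
    (?R(26 := g i, 28 := int (Suc i * N), 33 := ?s), ?AA (Suc i), out)" by (intro hr_Blk) (use iJ in \<open>auto simp: fun_eq_iff g_def residual_def simp flip: ov_Suc\<close>)
  have 5: "hr inp J (shl 26 34) (?R(26 := g i, 28 := int (Suc i * N), 33 := ?s), ?AA (Suc i), out) (7 * Z)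
   (?R(26 := g i * 2 ^ (q * i), 28 := int (Suc i * N), 33 := ?s), ?AA (Suc i), out)" by (intro hr_conv[OF shl_correct[where m = "q * i" and Z = Z]]) (use R Zb i qi(2)[of i] in \<open>auto simp: pregD\<close>)
  have 6: "hr inp J (Block [HAdd 27 27 26, HAdd 34 34 10, HConst 26 0, HConst 33 0])
   (?R(26 := g i * 2 ^ (q * i), 28 := int (Suc i * N), 33 := ?s), ?AA (Suc i), out) 4
   ((?RR (Suc i))(24 := int i, 25 := int i - int m), ?AA (Suc i), out)" by (intro hr_Blk) (use R in \<open>auto simp: pregD fun_eq_iff agg_def algebra_simps\<close>)
  show "hr inp J res_body (?R, ?AA i, out) (Z * (23 * Z + 8) + 25 * Z) ((?RR (Suc i))(24 := int i, 25 := int i - int m), ?AA (Suc i), out)"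
   unfolding res_body_def by (rule hr_conv[OF hr_Seq[OF 1 hr_Seq[OF 2 hr_Seq[OF 3 hr_Seq[OF 4 hr_Seq[OF 5 6]]]]]]) (use Zb in auto)
 qed (use R Zb in \<open>auto simp: pregD\<close>)
 have E: "hr inp J (Block [HStore 7 14 44, HStore 8 14 27, HStore 9 14 44, HAdd 22 14 44, HSub 21 44 45, HSub 20 44 45,
    HConst 23 0, HConst 27 0, HConst 28 0, HConst 34 0]) (?RR m, ?AA m, out) 10 (R(20 := -1, 21 := -1, 22 := 2 * int sg, 23 := 0),
   A(6 := ov m g (A 6), 7 := (A 7)(2 * sg := 0), 8 := (A 8)(2 * sg := agg q m g), 9 := (A 9)(2 * sg := 0)), out)" by (intro hr_Blk) (use R Jb in \<open>auto simp: pregD fun_eq_iff nat_mult_distrib\<close>)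
 have s: "?RR 0 = R" "?AA 0 = A" using R by (auto simp: fun_eq_iff pregD agg_def)
 show ?thesis unfolding res_code_def by (rule hr_conv2[OF hr_Seq[OF L E]]) (use s cubic_bound[of 23 8 25 8 10] in auto)
qed

lemma dec_code_correct:
 assumes R: "preg R" "R 18 = p" "R 21 = 0" "R 22 = 0"
 shows "hr inp J dec_code (R(21 := x, 22 := y, 23 := v), A, out) (40 * (Z * Z))
  (R(18 := p - 1, 23 := v div 2 ^ (q * N)), A(5 := ov N (%j. A 5 j + digit q v j) (A 5)), out)"
proof -
 let ?RR = "%i. R(21 := x, 22 := y, 23 := v div 2 ^ (q * i))"
 let ?AA = "%i. A(5 := ov i (%j. A 5 j + digit q v j) (A 5))"
 let ?body = "Block [HAdd 26 23 44] ;; shr 26 10 ;; Block [HAdd 27 26 44] ;; shl 27 10 ;;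
   Block [HSub 27 23 27, HLoad 28 5 24, HAdd 28 28 27, HStore 5 24 28, HAdd 23 26 44, HConst 26 0, HConst 27 0, HConst 28 0]"
 have L: "hr inp J (For 24 25 4 ?body) (?RR 0, ?AA 0, out) (Z * (24 * Z + 8)) (?RR N, ?AA N, out)"
 proof (rule hr_ForZ[where RR = ?RR and AA = ?AA])
  fix i assume i: "i < N"
  let ?R = "(?RR i)(24 := int i, 25 := int i - int N)"
  let ?x = "v div 2 ^ (q * i)"
  let ?y = "v div 2 ^ (q * Suc i)"
  have iJ: "i < J" using i Jb by simp
  have xy: "?x div 2 ^ q = ?y" by (simp add: zdiv_zmult2_eq[symmetric] power_add[symmetric] add.commute)
  have dg: "?x - ?y * 2 ^ q = digit q v i" unfolding xy[symmetric] digit_def by (simp add: minus_div_mult_eq_mod)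
  have 1: "hr inp J (Block [HAdd 26 23 44]) (?R, ?AA i, out) 1 (?R(26 := ?x), ?AA i, out)" by (intro hr_Blk) (use R in \<open>auto simp: pregD\<close>)
  have 2: "hr inp J (shr 26 10) (?R(26 := ?x), ?AA i, out) (7 * Z) (?R(26 := ?y), ?AA i, out)" by (intro hr_conv[OF shr_correct[where m = q and Z = Z]]) (use R Zb xy in \<open>auto simp: pregD\<close>)
  have 3: "hr inp J (Block [HAdd 27 26 44]) (?R(26 := ?y), ?AA i, out) 1 (?R(26 := ?y, 27 := ?y), ?AA i, out)" by (intro hr_Blk) (use R in \<open>auto simp: pregD\<close>)
  have 4: "hr inp J (shl 27 10) (?R(26 := ?y, 27 := ?y), ?AA i, out) (7 * Z) (?R(26 := ?y, 27 := ?y * 2 ^ q), ?AA i, out)" by (intro hr_conv[OF shl_correct[where m = q and Z = Z]]) (use R Zb in \<open>auto simp: pregD\<close>)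
  have 5: "hr inp J (Block [HSub 27 23 27, HLoad 28 5 24, HAdd 28 28 27, HStore 5 24 28, HAdd 23 26 44, HConst 26 0, HConst 27 0, HConst 28 0])
    (?R(26 := ?y, 27 := ?y * 2 ^ q), ?AA i, out) 8 ((?RR (Suc i))(24 := int i, 25 := int i - int N), ?AA (Suc i), out)" by (intro hr_Blk) (use R iJ dg in \<open>auto simp: pregD fun_eq_iff simp flip: ov_Suc\<close>)
  show "hr inp J ?body (?R, ?AA i, out) (24 * Z) ((?RR (Suc i))(24 := int i, 25 := int i - int N), ?AA (Suc i), out)" by (rule hr_conv[OF hr_Seq[OF 1 hr_Seq[OF 2 hr_Seq[OF 3 hr_Seq[OF 4 5]]]]]) (use Zb in auto)
 qed (use R Zb in \<open>auto simp: pregD\<close>)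
 have E: "hr inp J (Block [HSub 18 18 45, HConst 21 0, HConst 22 0]) (?RR N, ?AA N, out) 3 (R(18 := p - 1, 23 := v div 2 ^ (q * N)), ?AA N, out)" by (intro hr_Blk) (use R in \<open>auto simp: pregD fun_eq_iff\<close>)
 have s: "?RR 0 = R(21 := x, 22 := y, 23 := v)" "?AA 0 = A" by (auto simp: fun_eq_iff)
 show ?thesis unfolding dec_code_def by (rule hr_conv2[OF hr_Seq[OF L E]]) (use s quad_bound[of 24 8 3] in auto)
qed

end

section \<open>Magnitudes and running time of a phase\<close>

lemma hp_hq_mono: "hp (hq q inp J) (hqt q) c s b Q ==> q <= q' ==> hp (hq q' inp J) (hqt q') c s b Q"
 unfolding hp_def using runs_hq_mono by blast

definition phase_code :: "hatom com" where
 "phase_code = (shift_code ;; res_code) ;; Loop 20 sav_body ;; dec_code"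

lemma int_pow_le: "a <= b ==> (2::int) ^ a <= 2 ^ b" by (rule power_increasing) auto

lemma abs_agg_le:
 assumes "!!k. k < m ==> \<bar>v k\<bar> <= 2 ^ x"
 shows "\<bar>\<Sum>k<m. v k * 2 ^ (i + q * k)\<bar> < (2::int) ^ (m + x + i + q * m)"
proof -
 have "\<bar>\<Sum>k<m. v k * 2 ^ (i + q * k)\<bar> <= (\<Sum>k<m. 2 ^ (x + i + q * m))"
 proof (rule order_trans[OF sum_abs sum_mono])
  fix k assume k: "k \<in> {..<m}"
  have "q * k <= q * m" using k by (intro mult_le_mono2) simp
  then have "\<bar>v k\<bar> * 2 ^ (i + q * k) <= 2 ^ x * 2 ^ (i + q * m)" using k assms by (intro mult_mono int_pow_le) auto
  then show "\<bar>v k * 2 ^ (i + q * k)\<bar> <= 2 ^ (x + i + q * m)" by (simp add: abs_mult power_add)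
 qed
 also have "... = int m * 2 ^ (x + i + q * m)" by simp
 also have "... < 2 ^ m * 2 ^ (x + i + q * m)" by (rule mult_strict_right_mono) (auto simp: less_exp of_nat_less_two_power)
 also have "... = 2 ^ (m + x + i + q * m)" by (simp add: power_add)
 finally show ?thesis .
qed

locale phase_run = instance_params N m \<delta> \<nu> \<pi> \<mu> sg dd q e \<alpha> c BIG
 for N m \<delta> \<nu> \<pi> \<mu> sg dd q e :: nat and \<alpha> :: "nat => nat => int" and c :: "nat => int" and BIG :: int +
 fixes inp :: "int list" and J Z n l qb :: nat and b :: "nat => int"
 assumes Zsum: "2 * sg + 2 ^ sg + 2 ^ sg + q * N + q * m + q + q + \<mu> + m + \<nu> + \<delta> + l + l + e + e + (e + 1) * m + dd + N + 40 <= Z"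
  and J: "m * N <= J" "N <= J" "m <= J" "2 * sg < J"
  and inpb: "!!v. v \<in> set inp ==> \<bar>v\<bar> < 2 ^ qb" and qb: "Z <= qb"
  and b: "!!k. k < m ==> \<bar>b k\<bar> < 2 ^ l"
begin

lemma nn: "0 <= q * N" "0 <= q * m" "0 <= e * m" "(0::nat) <= 2 ^ sg" by simp_all

lemmas ZZ = Zsum nn

lemma qb1: "1 <= qb" using ZZ qb by linarith

sublocale prm inp J Z N m n l sg e q dd BIG by unfold_locales (use ZZ J in linarith)+

abbreviation "lev \<equiv> qb + 200 * (Z * (Z * Z))"
abbreviation "HQ \<equiv> hp (hq lev inp J) (hqt lev)"
abbreviation "tau \<equiv> N * (31 * Z + 4) + m * (50 * Z + 4) + 14 * Z + 80"

lemma tau_le: "tau + 2 <= 185 * (Z * Z)"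
proof -
 have "N * (31 * Z + 4) <= Z * (31 * Z + 4)" "m * (50 * Z + 4) <= Z * (50 * Z + 4)" using Zb by (intro mult_le_mono1; simp)+
 moreover have "Z * (31 * Z + 4) + 0 <= (31 + 4 + 0) * (Z * Z)" "Z * (50 * Z + 4) + 82 <= (50 + 4 + 82) * (Z * Z)" by (rule quad_bound)+
 moreover have "14 * Z <= 14 * (Z * Z)" using Z3(1) by simp
 moreover have "185 * (Z * Z) = (31 + 4 + 0) * (Z * Z) + (50 + 4 + 82) * (Z * Z) + 14 * (Z * Z)" by simp
 ultimately show ?thesis by linarith
qed

text \<open>Arrays 0, 1, 3, 4 and 5 hold the matrix by rows, the right-hand side, the packed
  columns, the weights and the current solution. The bit bound \<open>qb\<close> is part of the
  invariant and is restored by every phase, so that growth does not accumulate over the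
  phases.\<close>

definition phase_inv :: "int => (nat => int) => (nat => int) => (nat => nat => int) => bool" where
 "phase_inv p y R A \<longleftrightarrow> preg R & R 18 = p & R 20 = 0 & R 21 = 0 & R 22 = 0 &
   (\<forall>k<m. \<forall>j<N. A 0 (k * N + j) = \<alpha> k j) & (\<forall>k<m. A 1 k = b k) &
   (\<forall>j<N. A 3 j = col q m \<alpha> j) & (\<forall>j<N. A 4 j = wgt q N c j) & (\<forall>j<N. A 5 j = y j) &
   (\<forall>x. \<bar>R x\<bar> < 2 ^ qb) & (\<forall>f j. \<bar>A f j\<bar> < 2 ^ qb)"

lemma less_qb: "x < 2 ^ k ==> k <= Z ==> (x::int) < 2 ^ qb" using int_pow_le[of k qb] qb by linarith

text \<open>Soundness confines every value between minus the largest total weight of its steps and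
  \<open>BIG\<close>; as \<open>r\<close> is at most \<open>2 * sg\<close>, the lower end is no
  larger than \<open>BIG\<close> in absolute value.\<close>

lemma dist_bound:
 assumes "t + 2 ^ r <= 2 ^ sg * 2 ^ sg"
 shows "2 * \<bar>dist_rec (base_dist N (col q m \<alpha>) (wgt q N c) sg BIG) BIG (2 ^ ((e + 1) * m)) md r t V1 V2\<bar> < 2 ^ qb"
proof -
 let ?W = "2 ^ (q * N + \<mu> + 1 + 2 ^ sg) :: int"
 let ?d = "dist_rec (base_dist N (col q m \<alpha>) (wgt q N c) sg BIG) BIG (2 ^ ((e + 1) * m)) md r t V1 V2"
 have w: "\<bar>wgt q N c j * 2 ^ i\<bar> <= ?W" if j: "j < N" and i: "i < 2 ^ sg" for j i :: nat
 proof -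
  have "q * j <= q * N" using j by (intro mult_le_mono2) simp
  then have "(2::int) ^ (q * j) <= 2 ^ (q * N + \<mu>)" by (intro int_pow_le trans_le_add1)
  moreover have "\<bar>c j * 2 ^ (q * N)\<bar> <= 2 ^ (q * N + \<mu>)"
   unfolding abs_mult power_add using c[OF j] by (simp add: mult.commute less_imp_le)
  moreover have "(0::int) <= 2 ^ (q * j)" by simp
  ultimately have "\<bar>wgt q N c j\<bar> <= 2 * 2 ^ (q * N + \<mu>)" unfolding wgt_def by linarith
  then have "\<bar>wgt q N c j\<bar> * 2 ^ i <= (2 * 2 ^ (q * N + \<mu>)) * 2 ^ (2 ^ sg)" using i by (intro mult_mono int_pow_le) auto
  also have "... = ?W" by (simp add: power_add)
  finally show ?thesis by (simp add: abs_mult)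
 qed
 have B0: "0 <= BIG" by (simp add: BIG)
 have d: "?d <= BIG" "- (?W * 2 ^ r) <= ?d" using dist_rec_sound[of N sg "wgt q N c" ?W BIG t r "col q m \<alpha>" "2 ^ ((e + 1) * m)" md V1 V2] w B0 assms by auto
 have "(2::nat) ^ r <= 2 ^ (2 * sg)" using assms by (simp add: mult_2 power_add)
 then have r: "r <= 2 * sg" by (rule power_le_imp_le_exp[rotated]) simp
 have "?W * 2 ^ r <= ?W * 2 ^ (2 * sg)" using r by (intro mult_left_mono int_pow_le) auto
 also have "... <= BIG" unfolding BIG power_add[symmetric] by (intro int_pow_le) simp
 finally have "2 * \<bar>?d\<bar> <= 2 * BIG" using d by linarith
 also have "... < 2 ^ (2 * sg + 2 ^ sg + q * N + \<mu> + 4)" by (simp add: BIG power_add)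
 finally show ?thesis by (rule less_qb) (use ZZ in linarith)
qed

lemma value_range:
 "2 * \<bar>phase_value b' y\<bar> < 2 ^ qb"
 unfolding phase_value_def inner_value_def by (rule dist_bound) (simp add: mult_2 power_add)

abbreviation "gx \<equiv> \<nu> + \<delta> + q + l + 4"

text \<open>A crude bound from the range of \<open>y\<close> alone. The control of number sizes
  thereby stays separate from the optimality argument.\<close>

lemma phase_residual_bound:
 assumes y: "!!j. j < N ==> 0 <= y j & y j < 2 ^ (q + l + 1)" and k: "k < m"
 shows "\<bar>phase_residual (%k. trunc_div p (b k)) y k\<bar> <= 2 ^ gx"
proof -
 have u: "\<bar>shift_down dd y j\<bar> <= 2 ^ (q + l + 2)" if "j < N" for j
 proof -
  have "2 * y j - 2 ^ dd <= 2 * 2 ^ (q + l + 1)" using y[OF that] zero_le_power[of "2::int" dd] by linarith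
  then show ?thesis by (simp add: shift_down_def)
 qed
 have "\<bar>lin N (\<alpha> k) (shift_down dd y)\<bar> <= int N * (2 ^ \<delta> * 2 ^ (q + l + 2))" by (rule abs_lin_le) (use \<alpha> k u in auto)
 also have "... <= 2 ^ \<nu> * (2 ^ \<delta> * 2 ^ (q + l + 2))"
 proof (rule mult_right_mono)
  have "int N < int (2 ^ \<nu>)" using N by (simp only: of_nat_less_iff)
  then show "int N <= 2 ^ \<nu>" by simp
 qed simp
 also have "... = 2 ^ (\<nu> + \<delta> + q + l + 2)" by (simp add: power_add)
 finally have 1: "\<bar>lin N (\<alpha> k) (shift_down dd y)\<bar> <= 2 ^ (\<nu> + \<delta> + q + l + 2)" .
 have "(2::int) ^ l <= 2 ^ (\<nu> + \<delta> + q + l + 2)" by (intro int_pow_le) simp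
 then have 2: "\<bar>trunc_div p (b k)\<bar> <= 2 ^ (\<nu> + \<delta> + q + l + 2)" using abs_trunc_div[of p "b k"] b[OF k] by linarith
 have "\<bar>phase_residual (%k. trunc_div p (b k)) y k\<bar> <= 2 * 2 ^ (\<nu> + \<delta> + q + l + 2)" using 1 2 unfolding phase_residual_def residual_def by linarith
 also have "... <= 2 ^ gx" by (simp add: power_add)
 finally show ?thesis .
qed

lemma mid_bound:
 assumes g: "!!k. k < m ==> \<bar>g k\<bar> <= 2 ^ gx" and t: "t < 2 ^ sg * 2 ^ sg"
 shows "\<bar>mid_point q m sg e g t \<kappa>\<bar> < 2 ^ qb"
proof -
 let ?i = "t div 2 ^ sg"
 have i: "?i < 2 ^ sg" using t by (simp add: div_less_iff_less_mult)
 have "\<bar>g k div 2 ^ ?i - 2 ^ e + int (\<kappa> div 2 ^ ((e + 1) * k) mod 2 ^ (e + 1))\<bar> <= 2 ^ (gx + e + 3)" if k: "k < m" for k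
 proof -
  have "(2::int) ^ 0 <= 2 ^ ?i" by (rule int_pow_le) simp
  then have d: "1 <= (2::int) ^ ?i" by simp
  have "\<bar>g k div 2 ^ ?i\<bar> <= 2 ^ gx"
  proof -
   have "g k div 2 ^ ?i <= 2 ^ gx div 2 ^ ?i" using g[OF k] by (intro zdiv_mono1) auto
   also have "... <= 2 ^ gx" using zdiv_mono2[of "2 ^ gx" 1 "2 ^ ?i"] d by simp
   finally have 1: "g k div 2 ^ ?i <= 2 ^ gx" .
   have "- (2 ^ gx) * 2 ^ ?i <= g k"
   proof -
    have "1 * 2 ^ gx <= 2 ^ ?i * (2 ^ gx :: int)" using d by (intro mult_right_mono) auto
    moreover have "- (2 ^ gx) * 2 ^ ?i = - (2 ^ ?i * (2 ^ gx :: int))" by (simp add: mult.commute)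
    ultimately show ?thesis using g[OF k] by linarith
   qed
   then have "- (2 ^ gx) <= g k div 2 ^ ?i" using zdiv_mono1[of "- (2 ^ gx) * 2 ^ ?i" "g k" "2 ^ ?i"] nonzero_mult_div_cancel_right[of "2 ^ ?i" "- (2 ^ gx) :: int"] by (simp only: zero_less_power zero_less_numeral) simp
   then show ?thesis using 1 by linarith
  qed
  moreover have "(2::int) ^ gx <= 2 ^ (gx + e + 1)" "(2::int) ^ e <= 2 ^ (gx + e + 1)" by (intro int_pow_le; simp)+
  moreover have "int (\<kappa> div 2 ^ ((e + 1) * k) mod 2 ^ (e + 1)) <= 2 ^ (gx + e + 1)"
  proof -
   have "\<kappa> div 2 ^ ((e + 1) * k) mod 2 ^ (e + 1) < 2 ^ (e + 1)" by simp
   then have "int (\<kappa> div 2 ^ ((e + 1) * k) mod 2 ^ (e + 1)) < int (2 ^ (e + 1))" by (simp only: of_nat_less_iff)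
   also have "... = 2 ^ (e + 1)" by simp
   also have "... <= (2::int) ^ (gx + e + 1)" by (intro int_pow_le) simp
   finally show ?thesis by simp
  qed
  moreover have "(2::int) ^ (gx + e + 3) = 4 * 2 ^ (gx + e + 1)" by (simp add: power_add)
  moreover have "\<bar>x - y + z\<bar> <= C" if "\<bar>x\<bar> <= A" "A <= B" "0 <= y" "y <= B" "0 <= z" "z <= B" "C = 4 * B"
   for x y z A B C :: int using that by linarith
  ultimately show ?thesis by (metis of_nat_0_le_iff zero_le_numeral zero_le_power)
 qed
 from abs_agg_le[OF this, of m "%k. k" ?i q] have "\<bar>mid_point q m sg e g t \<kappa>\<bar> < 2 ^ (m + (gx + e + 3) + ?i + q * m)" by (simp add: mid_point_def Let_def)
 then show ?thesis by (rule less_qb) (use ZZ i in linarith)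
qed

lemma agg_bound:
 assumes g: "!!k. k < m ==> \<bar>g k\<bar> <= 2 ^ gx"
 shows "\<bar>agg q m g\<bar> < 2 ^ qb"
proof -
 have "\<bar>agg q m g\<bar> < 2 ^ (m + gx + 0 + q * m)" using abs_agg_le[OF g, of m "%k. k" 0 q] by (simp add: agg_def)
 then show ?thesis by (rule less_qb) (use ZZ in linarith)
qed

text \<open>The segments before and after the Savitch loop are short, so their magnitudes follow
  from the step count. The loop in between relies on the invariant of \<open>savb\<close>, and the
  new bounds on the solution come from the widths of its digits.\<close>

lemma phase_code_correct:
 assumes inv: "phase_inv (int p) y R A" and p: "p <= l" and y: "!!j. j < N ==> 0 <= y j & y j < 2 ^ (q + l + 1)"
 defines "b' \<equiv> %k. trunc_div p (b k)"
 shows "HQ phase_code (R, A, out) (185 * (Z * Z) * (8 * 2 ^ ((e + 1) * m)) ^ (2 * sg) + 200 * (Z * (Z * Z)))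
  (%s. \<exists>A'. phase_inv (int p - 1) (phase b' y) (R(18 := int p - 1, 23 := phase_value b' y div 2 ^ (q * N))) A' &
    s = (R(18 := int p - 1, 23 := phase_value b' y div 2 ^ (q * N)), A', out))"
proof -
 let ?u = "shift_down dd y" and ?g = "phase_residual b' y" and ?v = "phase_value b' y"
 have I: "preg R" "R 18 = int p" "R 20 = 0" "R 21 = 0" "R 22 = 0" "!!k j. k < m ==> j < N ==> A 0 (k * N + j) = \<alpha> k j"
  "!!k. k < m ==> A 1 k = b k" "!!j. j < N ==> A 3 j = col q m \<alpha> j" "!!j. j < N ==> A 4 j = wgt q N c j"
  "!!j. j < N ==> A 5 j = y j" "!!x. \<bar>R x\<bar> < 2 ^ qb" "!!f j. \<bar>A f j\<bar> < 2 ^ qb" using inv unfolding phase_inv_def by blast+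
 have pZ: "p <= Z" using p ZZ by linarith
 let ?A1 = "A(5 := ov N (shift_down dd (A 5)) (A 5))"
 let ?A2 = "?A1(6 := ov m ?g (A 6), 7 := (A 7)(2 * sg := 0), 8 := (A 8)(2 * sg := agg q m ?g), 9 := (A 9)(2 * sg := 0))"
 let ?R2 = "R(20 := -1, 21 := -1, 22 := 2 * int sg, 23 := 0)"
 have u: "0 <= ?u j & ?u j < 2 ^ (q + l + 2)" if "j < N" for j
 proof -
  have "2 * y j - 2 ^ dd < 2 * 2 ^ (q + l + 1)" using y[OF that] zero_le_power[of "2::int" dd] by linarith
  then show ?thesis by (simp add: shift_down_def)
 qed
 have lv: "q + l + 2 <= Z" using ZZ by linarith
 have uZ: "0 <= ?u j & ?u j < 2 ^ Z" if "j < N" for j using u[OF that] int_pow_le[OF lv] by linarith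
 have A5: "?A1 5 j = ?u j" if "j < N" for j using that I(10) by (simp add: shift_down_def)
 have gb: "\<bar>?g k\<bar> <= 2 ^ gx" if "k < m" for k unfolding b'_def by (rule phase_residual_bound) (use y that in auto)
 have gq: "\<bar>?g k\<bar> < 2 ^ qb" if "k < m" for k
 proof -
  have "(2::int) ^ gx < 2 ^ (gx + 1)" by simp
  then show ?thesis using gb[OF that] by (intro less_qb[of _ "gx + 1"]) (use ZZ in linarith)+
 qed
 have 1: "hr inp J shift_code (R, A, out) (17 * Z) (R, ?A1, out)" by (rule shift_code_correct[OF I(1)])
 have 2: "hr inp J res_code (R, ?A1, out) (80 * (Z * (Z * Z))) (?R2, ?A2, out)" by (rule hr_conv[OF res_code_correct[where A = ?A1 and R = R and u = ?u and \<alpha> = \<alpha> and b = b, OF I(1,2) pZ _ A5 _ uZ]])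
   (use I(6,7) in \<open>auto simp: fun_eq_iff phase_residual_def b'_def\<close>)
 have q0: "hbnd qb (R, A, out)" using I by (simp add: hbnd_def)
 have le: "17 * Z + 80 * (Z * (Z * Z)) <= 97 * (Z * (Z * Z))" using Z3 by linarith
 have 12: "HQ (shift_code ;; res_code) (R, A, out) (97 * (Z * (Z * Z))) (%s. s = (?R2, ?A2, out))" by (rule hp_hq[OF inpb qb1 hr_conv[OF hr_Seq[OF 1 2] le refl, unfolded hr_def] q0]) simp_all
 have tauE: "tau <= 200 * (Z * (Z * Z))" using tau_le Z3 by linarith
 interpret S: savb inp J N m sg e q Z BIG "col q m \<alpha>" "wgt q N c" ?g R out qb
 proof unfold_locales
  show "clean R" using I(1) by (simp add: preg_def)
  show "R 2 = int m" "R 4 = int N" "R 6 = int sg" "R 8 = int (e + 1)" "R 9 = 2 ^ e" "R 10 = int q"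
   "R 13 = BIG" "R 14 = int (2 * sg)" "R 15 = int (2 ^ ((e + 1) * m))" using I(1) unfolding preg_def by blast+
  show "N <= J" "m <= J" "2 * sg < J" by (fact J)+
  show "1 <= Z" "sg <= Z" "2 * sg <= Z" "2 ^ sg <= Z" "e + 1 <= Z" "2 ^ sg + q * m <= Z" "N <= Z" "m <= Z" using ZZ by linarith+
  show "\<bar>v\<bar> < 2 ^ qb" if "v \<in> set inp" for v by (rule inpb[OF that])
  show "1 <= qb" by (rule qb1)
  show "\<bar>R x\<bar> < 2 ^ qb" for x by (rule I(11))
  show "int (2 * sg + 2) < 2 ^ qb"
  proof (rule less_qb)
   show "int (2 * sg + 2) < 2 ^ (2 * sg + 2)" by (rule of_nat_less_two_power)
  qed (use ZZ in linarith)
  show "int (2 ^ sg * 2 ^ sg) < 2 ^ qb" by (rule less_qb[of _ "sg + sg + 1"]) (use ZZ in \<open>simp add: power_add\<close>, use ZZ in linarith)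
  show "\<bar>BIG\<bar> < 2 ^ qb" by (rule less_qb[of _ "2 * sg + 2 ^ sg + q * N + \<mu> + 3"]) (simp add: BIG power_add, use ZZ in linarith)
  show "int (2 ^ ((e + 1) * m)) < 2 ^ qb"
  proof (rule less_qb[of _ "(e + 1) * m + 1"])
   have "int (2 ^ ((e + 1) * m)) = 2 ^ ((e + 1) * m)" by simp
   also have "... < 2 ^ ((e + 1) * m + 1)" by (rule power_strict_increasing) auto
   finally show "int (2 ^ ((e + 1) * m)) < 2 ^ ((e + 1) * m + 1)" .
  qed (use ZZ in linarith)
  show "t + 2 ^ r <= 2 ^ sg * 2 ^ sg ==> 2 * \<bar>dist_rec (base_dist N (col q m \<alpha>) (wgt q N c) sg BIG) BIG (2 ^ ((e + 1) * m)) (mid_point q m sg e ?g) r t V1 V2\<bar> < 2 ^ qb" for r t V1 V2 by (rule dist_bound)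
  show "t < 2 ^ sg * 2 ^ sg ==> \<bar>mid_point q m sg e ?g t \<kappa>\<bar> < 2 ^ qb" for t \<kappa> by (rule mid_bound[OF gb])
 qed
 have st1: "(?R2, ?A2, out) = S.st (-1) (2 * sg) 0 ?A2" by (simp add: S.st_def)
 have p0: "(0::int) < 2 ^ qb" by simp
 have uq: "\<bar>?u j\<bar> < 2 ^ qb" if "j < N" for j using u[OF that] less_qb[OF _ lv, of "?u j"] by auto
 have A5b: "\<bar>?A1 5 j\<bar> < 2 ^ qb" for j using uq[of j] A5[of j] I(12)[of 5 j] by (cases "j < N") (auto simp: ov_def)
 have A6b: "\<bar>ov m ?g (A 6) j\<bar> < 2 ^ qb" for j using gq[of j] I(12)[of 6 j] by (cases "j < m") (auto simp: ov_def)
 have Ab2: "S.Ab ?A2" unfolding S.Ab_def using I(12) A5b A6b agg_bound[OF gb, simplified] p0 by simp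
 have tb: "S.tabs ?A2" unfolding S.tabs_def using I(8,9) by simp
 have "S.HB (Loop 20 sav_body) (S.st (-1) (2 * sg) 0 ?A2) ((tau + 2) * (8 * 2 ^ ((e + 1) * m)) ^ (2 * sg) + 2)
  (%s. \<exists>A'. agree (2 * sg) ?A2 A' & S.Ab A' & s = S.st 1 (Suc (2 * sg)) (S.D (2 * sg) 0 (?A2 8 (2 * sg)) (?A2 9 (2 * sg))) A')" by (rule S.savitch_loop[OF tb Ab2]) auto
 moreover have "S.D (2 * sg) 0 (?A2 8 (2 * sg)) (?A2 9 (2 * sg)) = ?v" by (simp add: phase_value_def inner_value_def)
 ultimately have "S.HB (Loop 20 sav_body) (?R2, ?A2, out) ((tau + 2) * (8 * 2 ^ ((e + 1) * m)) ^ (2 * sg) + 2)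
  (%s. \<exists>A'. agree (2 * sg) ?A2 A' & S.Ab A' & s = S.st 1 (Suc (2 * sg)) ?v A')" unfolding st1 by simp
 from hp_hq_mono[OF this[unfolded S.HB_def], of lev]
 have 3: "HQ (Loop 20 sav_body) (?R2, ?A2, out) ((tau + 2) * (8 * 2 ^ ((e + 1) * m)) ^ (2 * sg) + 2)
  (%s. \<exists>A'. agree (2 * sg) ?A2 A' & S.Ab A' & s = S.st 1 (Suc (2 * sg)) ?v A')" using tauE by simp
 let ?R3 = "R(18 := int p - 1, 23 := ?v div 2 ^ (q * N))"
 have 4: "HQ dec_code s (40 * (Z * Z)) (%s. \<exists>A'. phase_inv (int p - 1) (phase b' y) ?R3 A' & s = (?R3, A', out))"
  if h: "\<exists>A'. agree (2 * sg) ?A2 A' & S.Ab A' & s = S.st 1 (Suc (2 * sg)) ?v A'" for s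
 proof -
  obtain A' where A': "agree (2 * sg) ?A2 A'" "S.Ab A'" "s = S.st 1 (Suc (2 * sg)) ?v A'" using h by blast
  have s: "s = (R(21 := 1, 22 := int (Suc (2 * sg)), 23 := ?v), A', out)"
   unfolding A'(3) S.st_def using I(3) by (auto simp: fun_eq_iff)
  let ?A'' = "A'(5 := ov N (%j. A' 5 j + digit q ?v j) (A' 5))"
  have d: "hr inp J dec_code s (40 * (Z * Z)) (?R3, ?A'', out)" unfolding s by (rule dec_code_correct[OF I(1,2,4,5)])
  have hb: "hbnd qb s" unfolding A'(3) by (rule S.st_bnd[OF A'(2)]) (use value_range[of b' y] in auto)
  have A'5: "A' 5 j = ?u j" if "j < N" for j using agreeD(2)[OF A'(1), of 5 j] A5[OF that] by simp
  have y': "A' 5 j + digit q ?v j = phase b' y j" if "j < N" for j using A'5[OF that] by (simp add: phase_def)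
  have A'b: "\<bar>A' f j\<bar> < 2 ^ qb" for f j using A'(2) by (simp add: S.Ab_def)
  have yb: "\<bar>?A'' 5 j\<bar> < 2 ^ qb" for j
  proof (cases "j < N")
   case True
   have "0 <= digit q ?v j" "digit q ?v j < 2 ^ q" by (simp_all add: digit_def)
   moreover have "(2::int) ^ q <= 2 ^ (q + l + 2)" by (intro int_pow_le) simp
   moreover have "(2::int) ^ (q + l + 3) = 2 * 2 ^ (q + l + 2)" by (simp add: power_add)
   ultimately have "\<bar>A' 5 j + digit q ?v j\<bar> < 2 ^ (q + l + 3)" using u[OF True] A'5[OF True] by linarith
   then have "\<bar>A' 5 j + digit q ?v j\<bar> < 2 ^ qb" by (rule less_qb) (use ZZ in linarith)
   then show ?thesis using True by simp
  qed (use A'b in simp)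
  have vb: "\<bar>?v div 2 ^ (q * N)\<bar> < 2 ^ qb"
  proof -
   have "(1::int) <= 2 ^ (q * N)" by simp
   then have "\<bar>?v div 2 ^ (q * N)\<bar> <= \<bar>?v\<bar> + 1"
   proof -
    have "- \<bar>?v\<bar> * 2 ^ (q * N) <= ?v" "?v <= \<bar>?v\<bar> * 2 ^ (q * N)" using mult_mono[of 1 "2 ^ (q * N)" "\<bar>?v\<bar>" "\<bar>?v\<bar>"] by (auto simp: mult.commute)
    then have "- \<bar>?v\<bar> <= ?v div 2 ^ (q * N)" "?v div 2 ^ (q * N) <= \<bar>?v\<bar>" using zdiv_mono1[of "- \<bar>?v\<bar> * 2 ^ (q * N)" ?v "2 ^ (q * N)"] zdiv_mono1[of ?v "\<bar>?v\<bar> * 2 ^ (q * N)" "2 ^ (q * N)"]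
      nonzero_mult_div_cancel_right[of "2 ^ (q * N)" "- \<bar>?v\<bar>"] nonzero_mult_div_cancel_right[of "2 ^ (q * N)" "\<bar>?v\<bar>"] by simp_all
    then show ?thesis by linarith
   qed
   moreover have "(2::int) ^ 2 <= 2 ^ qb" by (intro int_pow_le) (use ZZ qb in linarith)
   ultimately show ?thesis using value_range[of b' y] by simp
  qed
  have pb: "\<bar>int p - 1\<bar> < 2 ^ qb"
  proof -
   have "\<bar>int p\<bar> < 2 ^ qb" using I(11)[of 18] I(2) by simp
   moreover have "(2::int) <= 2 ^ qb" using int_pow_le[OF qb1] by simp
   ultimately show ?thesis by linarith
  qed
  have "phase_inv (int p - 1) (phase b' y) ?R3 ?A''" unfolding phase_inv_def
  proof (intro conjI allI impI)
   show "preg ?R3" using I(1) by (auto simp: preg_def clean_def)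
   show "?R3 18 = int p - 1" "?R3 20 = 0" "?R3 21 = 0" "?R3 22 = 0" using I by auto
   show "\<bar>?R3 x\<bar> < 2 ^ qb" for x using I(11) pb vb by simp
   show "\<bar>?A'' f j\<bar> < 2 ^ qb" for f j using A'b[of f j] yb[of j] by (cases "f = 5") auto
   show "?A'' 5 j = phase b' y j" if "j < N" for j using y'[OF that] that by simp
   show "?A'' 0 (k * N + j) = \<alpha> k j" if "k < m" "j < N" for k j using agreeD(2)[OF A'(1), of 0] I(6) that by simp
   show "?A'' 1 k = b k" if "k < m" for k using agreeD(2)[OF A'(1), of 1] I(7) that by simp
   show "?A'' 3 j = col q m \<alpha> j" "?A'' 4 j = wgt q N c j" if "j < N" for j using agreeD(2)[OF A'(1), of 3] agreeD(2)[OF A'(1), of 4] I(8,9) that by auto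
  qed
  then have Q: "\<exists>A'. phase_inv (int p - 1) (phase b' y) ?R3 A' & (?R3, ?A'', out) = (?R3, A', out)" by blast
  show ?thesis by (rule hp_hq[OF inpb qb1 hp_mono[OF d[unfolded hr_def] order_refl] hb]) (use Q Z3 in auto)
 qed
 show ?thesis unfolding phase_code_def
 proof (rule hp_Seq[OF hp_mono[OF 12 order_refl]], rule hp_Seq[OF hp_mono[OF _ order_refl 4]])
  show "HQ (Loop 20 sav_body) s' ((tau + 2) * (8 * 2 ^ ((e + 1) * m)) ^ (2 * sg) + 2)
   (%s. \<exists>A'. agree (2 * sg) ?A2 A' & S.Ab A' & s = S.st 1 (Suc (2 * sg)) ?v A')" if "s' = (?R2, ?A2, out)" for s' unfolding that by (rule 3)
  have "(tau + 2) * (8 * 2 ^ ((e + 1) * m)) ^ (2 * sg) <= 185 * (Z * Z) * (8 * 2 ^ ((e + 1) * m)) ^ (2 * sg)" by (rule mult_le_mono1[OF tau_le])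
  then show "97 * (Z * (Z * Z)) + ((tau + 2) * (8 * 2 ^ ((e + 1) * m)) ^ (2 * sg) + 2 + 40 * (Z * Z))
   <= 185 * (Z * Z) * (8 * 2 ^ ((e + 1) * m)) ^ (2 * sg) + 200 * (Z * (Z * Z))" using Z3 Zb(1) by linarith
 qed simp_all
qed

end

section \<open>Reading the instance and computing the parameters\<close>

lemma mxa_ge: "v <= mxa v f n" "i < n ==> \<bar>f i\<bar> <= mxa v f n" by (induction n) (auto simp: less_Suc_eq max_def)

lemma mxa_le: "v <= B ==> (!!i. i < n ==> \<bar>f i\<bar> <= B) ==> mxa v f n <= B" by (induction n) auto

definition load_row :: "hatom com" where
 "load_row = For 34 35 3 (Block [HRead 36 30, HStore 0 31 36, HAdd 30 30 45, HAdd 31 31 45, HConst 36 0])"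

definition load_code :: "hatom com" where
 "load_code = Block [HConst 45 1, HRead 2 44, HRead 3 45, HAdd 4 2 2, HAdd 4 4 3, HAdd 30 45 45] ;;
   For 32 33 2 (load_row ;; Block [HAdd 36 31 32, HStore 0 36 45, HAdd 36 36 2, HSub 37 44 45, HStore 0 36 37,
    HAdd 31 31 2, HAdd 31 31 2, HConst 36 0, HConst 37 0]) ;;
   For 32 33 2 (Block [HRead 36 30, HStore 1 32 36, HAdd 30 30 45, HConst 36 0]) ;;
   For 32 33 3 (Block [HRead 36 30, HStore 2 32 36, HAdd 30 30 45, HConst 36 0]) ;;
   Block [HConst 30 0, HConst 31 0]"

definition param_code1 :: "hatom com" where
 "param_code1 = mulc 24 2 4 ;; maxabs 25 0 24 ;; bitlen 5 25 ;; maxabs 25 1 2 ;; maxabs 25 2 3 ;; bitlen 16 25 ;; bitlen 26 4 ;;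
   Block [HAdd 27 2 5, HAdd 27 27 26] ;; bitlen 28 27 ;; Block [HAdd 27 27 16] ;; bitlen 29 27 ;;
   Block [HConst 24 0, HConst 25 0, HConst 26 0, HConst 27 0, HAdd 30 45 45, HAdd 30 30 30, HAdd 6 28 28, HAdd 6 6 28, HAdd 6 6 30]"

definition param_code2 :: "hatom com" where
 "param_code2 = Block [HConst 7 1] ;; shl 7 6 ;; Block [HAdd 10 7 7, HAdd 10 10 10, HConst 11 1, HAdd 31 28 28, HAdd 31 31 30, HSub 31 31 45] ;;
   shl 11 31 ;; Block [HConst 12 1] ;; shl 12 11 ;; Block [HAdd 8 5 6, HAdd 8 8 30, HSub 8 8 45, HSub 31 8 45, HConst 9 1] ;; shl 9 31 ;;
   Block [HAdd 14 6 6, HConst 15 1] ;; mulc 32 2 8 ;; shl 15 32 ;; Block [HConst 33 1, HAdd 31 29 29, HAdd 31 31 30] ;; shl 33 31 ;; mulc 17 10 4 ;;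
   Block [HAdd 34 14 7, HAdd 34 34 17, HAdd 34 34 33, HAdd 34 34 30, HSub 34 34 45, HConst 13 1] ;; shl 13 34 ;;
   Block [HConst 35 1] ;; shl 35 33"

definition param_code3 :: "hatom com" where
 "param_code3 = Block [HAdd 36 3 44, HAdd 37 2 2] ;; Rep 38 37 (Block [HStore 2 36 35, HAdd 36 36 45]) ;;
   Block [HConst 28 0, HConst 29 0, HConst 30 0, HConst 31 0, HConst 32 0, HConst 33 0, HConst 34 0, HConst 35 0, HConst 36 0, HConst 37 0, HAdd 18 16 44]"

locale ilp_inst =
 fixes inp :: "int list" and m n :: nat
begin

definition "N = n + 2 * m"
definition "a k j = inp ! (2 + k * n + j)"
definition "bb k = inp ! (2 + m * n + k)"
definition "cc j = inp ! (2 + m * n + m + j)"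
definition "tab k i = (if i < k * N then ext_mat n m a (i div N) (i mod N) else 0)"
definition "Ba = ov m bb (%_. 0)"
definition "Ca = ov n cc (%_. 0)"
definition "\<delta> = bl (nat (mxa 0 (tab m) (m * N)))"
definition "l = bl (nat (mxa (mxa (mxa 0 (tab m) (m * N)) Ba m) Ca n))"
definition "\<nu> = bl N"
definition "\<pi> = bl (m + \<delta> + \<nu>)"
text \<open>\<open>\<pi>\<close> governs the exponent of the running time and must not depend on the
  sizes of \<open>b\<close> and \<open>c\<close>. \<open>lam\<close> also counts their bit length
  \<open>l\<close>, but it only determines the penalty \<open>2 ^ kM\<close>.\<close>

definition "lam = bl (m + \<delta> + \<nu> + l)"
definition "sg = 3 * \<pi> + 4"
definition "q = 4 * (2::nat) ^ sg"
definition "dd = (2::nat) ^ (2 * \<pi> + 3)"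
definition "e = \<delta> + sg + 2"
definition "kM = (2::nat) ^ (2 * lam + 4)"
definition "\<mu> = kM + 1"
definition "BIG = (2::int) ^ (2 * sg + 2 ^ sg + q * N + \<mu> + 2)"
definition "R1 = (%_ :: nat. 0 :: int)(45 := 1, 2 := int m, 3 := int n, 4 := int N)"
definition "A1 = (%(_ :: nat) (_ :: nat). 0 :: int)(0 := tab m, 1 := Ba, 2 := Ca)"
definition "R2 = R1(5 := int \<delta>, 16 := int l, 6 := int sg, 7 := 2 ^ sg, 10 := int q, 11 := int dd, 12 := 2 ^ dd, 8 := int (e + 1), 9 := 2 ^ e,
 14 := int (2 * sg), 15 := int (2 ^ ((e + 1) * m)), 17 := int (q * N), 13 := BIG, 18 := int l)"
definition "A2 = A1(2 := ov N (ext_cost n (2 ^ kM) cc) (%_. 0))"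

end

locale ilp_load = ilp_inst +
 fixes J Z :: nat
 assumes inp: "inp ! 0 = int m" "inp ! 1 = int n" "length inp = m * n + m + n + 2"
  and J: "m * N <= J" "N <= J" "m <= J"
  and Z: "m * N <= Z" "N <= Z" "m <= Z" "n <= Z" "1 <= Z" "\<delta> <= Z" "l <= Z" "\<nu> <= Z" "\<pi> <= Z" "lam <= Z" "sg <= Z" "dd <= Z" "2 * \<pi> + 3 <= Z"
   "(e + 1) * m <= Z" "e + 1 <= Z" "2 * lam + 4 <= Z" "kM <= Z" "2 * sg + 2 ^ sg + q * N + \<mu> + 2 <= Z"
begin

lemma tab_row: "i < N ==> (k * N + i) div N = k" "i < N ==> (k * N + i) mod N = i" by (auto simp: mult.commute)

text \<open>Array 0 while row \<open>k\<close> is being read: earlier rows are complete with their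
  slack entries, and \<open>p\<close> entries of this row are in place.\<close>

definition "rowt k p i = (if k * N <= i & i < k * N + p then a k (i - k * N) else tab k i)"

lemma rowt_0: "rowt k 0 = tab k" by (auto simp: rowt_def fun_eq_iff)

lemma rowt_Suc: "(rowt k p)(k * N + p := a k p) = rowt k (Suc p)" by (auto simp: rowt_def fun_eq_iff)

lemma tab_Suc:
 assumes "k < m"
 shows "(rowt k n)(k * N + n + k := 1, k * N + n + k + m := -1) = tab (Suc k)"
proof
 fix i
 consider "i < k * N" | p where "i = k * N + p" "p < N" | "Suc k * N <= i"
 proof -
  assume h: "i < k * N ==> thesis" "!!p. i = k * N + p ==> p < N ==> thesis" "Suc k * N <= i ==> thesis"
  show thesis using h(1) h(2)[of "i - k * N"] h(3) by (cases "i < k * N"; cases "Suc k * N <= i") auto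
 qed
 then show "((rowt k n)(k * N + n + k := 1, k * N + n + k + m := -1)) i = tab (Suc k) i"
 proof cases
  case 1
  then show ?thesis by (auto simp: rowt_def tab_def)
 next
  case (2 p)
  have "tab (Suc k) i = ext_mat n m a k p" using 2 tab_row[of p k] by (simp add: tab_def)
  moreover have "tab k i = 0" using 2 by (simp add: tab_def)
  ultimately show ?thesis using 2 assms by (auto simp: rowt_def ext_mat_def N_def)
 next
  case 3
  have "k * N + n + k + m < Suc k * N" using assms by (simp add: N_def)
  then have "i ~= k * N + n + k" "i ~= k * N + n + k + m" "\<not> i < k * N + n" using 3 by simp_all
  then show ?thesis using 3 by (auto simp: rowt_def tab_def)
 qed
qed

lemma a_idx: "k < m ==> j < n ==> 2 + k * n + j < length inp"
proof -
 assume k: "k < m" "j < n"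
 then have "k * n + j < Suc k * n" by simp
 also have "... <= m * n" using k by (intro mult_le_mono1) simp
 finally show ?thesis using inp by simp
qed

lemma t_idx: "k < m ==> j < N ==> k * N + j < J"
proof -
 assume k: "k < m" "j < N"
 then have "k * N + j < Suc k * N" by simp
 also have "... <= m * N" using k by (intro mult_le_mono1) simp
 finally show ?thesis using J by simp
qed

lemma load_code_correct:
 "hr inp J load_code ((%_. 0), (%_ _. 0), []) (100 * (Z * Z)) (R1, A1, [])"
proof -
 let ?A0 = "(%_ _. 0) :: nat => nat => int"
 have len: "1 < length inp" using inp(3) by simp
 have n0: "inp ! Suc 0 = int n" using inp by simp
 have b0: "hr inp J (Block [HConst 45 1, HRead 2 44, HRead 3 45, HAdd 4 2 2, HAdd 4 4 3, HAdd 30 45 45]) ((%_. 0), ?A0, []) 6 (R1(30 := 2), ?A0, [])" by (intro hr_Blk) (use inp(1) n0 len in \<open>auto simp: R1_def N_def fun_eq_iff\<close>)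
 let ?RR = "%k. R1(30 := int (2 + k * n), 31 := int (k * N))"
 let ?AA = "%k. ?A0(0 := tab k)"
 let ?body = "load_row ;; Block [HAdd 36 31 32, HStore 0 36 45, HAdd 36 36 2, HSub 37 44 45, HStore 0 36 37,
    HAdd 31 31 2, HAdd 31 31 2, HConst 36 0, HConst 37 0]"
 have b1: "hr inp J (For 32 33 2 ?body) (?RR 0, ?AA 0, []) (Z * ((Z * (5 + 8) + 9) + 8)) (?RR m, ?AA m, [])"
 proof (rule hr_ForZ[where RR = ?RR and AA = ?AA])
  fix k assume k: "k < m"
  let ?R = "(?RR k)(32 := int k, 33 := int k - int m)"
  let ?RRi = "%j. R1(30 := int (2 + k * n + j), 31 := int (k * N + j), 32 := int k, 33 := int k - int m)"
  let ?AAi = "%j. ?A0(0 := rowt k j)"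
  have 1: "hr inp J load_row (?RRi 0, ?AAi 0, []) (Z * (5 + 8)) (?RRi n, ?AAi n, [])" unfolding load_row_def
  proof (rule hr_ForZ[where RR = ?RRi and AA = ?AAi])
   fix j assume j: "j < n"
   have i2: "k * N + j < J" using t_idx[OF k, of j] j by (simp add: N_def)
   have "hat inp J (HRead 36 30) ((?RRi j)(34 := int j, 35 := int j - int n), ?AAi j, []) = Some ((?RRi j)(34 := int j, 35 := int j - int n, 36 := a k j), ?AAi j, [])" using a_idx[OF k j] by (simp add: a_def nat_add_distrib nat_mult_distrib flip: of_nat_mult of_nat_add)
   then show "hr inp J (Block [HRead 36 30, HStore 0 31 36, HAdd 30 30 45, HAdd 31 31 45, HConst 36 0]) ((?RRi j)(34 := int j, 35 := int j - int n), ?AAi j, []) 5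
    ((?RRi (Suc j))(34 := int j, 35 := int j - int n), ?AAi (Suc j), [])" using i2 rowt_Suc[of k j] by (intro hr_Blk) (auto simp: R1_def fun_eq_iff nat_add_distrib nat_mult_distrib simp flip: of_nat_mult of_nat_add)
  qed (use Z in \<open>auto simp: R1_def\<close>)
  have i3: "k * N + n + k < J" "k * N + n + k + m < J" using t_idx[OF k, of "n + k"] t_idx[OF k, of "n + k + m"] k by (auto simp: N_def)
  have "hr inp J (Block [HAdd 36 31 32, HStore 0 36 45, HAdd 36 36 2, HSub 37 44 45, HStore 0 36 37,
    HAdd 31 31 2, HAdd 31 31 2, HConst 36 0, HConst 37 0]) (R1(30 := y, 31 := int X, 32 := int k, 33 := z), ?A0(0 := F), []) 9
   (R1(30 := y, 31 := int (X + 2 * m), 32 := int k, 33 := z), ?A0(0 := F(X + k := 1, X + k + m := -1)), [])"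
   if "X + k < J" "X + k + m < J" for X F y z
  proof -
   have "nat (int X + int k) = X + k" "nat (int X + int k + int m) = X + k + m" by linarith+
   then show ?thesis by (intro hr_Blk) (use that in \<open>auto simp: R1_def fun_eq_iff\<close>)
  qed
  from this[OF i3]
  have 2: "hr inp J (Block [HAdd 36 31 32, HStore 0 36 45, HAdd 36 36 2, HSub 37 44 45, HStore 0 36 37,
    HAdd 31 31 2, HAdd 31 31 2, HConst 36 0, HConst 37 0]) (?RRi n, ?AAi n, []) 9 ((?RR (Suc k))(32 := int k, 33 := int k - int m), ?AA (Suc k), [])"
  proof (rule hr_conv2)
   have e1: "k * N + n + 2 * m = Suc k * N" by (simp add: N_def)
   have e2: "2 + k * n + n = 2 + Suc k * n" by simp
   show "(R1(30 := int (2 + k * n + n), 31 := int (k * N + n + 2 * m), 32 := int k, 33 := int k - int m),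
    ?A0(0 := (rowt k n)(k * N + n + k := 1, k * N + n + k + m := -1)), []) = ((?RR (Suc k))(32 := int k, 33 := int k - int m), ?AA (Suc k), [] :: int list)" by (simp only: tab_Suc[OF k] e1 e2)
  qed auto
  show "hr inp J ?body (?R, ?AA k, []) (Z * (5 + 8) + 9) ((?RR (Suc k))(32 := int k, 33 := int k - int m), ?AA (Suc k), [])" by (rule hr_conv2[OF hr_Seq[OF 1 2]]) (auto simp: rowt_0 fun_eq_iff)
 qed (use Z in \<open>auto simp: R1_def\<close>)
 let ?Rb = "%k. R1(30 := int (2 + m * n + k), 31 := int (m * N))"
 let ?Ab = "%k. ?A0(0 := tab m, 1 := ov k bb (%_. 0))"
 have b2: "hr inp J (For 32 33 2 (Block [HRead 36 30, HStore 1 32 36, HAdd 30 30 45, HConst 36 0])) (?Rb 0, ?Ab 0, []) (Z * (4 + 8)) (?Rb m, ?Ab m, [])"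
 proof (rule hr_ForZ[where RR = ?Rb and AA = ?Ab])
  fix k assume k: "k < m"
  have "hat inp J (HRead 36 30) ((?Rb k)(32 := int k, 33 := int k - int m), ?Ab k, []) = Some ((?Rb k)(32 := int k, 33 := int k - int m, 36 := bb k), ?Ab k, [])" using k inp by (simp add: bb_def nat_add_distrib nat_mult_distrib flip: of_nat_mult of_nat_add)
  then show "hr inp J (Block [HRead 36 30, HStore 1 32 36, HAdd 30 30 45, HConst 36 0]) ((?Rb k)(32 := int k, 33 := int k - int m), ?Ab k, []) 4
   ((?Rb (Suc k))(32 := int k, 33 := int k - int m), ?Ab (Suc k), [])" using k J(3) by (intro hr_Blk) (auto simp: R1_def fun_eq_iff simp flip: ov_Suc)
 qed (use Z in \<open>auto simp: R1_def\<close>)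
 let ?Rc = "%k. R1(30 := int (2 + m * n + m + k), 31 := int (m * N))"
 let ?Ac = "%k. ?A0(0 := tab m, 1 := Ba, 2 := ov k cc (%_. 0))"
 have b3: "hr inp J (For 32 33 3 (Block [HRead 36 30, HStore 2 32 36, HAdd 30 30 45, HConst 36 0])) (?Rc 0, ?Ac 0, []) (Z * (4 + 8)) (?Rc n, ?Ac n, [])"
 proof (rule hr_ForZ[where RR = ?Rc and AA = ?Ac])
  fix k assume k: "k < n"
  have kJ: "k < J" using k J(2) by (simp add: N_def)
  have "hat inp J (HRead 36 30) ((?Rc k)(32 := int k, 33 := int k - int n), ?Ac k, []) = Some ((?Rc k)(32 := int k, 33 := int k - int n, 36 := cc k), ?Ac k, [])" using k inp by (simp add: cc_def nat_add_distrib nat_mult_distrib flip: of_nat_mult of_nat_add)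
  then show "hr inp J (Block [HRead 36 30, HStore 2 32 36, HAdd 30 30 45, HConst 36 0]) ((?Rc k)(32 := int k, 33 := int k - int n), ?Ac k, []) 4
   ((?Rc (Suc k))(32 := int k, 33 := int k - int n), ?Ac (Suc k), [])" using kJ by (intro hr_Blk) (auto simp: R1_def fun_eq_iff simp flip: ov_Suc)
 qed (use Z in \<open>auto simp: R1_def\<close>)
 have b4: "hr inp J (Block [HConst 30 0, HConst 31 0]) (?Rc n, ?Ac n, []) 2 (R1, A1, [])" by (intro hr_Blk) (auto simp: R1_def A1_def Ca_def fun_eq_iff)
 have c1: "(R1(30 := 2), ?A0, []) = (?RR 0, ?AA 0, [] :: int list)" by (auto simp: R1_def tab_def fun_eq_iff)
 have c2: "(?RR m, ?AA m, [] :: int list) = (?Rb 0, ?Ab 0, [])" by (auto simp: fun_eq_iff)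
 have c3: "(?Rb m, ?Ab m, [] :: int list) = (?Rc 0, ?Ac 0, [])" by (auto simp: fun_eq_iff Ba_def)
 have ZZ: "Z <= Z * Z" "1 <= Z * Z" using Z(5) by (auto simp: mult_le_mono)
 have "6 + (Z * ((Z * (5 + 8) + 9) + 8) + (Z * (4 + 8) + (Z * (4 + 8) + 2))) = 13 * (Z * Z) + 41 * Z + 8" by (simp add: algebra_simps)
 then have t: "6 + (Z * ((Z * (5 + 8) + 9) + 8) + (Z * (4 + 8) + (Z * (4 + 8) + 2))) <= 100 * (Z * Z)" using ZZ by linarith
 show ?thesis unfolding load_code_def by (rule hr_conv[OF hr_Seq[OF b0[unfolded c1] hr_Seq[OF b1[unfolded c2] hr_Seq[OF b2[unfolded c3] hr_Seq[OF b3 b4]]]] t refl])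
qed


abbreviation "Mx \<equiv> mxa 0 (tab m) (m * N)"
abbreviation "My \<equiv> mxa (mxa Mx Ba m) Ca n"

lemma Mx: "0 <= Mx" "Mx <= My" using mxa_ge(1)[of 0 "tab m" "m * N"] mxa_ge(1)[of Mx Ba m] mxa_ge(1)[of "mxa Mx Ba m" Ca n] by linarith+

lemma param_code1_correct:
 "hr inp J param_code1 (R1, A1, []) (150 * Z) (R1(5 := int \<delta>, 16 := int l, 28 := int \<pi>, 29 := int lam, 30 := 4, 6 := int sg), A1, [])"
proof -
 have Nz: "int N < 2 ^ Z" using Z(2) of_nat_less_two_power[of N, where 'a = int] int_pow_le[of N Z] by linarith
 have r: "R1 44 = 0" "R1 45 = 1" "R1 2 = int m" "R1 3 = int n" "R1 4 = int N" "!!x. 4 < x ==> x < 45 ==> R1 x = 0" by (auto simp: R1_def)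
 have A: "A1 0 = tab m" "A1 1 = Ba" "A1 2 = Ca" by (auto simp: A1_def)
 have A': "A1 (Suc 0) = Ba" using A by simp
 have nJ: "n <= J" using J by (simp add: N_def)
 let ?S1 = "R1(24 := int (m * N))"
 have 1: "hr inp J (mulc 24 2 4) (R1, A1, []) (18 * Z) (?S1, A1, [])" by (rule hr_conv[OF mulc_correct[where Z = Z]]) (use r Nz Z in auto)
 let ?S2 = "?S1(25 := Mx)"
 have 2: "hr inp J (maxabs 25 0 24) (?S1, A1, []) (18 * Z) (?S2, A1, [])" by (rule hr_conv[OF maxabs_correct[where m = "m * N" and Z = Z]]) (use r J Z A in auto)
 let ?S3 = "?S2(5 := int \<delta>)"
 have 3: "hr inp J (bitlen 5 25) (?S2, A1, []) (10 * Z) (?S3, A1, [])" by (rule hr_conv[OF bitlen_correct[where z = "nat Mx" and Z = Z]]) (use r Z Mx in \<open>auto simp: \<delta>_def\<close>)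
 let ?S4 = "?S3(25 := mxa Mx Ba m)"
 have 4: "hr inp J (maxabs 25 1 2) (?S3, A1, []) (18 * Z) (?S4, A1, [])" by (rule hr_conv[OF maxabs_correct[where m = m and Z = Z]]) (use r J Z in \<open>auto simp: A A'\<close>)
 let ?S5 = "?S3(25 := My)"
 have 5: "hr inp J (maxabs 25 2 3) (?S4, A1, []) (18 * Z) (?S5, A1, [])" by (rule hr_conv[OF maxabs_correct[where m = n and Z = Z]]) (use r nJ Z in \<open>auto simp: A A'\<close>)
 let ?S6 = "?S5(16 := int l)"
 have 6: "hr inp J (bitlen 16 25) (?S5, A1, []) (10 * Z) (?S6, A1, [])" by (rule hr_conv[OF bitlen_correct[where z = "nat My" and Z = Z]]) (use r Z Mx in \<open>auto simp: l_def\<close>)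
 let ?S7 = "?S6(26 := int \<nu>)"
 have 7: "hr inp J (bitlen 26 4) (?S6, A1, []) (10 * Z) (?S7, A1, [])" by (rule hr_conv[OF bitlen_correct[where z = N and Z = Z]]) (use r Z in \<open>auto simp: \<nu>_def\<close>)
 let ?S8 = "?S7(27 := int (m + \<delta> + \<nu>))"
 have 8: "hr inp J (Block [HAdd 27 2 5, HAdd 27 27 26]) (?S7, A1, []) 2 (?S8, A1, [])" by (intro hr_Blk) (use r in auto)
 let ?S9 = "?S8(28 := int \<pi>)"
 have 9: "hr inp J (bitlen 28 27) (?S8, A1, []) (10 * Z) (?S9, A1, [])" by (rule hr_conv[OF bitlen_correct[where z = "m + \<delta> + \<nu>" and Z = Z]]) (use r Z in \<open>auto simp: \<pi>_def\<close>)
 let ?S10 = "?S9(27 := int (m + \<delta> + \<nu> + l))"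
 have 10: "hr inp J (Block [HAdd 27 27 16]) (?S9, A1, []) 1 (?S10, A1, [])" by (intro hr_Blk) (use r in \<open>auto simp: fun_eq_iff\<close>)
 let ?S11 = "?S10(29 := int lam)"
 have 11: "hr inp J (bitlen 29 27) (?S10, A1, []) (10 * Z) (?S11, A1, [])" by (rule hr_conv[OF bitlen_correct[where z = "m + \<delta> + \<nu> + l" and Z = Z]]) (use r Z in \<open>auto simp: lam_def\<close>)
 have 12: "hr inp J (Block [HConst 24 0, HConst 25 0, HConst 26 0, HConst 27 0, HAdd 30 45 45, HAdd 30 30 30, HAdd 6 28 28, HAdd 6 6 28, HAdd 6 6 30]) (?S11, A1, []) 9
  (R1(5 := int \<delta>, 16 := int l, 28 := int \<pi>, 29 := int lam, 30 := 4, 6 := int sg), A1, [])" by (intro hr_Blk) (use r in \<open>auto simp: fun_eq_iff sg_def\<close>)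
 show ?thesis unfolding param_code1_def by (rule hr_conv[OF hr_Seq[OF 1 hr_Seq[OF 2 hr_Seq[OF 3 hr_Seq[OF 4 hr_Seq[OF 5 hr_Seq[OF 6 hr_Seq[OF 7 hr_Seq[OF 8 hr_Seq[OF 9 hr_Seq[OF 10 hr_Seq[OF 11 12]]]]]]]]]]]])
   (use Z in auto)
qed

lemma param_code2_correct:
 "hr inp J param_code2 (R1(5 := int \<delta>, 16 := int l, 28 := int \<pi>, 29 := int lam, 30 := 4, 6 := int sg), A1, []) (150 * Z)
   (R2(18 := 0, 28 := int \<pi>, 29 := int lam, 30 := 4, 31 := int (2 * lam + 4), 32 := int ((e + 1) * m), 33 := int kM,
    34 := int (2 * sg + 2 ^ sg + q * N + \<mu> + 2), 35 := 2 ^ kM), A1, [])"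
proof -
 have lt: "int x < 2 ^ Z" if "x <= Z" for x using that of_nat_less_two_power[of x, where 'a = int] int_pow_le[of x Z] by linarith
 have r: "R1 44 = 0" "R1 45 = 1" "R1 2 = int m" "R1 3 = int n" "R1 4 = int N" "!!x. 4 < x ==> x < 45 ==> R1 x = 0" by (auto simp: R1_def)
 have ez: "e <= Z" using Z by simp
 let ?S0 = "R1(5 := int \<delta>, 16 := int l, 28 := int \<pi>, 29 := int lam, 30 := 4, 6 := int sg)"
 have 1: "hr inp J (Block [HConst 7 1]) (?S0, A1, []) 1 (?S0(7 := 1), A1, [])" by (intro hr_Blk) auto
 have 2: "hr inp J (shl 7 6) (?S0(7 := 1), A1, []) (7 * Z) (?S0(7 := 2 ^ sg), A1, [])" by (rule hr_conv[OF shl_correct[where m = sg and Z = Z]]) (use r Z in auto)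
 let ?S3 = "?S0(7 := 2 ^ sg, 10 := int q, 11 := 1, 31 := int (2 * \<pi> + 3))"
 have 3: "hr inp J (Block [HAdd 10 7 7, HAdd 10 10 10, HConst 11 1, HAdd 31 28 28, HAdd 31 31 30, HSub 31 31 45]) (?S0(7 := 2 ^ sg), A1, []) 6 (?S3, A1, [])" by (intro hr_Blk) (use r in \<open>auto simp: fun_eq_iff q_def\<close>)
 let ?S4 = "?S3(11 := int dd)"
 have 4: "hr inp J (shl 11 31) (?S3, A1, []) (7 * Z) (?S4, A1, [])" by (rule hr_conv[OF shl_correct[where m = "2 * \<pi> + 3" and Z = Z]]) (use r Z in \<open>auto simp: dd_def\<close>)
 let ?S5 = "?S4(12 := 1)"
 have 5: "hr inp J (Block [HConst 12 1]) (?S4, A1, []) 1 (?S5, A1, [])" by (intro hr_Blk) auto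
 let ?S6 = "?S4(12 := 2 ^ dd)"
 have 6: "hr inp J (shl 12 11) (?S5, A1, []) (7 * Z) (?S6, A1, [])" by (rule hr_conv[OF shl_correct[where m = dd and Z = Z]]) (use r Z in auto)
 let ?S7 = "?S6(8 := int (e + 1), 31 := int e, 9 := 1)"
 have 7: "hr inp J (Block [HAdd 8 5 6, HAdd 8 8 30, HSub 8 8 45, HSub 31 8 45, HConst 9 1]) (?S6, A1, []) 5 (?S7, A1, [])" by (intro hr_Blk) (use r in \<open>auto simp: fun_eq_iff e_def\<close>)
 let ?S8 = "?S7(9 := 2 ^ e)"
 have 8: "hr inp J (shl 9 31) (?S7, A1, []) (7 * Z) (?S8, A1, [])" by (rule hr_conv[OF shl_correct[where m = e and Z = Z]]) (use r Z ez in auto)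
 let ?S9 = "?S8(14 := int (2 * sg), 15 := 1)"
 have 9: "hr inp J (Block [HAdd 14 6 6, HConst 15 1]) (?S8, A1, []) 2 (?S9, A1, [])" by (intro hr_Blk) (use r in auto)
 let ?S10 = "?S9(32 := int ((e + 1) * m))"
 have 10: "hr inp J (mulc 32 2 8) (?S9, A1, []) (18 * Z) (?S10, A1, [])" by (rule hr_conv[OF mulc_correct[where Z = Z]]) (use r Z lt[OF Z(15)] in \<open>auto simp: fun_eq_iff algebra_simps\<close>)
 let ?S11 = "?S10(15 := int (2 ^ ((e + 1) * m)))"
 have 11: "hr inp J (shl 15 32) (?S10, A1, []) (7 * Z) (?S11, A1, [])" by (rule hr_conv[OF shl_correct[where m = "(e + 1) * m" and Z = Z]]) (use r Z in \<open>auto simp: fun_eq_iff\<close>)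
 let ?S12 = "?S11(33 := 1, 31 := int (2 * lam + 4))"
 have 12: "hr inp J (Block [HConst 33 1, HAdd 31 29 29, HAdd 31 31 30]) (?S11, A1, []) 3 (?S12, A1, [])" by (intro hr_Blk) (use r in \<open>auto simp: fun_eq_iff\<close>)
 let ?S13 = "?S12(33 := int kM)"
 have 13: "hr inp J (shl 33 31) (?S12, A1, []) (7 * Z) (?S13, A1, [])" by (rule hr_conv[OF shl_correct[where m = "2 * lam + 4" and Z = Z]]) (use r Z in \<open>auto simp: fun_eq_iff kM_def\<close>)
 let ?S14 = "?S13(17 := int (q * N))"
 have 14: "hr inp J (mulc 17 10 4) (?S13, A1, []) (18 * Z) (?S14, A1, [])" by (rule hr_conv[OF mulc_correct[where Z = Z]]) (use r Z lt[OF Z(2)] in \<open>auto simp: fun_eq_iff\<close>)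
 let ?x = "2 * sg + 2 ^ sg + q * N + \<mu> + 2"
 let ?S15 = "?S14(34 := int ?x, 13 := 1)"
 have 15: "hr inp J (Block [HAdd 34 14 7, HAdd 34 34 17, HAdd 34 34 33, HAdd 34 34 30, HSub 34 34 45, HConst 13 1]) (?S14, A1, []) 6 (?S15, A1, [])" by (intro hr_Blk) (use r in \<open>auto simp: fun_eq_iff \<mu>_def\<close>)
 let ?S16 = "?S15(13 := BIG)"
 have 16: "hr inp J (shl 13 34) (?S15, A1, []) (7 * Z) (?S16, A1, [])" by (rule hr_conv[OF shl_correct[where m = ?x and Z = Z]]) (use r Z in \<open>auto simp: fun_eq_iff BIG_def\<close>)
 let ?S17 = "?S16(35 := 1)"
 have 17: "hr inp J (Block [HConst 35 1]) (?S16, A1, []) 1 (?S17, A1, [])" by (intro hr_Blk) auto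
 have 18: "hr inp J (shl 35 33) (?S17, A1, []) (7 * Z) (?S16(35 := 2 ^ kM), A1, [])" by (rule hr_conv[OF shl_correct[where m = kM and Z = Z]]) (use r Z in \<open>auto simp: fun_eq_iff\<close>)
 have fin: "(?S16(35 := 2 ^ kM), A1, [] :: int list) = (R2(18 := 0, 28 := int \<pi>, 29 := int lam, 30 := 4, 31 := int (2 * lam + 4), 32 := int ((e + 1) * m), 33 := int kM,
    34 := int ?x, 35 := 2 ^ kM), A1, [])" using r unfolding R2_def by (auto simp: fun_eq_iff)
 show ?thesis unfolding param_code2_def by (rule hr_conv[OF hr_Seq[OF 1 hr_Seq[OF 2 hr_Seq[OF 3 hr_Seq[OF 4 hr_Seq[OF 5 hr_Seq[OF 6 hr_Seq[OF 7 hr_Seq[OF 8 hr_Seq[OF 9 hr_Seq[OF 10 hr_Seq[OF 11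
    hr_Seq[OF 12 hr_Seq[OF 13 hr_Seq[OF 14 hr_Seq[OF 15 hr_Seq[OF 16 hr_Seq[OF 17 18]]]]]]]]]]]]]]]]] _ fin])
   (use Z in linarith)
qed

lemma param_code3_correct:
 "hr inp J param_code3 (R2(18 := 0, 28 := int \<pi>, 29 := int lam, 30 := 4, 31 := int (2 * lam + 4), 32 := int ((e + 1) * m), 33 := int kM,
    34 := int (2 * sg + 2 ^ sg + q * N + \<mu> + 2), 35 := 2 ^ kM), A1, []) (30 * Z) (R2, A2, [])"
proof -
 let ?x = "2 * sg + 2 ^ sg + q * N + \<mu> + 2"
 let ?S = "R2(18 := 0, 28 := int \<pi>, 29 := int lam, 30 := 4, 31 := int (2 * lam + 4), 32 := int ((e + 1) * m), 33 := int kM,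
    34 := int ?x, 35 := 2 ^ kM)"
 have r: "R2 44 = 0" "R2 45 = 1" "R2 2 = int m" "R2 3 = int n" "!!x. 23 < x ==> x < 45 ==> R2 x = 0" "R2 16 = int l" "R2 18 = int l" by (auto simp: R2_def R1_def)
 have 1: "hr inp J (Block [HAdd 36 3 44, HAdd 37 2 2]) (?S, A1, []) 2 (?S(36 := int n, 37 := int (2 * m)), A1, [])" by (intro hr_Blk) (use r in auto)
 let ?C = "%i. ov (n + i) (ext_cost n (2 ^ kM) cc) (%_. 0)"
 let ?RR = "%i. ?S(36 := int (n + i), 37 := int (2 * m))"
 let ?AA = "%i. A1(2 := ?C i)"
 have 2: "hr inp J (Rep 38 37 (Block [HStore 2 36 35, HAdd 36 36 45])) (?RR 0, ?AA 0, []) ((2 * m) * (2 + 3) + 3) ((?RR (2 * m))(38 := 0), ?AA (2 * m), [])"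
 proof (rule hr_Rep[where RR = ?RR and AA = ?AA])
  fix i assume i: "i < 2 * m"
  have iJ: "n + i < J" using i J(2) by (simp add: N_def)
  have C: "(?C i)(n + i := 2 ^ kM) = ?C (Suc i)" using ov_Suc[of "n + i" "ext_cost n (2 ^ kM) cc"] by (simp add: ext_cost_def)
  have ni: "nat (int n + int i) = n + i" by linarith
  show "hr inp J (Block [HStore 2 36 35, HAdd 36 36 45]) ((?RR i)(38 := int i - int (2 * m)), ?AA i, []) 2
   ((?RR (Suc i))(38 := int i - int (2 * m)), ?AA (Suc i), [])"
   unfolding C[symmetric] by (intro hr_Blk) (use r iJ ni in \<open>auto simp: fun_eq_iff\<close>)
 qed (use r in auto)
 have C0: "A1 = ?AA 0" by (auto simp: A1_def Ca_def ov_def ext_cost_def fun_eq_iff)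
 have 3: "hr inp J (Block [HConst 28 0, HConst 29 0, HConst 30 0, HConst 31 0, HConst 32 0, HConst 33 0, HConst 34 0, HConst 35 0, HConst 36 0, HConst 37 0, HAdd 18 16 44])
  ((?RR (2 * m))(38 := 0), ?AA (2 * m), []) 11 (R2, A2, [])" by (intro hr_Blk) (use r in \<open>auto simp: fun_eq_iff A2_def N_def\<close>)
 have s: "(?S(36 := int n, 37 := int (2 * m)), A1, [] :: int list) = (?RR 0, ?AA 0, [])" using C0 by simp
 show ?thesis unfolding param_code3_def by (rule hr_conv[OF hr_Seq[OF 1[unfolded s] hr_Seq[OF 2 3]]]) (use Z in auto)
qed

end

section \<open>The output and the complete program\<close>

text \<open>A positive sum of slack entries means infeasibility. Otherwise each entry is written
  with \<open>q + l + 2\<close> bits, a width known beforehand from the range of the scaling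
  iterates.\<close>

definition final_code :: "hatom com" where
 "final_code = Block [HAdd 24 3 44, HAdd 27 2 2] ;; Rep 26 27 (Block [HLoad 29 5 24, HAdd 28 28 29, HAdd 24 24 45, HConst 29 0]) ;;
   Block [HSub 28 44 28] ;;
   Cond 28 (Block [HOut 44]) (Block [HOut 45, HAdd 33 10 16, HAdd 33 33 45, HAdd 33 33 45] ;;
    For 30 31 3 (Block [HLoad 34 5 30] ;; Rep 32 33 (Block [HOut 34, HHalf 34 34]) ;; Block [HConst 34 0]))"

definition dig_out :: "nat => int => int list" where
 "dig_out L z = map (%i. z div 2 ^ i mod 2) [0..<L]"

definition vec_out :: "nat => nat => (nat => int) => int list" where
 "vec_out L n y = concat (map (%j. dig_out L (y j)) [0..<n])"

context prm
begin

lemma final_code_correct: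
 assumes R: "preg R" and N: "N = n + 2 * m" and y: "!!j. j < N ==> A 5 j = y j" and Z: "q + l + 2 <= Z" "n <= Z" "2 * m <= Z"
 shows "\<exists>R'. hr inp J final_code (R, A, []) (60 * (Z * Z))
  (R', A, if 0 < (\<Sum>j\<in>{n..<N}. y j) then [0] else 1 # vec_out (q + l + 2) n y)"
proof -
 let ?s = "%i. \<Sum>j\<in>{n..<n + i}. y j"
 have r: "R 44 = 0" "R 45 = 1" "R 2 = int m" "R 3 = int n" "R 10 = int q" "R 16 = int l" "!!x. 23 < x ==> x < 44 ==> R x = 0" using R by (auto simp: preg_def clean_def)
 have 1: "hr inp J (Block [HAdd 24 3 44, HAdd 27 2 2]) (R, A, []) 2 (R(24 := int n, 27 := int (2 * m)), A, [])" by (intro hr_Blk) (use r in auto)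
 let ?RR = "%i. R(24 := int (n + i), 27 := int (2 * m), 28 := ?s i)"
 have 2: "hr inp J (Rep 26 27 (Block [HLoad 29 5 24, HAdd 28 28 29, HAdd 24 24 45, HConst 29 0])) (?RR 0, A, []) (2 * m * (4 + 3) + 3) ((?RR (2 * m))(26 := 0), A, [])"
 proof (rule hr_Rep[where RR = ?RR and AA = "%_. A" and oo = "%_. []"])
  fix i assume i: "i < 2 * m"
  have iN: "n + i < N" using i N by simp
  have ni: "nat (int n + int i) = n + i" by linarith
  show "hr inp J (Block [HLoad 29 5 24, HAdd 28 28 29, HAdd 24 24 45, HConst 29 0]) ((?RR i)(26 := int i - int (2 * m)), A, []) 4
   ((?RR (Suc i))(26 := int i - int (2 * m)), A, [])" by (intro hr_Blk) (use r iN ni y[OF iN] Jb(2) in \<open>auto simp: fun_eq_iff\<close>)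
 qed (use r in auto)
 let ?S = "R(24 := int N, 27 := int (2 * m), 28 := - ?s (2 * m))"
 have 3: "hr inp J (Block [HSub 28 44 28]) ((?RR (2 * m))(26 := 0), A, []) 1 (?S, A, [])" by (intro hr_Blk) (use r N in \<open>auto simp: fun_eq_iff\<close>)
 have e0: "(R(24 := int n, 27 := int (2 * m)), A, [] :: int list) = (?RR 0, A, [])" using r by (auto simp: fun_eq_iff)
 let ?L = "q + l + 2"
 let ?S1 = "?S(33 := int ?L)"
 let ?in = "Block [HLoad 34 5 30] ;; Rep 32 33 (Block [HOut 34, HHalf 34 34]) ;; Block [HConst 34 0]"
 have c: "\<exists>R'. hr inp J (Cond 28 (Block [HOut 44]) (Block [HOut 45, HAdd 33 10 16, HAdd 33 33 45, HAdd 33 33 45] ;; For 30 31 3 ?in)) (?S, A, [])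
  (30 * (Z * Z)) (R', A, if 0 < ?s (2 * m) then [0] else 1 # vec_out ?L n y)"
 proof (cases "0 < ?s (2 * m)")
  case True
  have "hr inp J (Block [HOut 44]) (?S, A, []) 1 (?S, A, [0])" by (intro hr_Blk) (use r in auto)
  then have "hr inp J (Cond 28 (Block [HOut 44]) (Block [HOut 45, HAdd 33 10 16, HAdd 33 33 45, HAdd 33 33 45] ;; For 30 31 3 ?in)) (?S, A, [])
   (1 + 2) (?S, A, [0])" by (intro hr_CondT) (use True in auto)
  moreover have "1 + 2 <= 30 * (Z * Z)" using Z3(3) by linarith
  ultimately show ?thesis using True by (intro exI[of _ ?S]) (auto elim: hr_conv)
 next
  case False
  have a1: "hr inp J (Block [HOut 45, HAdd 33 10 16, HAdd 33 33 45, HAdd 33 33 45]) (?S, A, []) 4 (?S1, A, [1])" by (intro hr_Blk) (use r in auto)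
  let ?O = "%i. 1 # vec_out ?L i y"
  have a2: "hr inp J (For 30 31 3 ?in) (?S1, A, ?O 0) (Z * ((5 * Z + 5) + 8)) (?S1, A, ?O n)"
  proof (rule hr_ForZ[where RR = "%_. ?S1" and AA = "%_. A" and oo = ?O])
   fix i assume i: "i < n"
   have iN: "i < N" using i N by simp
   let ?R = "?S1(30 := int i, 31 := int i - int n)"
   let ?R' = "%p. ?R(34 := y i div 2 ^ p)"
   let ?Oi = "%p. ?O i @ dig_out p (y i)"
   have b1: "hr inp J (Block [HLoad 34 5 30]) (?R, A, ?O i) 1 (?R' 0, A, ?Oi 0)" by (intro hr_Blk) (use r iN y[OF iN] Jb(2) in \<open>auto simp: dig_out_def\<close>)
   have b2: "hr inp J (Rep 32 33 (Block [HOut 34, HHalf 34 34])) (?R' 0, A, ?Oi 0) (?L * (2 + 3) + 3) ((?R' ?L)(32 := 0), A, ?Oi ?L)"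
   proof (rule hr_Rep[where RR = ?R' and AA = "%_. A" and oo = ?Oi])
    fix p
    have "y i div 2 ^ p div 2 = y i div 2 ^ Suc p" by (rule div_pow_Suc[symmetric])
    then show "hr inp J (Block [HOut 34, HHalf 34 34]) ((?R' p)(32 := int p - int ?L), A, ?Oi p) 2 ((?R' (Suc p))(32 := int p - int ?L), A, ?Oi (Suc p))" by (intro hr_Blk) (auto simp: fun_eq_iff dig_out_def simp del: power_Suc)
   qed (use r in auto)
   have b3: "hr inp J (Block [HConst 34 0]) ((?R' ?L)(32 := 0), A, ?Oi ?L) 1 (?R, A, ?O (Suc i))" by (intro hr_Blk) (use r in \<open>auto simp: fun_eq_iff vec_out_def\<close>)
   have t: "1 + (?L * (2 + 3) + 3 + 1) <= 5 * Z + 5" using mult_le_mono1[OF Z(1), of 5] by simp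
   show "hr inp J ?in (?R, A, ?O i) (5 * Z + 5) (?R, A, ?O (Suc i))" by (rule hr_conv[OF hr_Seq[OF b1 hr_Seq[OF b2 b3]] t refl])
  qed (use r Z Zb in auto)
  have O0: "?O 0 = [1]" by (simp add: vec_out_def)
  have "hr inp J (Cond 28 (Block [HOut 44]) (Block [HOut 45, HAdd 33 10 16, HAdd 33 33 45, HAdd 33 33 45] ;; For 30 31 3 ?in)) (?S, A, [])
   (4 + Z * ((5 * Z + 5) + 8) + 2) (?S1, A, ?O n)" by (rule hr_CondF[OF _ _ hr_Seq[OF a1 a2[unfolded O0]]]) (use False in auto)
  moreover have "4 + Z * ((5 * Z + 5) + 8) + 2 <= 30 * (Z * Z)" using quad_bound[of 5 13 6] by (simp add: add.assoc)
  ultimately show ?thesis using False by (intro exI[of _ ?S1]) (auto elim: hr_conv)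
 qed
 then obtain R' where c: "hr inp J (Cond 28 (Block [HOut 44]) (Block [HOut 45, HAdd 33 10 16, HAdd 33 33 45, HAdd 33 33 45] ;; For 30 31 3 ?in)) (?S, A, [])
  (30 * (Z * Z)) (R', A, if 0 < ?s (2 * m) then [0] else 1 # vec_out ?L n y)" by blast
 have t: "2 + (2 * m * (4 + 3) + 3 + (1 + 30 * (Z * Z))) <= 60 * (Z * Z)"
 proof -
  have "2 * m * (4 + 3) <= 7 * Z" using Z(3) by simp
  then show ?thesis using Z3 by linarith
 qed
 show ?thesis unfolding final_code_def N by (rule exI, rule hr_conv[OF hr_Seq[OF 1[unfolded e0] hr_Seq[OF 2 hr_Seq[OF 3 c]]] t refl])
qed

end

text \<open>The first phase has right-hand side 0, and a negative cost there reveals a negative ray.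
  Then no optimal solution exists, whether the program is feasible or not, so the verdict 0 is
  correct in both cases.\<close>

definition main_code :: "hatom com" where
 "main_code = (load_code ;; param_code1 ;; param_code2 ;; param_code3 ;; fill_code) ;; phase_code ;;
   Cond 23 (Block [HOut 44]) (Rep 19 16 phase_code ;; final_code)"

text \<open>Adding a negative ray to an optimal solution would improve it.\<close>

lemma opt_bounded_below: "opt n m a c b x ==> bounded_below n m a c"
 unfolding bounded_below_def
proof (intro allI impI)
 fix w assume x: "opt n m a c b x" and w: "feas n m a (%k. 0) w"
 have "feas n m a b (%j. x j + w j)" using x w by (auto simp: opt_def feas_def lin_add)
 then have "lin n c x <= lin n c (%j. x j + w j)" using x by (simp add: opt_def)
 then show "0 <= lin n c w" by (simp add: lin_add)
qed

context phase_run
begin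

text \<open>A phase at most doubles an entry and then adds a digit below
  \<open>2 ^ q\<close>.\<close>

lemma scaling_range: "j < N ==> 0 <= scaling l b i j & scaling l b i j <= (2 ^ i - 1) * 2 ^ q"
proof (induction i)
 case (Suc i)
 let ?b = "%k. trunc_div (l - i) (b k)"
 have d: "0 <= digit q v j" "digit q v j < 2 ^ q" for v by (simp_all add: digit_def)
 have s: "0 <= shift_down dd (scaling l b i) j" "shift_down dd (scaling l b i) j <= 2 * scaling l b i j" using Suc by (auto simp: shift_down_def)
 have "scaling l b (Suc i) j <= 2 * ((2 ^ i - 1) * 2 ^ q) + 2 ^ q" using d[of "phase_value ?b (scaling l b i)"] s Suc by (simp add: phase_def)
 also have "... = (2 ^ Suc i - 1) * 2 ^ q" by (simp add: algebra_simps)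
 finally show ?case using d[of "phase_value ?b (scaling l b i)"] s by (simp add: phase_def)
qed simp

lemma scaling_less:
 assumes "j < N" "i <= l + 1"
 shows "0 <= scaling l b i j & scaling l b i j < 2 ^ (q + l + 1)"
proof -
 have "(2 ^ i - 1) * 2 ^ q < (2 ^ i * 2 ^ q :: int)" by simp
 also have "... <= 2 ^ (q + l + 1)" unfolding power_add[symmetric] by (rule int_pow_le) (use assms in simp)
 finally show ?thesis using scaling_range[OF assms(1), of i] by linarith
qed

abbreviation "PH \<equiv> 185 * (Z * Z) * (8 * 2 ^ ((e + 1) * m)) ^ (2 * sg) + 200 * (Z * (Z * Z))"

lemma phase_step:
 assumes "phase_inv (int l - int i) (scaling l b i) R A" "i <= l"
 shows "HQ phase_code (R, A, out) PH
  (%s. \<exists>R' A'. phase_inv (int l - int (Suc i)) (scaling l b (Suc i)) R' A' & s = (R', A', out) &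
    R' = R(18 := int l - int (Suc i), 23 := phase_value (%k. trunc_div (l - i) (b k)) (scaling l b i) div 2 ^ (q * N)))"
proof -
 have p: "int l - int i = int (l - i)" "int (l - i) - 1 = int l - int (Suc i)" using assms(2) by simp_all
 show ?thesis
 proof (rule hp_mono[OF phase_code_correct[OF assms(1)[unfolded p(1)], unfolded p(2)] order_refl])
  show "l - i <= l" by simp
  show "0 <= scaling l b i j & scaling l b i j < 2 ^ (q + l + 1)" if "j < N" for j by (rule scaling_less[OF that]) (use assms(2) in simp)
 qed (simp only: scaling.simps, blast)
qed

lemma phase_inv_19: "phase_inv p y R A ==> \<bar>v\<bar> < 2 ^ qb ==> phase_inv p y (R(19 := v)) A"
 unfolding phase_inv_def preg_def clean_def by auto

lemma phase_inv_bnd: "phase_inv p y R A ==> hbnd qb (R, A, out)"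
 unfolding phase_inv_def hbnd_def by auto

lemma block_step:
 assumes "hat inp J ato s = Some s'" "hbnd qb s" "Q s'"
 shows "HQ (Block [ato]) s 1 Q" by (rule hp_hq[OF inpb qb1 hp_mono[OF hp_Block[where Q = "%x. x = s'"] order_refl] assms(2)])
  (use assms Zb(1) Z3 in auto)

text \<open>Phases are too long for counting bits by steps, so this loop is verified directly in the
  bounded semantics, where \<open>phase_inv\<close> renews the magnitude bounds in each
  round.\<close>

lemma rep_phases:
 assumes "phase_inv (int l - 1) (scaling l b 1) R A"
 shows "HQ (Rep 19 16 phase_code) (R, A, out) (l * (PH + 3) + 3)
  (%s. \<exists>R' A'. phase_inv (-1) (scaling l b (Suc l)) R' A' & s = (R', A', out))"
proof -
 let ?I = "%i s. \<exists>R A. s = (R, A, out) & R 19 = int i - int l & phase_inv (int l - int (Suc i)) (scaling l b (Suc i)) R A"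
 have lb: "int l < 2 ^ qb" by (rule less_qb[OF of_nat_less_two_power]) (use Zb in simp)
 have loop: "HQ (Loop 19 (phase_code ;; Block [HAdd 19 19 45])) s (l * ((PH + 1) + 2) + 2) (?I l)" if "?I 0 s" for s
 proof (rule hp_for[where I = ?I])
  fix i s assume i: "i < l" and "?I i s"
  then obtain R A where s: "s = (R, A, out)" "R 19 = int i - int l" "phase_inv (int l - int (Suc i)) (scaling l b (Suc i)) R A" by blast
  have "hqt lev 19 s = Some True" using hbnd_mono[OF phase_inv_bnd[OF s(3), of out], of lev] i s by (simp add: hqt_def hts_def)
  moreover have "HQ (phase_code ;; Block [HAdd 19 19 45]) s (PH + 1) (?I (Suc i))"
  proof (rule hp_Seq[OF hp_mono[OF phase_step[OF s(3), of out, folded s(1)] order_refl]])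
   show "Suc i <= l" using i by simp
   fix s' assume "\<exists>R' A'. phase_inv (int l - int (Suc (Suc i))) (scaling l b (Suc (Suc i))) R' A' & s' = (R', A', out) &
    R' = R(18 := int l - int (Suc (Suc i)), 23 := phase_value (%k. trunc_div (l - Suc i) (b k)) (scaling l b (Suc i)) div 2 ^ (q * N))"
   then obtain R' A' where s': "phase_inv (int l - int (Suc (Suc i))) (scaling l b (Suc (Suc i))) R' A'" "s' = (R', A', out)" "R' 19 = R 19" by auto
   have one: "R' 45 = 1" using s'(1) by (simp add: phase_inv_def preg_def clean_def)
   show "HQ (Block [HAdd 19 19 45]) s' 1 (?I (Suc i))"
   proof (rule block_step)
    have "R' 19 + R' 45 = int (Suc i) - int l" using s'(3) s(2) one by simp
    then show "hat inp J (HAdd 19 19 45) s' = Some (R'(19 := int (Suc i) - int l), A', out)" using s'(2) by simp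
    show "hbnd qb s'" unfolding s'(2) by (rule phase_inv_bnd[OF s'(1)])
    have "phase_inv (int l - int (Suc (Suc i))) (scaling l b (Suc (Suc i))) (R'(19 := int (Suc i) - int l)) A'" by (rule phase_inv_19[OF s'(1)]) (use lb i in linarith)
    then show "?I (Suc i) (R'(19 := int (Suc i) - int l), A', out)" by auto
   qed
  qed simp
  ultimately show "hqt lev 19 s = Some True & HQ (phase_code ;; Block [HAdd 19 19 45]) s (PH + 1) (?I (Suc i))" by blast
 next
  fix s assume "?I l s"
  then obtain R A where s: "s = (R, A, out)" "R 19 = int l - int l" "phase_inv (int l - int (Suc l)) (scaling l b (Suc l)) R A" by blast
  show "hqt lev 19 s = Some False" using hbnd_mono[OF phase_inv_bnd[OF s(3), of out], of lev] s by (simp add: hqt_def hts_def)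
 qed (rule that)
 have z: "R 44 = 0" "R 16 = int l" using assms by (simp_all add: phase_inv_def preg_def clean_def)
 have init: "HQ (Block [HSub 19 44 16]) (R, A, out) 1 (%s. HQ (Loop 19 (phase_code ;; Block [HAdd 19 19 45])) s (l * ((PH + 1) + 2) + 2) (?I l))"
 proof (rule block_step)
  show "hat inp J (HSub 19 44 16) (R, A, out) = Some (R(19 := - int l), A, out)" using z by simp
  show "hbnd qb (R, A, out)" by (rule phase_inv_bnd[OF assms])
  have "phase_inv (int l - 1) (scaling l b 1) (R(19 := - int l)) A" by (rule phase_inv_19[OF assms]) (use lb in simp)
  then show "HQ (Loop 19 (phase_code ;; Block [HAdd 19 19 45])) (R(19 := - int l), A, out) (l * ((PH + 1) + 2) + 2) (?I l)" by (intro loop) auto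
 qed
 have "HQ (Rep 19 16 phase_code) (R, A, out) (l * (PH + 3) + 3) (?I l)" unfolding Rep_def by (rule hp_Seq[OF init]) (simp add: algebra_simps)
 then show ?thesis by (rule hp_mono) auto
qed

end

section \<open>Correctness and resource bounds\<close>
locale ilp_main = ilp_load +
 assumes mn: "1 <= m" "1 <= n" and Z2: "2 * m <= Z" and J2: "2 * sg < J"
  and Zs: "2 * sg + 2 ^ sg + 2 ^ sg + q * N + q * m + q + q + \<mu> + m + \<nu> + \<delta> + l + l + e + e + (e + 1) * m + dd + N + 40 <= Z"
  and inpZ: "!!v. v \<in> set inp ==> \<bar>v\<bar> < 2 ^ Z"
begin

abbreviation "\<alpha> \<equiv> ext_mat n m a"
abbreviation "c \<equiv> ext_cost n (2 ^ kM) cc"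
abbreviation "qb \<equiv> Z + 500 * (Z * (Z * Z))"

lemma tab_eq: "k < m ==> j < N ==> tab m (k * N + j) = \<alpha> k j"
proof -
 assume k: "k < m" "j < N"
 then have "k * N + j < Suc k * N" by simp
 also have "... <= m * N" using k by (intro mult_le_mono1) simp
 finally show ?thesis using tab_row[OF k(2), of k] by (simp add: tab_def)
qed

lemma bl_bound: "0 <= x ==> x < 2 ^ bl (nat x)"
proof -
 assume "0 <= x"
 have "int (nat x) < int (2 ^ bl (nat x))" using less_bl[of "nat x"] by (simp only: of_nat_less_iff)
 then show ?thesis using \<open>0 <= x\<close> by simp
qed

lemma \<alpha>_bound: "k < m ==> j < N ==> \<bar>\<alpha> k j\<bar> <= 2 ^ \<delta>"
proof -
 assume k: "k < m" "j < N"
 then have "k * N + j < Suc k * N" by simp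
 also have "... <= m * N" using k by (intro mult_le_mono1) simp
 finally have "\<bar>tab m (k * N + j)\<bar> <= Mx" by (rule mxa_ge(2))
 then show ?thesis using bl_bound[OF Mx(1)] tab_eq[OF k] by (simp add: \<delta>_def)
qed

lemma My_less: "My < 2 ^ l" using bl_bound[of My] Mx by (simp add: l_def)

lemma bb_bound: "k < m ==> \<bar>bb k\<bar> < 2 ^ l"
proof -
 assume k: "k < m"
 have "\<bar>Ba k\<bar> <= mxa Mx Ba m" by (rule mxa_ge(2)[OF k])
 also have "... <= My" by (rule mxa_ge(1))
 finally show ?thesis using My_less k by (simp add: Ba_def)
qed

lemma cc_bound: "j < n ==> \<bar>cc j\<bar> < 2 ^ l" using mxa_ge(2)[of j n Ca "mxa Mx Ba m"] My_less by (simp add: Ca_def)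

lemma lam: "m + \<delta> + \<nu> + l < 2 ^ lam" unfolding lam_def by (rule less_bl)

lemma kM_eq: "kM = 16 * (2 ^ lam * 2 ^ lam)" unfolding kM_def mult_2[of lam] power_add by simp

text \<open>The first left side is the exponent of \<open>Bd\<close> with some room for the factors
  of 2 in the slack argument; it is at most quadratic in \<open>2 ^ lam\<close>.\<close>

lemma kM_ge: "\<nu> + l + m * (\<delta> + \<nu> + l + 4) + 4 <= kM" "l <= kM"
proof -
 define x where "x = m + \<delta> + \<nu> + l"
 define Y where "Y = (2::nat) ^ lam"
 have xY: "x + 1 <= Y" using lam by (simp add: x_def Y_def)
 have "m * (\<delta> + \<nu> + l + 4) <= x * (x + 4)" by (rule mult_le_mono) (auto simp: x_def)
 also have "... <= Y * (Y + 4)" using xY by (intro mult_le_mono) auto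
 finally have 1: "m * (\<delta> + \<nu> + l + 4) <= Y * Y + Y * 4" by (simp add: distrib_left)
 have 2: "Y <= Y * Y" "1 <= Y" using xY by auto
 have 3: "\<nu> + l <= Y" "l <= Y" using xY by (auto simp: x_def)
 show "\<nu> + l + m * (\<delta> + \<nu> + l + 4) + 4 <= kM" "l <= kM" unfolding kM_eq Y_def[symmetric] using 1 2 3 by linarith+
qed

sublocale ip: instance_params N m \<delta> \<nu> \<pi> \<mu> sg dd q e \<alpha> c BIG
proof unfold_locales
 show "\<bar>c j\<bar> < 2 ^ \<mu>" if "j < N" for j
 proof (cases "j < n")
  case True
  have "\<bar>cc j\<bar> < 2 ^ l" by (rule cc_bound[OF True])
  also have "... <= 2 ^ \<mu>" by (rule int_pow_le) (use kM_ge in \<open>simp add: \<mu>_def\<close>)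
  finally show ?thesis using True by (simp add: ext_cost_def)
 qed (simp add: ext_cost_def \<mu>_def)
 show "N < 2 ^ \<nu>" unfolding \<nu>_def by (rule less_bl)
 show "m + \<delta> + \<nu> < 2 ^ \<pi>" unfolding \<pi>_def by (rule less_bl)
qed (use mn \<alpha>_bound in \<open>auto simp: sg_def dd_def q_def e_def BIG_def\<close>)

sublocale pr: phase_run N m \<delta> \<nu> \<pi> \<mu> sg dd q e \<alpha> c BIG inp J Z n l qb bb
proof unfold_locales
 show "\<bar>v\<bar> < 2 ^ qb" if "v \<in> set inp" for v using inpZ[OF that] int_pow_le[of Z qb] by linarith
qed (use Zs J J2 bb_bound in auto)

sublocale sl: slack_params n m \<delta> \<nu> l "2 ^ sg" "2 ^ kM" a cc bb
proof unfold_locales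
 show "\<bar>a k j\<bar> <= 2 ^ \<delta>" if "k < m" "j < n" for k j using \<alpha>_bound[of k j] that by (simp add: ext_mat_def N_def)
 show "n + 2 * m < 2 ^ \<nu>" using less_bl[of N] by (simp add: \<nu>_def N_def)
 show "nat (2 * (int (2 ^ sg) * 2 ^ \<delta>) + 1) ^ m < 2 ^ 2 ^ sg" by (rule ip.support_bound)
qed (use mn bb_bound cc_bound in auto)

definition "A3 = A2(3 := ov N (col q m \<alpha>) (A2 3), 4 := ov N (wgt q N c) (A2 4))"

definition "init_code = load_code ;; param_code1 ;; param_code2 ;; param_code3 ;; fill_code"

lemma preg_R2: "pr.preg R2"
 unfolding pr.preg_def clean_def R2_def R1_def by simp

lemma init_correct: "hr inp J init_code ((%_. 0), (%_ _. 0), []) (500 * (Z * (Z * Z))) (R2, A3, [])"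
proof -
 have f: "hr inp J fill_code (R2, A2, []) (60 * (Z * (Z * Z))) (R2, A3, [])" unfolding A3_def
 proof (rule pr.fill_code_correct[OF preg_R2])
  show "A2 0 (k * N + j) = \<alpha> k j" if "k < m" "j < N" for k j using tab_eq[OF that] by (simp add: A2_def A1_def)
  show "A2 2 j = c j" if "j < N" for j using that by (simp add: A2_def)
 qed
 have t: "100 * (Z * Z) + (150 * Z + (150 * Z + (30 * Z + 60 * (Z * (Z * Z))))) <= 500 * (Z * (Z * Z))" using pr.Z3 by linarith
 show ?thesis unfolding init_code_def by (rule hr_conv[OF hr_Seq[OF load_code_correct hr_Seq[OF param_code1_correct hr_Seq[OF param_code2_correct hr_Seq[OF param_code3_correct f]]]] t refl])
qed

text \<open>The magnitudes of the initial data are not computed one by one: they are the outcome of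
  a run of known length from the zero state.\<close>

lemma init_inv: "pr.phase_inv (int l - int 0) (ip.scaling l bb 0) R2 A3"
proof -
 obtain t s' where t: "t <= 500 * (Z * (Z * Z))" "runs (hat inp J) hts init_code ((%_. 0), (%_ _. 0), []) t (R2, A3, [])" using init_correct unfolding hr_def hp_def by auto
 have "hbnd Z ((%_. 0), (%_ _. 0), [])" by (simp add: hbnd_def)
 then have "hbnd (Z + t) (R2, A3, [])" using runs_hq[OF inpZ Z(5) t(2), of Z] by simp
 then have h: "hbnd qb (R2, A3, [])" by (rule hbnd_mono) (use t in simp)
 have "R2 18 = int l" "R2 20 = 0" "R2 21 = 0" "R2 22 = 0" by (auto simp: R2_def R1_def)
 moreover have "A3 0 = tab m" "A3 1 = Ba" "A3 5 = (%_. 0)" "A3 3 = ov N (col q m \<alpha>) (A2 3)" "A3 4 = ov N (wgt q N c) (A2 4)" by (simp_all add: A3_def A2_def A1_def)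
 moreover have "\<bar>R2 x\<bar> < 2 ^ qb" "\<bar>A3 f j\<bar> < 2 ^ qb" for x f j using h unfolding hbnd_def by simp_all
 ultimately show ?thesis unfolding pr.phase_inv_def by (intro conjI allI impI preg_R2) (simp_all add: tab_eq Ba_def)
qed

definition "ys = ip.scaling l bb (Suc l)"
definition "out_list = (if bounded_below n m a cc then if 0 < (\<Sum>j\<in>{n..<N}. ys j) then [0] else 1 # vec_out (q + l + 2) n ys else [0])"

lemma M_half: "(2::int) ^ kM = 2 * 2 ^ (kM - 1)" "2 * sl.Bd < 2 ^ (kM - 1)" "sl.Bd <= 2 ^ kM"
proof -
 have k: "4 <= kM" using kM_ge(1) by linarith
 then have "Suc (kM - 1) = kM" by linarith
 then show "(2::int) ^ kM = 2 * 2 ^ (kM - 1)" using power_Suc[of "2::int" "kM - 1"] by simp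
 have "2 * sl.Bd = 2 ^ Suc (\<nu> + l + m * (\<delta> + \<nu> + l + 4))" by (simp add: sl.Bd_def)
 also have "... < 2 ^ (kM - 1)"
 proof (rule power_strict_increasing)
  show "Suc (\<nu> + l + m * (\<delta> + \<nu> + l + 4)) < kM - 1" using kM_ge(1) by linarith
 qed simp
 finally show 1: "2 * sl.Bd < 2 ^ (kM - 1)" .
 have "(2::int) ^ (kM - 1) <= 2 ^ kM" by (rule int_pow_le) simp
 then show "sl.Bd <= 2 ^ kM" using 1 sl.Bd_pos by linarith
qed

lemma bounded_iff: "bounded_below N m \<alpha> c \<longleftrightarrow> bounded_below n m a cc" using sl.bounded_below_ext[OF M_half(3)] by (simp add: N_def)

lemma out_list_correct:
 "(\<exists>x. opt n m a cc bb x & (\<forall>j<n. 0 <= x j & x j < 2 ^ (q + l + 2)) & out_list = 1 # vec_out (q + l + 2) n x) \<or>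
  ((\<nexists>x. opt n m a cc bb x) & out_list = [0])"
proof (cases "bounded_below n m a cc")
 case False
 then show ?thesis using opt_bounded_below[of n m a cc bb] by (auto simp: out_list_def)
next
 case True
 have o: "opt N m \<alpha> c bb ys" using ip.scaling_opt[OF True[folded bounded_iff], of bb l l] feas_ext_exists[of n m a] bb_bound by (simp add: ys_def N_def)
 show ?thesis
 proof (cases "0 < (\<Sum>j\<in>{n..<N}. ys j)")
  case pos: True
  have "\<not> feas n m a bb y" for y using sl.opt_ext(2)[OF M_half(1,2) True o[unfolded N_def]] pos by (simp add: N_def)
  then show ?thesis using True pos by (auto simp: out_list_def opt_def)
 next
  case le: False
  have "opt n m a cc bb ys" using sl.opt_ext(1)[OF M_half(1,2) True o[unfolded N_def]] le by (simp add: N_def)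
  moreover have "0 <= ys j & ys j < 2 ^ (q + l + 2)" if "j < n" for j
  proof -
   have "0 <= ys j & ys j < 2 ^ (q + l + 1)" unfolding ys_def by (rule pr.scaling_less) (use that in \<open>auto simp: N_def\<close>)
   moreover have "(2::int) ^ (q + l + 1) <= 2 ^ (q + l + 2)" by (rule int_pow_le) simp
   ultimately show ?thesis by linarith
  qed
  ultimately show ?thesis using True le by (auto simp: out_list_def)
 qed
qed

abbreviation "GG \<equiv> (8 * 2 ^ ((e + 1) * m)) ^ (2 * sg) :: nat"

text \<open>There are \<open>l + 1\<close>, hence at most \<open>Z\<close>, phases. Each is
  dominated by its Savitch loop with the factor \<open>GG\<close>; everything else is polynomial in
  \<open>Z\<close>.\<close>

lemma main_correct:
 "pr.HQ main_code ((%_. 0), (%_ _. 0), []) (2000 * (Z * (Z * (Z * Z))) * GG) (%s. snd (snd s) = out_list)"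
proof -
 have h0: "hbnd Z ((%_. 0), (%_ _. 0), [])" by (simp add: hbnd_def)
 have 1: "pr.HQ init_code ((%_. 0), (%_ _. 0), []) (500 * (Z * (Z * Z))) (%s. s = (R2, A3, []))" by (rule hp_hq[OF inpZ Z(5) init_correct[unfolded hr_def] h0]) simp_all
 let ?v = "ip.phase_value (%k. trunc_div (l - 0) (bb k)) (ip.scaling l bb 0) div 2 ^ (q * N)"
 have v: "?v < 0 \<longleftrightarrow> \<not> bounded_below n m a cc"
  unfolding bounded_iff[symmetric] ip.scaling.simps(1) by (rule ip.phase_start) (simp add: trunc_div_big bb_bound)
 have 3: "pr.HQ (Cond 23 (Block [HOut 44]) (Rep 19 16 phase_code ;; final_code)) s (l * (pr.PH + 3) + 3 + 60 * (Z * Z) + 2) (%s. snd (snd s) = out_list)"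
  if s: "\<exists>R' A'. pr.phase_inv (int l - int (Suc 0)) (ip.scaling l bb (Suc 0)) R' A' & s = (R', A', []) &
    R' = R2(18 := int l - int (Suc 0), 23 := ?v)" for s
 proof -
  obtain R' A' where s: "pr.phase_inv (int l - int (Suc 0)) (ip.scaling l bb (Suc 0)) R' A'" "s = (R', A', [])" "R' 23 = ?v" using s by auto
  have hb: "hbnd qb s" unfolding s(2) by (rule pr.phase_inv_bnd[OF s(1)])
  have "hqt pr.lev 23 s = Some (?v < 0)" using hbnd_mono[OF hb, of pr.lev] s(2,3) by (simp add: hqt_def hts_def)
  then have test: "hqt pr.lev 23 s = Some (\<not> bounded_below n m a cc)" by (simp only: v)
  show ?thesis
  proof (cases "bounded_below n m a cc")
   case False
   have z: "R' 44 = 0" using s(1) by (simp add: pr.phase_inv_def pr.preg_def clean_def)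
   have "pr.HQ (Block [HOut 44]) s 1 (%s. snd (snd s) = out_list)" by (rule pr.block_step[OF _ hb]) (use s(2) z False in \<open>auto simp: out_list_def\<close>)
   then show ?thesis by (rule hp_CondT[rotated 1]) (use test False in simp_all)
  next
   case True
   have "pr.HQ (Rep 19 16 phase_code ;; final_code) s (l * (pr.PH + 3) + 3 + 60 * (Z * Z)) (%s. snd (snd s) = out_list)"
   proof (rule hp_Seq)
    have i: "pr.phase_inv (int l - 1) (ip.scaling l bb 1) R' A'" using s(1) by simp
    show "pr.HQ (Rep 19 16 phase_code) s (l * (pr.PH + 3) + 3) (%s1. pr.HQ final_code s1 (60 * (Z * Z)) (%s. snd (snd s) = out_list))"
     unfolding s(2)
    proof (rule hp_mono[OF pr.rep_phases[OF i] order_refl])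
     fix s2 :: hst assume "\<exists>R' A'. pr.phase_inv (- 1) (ip.scaling l bb (Suc l)) R' A' & s2 = (R', A', [])"
     then obtain R2 A2 where s2: "pr.phase_inv (- 1) ys R2 A2" "s2 = (R2, A2, [])" unfolding ys_def by blast
     have pre: "pr.preg R2" and y: "!!j. j < N ==> A2 5 j = ys j" using s2(1) unfolding pr.phase_inv_def by auto
     have L: "q + l + 2 <= Z" using pr.ZZ by linarith
     obtain R3 where f: "hr inp J final_code (R2, A2, []) (60 * (Z * Z))
      (R3, A2, if 0 < (\<Sum>j\<in>{n..<N}. ys j) then [0] else 1 # vec_out (q + l + 2) n ys)" using pr.final_code_correct[where A = A2 and y = ys, OF pre N_def y L Z(4) Z2] by blast
     have "hp (hat inp J) hts final_code s2 (60 * (Z * Z)) (%s. snd (snd s) = out_list)"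
      unfolding s2(2) by (rule hp_mono[OF f[unfolded hr_def] order_refl]) (use True in \<open>auto simp: out_list_def\<close>)
     moreover have "hbnd qb s2" unfolding s2(2) by (rule pr.phase_inv_bnd[OF s2(1)])
     moreover have "qb + 60 * (Z * Z) <= pr.lev" using pr.Z3 by linarith
     ultimately show "pr.HQ final_code s2 (60 * (Z * Z)) (%s. snd (snd s) = out_list)" by (intro hp_hq[OF pr.inpb pr.qb1])
    qed
   qed simp
   then show ?thesis by (rule hp_CondF[rotated 1]) (use test True in simp_all)
  qed
 qed
 have 2: "pr.HQ (phase_code ;; Cond 23 (Block [HOut 44]) (Rep 19 16 phase_code ;; final_code)) (R2, A3, [])
  (pr.PH + (l * (pr.PH + 3) + 3 + 60 * (Z * Z) + 2)) (%s. snd (snd s) = out_list)" by (rule hp_Seq[OF hp_mono[OF pr.phase_step[OF init_inv] order_refl 3]]) simp_all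
 have "pr.HQ main_code ((%_. 0), (%_ _. 0), []) (500 * (Z * (Z * Z)) + (pr.PH + (l * (pr.PH + 3) + 3 + 60 * (Z * Z) + 2))) (%s. snd (snd s) = out_list)"
  unfolding main_code_def init_code_def[symmetric] by (rule hp_Seq[OF hp_mono[OF 1 order_refl]]) (use 2 in auto)
 moreover have "500 * (Z * (Z * Z)) + (pr.PH + (l * (pr.PH + 3) + 3 + 60 * (Z * Z) + 2)) <= 2000 * (Z * (Z * (Z * Z))) * GG"
 proof -
  define G where "G = GG"
  define Y where "Y = Z * (Z * Z)"
  have G: "1 <= G" unfolding G_def by simp
  have Y: "Z * Z <= Y" "1 <= Y" using pr.Z3 unfolding Y_def by linarith+
  have YG: "Y * 1 <= Y * G" using G by (rule mult_le_mono2)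
  have "Z * Z * G <= Y * G" using Y by (intro mult_le_mono1) simp
  moreover have "pr.PH = 185 * (Z * Z * G) + 200 * Y" unfolding G_def Y_def by (simp only: mult.assoc)
  ultimately have ph: "pr.PH <= 385 * (Y * G)" using YG by linarith
  have l: "l + 1 <= Z" using pr.ZZ by linarith
  have "500 * Y + (pr.PH + (l * (pr.PH + 3) + 3 + 60 * (Z * Z) + 2)) <= 500 * Y + ((l + 1) * (pr.PH + 3) + 5 + 60 * Y)" using Y by simp
  also have "... <= 500 * Y + (Z * (385 * (Y * G) + 3) + 5 + 60 * Y)" using mult_le_mono[OF l, of "pr.PH + 3" "385 * (Y * G) + 3"] ph by simp
  also have "... <= 2000 * (Z * (Y * G))"
  proof -
   have a: "1 * (Y * G) <= Z * (Y * G)" using Z(5) by (rule mult_le_mono1)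
   have b: "Z * 1 <= Z * (Y * G)" using YG Y by (intro mult_le_mono2) linarith
   have "Z * (385 * (Y * G) + 3) = 385 * (Z * (Y * G)) + 3 * Z" by (simp add: algebra_simps)
   then show ?thesis using a b YG Y by linarith
  qed
  also have "... = 2000 * (Z * Y) * G" by (simp add: mult.assoc)
  finally show ?thesis unfolding Y_def G_def .
 qed
 ultimately show ?thesis by (rule hp_mono) auto
qed

end

section \<open>The exponent of the running time\<close>

text \<open>The left side bounds the logarithm of the Savitch cost; \<open>s\<close> stands for
  \<open>sg\<close>, which contains \<open>log 2 (1 + \<nu>)\<close>, a doubly logarithmic term in
  the number of columns. If this term is at most \<open>3 * (\<Lambda> + 1)\<close>, the whole
  expression is governed by \<open>M\<close> and \<open>D\<close>. Otherwise \<open>M * D\<close> is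
  below the cube root of \<open>1 + \<nu>\<close>, and everything is of order
  \<open>1 + \<nu>\<close>, which later becomes a polynomial factor. \<open>gap\<close> keeps
  \<open>\<Lambda>\<close> away from 0 except for \<open>M = D = 1\<close>, where the first term on
  the right vanishes and the second one takes over.\<close>

lemma log2_sum_bound:
 fixes M D \<nu> s :: real
 assumes "1 <= M" "1 <= D" "0 <= \<nu>" "0 <= s" and s: "s <= 3 * log 2 (M * D) + 3 * log 2 (1 + \<nu>) + 13"
  and gap: "M = 1 ==> D = 1 \<or> 3 / 2 <= D" "M = 1 \<or> 2 <= M"
 shows "16 * M * (D + s) * s <= 70752 * (M * (log 2 M + D) * (log 2 M + log 2 D)) + 82944 * (1 + \<nu>)"
proof -
 define \<Lambda> where "\<Lambda> = log 2 M + log 2 D"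
 define \<omega> where "\<omega> = log 2 (1 + \<nu>)"
 define P where "P = log 2 M + D"
 have l0: "0 <= log 2 M" "0 <= log 2 D" "0 <= \<omega>" using assms by (simp_all add: \<omega>_def)
 have \<Lambda>: "log 2 (M * D) = \<Lambda>" "0 <= \<Lambda>" using assms l0 by (simp_all add: \<Lambda>_def log_mult)
 have ln2: "1 <= 2 * ln (2::real)"
 proof -
  have "1 / 2 <= ln (2::real)" using exp_half_le2 by (subst ln_ge_iff) auto
  then show ?thesis by simp
 qed
 have lnD: "log 2 D <= 2 * D"
 proof -
  have "ln D <= D" using assms(2) ln_le_minus_one[of D] by simp
  moreover have "D <= 2 * ln 2 * D" using assms(2) ln2 by simp
  ultimately show ?thesis unfolding log_def by (simp add: divide_le_eq mult.commute mult.left_commute)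
 qed
 have P1: "1 <= P" using l0 assms(2) unfolding P_def by linarith
 show ?thesis
 proof (cases "\<omega> <= 3 * (\<Lambda> + 1)")
  case True
  have s1: "s <= 22 * (\<Lambda> + 1)" using s \<Lambda> True unfolding \<omega>_def[symmetric] by simp
  have Ds: "D + s <= 67 * P" using s1 lnD assms(2) l0 unfolding \<Lambda>_def P_def distrib_left by linarith
  have "16 * M * (D + s) * s <= 16 * M * (67 * P) * (22 * (\<Lambda> + 1))" using Ds s1 assms \<Lambda>(2) P1 by (intro mult_mono) auto
  also have "... = 23584 * (M * P * (\<Lambda> + 1))" by simp
  finally have E: "16 * M * (D + s) * s <= 23584 * (M * P * (\<Lambda> + 1))" .
  show ?thesis
  proof (cases "M = 1 & D = 1")
   case True
   then have "\<Lambda> = 0" "P = 1" by (simp_all add: \<Lambda>_def P_def)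
   then show ?thesis using E True assms(3) by simp
  next
   case False
   have "1 / 2 <= \<Lambda>"
   proof (cases "M = 1")
    case True
    then have "3 / 2 <= D" using gap False by auto
    then have "2 <= D ^ 2" using power_mono[of "3/2" D 2] by (simp add: power_divide)
    then have "log 2 2 <= log 2 (D ^ 2)" by (subst log_le_cancel_iff) (use assms in auto)
    also have "... = 2 * log 2 D" using assms by (simp add: log_nat_power)
    finally show ?thesis using l0 by (simp add: \<Lambda>_def)
   next
    case False
    then have "log 2 2 <= log 2 M" using gap by (subst log_le_cancel_iff) auto
    then show ?thesis using l0 by (simp add: \<Lambda>_def)
   qed
   then have "M * P * (\<Lambda> + 1) <= M * P * (3 * \<Lambda>)" using assms P1 by (intro mult_left_mono) auto
   then have "16 * M * (D + s) * s <= 70752 * (M * P * \<Lambda>)" using E by simp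
   moreover have "0 <= 82944 * (1 + \<nu>)" using assms by simp
   ultimately show ?thesis unfolding \<Lambda>_def P_def by linarith
  qed
 next
  case False
  define t where "t = \<omega> / 3"
  \<comment> \<open>\<open>T\<close> is the cube root of \<open>1 + \<nu>\<close>. The product to be
    bounded is of order \<open>T * t\<^sup>2\<close>, and \<open>t\<^sup>2 <= 8 * T\<close> brings
    it below a multiple of \<open>T ^ 3\<close>.\<close>
  define T where "T = 2 powr t"
  have t: "\<Lambda> + 1 < t" using False by (simp add: t_def)
  have T3: "T ^ 3 = 1 + \<nu>"
  proof -
   have "T ^ 3 = 2 powr (3 * t)" unfolding T_def by (subst powr_power) simp_all
   also have "3 * t = log 2 (1 + \<nu>)" by (simp add: t_def \<omega>_def)
   also have "2 powr ... = 1 + \<nu>" using assms(3) by (intro powr_log_cancel) auto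
   finally show ?thesis .
  qed
  have T1: "1 <= T" using t \<Lambda> ge_one_powr_ge_zero[of 2 t] by (simp add: T_def)
  have t2: "t\<^sup>2 <= 8 * T"
  proof -
   have x: "t <= 2 * (t * ln 2)" using mult_left_mono[OF ln2, of t] t \<Lambda> by simp
   have "1 + t * ln 2 + (t * ln 2)\<^sup>2 / 2 <= exp (t * ln 2)" by (rule exp_lower_Taylor_quadratic) (use t \<Lambda> in simp)
   moreover have "exp (t * ln 2) = T" by (simp add: T_def powr_def)
   moreover have "t\<^sup>2 <= (2 * (t * ln 2))\<^sup>2" using x t \<Lambda> by (intro power_mono) auto
   moreover have "0 <= t * ln 2" using t \<Lambda> by simp
   ultimately show ?thesis by (simp add: power_mult_distrib)
  qed
  have s1: "s <= 22 * t" using s t \<Lambda> unfolding \<omega>_def[symmetric] by (simp add: t_def)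
  have MD: "M * D <= T"
  proof -
   have "M * D = 2 powr \<Lambda>" using assms by (simp add: \<Lambda>_def powr_add)
   also have "... <= T" unfolding T_def using t by simp
   finally show ?thesis .
  qed
  have "M * (D + s) <= M * D + M * (22 * t)" using s1 assms by (simp add: distrib_left)
  also have "M * (22 * t) <= M * D * (22 * t)" using assms t \<Lambda> mult_left_mono[of 1 D M] by (intro mult_right_mono) auto
  also have "M * D + M * D * (22 * t) = M * D * (1 + 22 * t)" by (simp add: distrib_left)
  also have "... <= T * (23 * t)" using MD assms t \<Lambda> T1 by (intro mult_mono) auto
  finally have Ms: "M * (D + s) <= T * (23 * t)" by simp
  have "16 * M * (D + s) * s = 16 * (M * (D + s)) * s" by simp
  also have "... <= 16 * (T * (23 * t)) * (22 * t)"
  proof (rule mult_mono)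
   show "16 * (M * (D + s)) <= 16 * (T * (23 * t))" using Ms by simp
   show "0 <= 16 * (T * (23 * t))" using T1 t \<Lambda>(2) by simp
  qed (use s1 assms(4) in simp_all)
  also have "... = 8096 * T * t\<^sup>2" by (simp add: power2_eq_square)
  also have "... <= 8096 * T * (8 * T)" using t2 T1 by (intro mult_left_mono) auto
  also have "... = 64768 * T\<^sup>2" by (simp add: power2_eq_square)
  also have "... <= 64768 * T ^ 3" using power_increasing[OF _ T1, of 2 3] by simp
  finally have "16 * M * (D + s) * s <= 82944 * (1 + \<nu>)" using assms(3) unfolding T3 by simp
  moreover have "0 <= M * (log 2 M + D) * (log 2 M + log 2 D)" using assms l0 by simp
  ultimately show ?thesis by linarith
 qed
qed

section \<open>Polynomial bounds in the input size\<close>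

locale ilp_poly = ilp_inst +
 assumes mn: "1 <= m" "1 <= n"
  and inp: "inp ! 0 = int m" "inp ! 1 = int n" "length inp = m * n + m + n + 2"
begin

definition "X = m + n + in_bits inp + 100"

lemma inp_set: "i < length inp ==> \<bar>inp ! i\<bar> < 2 ^ in_bits inp" by (rule in_bits) simp

lemma ib1: "1 < (2::int) ^ in_bits inp"
proof -
 have "\<bar>inp ! 1\<bar> < 2 ^ in_bits inp" by (rule inp_set) (use inp(3) mn in simp)
 then show ?thesis using mn unfolding inp(2) by linarith
qed

lemma a_less: "k < m ==> j < n ==> \<bar>a k j\<bar> < 2 ^ in_bits inp"
proof -
 assume k: "k < m" "j < n"
 then have "k * n + j < Suc k * n" by simp
 also have "... <= m * n" using k by (intro mult_le_mono1) simp
 finally show ?thesis unfolding a_def by (intro inp_set) (use inp(3) in simp)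
qed

lemma ext_entry: "k < m ==> (!!j. j < n ==> \<bar>a k j\<bar> <= B) ==> 1 <= B ==> \<bar>ext_mat n m a k j\<bar> <= B" by (auto simp: ext_mat_def)

lemma Mx_le:
 assumes "!!k j. k < m ==> j < n ==> \<bar>a k j\<bar> <= B" "1 <= B"
 shows "mxa 0 (tab m) (m * N) <= B"
proof (rule mxa_le)
 fix i assume i: "i < m * N"
 then have "i div N < m" by (simp add: less_mult_imp_div_less)
 then show "\<bar>tab m i\<bar> <= B" using ext_entry[of "i div N" B] assms i by (simp add: tab_def)
qed (use assms in simp)

lemma My_le: "mxa (mxa (mxa 0 (tab m) (m * N)) Ba m) Ca n <= 2 ^ in_bits inp - 1"
proof (intro mxa_le)
 show "0 <= 2 ^ in_bits inp - (1::int)" using ib1 by simp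
 show "\<bar>Ba i\<bar> <= 2 ^ in_bits inp - 1" if "i < m" for i using inp_set[of "2 + m * n + i"] that inp(3) by (simp add: Ba_def bb_def)
 show "\<bar>Ca i\<bar> <= 2 ^ in_bits inp - 1" if "i < n" for i using inp_set[of "2 + m * n + m + i"] that inp(3) by (simp add: Ca_def cc_def)
 show "\<bar>tab m i\<bar> <= 2 ^ in_bits inp - 1" if i: "i < m * N" for i
 proof -
  have "i div N < m" using i by (simp add: less_mult_imp_div_less)
  then have "\<bar>ext_mat n m a (i div N) (i mod N)\<bar> <= 2 ^ in_bits inp - 1" by (rule ext_entry) (use a_less[OF \<open>i div N < m\<close>] ib1 in auto)
  then show ?thesis using i by (simp add: tab_def)
 qed
qed

lemma bl_nat_le: "x <= 2 ^ k - 1 ==> bl (nat x) <= k"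
proof (rule bl_least)
 assume "x <= 2 ^ k - 1"
 then have "x < int (2 ^ k)" by simp
 then show "nat x < 2 ^ k" by (cases "0 <= x") (simp_all only: nat_less_iff, simp)
qed

lemma l_le: "l <= in_bits inp" unfolding l_def by (rule bl_nat_le[OF My_le])

lemma \<delta>_le: "\<delta> <= in_bits inp" unfolding \<delta>_def
proof (rule bl_nat_le[OF Mx_le])
 show "\<bar>a k j\<bar> <= 2 ^ in_bits inp - 1" if "k < m" "j < n" for k j using a_less[OF that] by simp
qed (use ib1 in simp)

lemma pow_bl: "0 < x ==> 2 ^ bl x <= 2 * x"
proof -
 assume x: "0 < x"
 have "bl x = Suc (bl (x div 2))" using x by (subst bl.simps) simp
 then have "(2::nat) ^ bl x = 2 * 2 ^ (bl x - 1)" by simp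
 then show ?thesis using bl_le[OF x] by simp
qed

lemma \<nu>_le: "\<nu> <= N" unfolding \<nu>_def by (rule bl_least) (rule less_exp)

text \<open>Rounding \<open>m + \<delta> + \<nu>\<close> up to the power \<open>2 ^ \<pi>\<close>
  costs at most a factor 2, so \<open>2 ^ sg\<close> is of order \<open>X ^ 3\<close>, and the
  longest shift, \<open>q * N\<close>, is of order \<open>X ^ 4\<close>.\<close>

lemma poly_bounds:
 defines "B \<equiv> X ^ 4"
 shows "X <= B" "100 <= X" "\<delta> <= X" "l <= X" "\<nu> <= 2 * X" "N <= 2 * X" "m <= X" "n <= X" "\<pi> <= 6 * X" "lam <= 8 * X" "sg <= 19 * X" "e + 1 <= 22 * X"
  "2 ^ sg <= 3456 * B" "q <= 13824 * B" "q * N <= 27648 * B" "q * m <= 13824 * B" "dd <= 288 * B" "kM <= 1024 * B" "(e + 1) * m <= 22 * B" "m * N <= 2 * B"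
proof -
 show X: "100 <= X" by (simp add: X_def)
 have pw: "X ^ 1 <= B" "X ^ 2 <= B" "X ^ 3 <= B" unfolding B_def by (intro power_increasing; use X in simp)+
 show "X <= B" using pw by simp
 show d: "\<delta> <= X" "l <= X" using \<delta>_le l_le by (simp_all add: X_def)
 show N: "N <= 2 * X" "m <= X" "n <= X" by (simp_all add: X_def N_def)
 show \<nu>: "\<nu> <= 2 * X" using \<nu>_le N by simp
 have sm: "m + \<delta> <= X" using \<delta>_le by (simp add: X_def)
 have p: "2 ^ \<pi> <= 6 * X" using pow_bl[of "m + \<delta> + \<nu>"] mn sm \<nu> unfolding \<pi>_def by simp
 have la: "2 ^ lam <= 8 * X" using pow_bl[of "m + \<delta> + \<nu> + l"] mn sm \<nu> d unfolding lam_def by simp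
 show \<pi>: "\<pi> <= 6 * X" using p less_exp[of \<pi>] by linarith
 show "lam <= 8 * X" using la less_exp[of lam] by linarith
 show sg: "sg <= 19 * X" using \<pi> X by (simp add: sg_def)
 show e: "e + 1 <= 22 * X" using sg d X by (simp add: e_def)
 have "(2::nat) ^ sg = 16 * (2 ^ \<pi>) ^ 3" by (simp add: sg_def power_add power_mult[symmetric] mult.commute)
 also have "... <= 16 * (6 * X) ^ 3" using p by (intro mult_le_mono2 power_mono) auto
 finally have s: "2 ^ sg <= 3456 * X ^ 3" by (simp add: power_mult_distrib)
 then show "2 ^ sg <= 3456 * B" using pw by linarith
 have qx: "q <= 13824 * X ^ 3" using s by (simp add: q_def)
 then show "q <= 13824 * B" using pw by linarith
 have B: "B = X ^ 3 * X" by (simp add: B_def power4_eq_xxxx power3_eq_cube)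
 show "q * N <= 27648 * B" using mult_le_mono[OF qx N(1)] by (simp add: B)
 show "q * m <= 13824 * B" using mult_le_mono[OF qx N(2)] by (simp add: B)
 have "dd = 8 * (2 ^ \<pi>) ^ 2" by (simp add: dd_def power_add power_mult[symmetric] mult.commute)
 also have "... <= 8 * (6 * X) ^ 2" using p by (intro mult_le_mono2 power_mono) auto
 finally show "dd <= 288 * B" using pw by (simp add: power_mult_distrib)
 have "kM = 16 * (2 ^ lam) ^ 2" by (simp add: kM_def power_add power_mult[symmetric] mult.commute)
 also have "... <= 16 * (8 * X) ^ 2" using la by (intro mult_le_mono2 power_mono) auto
 finally show "kM <= 1024 * B" using pw by (simp add: power_mult_distrib)
 show "(e + 1) * m <= 22 * B" using mult_le_mono[OF e N(2)] pw(2) by (simp add: power2_eq_square)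
 show "m * N <= 2 * B" using mult_le_mono[OF N(2) N(1)] pw(2) by (simp add: power2_eq_square)
qed

text \<open>The shift lengths are of order \<open>X ^ 4\<close> with large constants. As
  \<open>X\<close> is at least 100, the four further powers in \<open>Z = X ^ 8\<close> absorb these
  constants.\<close>

lemma main_locale: "ilp_main inp m n (X ^ 30) (X ^ 8)"
proof -
 define B where "B = X ^ 4"
 note pb = poly_bounds[folded B_def]
 have B8: "100000000 * B <= X ^ 8"
 proof -
  have "100 ^ 4 <= X ^ 4" using pb(2) by (rule power_mono) simp
  then have "100 ^ 4 * X ^ 4 <= X ^ 4 * X ^ 4" by (rule mult_le_mono1)
  then show ?thesis by (simp add: B_def power_add[symmetric])
 qed
 have J: "X ^ 8 <= X ^ 30" by (rule power_increasing) (use pb(2) in simp_all)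
 have \<mu>: "\<mu> <= 1024 * B + 1" using pb(18) by (simp add: \<mu>_def)
 have ibZ: "in_bits inp <= X ^ 8" using pb(1) B8 by (simp add: X_def)
 show ?thesis
 proof unfold_locales
  show "2 * sg + 2 ^ sg + 2 ^ sg + q * N + q * m + q + q + \<mu> + m + \<nu> + \<delta> + l + l + e + e + (e + 1) * m + dd + N + 40 <= X ^ 8" using pb \<mu> B8 by linarith
  show "\<bar>v\<bar> < 2 ^ X ^ 8" if "v \<in> set inp" for v using in_bits[OF that] int_pow_le[OF ibZ] by linarith
  show "2 * sg + 2 ^ sg + q * N + \<mu> + 2 <= X ^ 8" using pb \<mu> B8 by linarith
  show "m * N <= X ^ 30" "N <= X ^ 30" "m <= X ^ 30" "2 * sg < X ^ 30" using pb B8 J by linarith+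
  show "kM <= X ^ 8" "(e + 1) * m <= X ^ 8" "dd <= X ^ 8" "m * N <= X ^ 8" using pb B8 by linarith+
  show "N <= X ^ 8" "m <= X ^ 8" "n <= X ^ 8" "1 <= X ^ 8" "\<delta> <= X ^ 8" "l <= X ^ 8" "\<nu> <= X ^ 8" "\<pi> <= X ^ 8" "lam <= X ^ 8" "sg <= X ^ 8"
   "2 * \<pi> + 3 <= X ^ 8" "e + 1 <= X ^ 8" "2 * lam + 4 <= X ^ 8" "2 * m <= X ^ 8" using pb(1-12) B8 by linarith+
 qed (use mn inp in auto)
qed

definition "GGx = ((8 * 2 ^ ((e + 1) * m)) ^ (2 * sg) :: nat)"

text \<open>Numbers have a bit bound of order \<open>Z ^ 3 = X ^ 24\<close>, constants included
  below \<open>X ^ 30\<close>. This is the reason for the exponent 30 in \<open>boot\<close>; memory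
  then amounts to about \<open>16 * X ^ 60\<close> words.\<close>

lemma ram_bound:
 assumes word: "!!v. \<bar>v\<bar> <= 2 * int (X ^ 62) + 4 * 2 ^ in_bits inp ==> is_word w v"
 shows "\<exists>T S out. ram_computes w (compile 0 (boot 30 ;; tr main_code) @ [Halt]) inp T S out & T <= X ^ 70 * GGx & S <= X ^ 61 &
  ((\<exists>x. opt n m a cc bb x & (\<forall>j<n. 0 <= x j & x j < 2 ^ (q + l + 2)) & out = 1 # vec_out (q + l + 2) n x) \<or>
   ((\<nexists>x. opt n m a cc bb x) & out = [0]))"
proof -
 interpret M: ilp_main inp m n "X ^ 30" "X ^ 8" by (rule main_locale)
 define Q where "Q = X ^ 30"
 have X: "100 <= X" by (simp add: X_def)
 have pw: "c * X ^ i <= X ^ j" if "c <= 100 ^ k" "k + i <= j" for c i j k :: nat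
 proof -
  have "c <= X ^ k" using that(1) power_mono[OF X, of k] by simp
  then have "c * X ^ i <= X ^ k * X ^ i" by (rule mult_le_mono1)
  also have "... = X ^ (k + i)" by (simp add: power_add)
  also have "... <= X ^ j" by (rule power_increasing) (use that X in auto)
  finally show ?thesis .
 qed
 have Z3: "X ^ 8 * (X ^ 8 * X ^ 8) = X ^ 24" "X ^ 8 * (X ^ 8 * (X ^ 8 * X ^ 8)) = X ^ 32" by (simp_all add: power_add[symmetric])
 have lev: "M.pr.lev = X ^ 8 + 700 * X ^ 24" by (simp add: Z3)
 have sucl: "Suc M.pr.lev <= Q"
 proof -
  have "1 * X ^ 8 <= X ^ 29" "700 * X ^ 24 <= X ^ 29" "1 * X ^ 0 <= X ^ 29" by (rule pw[where k = 2]; simp)+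
  moreover have "3 * X ^ 29 <= X ^ 30" by (rule pw[where k = 1]; simp)
  ultimately show ?thesis unfolding lev Q_def by simp
 qed
 have SS: "32 + (48 + 16 * Q) * Q = 32 + 48 * X ^ 30 + 16 * X ^ 60"
  unfolding Q_def by (simp add: distrib_right mult.assoc power_add[symmetric])
 have S: "32 + (48 + 16 * Q) * Q <= X ^ 61"
 proof -
  have "32 * X ^ 0 <= X ^ 60" "48 * X ^ 30 <= X ^ 60" "18 * X ^ 60 <= X ^ 61" by (rule pw[where k = 1]; simp)+
  then show ?thesis unfolding SS by simp
 qed
 have S2: "2 * int (32 + (48 + 16 * Q) * Q) + 100 <= 2 * int (X ^ 62)"
 proof -
  have "3 * X ^ 61 <= X ^ 62" "100 * X ^ 0 <= X ^ 61" by (rule pw[where k = 1]; simp)+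
  then have "2 * (32 + (48 + 16 * Q) * Q) + 100 <= 2 * X ^ 62" using S by simp
  then have "int (2 * (32 + (48 + 16 * Q) * Q) + 100) <= int (2 * X ^ 62)" by (simp only: of_nat_le_iff)
  then show ?thesis by (simp only: of_nat_add of_nat_mult of_nat_numeral)
 qed
 let ?b = "2000 * X ^ 32 * GGx"
 have h: "hp (hq M.pr.lev inp Q) (hqt M.pr.lev) main_code ((%_. 0), (%_ _. 0), []) ?b (%s. snd (snd s) = M.out_list)" using M.main_correct unfolding Q_def GGx_def Z3 power_add[of X 8 24, symmetric] by simp
 have "\<exists>T \<le> 20 + length inp * (6 * in_bits inp + 20) + 30 + ?b * (40 * Q).
  ram_computes w (compile 0 (boot 30 ;; tr main_code) @ [Halt]) inp T (32 + (48 + 16 * Q) * Q) M.out_list"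
 proof -
  note R = ram_from_H[where m = m and n = n and inp = inp and \<kappa> = 30 and w = w and out = M.out_list and c = main_code and q = M.pr.lev and b = ?b,
   OF inp(3,1,2), folded X_def, folded Q_def]
  show ?thesis by (rule R[OF _ _ sucl h]) (rule word, use S2 in simp, simp)
 qed
 then obtain T where T: "T <= 20 + length inp * (6 * in_bits inp + 20) + 30 + ?b * (40 * Q)"
  "ram_computes w (compile 0 (boot 30 ;; tr main_code) @ [Halt]) inp T (32 + (48 + 16 * Q) * Q) M.out_list" by blast
 have len: "length inp <= 3 * X ^ 2"
 proof -
  have "m * n <= X * X" by (rule mult_le_mono) (simp_all add: X_def)
  moreover have "m + n + 2 <= 2 * X" by (simp add: X_def)
  moreover have "2 * X <= 2 * (X * X)" using X by simp
  ultimately show ?thesis using inp(3) unfolding power2_eq_square by linarith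
 qed
 have "length inp * (6 * in_bits inp + 20) <= 3 * X ^ 2 * (6 * X)" by (rule mult_le_mono[OF len]) (simp add: X_def)
 also have "... = 18 * X ^ 3" by (simp add: power2_eq_square power3_eq_cube)
 also have "... <= X ^ 69" by (rule pw[where k = 1]) simp_all
 finally have t1: "length inp * (6 * in_bits inp + 20) <= X ^ 69" .
 have t2: "?b * (40 * Q) = 80000 * X ^ 62 * GGx" unfolding Q_def by (simp add: power_add[symmetric] mult.assoc mult.left_commute)
 have t3: "80000 * X ^ 62 <= X ^ 69" "50 * X ^ 0 <= X ^ 69" "3 * X ^ 69 <= X ^ 70"
  proof -
  show "80000 * X ^ 62 <= X ^ 69" "50 * X ^ 0 <= X ^ 69" by (rule pw[where k = 3]; simp)+
  show "3 * X ^ 69 <= X ^ 70" by (rule pw[where k = 1]; simp)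
 qed
 have G: "1 <= GGx" by (simp add: GGx_def)
 have "T <= 50 + X ^ 69 + 80000 * X ^ 62 * GGx" using T(1) t1 t2 by simp
 also have "... <= X ^ 69 * GGx + X ^ 69 * GGx + X ^ 69 * GGx"
 proof -
  have "50 <= X ^ 69" using t3(2) by simp
  moreover have "X ^ 69 * 1 <= X ^ 69 * GGx" by (rule mult_le_mono2[OF G])
  moreover have "80000 * X ^ 62 * GGx <= X ^ 69 * GGx" by (rule mult_le_mono1[OF t3(1)])
  ultimately show ?thesis by linarith
 qed
 also have "... = 3 * X ^ 69 * GGx" by simp
 also have "... <= X ^ 70 * GGx" by (rule mult_le_mono1[OF t3(3)])
 finally have "T <= X ^ 70 * GGx" .
 then show ?thesis using T(2) S M.out_list_correct by blast
qed

end

section \<open>Matrices, vectors and the given encoding\<close>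

lemma concat_nth_uniform:
 assumes "!!xs. xs \<in> set xss ==> length xs = n" "k < length xss" "j < n"
 shows "concat xss ! (k * n + j) = xss ! k ! j" using assms
proof (induction xss arbitrary: k)
 case (Cons x xss)
 have x: "length x = n" using Cons.prems(1)[of x] by simp
 show ?case
 proof (cases k)
  case 0
  then show ?thesis using x Cons.prems by (simp add: nth_append)
 next
  case (Suc k')
  have "concat xss ! (k' * n + j) = xss ! k' ! j" using Cons Suc by auto
  then show ?thesis using x Suc by (simp add: nth_append)
 qed
qed simp

lemma length_concat_uniform: "(!!xs. xs \<in> set xss ==> length xs = n) ==> length (concat xss) = length xss * n" by (induction xss) auto

lemma log2_nat_bound:
 assumes "real_of_int \<bar>v\<bar> <= 2 powr r" "nat \<lceil>r\<rceil> < L"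
 shows "\<bar>v\<bar> < 2 ^ L"
proof -
 have "r <= real (nat \<lceil>r\<rceil>)" by linarith
 then have "2 powr r <= 2 powr real (nat \<lceil>r\<rceil>)" by simp
 also have "... = 2 ^ nat \<lceil>r\<rceil>" by (simp add: powr_realpow)
 also have "... < (2::real) ^ L" using assms(2) by (intro power_strict_increasing) auto
 finally have "real_of_int \<bar>v\<bar> < real_of_int (2 ^ L)" using assms(1) by simp
 then show ?thesis by (simp only: of_int_less_iff)
qed

lemma two_powr_nat: "2 powr real k = real (2 ^ k)" by (simp add: powr_realpow)

lemma abs_le_log_norm:
 assumes "i < dim_vec v"
 shows "real_of_int \<bar>v $ i\<bar> <= 2 powr log_norm v"
proof -
 have "\<bar>v $ i\<bar> \<in> abs ` set\<^sub>v v" using assms by (auto intro: vec_setI)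
 then have "\<bar>v $ i\<bar> <= inf_norm v" unfolding inf_norm_def by (intro Max_ge) (auto simp: vec_set_def)
 then have "\<bar>v $ i\<bar> <= max 1 (inf_norm v)" by simp
 then show ?thesis unfolding log_norm_def by (subst powr_log_cancel) (auto simp: of_int_le_iff simp del: of_int_max)
qed

lemma log_norm_nonneg: "0 <= log_norm v"
 unfolding log_norm_def by simp

locale ilp_mat =
 fixes m n :: nat and A :: "int mat" and b c :: "int vec" and \<Delta> :: int
 assumes mn: "1 <= m" "1 <= n" and A: "A \<in> carrier_mat m n" and b: "b \<in> carrier_vec m" and c: "c \<in> carrier_vec n"
  and \<Delta>: "1 < \<Delta>" "!!i j. i < m ==> j < n ==> \<bar>A $$ (i, j)\<bar> <= \<Delta>"
begin

abbreviation "inp \<equiv> ilp_input A b c"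
abbreviation "body \<equiv> concat (mat_to_list A)"

lemma dims: "dim_row A = m" "dim_col A = n" "dim_vec b = m" "dim_vec c = n" using A b c by auto

lemma rows: "xs \<in> set (mat_to_list A) ==> length xs = n" by (auto simp: mat_to_list_def dims)

lemma len_body: "length body = m * n"
proof -
 have "length body = length (mat_to_list A) * n" by (rule length_concat_uniform[OF rows])
 moreover have "length (mat_to_list A) = m" by (simp add: mat_to_list_def dims)
 ultimately show ?thesis by simp
qed

lemma inp_nth:
 "inp ! 0 = int m" "inp ! 1 = int n" "length inp = m * n + m + n + 2"
 "k < m ==> j < n ==> inp ! (2 + k * n + j) = A $$ (k, j)"
 "k < m ==> inp ! (2 + m * n + k) = b $ k"
 "j < n ==> inp ! (2 + m * n + m + j) = c $ j"
proof -
 show "inp ! 0 = int m" "inp ! 1 = int n" "length inp = m * n + m + n + 2" using len_body by (simp_all add: ilp_input_def dims)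
 show "inp ! (2 + k * n + j) = A $$ (k, j)" if k: "k < m" "j < n"
 proof -
  have "k * n + j < Suc k * n" using k by simp
  also have "... <= m * n" using k by (intro mult_le_mono1) simp
  finally have "inp ! (2 + k * n + j) = body ! (k * n + j)" using len_body by (simp add: ilp_input_def nth_append)
  also have "... = mat_to_list A ! k ! j" by (rule concat_nth_uniform[OF rows]) (use k in \<open>auto simp: mat_to_list_def dims\<close>)
  finally show ?thesis using k by (simp add: mat_to_list_def dims)
 qed
 show "inp ! (2 + m * n + k) = b $ k" if "k < m" using that len_body by (simp add: ilp_input_def nth_append dims list_of_vec_index)
 show "inp ! (2 + m * n + m + j) = c $ j" if "j < n" using that len_body by (simp add: ilp_input_def nth_append dims list_of_vec_index)
qed

sublocale P: ilp_poly inp m n by unfold_locales (use mn inp_nth in auto)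

lemma entries: "k < m ==> j < n ==> P.a k j = A $$ (k, j)" "k < m ==> P.bb k = b $ k" "j < n ==> P.cc j = c $ j" using inp_nth by (auto simp: P.a_def P.bb_def P.cc_def)

lemma feas_iff: "x \<in> carrier_vec n ==> x \<in> ilp_feasible A b \<longleftrightarrow> feas n m P.a P.bb (%j. x $ j)"
proof -
 assume x: "x \<in> carrier_vec n"
 have l: "lin n (P.a k) (%j. x $ j) = (A *\<^sub>v x) $ k" if "k < m" for k using that x dims entries(1)[OF that] by (auto simp: lin_def scalar_prod_def atLeast0LessThan)
 have "A *\<^sub>v x = b \<longleftrightarrow> (\<forall>k<m. lin n (P.a k) (%j. x $ j) = P.bb k)" using l entries(2) dims by (auto simp: vec_eq_iff)
 moreover have "0\<^sub>v n <= x \<longleftrightarrow> (\<forall>j<n. 0 <= x $ j)" using x by (auto simp: less_eq_vec_def)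
 ultimately show ?thesis using x by (auto simp: ilp_feasible_def feas_def dims)
qed

lemma lin_cost: "x \<in> carrier_vec n ==> lin n P.cc (%j. x $ j) = c \<bullet> x" using entries(3) by (auto simp: lin_def scalar_prod_def atLeast0LessThan)

lemma feas_vec: "feas n m P.a P.bb f \<longleftrightarrow> vec n f \<in> ilp_feasible A b"
proof -
 have "lin n a' (%j. vec n f $ j) = lin n a' f" for a' by (simp add: lin_def)
 then show ?thesis unfolding feas_iff[OF vec_carrier] by (simp add: feas_def)
qed

lemma opt_vec: "opt n m P.a P.cc P.bb f \<longleftrightarrow> ilp_solution A b c (vec n f)"
proof -
 have lf: "lin n P.cc f = c \<bullet> vec n f" for f using lin_cost[of "vec n f"] by (simp add: lin_def)
 have car: "y \<in> ilp_feasible A b ==> y \<in> carrier_vec n" for y by (auto simp: ilp_feasible_def dims)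
 have "(\<forall>y. feas n m P.a P.bb y \<longrightarrow> lin n P.cc f <= lin n P.cc y) \<longleftrightarrow> (\<forall>y\<in>ilp_feasible A b. c \<bullet> vec n f <= c \<bullet> y)"
 proof (intro iffI allI ballI impI)
  fix y assume h: "\<forall>y. feas n m P.a P.bb y \<longrightarrow> lin n P.cc f <= lin n P.cc y" and y: "y \<in> ilp_feasible A b"
  then show "c \<bullet> vec n f <= c \<bullet> y" using feas_iff[OF car[OF y]] lin_cost[OF car[OF y]] lf[of f] by auto
 next
  fix y assume h: "\<forall>y\<in>ilp_feasible A b. c \<bullet> vec n f <= c \<bullet> y" and y: "feas n m P.a P.bb y"
  then show "lin n P.cc f <= lin n P.cc y" using feas_vec lf by auto
 qed
 then show ?thesis unfolding opt_def ilp_solution_def feas_vec by blast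
qed

lemma answer:
 assumes "(\<exists>x. opt n m P.a P.cc P.bb x & (\<forall>j<n. 0 <= x j & x j < 2 ^ L) & out = 1 # vec_out L n x) \<or>
   ((\<nexists>x. opt n m P.a P.cc P.bb x) & out = [0])"
 shows "ilp_answer A b c out" using assms
proof (elim disjE exE conjE)
 fix x assume x: "opt n m P.a P.cc P.bb x" "\<forall>j<n. 0 <= x j & x j < 2 ^ L" "out = 1 # vec_out L n x"
 have lv: "list_of_vec (vec n x) = map x [0..<n]" by (simp add: list_of_vec_vec)
 have "encodes_vec (vec_out L n x) (vec n x)" unfolding encodes_vec_def by (intro exI[of _ L]) (use x(2) in \<open>auto simp: lv vec_out_def dig_out_def bits_def comp_def\<close>)
 then show ?thesis using x opt_vec unfolding ilp_answer_def by blast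
next
 assume no: "\<nexists>x. opt n m P.a P.cc P.bb x" and o: "out = [0]"
 have "\<not> ilp_solution A b c y" for y
 proof
  assume y: "ilp_solution A b c y"
  then have "y \<in> carrier_vec n" by (auto simp: ilp_solution_def ilp_feasible_def dims)
  then have "vec n (%j. y $ j) = y" by auto
  then show False using no opt_vec y by metis
 qed
 then show ?thesis using o by (auto simp: ilp_answer_def)
qed

abbreviation "sz \<equiv> ilp_size n m \<Delta> b c"
abbreviation "D \<equiv> log 2 (real_of_int \<Delta>)"

lemma D1: "1 <= D" using \<Delta>(1) by simp

lemma sz3: "3 <= sz" using D1 mn log_norm_nonneg[of b] log_norm_nonneg[of c] by (simp add: ilp_size_def)

lemma in_bits_size: "real (in_bits inp) <= sz + 4"
proof -
 \<comment> \<open>One extra bit makes the bounds strict, and the three roundings cost at most 1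
   each; together they give the 4.\<close>
 define L where "L = m + n + nat \<lceil>D\<rceil> + nat \<lceil>log_norm b\<rceil> + nat \<lceil>log_norm c\<rceil> + 1"
 have "in_bits inp <= L"
 proof (rule in_bits_le)
  fix v assume "v \<in> set inp"
  then consider "v = int m" | "v = int n" | i j where "i < m" "j < n" "v = A $$ (i, j)" | i where "i < m" "v = b $ i" | i where "i < n" "v = c $ i" using dims by (auto simp: ilp_input_def mat_to_list_def set_list_of_vec vec_set_def)
  then show "\<bar>v\<bar> < 2 ^ L"
  proof cases
   case 1
   have "(2::int) ^ m <= 2 ^ L" by (rule int_pow_le) (simp add: L_def)
   then show ?thesis using of_nat_less_two_power[of m, where 'a = int] unfolding 1 by linarith
  next
   case 2
   have "(2::int) ^ n <= 2 ^ L" by (rule int_pow_le) (simp add: L_def)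
   then show ?thesis using of_nat_less_two_power[of n, where 'a = int] unfolding 2 by linarith
  next
   case (3 i j)
   have "real_of_int \<bar>v\<bar> <= real_of_int \<Delta>" using \<Delta>(2)[of i j] 3 by (simp only: of_int_le_iff)
   then have "real_of_int \<bar>v\<bar> <= 2 powr D" using \<Delta>(1) by simp
   then show ?thesis by (rule log2_nat_bound) (simp add: L_def)
  next
   case (4 i)
   have "real_of_int \<bar>v\<bar> <= 2 powr log_norm b" using abs_le_log_norm[of i b] 4 dims by simp
   then show ?thesis by (rule log2_nat_bound) (simp add: L_def)
  next
   case (5 i)
   have "real_of_int \<bar>v\<bar> <= 2 powr log_norm c" using abs_le_log_norm[of i c] 5 dims by simp
   then show ?thesis by (rule log2_nat_bound) (simp add: L_def)
  qed
 qed
 then have "real (in_bits inp) <= real L" by simp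
 also have "... = real m + real n + real (nat \<lceil>D\<rceil>) + real (nat \<lceil>log_norm b\<rceil>) + real (nat \<lceil>log_norm c\<rceil>) + 1" by (simp add: L_def)
 also have "... <= sz + 4"
 proof -
  have "real (nat \<lceil>x\<rceil>) <= x + 1" if "0 <= x" for x :: real using that by linarith
  from this[of D] this[of "log_norm b"] this[of "log_norm c"] show ?thesis using D1 log_norm_nonneg[of b] log_norm_nonneg[of c] unfolding ilp_size_def by linarith
 qed
 finally show ?thesis .
qed

lemma X_size: "real P.X <= 40 * sz"
proof -
 have "real m + real n <= sz" using D1 log_norm_nonneg[of b] log_norm_nonneg[of c] unfolding ilp_size_def by linarith
 moreover have "real P.X = real m + real n + real (in_bits inp) + 100" by (simp add: P.X_def)
 ultimately show ?thesis using in_bits_size sz3 by linarith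
qed

text \<open>The input contains \<open>m\<close> and \<open>n\<close>, so \<open>P.X\<close> is at
  most \<open>104 * W\<close>, hence at most \<open>2 ^ (7 * u)\<close> for the unit
  \<open>u\<close> of the word length. The power 62 needs \<open>434 * u\<close> bits, and the rest
  up to \<open>440 * u\<close> covers the constants and the sign.\<close>

lemma word:
 assumes "\<bar>v\<bar> <= 2 * int (P.X ^ 62) + 4 * 2 ^ in_bits inp"
 shows "is_word (word_length 440 n inp) v"
proof -
 define W where "W = Max (abs ` set inp)"
 define u where "u = 1 + nat \<lceil>log 2 (real n) + log 2 (real_of_int W)\<rceil>"
 have W: "\<bar>x\<bar> <= W" if "x \<in> set inp" for x unfolding W_def using that by (intro Max_ge) auto
 have len: "1 < length inp" using inp_nth(3) by simp
 have mem: "int m \<in> set inp" "int n \<in> set inp" by (simp_all add: ilp_input_def dims)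
 have Wm: "int m <= W" "int n <= W" using W[OF mem(1)] W[OF mem(2)] by simp_all
 have W1: "1 <= W" using Wm mn by linarith
 have uW: "2 * W <= 2 ^ u"
 proof -
  have "log 2 (real_of_int W) <= log 2 (real n) + log 2 (real_of_int W)" using mn by simp
  also have "... <= real (u - 1)" unfolding u_def by simp linarith
  finally have "2 powr log 2 (real_of_int W) <= 2 powr real (u - 1)" by simp
  then have "real_of_int W <= 2 ^ (u - 1)" using W1 by (simp add: powr_realpow)
  then have "real_of_int (2 * W) <= real_of_int (2 ^ u)" unfolding u_def by simp
  then show ?thesis by (simp only: of_int_le_iff)
 qed
 have ib: "2 ^ in_bits inp <= 2 * W"
 proof (cases "in_bits inp")
  case 0
  then show ?thesis using W1 by simp
 next
  case (Suc k)
  then have "\<not> in_bits inp <= k" by simp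
  then obtain x where "x \<in> set inp" "2 ^ k <= \<bar>x\<bar>" using in_bits_le[of inp k] by force
  then show ?thesis using W[of x] Suc by simp
 qed
 have "int (in_bits inp) < 2 ^ in_bits inp" by (rule of_nat_less_two_power)
 then have "int P.X <= 104 * W" using ib Wm W1 unfolding P.X_def of_nat_add of_nat_numeral by linarith
 also have "... <= 52 * 2 ^ u" using uW by simp
 also have "... <= 2 ^ (6 * u) * 2 ^ u"
 proof (rule mult_right_mono)
  have "(2::int) ^ 6 <= 2 ^ (6 * u)" by (rule int_pow_le) (simp add: u_def)
  then show "(52::int) <= 2 ^ (6 * u)" by simp
 qed simp
 also have "... = 2 ^ (7 * u)" by (simp add: power_add[symmetric])
 finally have "int P.X ^ 62 <= (2 ^ (7 * u)) ^ 62" by (intro power_mono) auto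
 also have "... = 2 ^ (434 * u)" by (simp add: power_mult[symmetric] mult.commute)
 finally have X62: "int (P.X ^ 62) <= 2 ^ (434 * u)" by simp
 have "(2::int) ^ u <= 2 ^ (434 * u)" by (rule int_pow_le) simp
 then have "\<bar>v\<bar> <= 6 * 2 ^ (434 * u)" using assms X62 ib uW by linarith
 also have "... < 8 * 2 ^ (434 * u)" by simp
 also have "... = 2 ^ (434 * u + 3)" by (simp add: power_add)
 also have "... <= 2 ^ (440 * u - 1)" by (rule int_pow_le) (simp add: u_def)
 finally have "\<bar>v\<bar> < 2 ^ (440 * u - 1)" .
 moreover have "word_length 440 n inp = 440 * u" unfolding word_length_def Let_def u_def W_def ..
 ultimately show ?thesis unfolding is_word_def by (simp add: abs_less_iff)
qed

text \<open>\<open>P.GGx\<close> is a power of two whose exponent is of order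
  \<open>m * (\<delta> + sg) * sg\<close>. The part with factor \<open>log 2 m + D\<close> becomes a
  power of \<open>m * \<Delta>\<close>. The part of order \<open>1 + \<nu>\<close> becomes
  polynomial in \<open>sz\<close>, because \<open>\<nu>\<close> is a bit length.\<close>

lemma GG_bound:
 "real P.GGx <= (real m * real_of_int \<Delta>) powr (70752 * (real m * (log 2 (real m) + log 2 D))) * 2 powr (82944 * (log 2 sz + 3))"
proof -
 let ?M = "real m" and ?s = "real P.sg" and ?\<nu> = "real P.\<nu>"
 have M1: "1 <= ?M" using mn by simp
 have \<delta>D: "real P.\<delta> <= D + 1"
 proof -
  let ?x = "nat (mxa 0 (P.tab m) (m * P.N))"
  have xD: "int ?x <= \<Delta>" using P.Mx_le[of \<Delta>] \<Delta> entries(1) by simp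
  show ?thesis
  proof (cases "?x = 0")
   case True
   then show ?thesis using D1 by (simp add: P.\<delta>_def)
  next
   case False
   have "int (2 ^ bl ?x) <= int (2 * ?x)" using P.pow_bl[of ?x] False by (simp only: of_nat_le_iff)
   then have "(2::int) ^ P.\<delta> <= 2 * \<Delta>" using xD by (simp add: P.\<delta>_def)
   then have "real_of_int (2 ^ P.\<delta>) <= real_of_int (2 * \<Delta>)" by (simp only: of_int_le_iff)
   then have "log 2 (2 ^ P.\<delta>) <= log 2 (2 * real_of_int \<Delta>)" using \<Delta>(1) by (subst log_le_cancel_iff) auto
   then show ?thesis using \<Delta>(1) by (simp add: log_mult log_nat_power)
  qed
 qed
 have Npos: "0 < P.N" using mn by (simp add: P.N_def)
 have \<nu>z: "1 + ?\<nu> <= log 2 sz + 3"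
 proof -
  have "real (2 ^ P.\<nu>) <= real (2 * P.N)" using P.pow_bl[OF Npos] unfolding P.\<nu>_def by (simp only: of_nat_le_iff)
  also have "... <= 4 * sz"
  proof -
   have "real n + real m <= sz" using D1 log_norm_nonneg[of b] log_norm_nonneg[of c] unfolding ilp_size_def by linarith
   then show ?thesis by (simp add: P.N_def)
  qed
  finally have "log 2 (2 ^ P.\<nu>) <= log 2 (4 * sz)" using sz3 by (subst log_le_cancel_iff) auto
  moreover have "log 2 (4 * sz) = 2 + log 2 sz"
  proof -
   have "log 2 (4 :: real) = log 2 (2 ^ 2)" by simp
   also have "... = 2" by (subst log_nat_power) auto
   finally show ?thesis using sz3 by (simp add: log_mult)
  qed
  ultimately show ?thesis by (simp add: log_nat_power)
 qed
 have MD: "?M * D \<ge> 1" "?M + D <= ?M * D + 1"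
 proof -
  have "0 <= (?M - 1) * (D - 1)" using M1 D1 by simp
  then show "?M + D <= ?M * D + 1" by (simp add: algebra_simps)
  then show "?M * D \<ge> 1" using M1 D1 by linarith
 qed
 have s: "?s <= 3 * log 2 (?M * D) + 3 * log 2 (1 + ?\<nu>) + 13"
 proof -
  have "real (2 ^ P.\<pi>) <= real (2 * (m + P.\<delta> + P.\<nu>))" using P.pow_bl[of "m + P.\<delta> + P.\<nu>"] mn unfolding P.\<pi>_def by (simp only: of_nat_le_iff)
  also have "... <= 8 * (?M * D * (1 + ?\<nu>))"
  proof -
   have "real (m + P.\<delta> + P.\<nu>) <= ?M * D + 2 + ?\<nu>" using \<delta>D MD by simp
   also have "... <= 4 * (?M * D * (1 + ?\<nu>))"
   proof -
    have "1 * ?\<nu> <= ?M * D * ?\<nu>" using MD by (intro mult_right_mono) auto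
    then show ?thesis using MD unfolding distrib_left by simp
   qed
   finally show ?thesis by simp
  qed
  finally have "log 2 (2 ^ P.\<pi>) <= log 2 (8 * (?M * D * (1 + ?\<nu>)))" using MD D1 M1 by (subst log_le_cancel_iff) auto
  also have "... = 3 + log 2 (?M * D) + log 2 (1 + ?\<nu>)"
  proof -
   have "log 2 (8 :: real) = log 2 (2 ^ 3)" by simp
   also have "... = 3" by (subst log_nat_power) auto
   finally have l8: "log 2 (8 :: real) = 3" .
   have pos: "0 < ?M * D" "0 < 1 + ?\<nu>" using MD by linarith+
   show ?thesis by (subst log_mult, use pos in simp, use pos in simp, subst log_mult) (use pos l8 in auto)
  qed
  finally have "real P.\<pi> <= 3 + log 2 (?M * D) + log 2 (1 + ?\<nu>)" by (simp add: log_nat_power)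
  then show ?thesis unfolding P.sg_def by simp
 qed
 \<comment> \<open>\<open>\<Delta>\<close> is an integer, so it is 2 or at least 3; in the latter
   case its square is at least \<open>2 ^ 3\<close>.\<close>
 have gap: "D = 1 \<or> 3 / 2 <= D"
 proof (cases "\<Delta> = 2")
  case False
  then have "3 <= \<Delta>" using \<Delta>(1) by linarith
  then have "2 ^ 3 <= (real_of_int \<Delta>) ^ 2" using power_mono[of 3 "real_of_int \<Delta>" 2] by simp
  then have "log 2 (2 ^ 3) <= log 2 (real_of_int \<Delta> ^ 2)" using \<Delta>(1) by (subst log_le_cancel_iff) auto
  moreover have "log 2 ((2::real) ^ 3) = 3" by (subst log_nat_power) auto
  moreover have "log 2 (real_of_int \<Delta> ^ 2) = 2 * D" using \<Delta>(1) by (simp add: log_nat_power)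
  ultimately have "3 / 2 <= D" by linarith
  then show ?thesis ..
 qed simp
 let ?E = "((P.e + 1) * m + 3) * (2 * P.sg)"
 have E: "P.GGx = 2 ^ ?E"
 proof -
  have "(8::nat) * 2 ^ ((P.e + 1) * m) = 2 ^ ((P.e + 1) * m + 3)" by (simp add: power_add)
  then show ?thesis unfolding P.GGx_def by (simp only: power_mult)
 qed
 have "real ?E <= 16 * ?M * (D + ?s) * ?s"
 proof -
  have "real (P.e + 1) = real P.\<delta> + ?s + 3" by (simp add: P.e_def)
  then have "?M * real (P.e + 1) <= ?M * (D + ?s + 4)" using \<delta>D by (intro mult_left_mono) auto
  moreover have "3 <= ?M * 3" using M1 by simp
  moreover have "?M * 7 <= ?M * (7 * D)" "0 <= ?M * ?s" using M1 D1 by auto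
  ultimately have "?M * real (P.e + 1) + 3 <= 8 * (?M * (D + ?s))" unfolding distrib_left by linarith
  then have "(?M * real (P.e + 1) + 3) * (2 * ?s) <= 8 * (?M * (D + ?s)) * (2 * ?s)" by (intro mult_right_mono) auto
  moreover have "real ?E = (?M * real (P.e + 1) + 3) * (2 * ?s)" by (simp add: algebra_simps)
  moreover have "8 * (?M * (D + ?s)) * (2 * ?s) = 16 * ?M * (D + ?s) * ?s" by (simp add: algebra_simps)
  ultimately show ?thesis by linarith
 qed
 also have "... <= 70752 * (?M * (log 2 ?M + D) * (log 2 ?M + log 2 D)) + 82944 * (1 + ?\<nu>)" by (rule log2_sum_bound) (use M1 D1 s gap mn in auto)
 also have "... <= (log 2 ?M + D) * (70752 * (?M * (log 2 ?M + log 2 D))) + 82944 * (log 2 sz + 3)" using \<nu>z by simp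
 finally have "2 powr real ?E <= 2 powr ((log 2 ?M + D) * (70752 * (?M * (log 2 ?M + log 2 D))) + 82944 * (log 2 sz + 3))" by simp
 also have "... = (2 powr (log 2 ?M + D)) powr (70752 * (?M * (log 2 ?M + log 2 D))) * 2 powr (82944 * (log 2 sz + 3))"
  unfolding powr_powr by (rule powr_add)
 also have "2 powr (log 2 ?M + D) = ?M * real_of_int \<Delta>" using M1 \<Delta>(1) by (simp add: powr_add)
 finally show ?thesis by (simp only: E two_powr_nat)
qed

lemma solved:
 assumes C2: "real C2 = 82944"
 shows "\<exists>T S out. ram_computes (word_length 440 n inp) (compile 0 (boot 30 ;; tr main_code) @ [Halt]) inp T S out & ilp_answer A b c out &
  real T <= (real m * real_of_int \<Delta>) powr (70752 * (real m * (log 2 (real m) + log 2 D))) * (40 ^ 70 * 2 ^ (3 * C2) * sz ^ (70 + C2)) &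
  real S <= 40 ^ 70 * 2 ^ (3 * C2) * sz ^ (70 + C2)"
proof -
 obtain T S out where r: "ram_computes (word_length 440 n inp) (compile 0 (boot 30 ;; tr main_code) @ [Halt]) inp T S out"
  "T <= P.X ^ 70 * P.GGx" "S <= P.X ^ 61" "ilp_answer A b c out" using P.ram_bound[OF word] answer by metis
 let ?w = "(real m * real_of_int \<Delta>) powr (70752 * (real m * (log 2 (real m) + log 2 D)))"
 have z: "1 <= sz" using sz3 by simp
 have Xp: "real P.X ^ k <= 40 ^ k * sz ^ k" for k using power_mono[OF X_size, of k] by (simp add: power_mult_distrib)
 have pz: "2 powr (82944 * (log 2 sz + 3)) = 2 ^ (3 * C2) * sz ^ C2"
 proof -
  have "2 powr (82944 * (log 2 sz + 3)) = 2 powr (log 2 sz * real C2) * 2 powr real (3 * C2)"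
   unfolding powr_add[symmetric] C2[symmetric] by (simp add: algebra_simps)
  also have "2 powr real (3 * C2) = 2 ^ (3 * C2)" by (rule powr_realpow) simp
  also have "2 powr (log 2 sz * real C2) = sz powr real C2" using z by (simp only: powr_powr[symmetric]) simp
  finally show ?thesis using z by (simp add: powr_realpow mult.commute)
 qed
 have w0: "0 <= ?w" by simp
 have "real T <= real (P.X ^ 70 * P.GGx)" using r(2) by (simp only: of_nat_le_iff)
 also have "... = real P.X ^ 70 * real P.GGx" by simp
 also have "... <= (40 ^ 70 * sz ^ 70) * (?w * (2 ^ (3 * C2) * sz ^ C2))" by (rule mult_mono[OF Xp GG_bound[unfolded pz]]) (use z in auto)
 also have "... = ?w * (40 ^ 70 * 2 ^ (3 * C2) * sz ^ (70 + C2))" by (simp only: power_add mult.assoc mult.left_commute)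
 finally have T: "real T <= ?w * (40 ^ 70 * 2 ^ (3 * C2) * sz ^ (70 + C2))" .
 have "real S <= real (P.X ^ 61)" using r(3) by (simp only: of_nat_le_iff)
 also have "... <= 40 ^ 61 * sz ^ 61" using Xp[of 61] by simp
 also have "... <= (40 ^ 70 * 2 ^ (3 * C2)) * sz ^ (70 + C2)"
 proof (rule mult_mono)
  have "(40::real) ^ 61 * 1 <= 40 ^ 70 * 2 ^ (3 * C2)" by (rule mult_mono[OF power_increasing one_le_power]) auto
  then show "(40::real) ^ 61 <= 40 ^ 70 * 2 ^ (3 * C2)" by simp
  show "sz ^ 61 <= sz ^ (70 + C2)" by (rule power_increasing) (use z in auto)
 qed (use z in auto)
 finally show ?thesis using r T by blast
qed

end

theorem theorem1:
  shows "\<exists>(P :: instr list) (k :: nat) (C :: real) (K :: real) (d :: nat).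
    \<forall>(m :: nat) (n :: nat) (A :: int mat) (b :: int vec) (c :: int vec) (\<Delta> :: int).
      m \<ge> 1 \<longrightarrow> n \<ge> 1 \<longrightarrow>
      A \<in> carrier_mat m n \<longrightarrow> b \<in> carrier_vec m \<longrightarrow> c \<in> carrier_vec n \<longrightarrow>
      \<Delta> > 1 \<longrightarrow> (\<forall>i<m. \<forall>j<n. \<bar>A $$ (i, j)\<bar> \<le> \<Delta>) \<longrightarrow>
      (\<exists>T S out.
         ram_computes (word_length k n (ilp_input A b c)) P (ilp_input A b c) T S out \<and>
         ilp_answer A b c out \<and>
         real T \<le> (real m * real_of_int \<Delta>)
                    powr (C * (real m * (log 2 (real m) + log 2 (log 2 (real_of_int \<Delta>)))))
                  * (K * ilp_size n m \<Delta> b c ^ d) \<and>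
         real S \<le> K * ilp_size n m \<Delta> b c ^ d)"
proof -
  \<comment> \<open>The exponent is kept as an opaque constant, so that simplification does not
    evaluate powers of this size.\<close>
  obtain C2 :: nat where C2: "real C2 = 82944" by (metis of_nat_numeral)
  show ?thesis
  proof (rule exI[of _ "compile 0 (boot 30 ;; tr main_code) @ [Halt]"], rule exI[of _ 440], rule exI[of _ 70752],
      rule exI[of _ "40 ^ 70 * 2 ^ (3 * C2)"], rule exI[of _ "70 + C2"], intro allI impI)
    fix m n :: nat and A :: "int mat" and b c :: "int vec" and \<Delta> :: int
    assume "1 \<le> m" "1 \<le> n" "A \<in> carrier_mat m n" "b \<in> carrier_vec m" "c \<in> carrier_vec n" "1 < \<Delta>" "\<forall>i<m. \<forall>j<n. \<bar>A $$ (i, j)\<bar> \<le> \<Delta>"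
    then interpret ilp_mat m n A b c \<Delta> by unfold_locales auto
    show "\<exists>T S out.
         ram_computes (word_length 440 n (ilp_input A b c)) (compile 0 (boot 30 ;; tr main_code) @ [Halt]) (ilp_input A b c) T S out \<and>
         ilp_answer A b c out \<and>
         real T \<le> (real m * real_of_int \<Delta>) powr (70752 * (real m * (log 2 (real m) + log 2 (log 2 (real_of_int \<Delta>)))))
                  * (40 ^ 70 * 2 ^ (3 * C2) * ilp_size n m \<Delta> b c ^ (70 + C2)) \<and>
         real S \<le> 40 ^ 70 * 2 ^ (3 * C2) * ilp_size n m \<Delta> b c ^ (70 + C2)"
      by (rule solved[OF C2])
  qed
qed

end
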